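(* Let $\alpha$ be a real number with $2 \leq \alpha \leq 9/4$. Given two $n \times n$ matrices $A$ and $B$ stored in a 3-dimensional mesh-connected computer of size $n^\alpha$, there is an algorithm that computes their general matrix product $C = A \times B$ in $\Theta(n^{3-\alpha})$ time, where the implied constants depend on $\alpha$. When $\alpha = 9/4$ the time is $\Theta(n^{3/4})$, and this is optimal for general matrix multiplication on a 3-dimensional mesh-connected computer of any size.
   Context: Model: a 3-dimensional mesh-connected computer is a cubical grid of processors, each connected to its (up to) 6 adjacent neighbors; its size is the total number of processors. Each processor has a fixed number of words of $\Omega(\log p)$ bits ($p$ the number of processors); an operation on words, and exchanging a word with a neighbor, each take unit time. The matrices are stored with at most one entry of each matrix per processor, with no entry duplicated; when the mesh is larger than the input, the input starts in a corner of the mesh. General matrix multiplication means computing $C(i,j) = \bigoplus_{k=0}^{n-1} A(i,k) \otimes B(k,j)$ for $0 \leq i,j \leq n-1$, where $\oplus$ is an arbitrary associative operation and $\otimes$ an arbitrary operation, each computable in unit time; an algorithm must be correct for all such choices. It is assumed that for arbitrary $(\oplus,\otimes)$ no serial algorithm is faster than $\Omega(n^3)$. *)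

theory Defs
  imports Complex_Main "HOL-Library.Landau_Symbols"
begin

type_synonym pos = "nat \<times> nat \<times> nat"

definition mesh :: "nat \<Rightarrow> pos set" where
  "mesh s = {0..<s} \<times> {0..<s} \<times> {0..<s}"

datatype dir = XPlus | XMinus | YPlus | YMinus | ZPlus | ZMinus

fun neighbour :: "nat \<Rightarrow> dir \<Rightarrow> pos \<Rightarrow> pos option" where
  "neighbour s XPlus (x, y, z) = (if x + 1 < s then Some (x + 1, y, z) else None)"
| "neighbour s XMinus (x, y, z) = (if 0 < x then Some (x - 1, y, z) else None)"
| "neighbour s YPlus (x, y, z) = (if y + 1 < s then Some (x, y + 1, z) else None)"
| "neighbour s YMinus (x, y, z) = (if 0 < y then Some (x, y - 1, z) else None)"
| "neighbour s ZPlus (x, y, z) = (if z + 1 < s then Some (x, y, z + 1) else None)"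
| "neighbour s ZMinus (x, y, z) = (if 0 < z then Some (x, y, z - 1) else None)"

text \<open>
  An algorithm is one finite program, run synchronously by every processor (each with its own
  program counter).  The word registers of a processor are numbered by natural numbers, but
  there is no indirect addressing, so a program uses a fixed number of words per processor,
  independently of the size of the mesh and of the input.  Every instruction takes one time unit.
\<close>

type_synonym reg = nat

datatype arith_op = Add | Sub | Mul | Div | Mod | Less | Eq | And | Or | Xor

datatype instr =
    Const reg nat
  | Move reg reg
  | CMove reg reg reg
  | Arith arith_op reg reg reg
  | Oplus reg reg reg
  | Otimes reg reg reg
  | Recv dir reg reg
  | JumpIfZero reg nat
  | Halt

type_synonym program = "instr list"

text \<open>Program counter and register contents of every processor.  A processor has halted when its
  program counter points behind the program.\<close>

type_synonym config = "pos \<Rightarrow> nat \<times> (reg \<Rightarrow> nat)"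

fun arith :: "arith_op \<Rightarrow> nat \<Rightarrow> nat \<Rightarrow> nat" where
  "arith Add a b = a + b"
| "arith Sub a b = a - b"
| "arith Mul a b = a * b"
| "arith Div a b = a div b"
| "arith Mod a b = a mod b"
| "arith Less a b = of_bool (a < b)"
| "arith Eq a b = of_bool (a = b)"
| "arith And a b = Bit_Operations.and a b"
| "arith Or a b = Bit_Operations.or a b"
| "arith Xor a b = Bit_Operations.xor a b"

text \<open>
  One instruction of the processor at \<open>q\<close>.  Here \<open>w\<close> is the number of bits of a word, and
  constants and results of arithmetic are truncated to \<open>w\<close> bits.
  \<open>f\<close> and \<open>g\<close> are the two operations of the general matrix product.
  \<open>Recv d r a\<close> reads the word that the neighbour in direction \<open>d\<close> holds in register \<open>a\<close> at the
  beginning of the time step; it has no effect at the boundary of the mesh.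
\<close>

fun exec :: "nat \<Rightarrow> nat \<Rightarrow> (nat \<Rightarrow> nat \<Rightarrow> nat) \<Rightarrow> (nat \<Rightarrow> nat \<Rightarrow> nat) \<Rightarrow> program \<Rightarrow> config
    \<Rightarrow> pos \<Rightarrow> instr \<Rightarrow> nat \<times> (reg \<Rightarrow> nat) \<Rightarrow> nat \<times> (reg \<Rightarrow> nat)" where
  "exec w s f g P c q (Const r k) (pc, R) = (pc + 1, R(r := k mod 2 ^ w))"
| "exec w s f g P c q (Move r a) (pc, R) = (pc + 1, R(r := R a))"
| "exec w s f g P c q (CMove r t a) (pc, R) = (pc + 1, if R t \<noteq> 0 then R(r := R a) else R)"
| "exec w s f g P c q (Arith h r a b) (pc, R) = (pc + 1, R(r := arith h (R a) (R b) mod 2 ^ w))"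
| "exec w s f g P c q (Oplus r a b) (pc, R) = (pc + 1, R(r := f (R a) (R b)))"
| "exec w s f g P c q (Otimes r a b) (pc, R) = (pc + 1, R(r := g (R a) (R b)))"
| "exec w s f g P c q (Recv d r a) (pc, R) =
     (pc + 1, case neighbour s d q of None \<Rightarrow> R | Some q' \<Rightarrow> R(r := snd (c q') a))"
| "exec w s f g P c q (JumpIfZero r l) (pc, R) = (if R r = 0 then l else pc + 1, R)"
| "exec w s f g P c q Halt (pc, R) = (length P, R)"

definition step :: "nat \<Rightarrow> nat \<Rightarrow> (nat \<Rightarrow> nat \<Rightarrow> nat) \<Rightarrow> (nat \<Rightarrow> nat \<Rightarrow> nat) \<Rightarrow> program
    \<Rightarrow> config \<Rightarrow> config" where
  "step w s f g P c =
     (\<lambda>q. if fst (c q) < length P then exec w s f g P c q (P ! fst (c q)) (c q) else c q)"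

definition run :: "nat \<Rightarrow> nat \<Rightarrow> (nat \<Rightarrow> nat \<Rightarrow> nat) \<Rightarrow> (nat \<Rightarrow> nat \<Rightarrow> nat) \<Rightarrow> program
    \<Rightarrow> nat \<Rightarrow> config \<Rightarrow> config" where
  "run w s f g P t c = (step w s f g P ^^ t) c"

definition halted :: "nat \<Rightarrow> program \<Rightarrow> config \<Rightarrow> bool" where
  "halted s P c \<longleftrightarrow> (\<forall>q\<in>mesh s. length P \<le> fst (c q))"

text \<open>No fold from a start value here: \<open>f\<close> need neither be commutative nor have a neutral
  element.\<close>

primrec big_oplus :: "(nat \<Rightarrow> nat \<Rightarrow> nat) \<Rightarrow> (nat \<Rightarrow> nat) \<Rightarrow> nat \<Rightarrow> nat" where
  "big_oplus f h 0 = h 0"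
| "big_oplus f h (Suc k) = f (big_oplus f h k) (h (Suc k))"

definition gen_matrix_prod :: "(nat \<Rightarrow> nat \<Rightarrow> nat) \<Rightarrow> (nat \<Rightarrow> nat \<Rightarrow> nat) \<Rightarrow> nat
    \<Rightarrow> (nat \<Rightarrow> nat \<Rightarrow> nat) \<Rightarrow> (nat \<Rightarrow> nat \<Rightarrow> nat) \<Rightarrow> (nat \<Rightarrow> nat \<Rightarrow> nat)" where
  "gen_matrix_prod f g n A B = (\<lambda>i j. big_oplus f (\<lambda>k. g (A i k) (B k j)) (n - 1))"

text \<open>Matrix entries are words of \<open>w\<close> bits.\<close>

definition word_ops :: "nat \<Rightarrow> (nat \<Rightarrow> nat \<Rightarrow> nat) \<Rightarrow> (nat \<Rightarrow> nat \<Rightarrow> nat) \<Rightarrow> bool" where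
  "word_ops w f g \<longleftrightarrow>
     (\<forall>a < 2 ^ w. \<forall>b < 2 ^ w. f a b < 2 ^ w \<and> g a b < 2 ^ w) \<and>
     (\<forall>a < 2 ^ w. \<forall>b < 2 ^ w. \<forall>d < 2 ^ w. f (f a b) d = f a (f b d))"

definition word_matrix :: "nat \<Rightarrow> nat \<Rightarrow> (nat \<Rightarrow> nat \<Rightarrow> nat) \<Rightarrow> bool" where
  "word_matrix w n M \<longleftrightarrow> (\<forall>i<n. \<forall>j<n. M i j < 2 ^ w)"

text \<open>
  A matrix is stored in the four registers \<open>b, \<dots>, b + 3\<close>: an occupancy flag, the row and the
  column of the entry held by this processor, and its value.  So a processor holds at most one
  entry, and every entry is held by exactly one processor.
\<close>

definition stored :: "nat \<Rightarrow> nat \<Rightarrow> reg \<Rightarrow> (nat \<Rightarrow> nat \<Rightarrow> nat) \<Rightarrow> config \<Rightarrow> bool" where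
  "stored s n b M c \<longleftrightarrow>
     (\<forall>q\<in>mesh s. snd (c q) b = 0 \<or>
        snd (c q) b = 1 \<and> snd (c q) (b + 1) < n \<and> snd (c q) (b + 2) < n \<and>
        snd (c q) (b + 3) = M (snd (c q) (b + 1)) (snd (c q) (b + 2))) \<and>
     (\<forall>i<n. \<forall>j<n. \<exists>!q. q \<in> mesh s \<and>
        snd (c q) b = 1 \<and> snd (c q) (b + 1) = i \<and> snd (c q) (b + 2) = j)"

abbreviation (input) regA :: reg where "regA \<equiv> 5"
abbreviation (input) regB :: reg where "regB \<equiv> 9"
abbreviation (input) regC :: reg where "regC \<equiv> 13"

text \<open>The side of the smallest cube that has room for the entries of an \<open>n \<times> n\<close> matrix.\<close>

definition corner_side :: "nat \<Rightarrow> nat" where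
  "corner_side n = (LEAST m. n ^ 2 \<le> m ^ 3)"

text \<open>
  Initially every processor knows its coordinates, the side of the mesh and \<open>n\<close>.  The entries of
  \<open>A\<close> and \<open>B\<close> are placed arbitrarily, but one per processor, in the corner of the mesh
  at the origin.  All other registers are 0.
\<close>

definition initial_input :: "nat \<Rightarrow> nat \<Rightarrow> (nat \<Rightarrow> nat \<Rightarrow> nat) \<Rightarrow> (nat \<Rightarrow> nat \<Rightarrow> nat)
    \<Rightarrow> config \<Rightarrow> bool" where
  "initial_input s n A B c \<longleftrightarrow>
     (\<forall>x y z. (x, y, z) \<in> mesh s \<longrightarrow> fst (c (x, y, z)) = 0 \<and>
        snd (c (x, y, z)) 0 = x \<and> snd (c (x, y, z)) 1 = y \<and> snd (c (x, y, z)) 2 = z \<and>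
        snd (c (x, y, z)) 3 = s \<and> snd (c (x, y, z)) 4 = n \<and>
        (\<forall>r\<ge>regC. snd (c (x, y, z)) r = 0)) \<and>
     stored s n regA A c \<and> stored s n regB B c \<and>
     (\<forall>q\<in>mesh s. \<forall>b\<in>{regA, regB}.
        (snd (c q) b = 1 \<longrightarrow> q \<in> mesh (corner_side n)) \<and>
        (snd (c q) b = 0 \<longrightarrow> (\<forall>r\<in>{b..b + 3}. snd (c q) r = 0)))"

definition gmm_instance :: "nat \<Rightarrow> nat \<Rightarrow> nat \<Rightarrow> (nat \<Rightarrow> nat \<Rightarrow> nat) \<Rightarrow> (nat \<Rightarrow> nat \<Rightarrow> nat)
    \<Rightarrow> (nat \<Rightarrow> nat \<Rightarrow> nat) \<Rightarrow> (nat \<Rightarrow> nat \<Rightarrow> nat) \<Rightarrow> config \<Rightarrow> bool" where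
  "gmm_instance w s n f g A B c \<longleftrightarrow>
     word_ops w f g \<and> word_matrix w n A \<and> word_matrix w n B \<and> initial_input s n A B c"

text \<open>
  In the following, \<open>W p\<close> is the word length of a mesh of size \<open>p\<close>, and \<open>n \<times> n\<close> matrices are
  multiplied on the mesh of side \<open>S n\<close>.  For fixed \<open>n\<close> there are only finitely many essentially
  different instances, so the bound \<open>t\<close> that is uniform in the instance exists as soon as the
  program halts on each of them.  The time is the worst case over all instances.
\<close>

definition computes_gmm :: "(nat \<Rightarrow> nat) \<Rightarrow> (nat \<Rightarrow> nat) \<Rightarrow> program \<Rightarrow> bool" where
  "computes_gmm W S P \<longleftrightarrow>
     (\<forall>n\<ge>1. \<exists>t. \<forall>f g A B c. gmm_instance (W (S n ^ 3)) (S n) n f g A B c \<longrightarrow>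
        halted (S n) P (run (W (S n ^ 3)) (S n) f g P t c) \<and>
        stored (S n) n regC (gen_matrix_prod f g n A B) (run (W (S n ^ 3)) (S n) f g P t c))"

definition run_time :: "(nat \<Rightarrow> nat) \<Rightarrow> (nat \<Rightarrow> nat) \<Rightarrow> program \<Rightarrow> nat \<Rightarrow> nat" where
  "run_time W S P n =
     (LEAST t. \<forall>f g A B c. gmm_instance (W (S n ^ 3)) (S n) n f g A B c \<longrightarrow>
        halted (S n) P (run (W (S n ^ 3)) (S n) f g P t c))"

text \<open>Side of the smallest cubical mesh of size at least \<open>n powr \<alpha>\<close>.\<close>

definition mesh_side :: "real \<Rightarrow> nat \<Rightarrow> nat" where
  "mesh_side \<alpha> n = nat \<lceil>real n powr (\<alpha> / 3)\<rceil>"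

text \<open>Words of \<open>\<Omega>(log p)\<close> bits: a word can hold any number up to the number of processors
  (smaller implied constants only change the fixed number of words).\<close>

definition word_length :: "(nat \<Rightarrow> nat) \<Rightarrow> bool" where
  "word_length W \<longleftrightarrow> (\<forall>p. p < 2 ^ W p)"

end

theory Submission
  imports Defs
begin

text \<open>
  Lower bound: run the program with \<open>max\<close> as addition, the zero product and \<open>A = B\<close> having \<open>n ^ 2\<close>
  distinct entries.  If some product \<open>A i k \<otimes> A k j\<close> is not queried within distance \<open>2 T\<close> of the input
  corner, raising it to 1 changes the entry \<open>(i, j)\<close> of the result, but it changes neither the
  processors within distance \<open>T\<close> of the corner nor the remaining ones, which the input never
  reaches.  So \<open>n ^ 3 \<le> T * min (s ^ 3) ((corner_side n + 2 * T) ^ 3)\<close>.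

  Upper bound: cut the matrices into four tiles each and multiply pairs of tiles.  The entries of a
  tile are radix sorted inside the input corner, whose side is of order \<open>n powr (2 / 3)\<close>, which takes
  \<open>O(n powr (2 / 3) * log n)\<close> steps.  Sorting makes the subsequent expansion to the whole mesh order
  preserving, so that dimension-order routing is free of conflicts and takes \<open>O(s)\<close> steps.  A
  cell then holds one entry of each factor, and a systolic algorithm with pipelined row and column
  broadcasts and line sums multiplies the tiles in \<open>O(n ^ 3 / s ^ 3 + s)\<close> steps.
\<close>

section \<open>Synchronous structured programs\<close>

text \<open>The range of \<open>\<alpha>\<close> balances three costs:
  \<open>n powr (3 - \<alpha>)\<close> for the products, \<open>n powr (\<alpha> / 3)\<close> for
  transport, and sorting, which is cheap enough only because it stays in the input corner. For
  \<open>\<alpha> \<le> 9 / 4\<close> the last two are \<open>O(n powr (3 / 4))\<close>, hence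
  dominated; the gap \<open>1 / 12\<close> between \<open>2 / 3\<close> and \<open>3 / 4\<close>
  swallows the logarithm. The obstacle is the arbitrary placement of the entries: a cell has room
  for a fixed number of packets, so no axis-parallel phase may send two packets to one cell. Ranks
  contract distances and sorted keys expand them; either property excludes collisions for one order
  of the axes. The addition need not commute nor have a neutral element, so absent terms carry a
  flag and the inner index is always summed in increasing order. Four tiles are needed because
  \<open>n ^ 2 \<le> s ^ 3\<close> bounds only the square of the rounded up \<open>n / s\<close>
  minus 1 by \<open>s\<close>. In the lower bound a remote processor may evaluate the altered
  product unobserved; it is therefore compared with a third run, on a constant matrix whose product
  is zero.\<close>

type_synonym state = "pos \<Rightarrow> reg \<Rightarrow> nat"

datatype cmd = Block "instr list" | Seq cmd cmd (infixr ";;" 60) | Loop reg cmd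

text \<open>The scalar registers agree on all processors.  Since only they control loops, all program counters
  stay equal, and a program can be treated as a structured one.\<close>

definition scalar :: "reg \<Rightarrow> bool" where
  "scalar r \<longleftrightarrow> r = 3 \<or> r = 4 \<or> 100 \<le> r"

text \<open>A static flow check that keeps scalars equal on all processors: a scalar may be computed
  from scalars only. \<open>Recv\<close> is excluded because it acts differently at the boundary,
  \<open>Oplus\<close> and \<open>Otimes\<close> because nothing in \<open>machine\<close> bounds
  their results.\<close>

fun plain :: "instr \<Rightarrow> bool" where
  "plain (Const r k) \<longleftrightarrow> True"
| "plain (Move r a) \<longleftrightarrow> (scalar r \<longrightarrow> scalar a)"
| "plain (CMove r t a) \<longleftrightarrow> (scalar r \<longrightarrow> scalar t \<and> scalar a)"
| "plain (Arith h r a b) \<longleftrightarrow> (scalar r \<longrightarrow> scalar a \<and> scalar b)"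
| "plain (Oplus r a b) \<longleftrightarrow> \<not> scalar r"
| "plain (Otimes r a b) \<longleftrightarrow> \<not> scalar r"
| "plain (Recv d r a) \<longleftrightarrow> \<not> scalar r"
| "plain (JumpIfZero r l) \<longleftrightarrow> False"
| "plain Halt \<longleftrightarrow> False"

fun target :: "instr \<Rightarrow> reg" where
  "target (Const r k) = r"
| "target (Move r a) = r"
| "target (CMove r t a) = r"
| "target (Arith h r a b) = r"
| "target (Oplus r a b) = r"
| "target (Otimes r a b) = r"
| "target (Recv d r a) = r"
| "target (JumpIfZero r l) = r"
| "target Halt = 0"

primrec writes :: "cmd \<Rightarrow> reg list" where
  "writes (Block is) = map target is"
| "writes (c ;; d) = writes c @ writes d"
| "writes (Loop r c) = r # 100 # 101 # writes c"

primrec well_formed :: "cmd \<Rightarrow> bool" where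
  "well_formed (Block is) \<longleftrightarrow> list_all plain is"
| "well_formed (c ;; d) \<longleftrightarrow> well_formed c \<and> well_formed d"
| "well_formed (Loop r c) \<longleftrightarrow> 101 < r \<and> r \<notin> set (writes c) \<and> well_formed c"

text \<open>Jump targets are absolute, so the address \<open>k\<close> of the first instruction is a
  parameter. There is neither an immediate operand nor an unconditional jump: register 101 supplies
  the 1 for the decrement, and register 100 is cleared so that \<open>JumpIfZero 100 k\<close>
  always jumps. The 5 counts the leading jump and the four trailing instructions.\<close>

primrec comp :: "nat \<Rightarrow> cmd \<Rightarrow> program" where
  "comp k (Block is) = is"
| "comp k (c ;; d) = comp k c @ comp (k + length (comp k c)) d"
| "comp k (Loop r c) = JumpIfZero r (k + length (comp (k + 1) c) + 5) # comp (k + 1) c @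
     [Const 101 1, Arith Sub r r 101, Const 100 0, JumpIfZero 100 k]"

section \<open>Meaning and running time of structured programs\<close>

locale machine =
  fixes w s :: nat and f g :: "nat \<Rightarrow> nat \<Rightarrow> nat"
  assumes w_pos: "0 < w" and s_pos: "0 < s"
begin

fun sem :: "instr \<Rightarrow> state \<Rightarrow> state" where
  "sem (Const r k) \<sigma> q = (\<sigma> q)(r := k mod 2 ^ w)"
| "sem (Move r a) \<sigma> q = (\<sigma> q)(r := \<sigma> q a)"
| "sem (CMove r t a) \<sigma> q = (if \<sigma> q t \<noteq> 0 then (\<sigma> q)(r := \<sigma> q a) else \<sigma> q)"
| "sem (Arith h r a b) \<sigma> q = (\<sigma> q)(r := arith h (\<sigma> q a) (\<sigma> q b) mod 2 ^ w)"
| "sem (Oplus r a b) \<sigma> q = (\<sigma> q)(r := f (\<sigma> q a) (\<sigma> q b))"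
| "sem (Otimes r a b) \<sigma> q = (\<sigma> q)(r := g (\<sigma> q a) (\<sigma> q b))"
| "sem (Recv d r a) \<sigma> q =
     (case neighbour s d q of None \<Rightarrow> \<sigma> q | Some q' \<Rightarrow> (\<sigma> q)(r := \<sigma> q' a))"
| "sem _ \<sigma> q = \<sigma> q"

lemma sem_apply:
  "sem (Const r k) \<sigma> q x = (if x = r then k mod 2 ^ w else \<sigma> q x)"
  "sem (Move r a) \<sigma> q x = (if x = r then \<sigma> q a else \<sigma> q x)"
  "sem (CMove r t a) \<sigma> q x = (if x = r then if \<sigma> q t \<noteq> 0 then \<sigma> q a else \<sigma> q r else \<sigma> q x)"
  "sem (Arith h r a b) \<sigma> q x =
     (if x = r then arith h (\<sigma> q a) (\<sigma> q b) mod 2 ^ w else \<sigma> q x)"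
  "sem (Oplus r a b) \<sigma> q x = (if x = r then f (\<sigma> q a) (\<sigma> q b) else \<sigma> q x)"
  "sem (Otimes r a b) \<sigma> q x = (if x = r then g (\<sigma> q a) (\<sigma> q b) else \<sigma> q x)"
  "sem (Recv d r a) \<sigma> q x = (if x = r then
     (case neighbour s d q of None \<Rightarrow> \<sigma> q r | Some q' \<Rightarrow> \<sigma> q' a) else \<sigma> q x)"
  by (auto split: option.split)

declare sem.simps [simp del]

definition dec :: "reg \<Rightarrow> state \<Rightarrow> state" where
  "dec r \<sigma> = sem (Const 100 0) (sem (Arith Sub r r 101) (sem (Const 101 1) \<sigma>))"

lemma dec_apply:
  "101 < r \<Longrightarrow> dec r \<sigma> q x = (if x = r then (\<sigma> q r - 1) mod 2 ^ w
     else if x = 100 then 0 else if x = 101 then 1 else \<sigma> q x)"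
  using w_pos by (auto simp: dec_def sem_apply)

text \<open>The number of rounds is read at the origin; it is the number for every processor as long
  as the state is \<open>uniform\<close> and the counter is a scalar.\<close>

primrec den :: "cmd \<Rightarrow> state \<Rightarrow> state" where
  "den (Block is) \<sigma> = fold sem is \<sigma>"
| "den (c ;; d) \<sigma> = den d (den c \<sigma>)"
| "den (Loop r c) \<sigma> = ((\<lambda>\<sigma>. dec r (den c \<sigma>)) ^^ \<sigma> (0, 0, 0) r) \<sigma>"

text \<open>Each round pays for the leading jump and the four instructions of loop control; the
  final 1 is the jump that leaves the loop.\<close>

primrec time :: "cmd \<Rightarrow> state \<Rightarrow> nat" where
  "time (Block is) \<sigma> = length is"
| "time (c ;; d) \<sigma> = time c \<sigma> + time d (den c \<sigma>)"
| "time (Loop r c) \<sigma> =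
     (\<Sum>t<\<sigma> (0, 0, 0) r. time c (((\<lambda>\<sigma>. dec r (den c \<sigma>)) ^^ t) \<sigma>) + 5) + 1"

lemma sem_frame: "x \<noteq> target i \<Longrightarrow> sem i \<sigma> q x = \<sigma> q x"
  by (cases i) (auto simp: sem.simps split: option.split)

lemma dec_frame: "x \<notin> {r, 100, 101} \<Longrightarrow> dec r \<sigma> q x = \<sigma> q x"
  by (simp add: dec_def sem_apply)

lemma fold_sem_frame: "x \<notin> target ` set is \<Longrightarrow> fold sem is \<sigma> q x = \<sigma> q x"
  by (induction "is" arbitrary: \<sigma>) (auto simp: sem_frame)

lemma den_frame: "x \<notin> set (writes c) \<Longrightarrow> den c \<sigma> q x = \<sigma> q x"
proof (induction c arbitrary: \<sigma> q)
  case (Loop r c)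
  have "((\<lambda>\<sigma>. dec r (den c \<sigma>)) ^^ t) \<sigma> q x = \<sigma> q x" for t
    using Loop by (induction t) (auto simp: dec_frame)
  then show ?case by simp
qed (auto simp: fold_sem_frame)

lemma den_Loop:
  assumes "\<sigma> (0, 0, 0) r = N" and "I 0 \<sigma>"
    and "\<And>t \<sigma>. t < N \<Longrightarrow> I t \<sigma> \<Longrightarrow> I (Suc t) (dec r (den c \<sigma>))"
  shows "I N (den (Loop r c) \<sigma>)"
proof -
  have "t \<le> N \<Longrightarrow> I t (((\<lambda>\<sigma>. dec r (den c \<sigma>)) ^^ t) \<sigma>)" for t
    by (induction t) (use assms in auto)
  then show ?thesis using assms(1) by simp
qed

lemma time_Loop:
  assumes "\<sigma> (0, 0, 0) r = N" and "I 0 \<sigma>"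
    and "\<And>t \<sigma>. t < N \<Longrightarrow> I t \<sigma> \<Longrightarrow> I (Suc t) (dec r (den c \<sigma>))"
    and "\<And>t \<sigma>. t < N \<Longrightarrow> I t \<sigma> \<Longrightarrow> time c \<sigma> \<le> T"
  shows "time (Loop r c) \<sigma> \<le> N * (T + 5) + 1"
proof -
  let ?st = "\<lambda>t. ((\<lambda>\<sigma>. dec r (den c \<sigma>)) ^^ t) \<sigma>"
  have "t \<le> N \<Longrightarrow> I t (?st t)" for t
    by (induction t) (use assms in auto)
  then have "(\<Sum>t<N. time c (?st t) + 5) \<le> (\<Sum>t<N. T + 5)"
    using assms(4) by (intro sum_mono) auto
  then show ?thesis using assms(1) by simp
qed

lemma time_Loop_const:
  assumes "\<sigma> (0, 0, 0) r = N" and "\<And>\<sigma>. time c \<sigma> \<le> T"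
  shows "time (Loop r c) \<sigma> \<le> N * (T + 5) + 1"
  by (rule time_Loop[where I = "\<lambda>_ _. True"]) (use assms in auto)

text \<open>The bound \<open>2 ^ w\<close> makes the truncated decrement of a loop counter
  exact.\<close>

definition uniform :: "state \<Rightarrow> bool" where
  "uniform \<sigma> \<longleftrightarrow> (\<forall>r. scalar r \<longrightarrow> \<sigma> (0, 0, 0) r < 2 ^ w \<and> (\<forall>q\<in>mesh s. \<sigma> q r = \<sigma> (0, 0, 0) r))"

lemma origin_mesh: "(0, 0, 0) \<in> mesh s"
  using s_pos by (simp add: mesh_def)

lemma neighbour_mesh: "q \<in> mesh s \<Longrightarrow> neighbour s d q = Some q' \<Longrightarrow> q' \<in> mesh s"
  by (cases "(s, d, q)" rule: neighbour.cases) (auto simp: mesh_def split: if_splits)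

lemma uniform_sem: "uniform \<sigma> \<Longrightarrow> plain i \<Longrightarrow> uniform (sem i \<sigma>)"
proof -
  assume *: "uniform \<sigma>" "plain i"
  define h where "h = \<sigma> (0, 0, 0)"
  have h: "h r < 2 ^ w" "\<And>q. q \<in> mesh s \<Longrightarrow> \<sigma> q r = h r" if "scalar r" for r
    using * that by (auto simp: uniform_def h_def)
  show "uniform (sem i \<sigma>)"
    using *(2) h origin_mesh unfolding uniform_def by (cases i) (auto simp: sem_apply)
qed

section \<open>Simulation of structured programs by the machine\<close>

abbreviation go :: "program \<Rightarrow> nat \<Rightarrow> config \<Rightarrow> config" where
  "go \<equiv> run w s f g"

definition sync :: "nat \<Rightarrow> state \<Rightarrow> config \<Rightarrow> bool" where
  "sync pc \<sigma> c \<longleftrightarrow> (\<forall>q\<in>mesh s. c q = (pc, \<sigma> q))"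

lemma go_Suc: "go P (Suc t) c = go P t (step w s f g P c)"
  unfolding run_def by (simp add: funpow_swap1)

lemma go_add: "go P (t + u) c = go P u (go P t c)"
  unfolding run_def by (metis add.commute comp_apply funpow_add)

lemma step_plain:
  assumes "sync pc \<sigma> c" and "pc < length P" and "P ! pc = i" and "plain i"
  shows "sync (Suc pc) (sem i \<sigma>) (step w s f g P c)"
proof -
  have "exec w s f g P c q i (pc, \<sigma> q) = (Suc pc, sem i \<sigma> q)" if "q \<in> mesh s" for q
    using assms(1,4) that neighbour_mesh
    by (cases i) (auto simp: sync_def sem.simps split: option.split)
  then show ?thesis using assms by (simp add: sync_def step_def)
qed

lemma step_jump:
  assumes "sync pc \<sigma> c" and "pc < length P" and "P ! pc = JumpIfZero r l"
    and "uniform \<sigma>" and "scalar r"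
  shows "sync (if \<sigma> (0, 0, 0) r = 0 then l else Suc pc) \<sigma> (step w s f g P c)"
proof -
  have "\<sigma> q r = \<sigma> (0, 0, 0) r" if "q \<in> mesh s" for q
    using assms(4,5) that unfolding uniform_def by blast
  then show ?thesis using assms(1-3) by (simp add: sync_def step_def)
qed

lemma go_plain:
  assumes "sync (length pre) \<sigma> c" and "P = pre @ is @ post" and "list_all plain is"
    and "uniform \<sigma>"
  shows "sync (length pre + length is) (fold sem is \<sigma>) (go P (length is) c) \<and>
    uniform (fold sem is \<sigma>)"
  using assms
proof (induction "is" arbitrary: pre \<sigma> c)
  case (Cons i "is")
  have "sync (Suc (length pre)) (sem i \<sigma>) (step w s f g P c)"
    using Cons.prems by (intro step_plain) auto
  then show ?case
    using Cons.IH[of "pre @ [i]" "sem i \<sigma>" "step w s f g P c"] Cons.prems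
    by (auto simp: go_Suc uniform_sem)
qed (simp add: run_def)

text \<open>Induction on the structured program, for code between arbitrary \<open>pre\<close> and
  \<open>post\<close>, because the parts of a compound program sit at different absolute
  addresses.\<close>

theorem go_comp:
  assumes "sync (length pre) \<sigma> c" and "P = pre @ comp (length pre) p @ post"
    and "well_formed p" and "uniform \<sigma>"
  shows "sync (length pre + length (comp (length pre) p)) (den p \<sigma>) (go P (time p \<sigma>) c) \<and>
    uniform (den p \<sigma>)"
  using assms
proof (induction p arbitrary: pre post \<sigma> c)
  case (Block "is")
  then show ?case using go_plain by fastforce
next
  case (Seq p1 p2)
  let ?c1 = "comp (length pre) p1"
  have 1: "sync (length pre + length ?c1) (den p1 \<sigma>) (go P (time p1 \<sigma>) c) \<and> uniform (den p1 \<sigma>)"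
    using Seq.prems by (intro Seq.IH(1)[where post = "comp (length pre + length ?c1) p2 @ post"]) auto
  have "sync (length (pre @ ?c1) + length (comp (length (pre @ ?c1)) p2)) (den p2 (den p1 \<sigma>))
      (go P (time p2 (den p1 \<sigma>)) (go P (time p1 \<sigma>) c)) \<and> uniform (den p2 (den p1 \<sigma>))"
    by (rule Seq.IH(2)[where post = post]) (use Seq.prems 1 in auto)
  then show ?case by (simp add: go_add add.assoc)
next
  case (Loop r p)
  let ?cp = "comp (Suc (length pre)) p"
  let ?b = "\<lambda>\<sigma>. dec r (den p \<sigma>)"
  let ?tail = "[Const 101 1, Arith Sub r r 101, Const 100 0]"
  let ?end = "length pre + length ?cp + 5"
  have r: "101 < r" "r \<notin> set (writes p)" "scalar r" "well_formed p"
    using Loop.prems by (auto simp: scalar_def)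
  have P: "P = pre @ JumpIfZero r ?end # ?cp @ ?tail @ [JumpIfZero 100 (length pre)] @ post"
    using Loop.prems(2) by simp
  \<comment> \<open>One full round, from the loop head back to the loop head, for a counter that is
    not yet 0.\<close>
  have round: "sync (length pre) (?b \<sigma>) (go P (time p \<sigma> + 5) c) \<and> uniform (?b \<sigma>)"
    if "sync (length pre) \<sigma> c" "uniform \<sigma>" "\<sigma> (0, 0, 0) r \<noteq> 0" for \<sigma> c
  proof -
    let ?c1 = "go P 1 c"
    have "sync (Suc (length pre)) \<sigma> ?c1"
      using step_jump[of "length pre" \<sigma> c P r ?end] that r P by (simp add: run_def nth_append)
    then have 1: "sync (Suc (length pre) + length ?cp) (den p \<sigma>) (go P (time p \<sigma>) ?c1)
        \<and> uniform (den p \<sigma>)"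
      using Loop.IH[of "pre @ [JumpIfZero r ?end]" \<sigma> ?c1
          "?tail @ [JumpIfZero 100 (length pre)] @ post"] that r P by simp
    let ?c2 = "go P (time p \<sigma>) ?c1"
    have "sync (length (pre @ JumpIfZero r ?end # ?cp) + length ?tail) (fold sem ?tail (den p \<sigma>))
        (go P (length ?tail) ?c2) \<and> uniform (fold sem ?tail (den p \<sigma>))"
      using 1 r P
      by (intro go_plain[where post = "[JumpIfZero 100 (length pre)] @ post"])
        (auto simp: scalar_def)
    then have 3: "sync (length pre + length ?cp + 4) (?b \<sigma>) (go P 3 ?c2)" "uniform (?b \<sigma>)"
      by (simp_all add: dec_def numeral_eq_Suc)
    moreover have "P ! (length pre + length ?cp + 4) = JumpIfZero 100 (length pre)"
      by (subst P) (simp add: nth_append)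
    moreover have "?b \<sigma> (0, 0, 0) 100 = 0" using r(1) by (simp add: dec_apply)
    ultimately have "sync (length pre) (?b \<sigma>) (step w s f g P (go P 3 ?c2))"
      using step_jump[of "length pre + length ?cp + 4" "?b \<sigma>" "go P 3 ?c2" P 100 "length pre"] P
      by (simp add: scalar_def)
    then have "sync (length pre) (?b \<sigma>) (go P (1 + time p \<sigma> + 3 + 1) c)"
      by (simp only: go_add) (simp add: run_def)
    then show ?thesis using 3 by (simp add: ac_simps numeral_eq_Suc)
  qed
  \<comment> \<open>The body does not write the counter and the decrement does not wrap, so the
    counter is known exactly after each round; the jump out of the loop is taken after the last
    round and not before.\<close>
  have "sync (length pre) ((?b ^^ t) \<sigma>) (go P (\<Sum>u<t. time p ((?b ^^ u) \<sigma>) + 5) c)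
      \<and> uniform ((?b ^^ t) \<sigma>) \<and> (?b ^^ t) \<sigma> (0, 0, 0) r = \<sigma> (0, 0, 0) r - t"
    if "t \<le> \<sigma> (0, 0, 0) r" for t
    using that
  proof (induction t)
    case (Suc t)
    let ?\<tau> = "(?b ^^ t) \<sigma>"
    let ?c = "go P (\<Sum>u<t. time p ((?b ^^ u) \<sigma>) + 5) c"
    have IH: "sync (length pre) ?\<tau> ?c" "uniform ?\<tau>" "?\<tau> (0, 0, 0) r = \<sigma> (0, 0, 0) r - t"
      using Suc by auto
    have "?\<tau> (0, 0, 0) r < 2 ^ w" using IH(2) r(3) by (simp add: uniform_def)
    then have "?b ?\<tau> (0, 0, 0) r = \<sigma> (0, 0, 0) r - Suc t"
      using IH(3) r den_frame[of r p ?\<tau>] by (simp add: dec_apply)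
    moreover have "sync (length pre) (?b ?\<tau>) (go P (time p ?\<tau> + 5) ?c) \<and> uniform (?b ?\<tau>)"
      using IH Suc.prems by (intro round) auto
    ultimately show ?case by (simp add: go_add)
  qed (use Loop.prems in \<open>auto simp: run_def\<close>)
  from this[of "\<sigma> (0, 0, 0) r"]
  have fin: "sync (length pre) (den (Loop r p) \<sigma>)
        (go P (\<Sum>u<\<sigma> (0, 0, 0) r. time p ((?b ^^ u) \<sigma>) + 5) c)"
      "uniform (den (Loop r p) \<sigma>)" "den (Loop r p) \<sigma> (0, 0, 0) r = 0"
    by simp_all
  have "sync ?end (den (Loop r p) \<sigma>)
      (step w s f g P (go P (\<Sum>u<\<sigma> (0, 0, 0) r. time p ((?b ^^ u) \<sigma>) + 5) c))"
    using step_jump[OF fin(1), of P r ?end] fin P r by (simp add: nth_append)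
  then show ?case using fin(2) by (simp add: go_add run_def numeral_eq_Suc)
qed

end

section \<open>Conflict-free routing\<close>

fun crd :: "nat \<Rightarrow> pos \<Rightarrow> nat" where
  "crd d (x, y, z) = (if d = 0 then x else if d = 1 then y else z)"

fun mv :: "nat \<Rightarrow> pos \<Rightarrow> nat \<Rightarrow> pos" where
  "mv d (x, y, z) v = (if d = 0 then (v, y, z) else if d = 1 then (x, v, z) else (x, y, v))"

definition minus_dir :: "nat \<Rightarrow> dir" where
  "minus_dir d = (if d = 0 then XMinus else if d = 1 then YMinus else ZMinus)"

definition plus_dir :: "nat \<Rightarrow> dir" where
  "plus_dir d = (if d = 0 then XPlus else if d = 1 then YPlus else ZPlus)"

lemma crd_mv: "d < 3 \<Longrightarrow> e < 3 \<Longrightarrow> crd e (mv d q v) = (if e = d then v else crd e q)"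
  by (cases q) auto

lemma crd_mv_same [simp]: "crd d (mv d q v) = v"
  by (cases q) auto

lemma mv_mv [simp]: "mv d (mv d q u) v = mv d q v"
  by (cases q) auto

lemma mv_crd [simp]: "mv d q (crd d q) = q"
  by (cases q) auto

lemma mem_mesh_crd: "q \<in> mesh s \<longleftrightarrow> (\<forall>d<3. crd d q < s)"
  by (cases q) (auto simp: mesh_def numeral_eq_Suc less_Suc_eq)

lemma pos_eqI:
  assumes "\<And>d. d < 3 \<Longrightarrow> crd d p = crd d q"
  shows "p = q"
  using assms[of 0] assms[of 1] assms[of 2] by (cases p; cases q) simp

lemma mv_mesh: "q \<in> mesh s \<Longrightarrow> v < s \<Longrightarrow> mv d q v \<in> mesh s"
  by (cases q) (auto simp: mesh_def)

lemma crd_mesh: "q \<in> mesh s \<Longrightarrow> crd d q < s"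
  by (cases q) (auto simp: mesh_def)

lemma neighbour_minus:
  "neighbour s (minus_dir d) q = (if crd d q = 0 then None else Some (mv d q (crd d q - 1)))"
  by (cases q) (auto simp: minus_dir_def)

lemma neighbour_plus:
  "neighbour s (plus_dir d) q =
     (if crd d q + 1 < s then Some (mv d q (crd d q + 1)) else None)"
  by (cases q) (auto simp: plus_dir_def)

primrec reach :: "nat \<Rightarrow> dir \<Rightarrow> nat \<Rightarrow> pos \<Rightarrow> pos option" where
  "reach s dr 0 q = Some q"
| "reach s dr (Suc t) q = (case neighbour s dr q of None \<Rightarrow> None | Some q' \<Rightarrow> reach s dr t q')"

lemma reach_minus:
  "reach s (minus_dir d) t q = (if t \<le> crd d q then Some (mv d q (crd d q - t)) else None)"
  by (induction t arbitrary: q) (auto simp: neighbour_minus)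

lemma reach_plus:
  "q \<in> mesh s \<Longrightarrow>
    reach s (plus_dir d) t q = (if crd d q + t < s then Some (mv d q (crd d q + t)) else None)"
  by (induction t arbitrary: q) (auto simp: neighbour_plus mv_mesh crd_mesh)

text \<open>A plain \<open>Recv\<close> would keep the old word at the boundary. The detour through
  register 35 lets zeros enter there instead, so that no packet is duplicated.\<close>

definition shift :: "dir \<Rightarrow> reg \<Rightarrow> instr list" where
  "shift dr r = [Const 35 0, Recv dr 35 r, Move r 35]"

text \<open>A packet occupies the registers 20 to 23: a flag, its linear destination, and two
  words of payload.\<close>

definition capture :: "dir \<Rightarrow> cmd" where
  "capture dr = Block (
     [Arith Eq 34 24 33, CMove 28 34 34, CMove 29 34 25, CMove 30 34 26, CMove 31 34 27] @
     shift dr 24 @ shift dr 25 @ shift dr 26 @ shift dr 27)"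

text \<open>Register 36 holds the target coordinate on axis \<open>d\<close>, and 110 the length of
  the line. Headers are coordinates plus 1, so that 0 marks an empty lane. The packets pass by in
  both directions and each cell copies the one addressed to it; copying instead of stopping keeps
  all lanes in lockstep.\<close>

definition gather :: "nat \<Rightarrow> cmd" where
  "gather d =
     Block [Const 32 1, Arith Add 33 d 32, Arith Add 37 36 32, Const 38 0, CMove 38 20 37,
       Const 28 0, Move 24 38, Move 25 21, Move 26 22, Move 27 23, Move 111 110] ;;
     Loop 111 (capture (minus_dir d)) ;;
     Block [Move 24 38, Move 25 21, Move 26 22, Move 27 23, Move 111 110] ;;
     Loop 111 (capture (plus_dir d)) ;;
     Block [Move 20 28, Move 21 29, Move 22 30, Move 23 31]"

context machine
begin

lemma sem_shift:
  "x \<noteq> 35 \<Longrightarrow> r \<noteq> 35 \<Longrightarrow> fold sem (shift dr r) \<sigma> q x =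
    (if x = r then (case neighbour s dr q of None \<Rightarrow> 0 | Some q' \<Rightarrow> \<sigma> q' r) else \<sigma> q x)"
  by (auto simp: shift_def sem_apply split: option.split)

text \<open>The lane after \<open>t\<close> shifts; the default 0 is the word that entered at the
  boundary.\<close>

definition flown :: "dir \<Rightarrow> nat \<Rightarrow> state \<Rightarrow> pos \<Rightarrow> reg \<Rightarrow> nat" where
  "flown dr t \<sigma> q r = (case reach s dr t q of None \<Rightarrow> 0 | Some q' \<Rightarrow> \<sigma> q' r)"

lemma flown_0 [simp]: "flown dr 0 \<sigma> q r = \<sigma> q r"
  by (simp add: flown_def)

lemma flown_Suc:
  "flown dr (Suc t) \<sigma> q r =
    (case neighbour s dr q of None \<Rightarrow> 0 | Some q' \<Rightarrow> flown dr t \<sigma> q' r)"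
  by (auto simp: flown_def split: option.split)

lemma den_capture_flow:
  "x \<in> {24, 25, 26, 27} \<Longrightarrow> den (capture dr) \<sigma> q x =
     (case neighbour s dr q of None \<Rightarrow> 0 | Some q' \<Rightarrow> \<sigma> q' x)"
  by (auto simp: capture_def sem_shift sem_apply split: option.split)

lemma den_capture_out:
  "x \<in> {28, 29, 30, 31} \<Longrightarrow> den (capture dr) \<sigma> q x =
     (if \<sigma> q 24 = \<sigma> q 33 then if x = 28 then 1 else \<sigma> q (x - 4) else \<sigma> q x)"
  using w_pos by (auto simp: capture_def sem_shift sem_apply)

text \<open>If several matching headers pass, the last one wins. The statement leaves open which
  \<open>t\<close> this is, since \<open>holds_gather\<close> obtains uniqueness from the
  injectivity of the targets.\<close>

lemma den_Loop_capture:
  fixes dr \<sigma>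
  defines "\<sigma>' \<equiv> den (Loop 111 (capture dr)) \<sigma>"
  assumes "\<sigma> (0, 0, 0) 111 = N" and "q \<in> mesh s"
  shows "((\<forall>t<N. flown dr t \<sigma> q 24 \<noteq> \<sigma> q 33) \<and> (\<forall>x\<in>{28, 29, 30, 31}. \<sigma>' q x = \<sigma> q x)) \<or>
    (\<exists>t<N. flown dr t \<sigma> q 24 = \<sigma> q 33 \<and> \<sigma>' q 28 = 1 \<and>
       (\<forall>x\<in>{29, 30, 31}. \<sigma>' q x = flown dr t \<sigma> q (x - 4)))"
proof -
  let ?I = "\<lambda>N \<tau>. \<forall>q\<in>mesh s. \<tau> q 33 = \<sigma> q 33 \<and>
    (\<forall>x\<in>{24, 25, 26, 27}. \<tau> q x = flown dr N \<sigma> q x) \<and>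
    (((\<forall>t<N. flown dr t \<sigma> q 24 \<noteq> \<sigma> q 33) \<and> (\<forall>x\<in>{28, 29, 30, 31}. \<tau> q x = \<sigma> q x)) \<or>
    (\<exists>t<N. flown dr t \<sigma> q 24 = \<sigma> q 33 \<and> \<tau> q 28 = 1 \<and>
       (\<forall>x\<in>{29, 30, 31}. \<tau> q x = flown dr t \<sigma> q (x - 4))))"
  have "?I N \<sigma>'"
    unfolding \<sigma>'_def
  proof (rule den_Loop[where I = ?I])
    show "\<sigma> (0, 0, 0) 111 = N" by (fact assms)
  next
    fix t \<tau>
    assume I: "?I t \<tau>"
    show "?I (Suc t) (dec 111 (den (capture dr) \<tau>))"
    proof
      fix q assume q: "q \<in> mesh s"
      let ?\<tau>' = "dec 111 (den (capture dr) \<tau>)"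
      have fr: "?\<tau>' q 33 = \<tau> q 33"
        by (subst dec_frame, simp, rule den_frame, simp add: capture_def shift_def)
      have fl: "?\<tau>' q x = flown dr (Suc t) \<sigma> q x" if "x \<in> {24, 25, 26, 27}" for x
      proof -
        have "?\<tau>' q x = (case neighbour s dr q of None \<Rightarrow> 0 | Some q' \<Rightarrow> \<tau> q' x)"
          using that den_capture_flow[OF that, of dr \<tau> q] by (subst dec_frame) auto
        then show ?thesis
          using I that neighbour_mesh[OF q] unfolding flown_Suc by (auto split: option.split)
      qed
      have out: "?\<tau>' q x =
          (if \<tau> q 24 = \<tau> q 33 then if x = 28 then 1 else \<tau> q (x - 4) else \<tau> q x)"
        if "x \<in> {28, 29, 30, 31}" for x
        using that den_capture_out[OF that, of dr \<tau> q] by (subst dec_frame) auto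
      have Iq: "\<tau> q 33 = \<sigma> q 33" "\<tau> q 24 = flown dr t \<sigma> q 24"
        "\<forall>x\<in>{29, 30, 31}. \<tau> q (x - 4) = flown dr t \<sigma> q (x - 4)"
        "((\<forall>u<t. flown dr u \<sigma> q 24 \<noteq> \<sigma> q 33) \<and> (\<forall>x\<in>{28, 29, 30, 31}. \<tau> q x = \<sigma> q x)) \<or>
        (\<exists>u<t. flown dr u \<sigma> q 24 = \<sigma> q 33 \<and> \<tau> q 28 = 1 \<and>
           (\<forall>x\<in>{29, 30, 31}. \<tau> q x = flown dr u \<sigma> q (x - 4)))"
        using bspec[OF I q] by simp_all
      have R: "((\<forall>u<Suc t. flown dr u \<sigma> q 24 \<noteq> \<sigma> q 33) \<and> (\<forall>x\<in>{28, 29, 30, 31}. ?\<tau>' q x = \<sigma> q x)) \<or>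
        (\<exists>u<Suc t. flown dr u \<sigma> q 24 = \<sigma> q 33 \<and> ?\<tau>' q 28 = 1 \<and>
           (\<forall>x\<in>{29, 30, 31}. ?\<tau>' q x = flown dr u \<sigma> q (x - 4)))"
      proof (cases "\<tau> q 24 = \<tau> q 33")
        case True
        then show ?thesis
          using Iq(1-3) out by (intro disjI2 exI[of _ t]) simp
      next
        case False
        have o: "\<forall>x\<in>{28, 29, 30, 31}. ?\<tau>' q x = \<tau> q x"
          using False out by simp
        moreover have "flown dr t \<sigma> q 24 \<noteq> \<sigma> q 33" using Iq(1,2) False by simp
        ultimately show ?thesis
          using Iq(4) unfolding All_less_Suc Ex_less_Suc by simp
      qed
      have a: "?\<tau>' q 33 = \<sigma> q 33" using fr Iq(1) by simp
      have b: "\<forall>x\<in>{24, 25, 26, 27}. ?\<tau>' q x = flown dr (Suc t) \<sigma> q x" using fl by blast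
      show "?\<tau>' q 33 = \<sigma> q 33 \<and>
        (\<forall>x\<in>{24, 25, 26, 27}. ?\<tau>' q x = flown dr (Suc t) \<sigma> q x) \<and>
        (((\<forall>u<Suc t. flown dr u \<sigma> q 24 \<noteq> \<sigma> q 33) \<and> (\<forall>x\<in>{28, 29, 30, 31}. ?\<tau>' q x = \<sigma> q x)) \<or>
        (\<exists>u<Suc t. flown dr u \<sigma> q 24 = \<sigma> q 33 \<and> ?\<tau>' q 28 = 1 \<and>
           (\<forall>x\<in>{29, 30, 31}. ?\<tau>' q x = flown dr u \<sigma> q (x - 4))))"
        by (rule conjI[OF a conjI[OF b R]])
    qed
  qed simp
  then show ?thesis using assms(3) by auto
qed

text \<open>Packets are named by an index set, so that routing changes only the position map
  \<open>ps\<close>, while keys and values stay attached to the names.\<close>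

definition holds :: "'i set \<Rightarrow> ('i \<Rightarrow> pos) \<Rightarrow> ('i \<Rightarrow> nat) \<Rightarrow> ('i \<Rightarrow> nat) \<Rightarrow> ('i \<Rightarrow> nat) \<Rightarrow> state \<Rightarrow> bool"
  where "holds S ps D K V \<sigma> \<longleftrightarrow> inj_on ps S \<and> ps ` S \<subseteq> mesh s \<and>
    (\<forall>i\<in>S. \<sigma> (ps i) 20 = 1 \<and> \<sigma> (ps i) 21 = D i \<and> \<sigma> (ps i) 22 = K i \<and> \<sigma> (ps i) 23 = V i) \<and>
    (\<forall>q\<in>mesh s - ps ` S. \<sigma> q 20 = 0)"

text \<open>The pass with \<open>minus_dir\<close> delivers every packet whose target is not below
  its source, the pass with \<open>plus_dir\<close> every packet whose target is not above it.
  \<open>M\<close> rounds suffice because source and target both lie below \<open>M\<close>; by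
  \<open>inj\<close> no cell is claimed by two packets.\<close>

lemma holds_gather:
  assumes "d < 3" and S: "holds S ps D K V \<sigma>"
    and tgt: "\<And>i. i \<in> S \<Longrightarrow> \<sigma> (ps i) 36 = tgt i \<and> tgt i < M \<and> crd d (ps i) < M"
    and inj: "inj_on (\<lambda>i. mv d (ps i) (tgt i)) S"
    and M: "\<sigma> (0, 0, 0) 110 = M" "M \<le> s" and sw: "s < 2 ^ w"
    and own: "\<And>q. q \<in> mesh s \<Longrightarrow> \<sigma> q d = crd d q"
  shows "holds S (\<lambda>i. mv d (ps i) (tgt i)) D K V (den (gather d) \<sigma>)"
proof -
  let ?np = "\<lambda>i. mv d (ps i) (tgt i)"
  define H where "H q = (if \<sigma> q 20 \<noteq> 0 then \<sigma> q 36 + 1 else 0)" for q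
  define \<sigma>1 where "\<sigma>1 = den (Block [Const 32 1, Arith Add 33 d 32, Arith Add 37 36 32, Const 38 0,
    CMove 38 20 37, Const 28 0, Move 24 38, Move 25 21, Move 26 22, Move 27 23, Move 111 110]) \<sigma>"
  define \<sigma>2 where "\<sigma>2 = den (Loop 111 (capture (minus_dir d))) \<sigma>1"
  define \<sigma>3 where "\<sigma>3 = den (Block [Move 24 38, Move 25 21, Move 26 22, Move 27 23, Move 111 110]) \<sigma>2"
  define \<sigma>4 where "\<sigma>4 = den (Loop 111 (capture (plus_dir d))) \<sigma>3"
  define \<sigma>5 where "\<sigma>5 = den (Block [Move 20 28, Move 21 29, Move 22 30, Move 23 31]) \<sigma>4"
  have den: "den (gather d) \<sigma> = \<sigma>5"
    by (simp add: gather_def \<sigma>1_def \<sigma>2_def \<sigma>3_def \<sigma>4_def \<sigma>5_def)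
  have src: "\<exists>i\<in>S. q = ps i" if "q \<in> mesh s" "\<sigma> q 20 \<noteq> 0" for q
    using S that unfolding holds_def by (metis DiffI imageE)
  have bound: "crd d q + 1 < 2 ^ w" if "q \<in> mesh s" for q
    using crd_mesh[OF that, of d] sw by simp
  have H: "\<sigma>1 q 38 = H q" if "q \<in> mesh s" for q
  proof (cases "\<sigma> q 20 = 0")
    case False
    then obtain i where "i \<in> S" "q = ps i" using src \<open>q \<in> mesh s\<close> by blast
    then have "\<sigma> q 36 + 1 < 2 ^ w" using tgt M sw by fastforce
    then show ?thesis using False w_pos \<open>d < 3\<close> by (simp add: \<sigma>1_def H_def sem_apply)
  qed (use \<open>d < 3\<close> in \<open>simp add: \<sigma>1_def H_def sem_apply\<close>)
  have s1: "\<sigma>1 q 33 = crd d q + 1" "\<sigma>1 q 28 = 0" "\<sigma>1 q 24 = H q"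
    "\<sigma>1 q 25 = \<sigma> q 21" "\<sigma>1 q 26 = \<sigma> q 22" "\<sigma>1 q 27 = \<sigma> q 23"
    "\<sigma>1 q 20 = \<sigma> q 20" "\<sigma>1 q 21 = \<sigma> q 21" "\<sigma>1 q 22 = \<sigma> q 22" "\<sigma>1 q 23 = \<sigma> q 23"
    "\<sigma>1 q 110 = \<sigma> q 110" "\<sigma>1 q 111 = \<sigma> q 110"
    if "q \<in> mesh s" for q
    using own[OF that] bound[OF that] H[OF that] \<open>d < 3\<close> w_pos
    by (simp_all add: \<sigma>1_def sem_apply)
  have fr2: "\<sigma>2 q x = \<sigma>1 q x" if "x \<in> {20, 21, 22, 23, 33, 38, 110}" for q x
    unfolding \<sigma>2_def using that by (subst den_frame) (auto simp: capture_def shift_def)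
  have s3: "\<sigma>3 q 33 = crd d q + 1" "\<sigma>3 q 24 = H q"
    "\<sigma>3 q 25 = \<sigma> q 21" "\<sigma>3 q 26 = \<sigma> q 22" "\<sigma>3 q 27 = \<sigma> q 23"
    "\<forall>x\<in>{28, 29, 30, 31}. \<sigma>3 q x = \<sigma>2 q x" "\<sigma>3 q 111 = \<sigma> q 110"
    if "q \<in> mesh s" for q
    using s1[OF that] H[OF that] fr2 by (auto simp: \<sigma>3_def sem_apply)
  have s5: "\<sigma>5 q 20 = \<sigma>4 q 28" "\<sigma>5 q 21 = \<sigma>4 q 29" "\<sigma>5 q 22 = \<sigma>4 q 30" "\<sigma>5 q 23 = \<sigma>4 q 31" for q
    by (simp_all add: \<sigma>5_def sem_apply)
  have hit: "\<exists>i\<in>S. ?np i = q \<and> q' = ps i"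
    if "q \<in> mesh s" "q' \<in> mesh s" "q' = mv d q c" "H q' = crd d q + 1" for q q' c
  proof -
    have "\<sigma> q' 20 \<noteq> 0" "\<sigma> q' 36 = crd d q" using that(4) by (auto simp: H_def split: if_splits)
    then obtain i where "i \<in> S" "q' = ps i" using src \<open>q' \<in> mesh s\<close> by blast
    then show ?thesis using tgt[of i] \<open>\<sigma> q' 36 = crd d q\<close> that(3) by (metis mv_crd mv_mv)
  qed
  have HS: "H (ps i) = tgt i + 1" if "i \<in> S" for i
    using S tgt that by (auto simp: H_def holds_def)
  let ?good = "\<lambda>\<tau> q. \<exists>i\<in>S. ?np i = q \<and> \<tau> q 28 = 1 \<and> \<tau> q 29 = D i \<and> \<tau> q 30 = K i \<and> \<tau> q 31 = V i"
  have pay: "\<sigma> (ps i) 21 = D i" "\<sigma> (ps i) 22 = K i" "\<sigma> (ps i) 23 = V i" if "i \<in> S" for i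
    using S that by (auto simp: holds_def)
  have l1: "?good \<sigma>2 q \<or> \<sigma>2 q 28 = 0 \<and> (\<forall>i\<in>S. ?np i = q \<longrightarrow> crd d q < crd d (ps i))"
    if q: "q \<in> mesh s" for q
  proof -
    have fl: "flown (minus_dir d) t \<sigma>1 q x =
        (if t \<le> crd d q then \<sigma>1 (mv d q (crd d q - t)) x else 0)" for t x
      by (simp add: flown_def reach_minus)
    have mm: "mv d q (crd d q - t) \<in> mesh s" for t
      using crd_mesh[OF q, of d] by (intro mv_mesh[OF q]) auto
    have "\<sigma>1 (0, 0, 0) 111 = M" using s1 origin_mesh M by simp
    from den_Loop_capture[of \<sigma>1 M q "minus_dir d", OF this q, folded \<sigma>2_def]
    consider (no) "\<forall>t<M. flown (minus_dir d) t \<sigma>1 q 24 \<noteq> \<sigma>1 q 33" "\<sigma>2 q 28 = 0"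
      | (yes) t where "t < M" "flown (minus_dir d) t \<sigma>1 q 24 = \<sigma>1 q 33" "\<sigma>2 q 28 = 1"
        "\<forall>x\<in>{29, 30, 31}. \<sigma>2 q x = flown (minus_dir d) t \<sigma>1 q (x - 4)"
      using s1(2)[OF q] by auto
    then show ?thesis
    proof cases
      case no
      have "crd d q < crd d (ps i)" if "i \<in> S" "?np i = q" for i
      proof (rule ccontr)
        assume "\<not> crd d q < crd d (ps i)"
        then have le: "crd d (ps i) \<le> crd d q" by simp
        define t where "t = crd d q - crd d (ps i)"
        have "crd d q = tgt i" using that by auto
        then have "t < M" using tgt[OF that(1)] unfolding t_def by linarith
        moreover have "mv d q (crd d q - t) = ps i"
          using that(2) le by (auto simp: t_def)
        ultimately show False
          using no(1) fl[of t 24] s1[OF mm[of t]] s1(1)[OF q] HS[OF that(1)] \<open>crd d q = tgt i\<close>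
          by (auto simp: t_def)
      qed
      then show ?thesis using no by auto
    next
      case yes
      then have le: "t \<le> crd d q" using fl s1(1)[OF q] by (metis add_is_0 one_neq_zero)
      then have "H (mv d q (crd d q - t)) = crd d q + 1"
        using yes(2) fl s1(1)[OF q] s1(3)[OF mm] by simp
      from hit[OF q mm refl this] obtain i where i: "i \<in> S" "?np i = q" "mv d q (crd d q - t) = ps i"
        by auto
      have "\<sigma>1 (ps i) 25 = D i" "\<sigma>1 (ps i) 26 = K i" "\<sigma>1 (ps i) 27 = V i"
        using s1(4-6)[OF mm[of t]] pay[OF i(1)] by (simp_all add: i(3))
      then show ?thesis
        using yes(3,4) le i(1,2) by (intro disjI1 bexI[of _ i]) (simp_all add: fl i(3))
    qed
  qed
  have l2: "?good \<sigma>4 q \<or> \<sigma>4 q 28 = 0 \<and> (\<forall>i\<in>S. ?np i \<noteq> q)"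
    if q: "q \<in> mesh s" for q
  proof -
    have fl: "flown (plus_dir d) t \<sigma>3 q x =
        (if crd d q + t < s then \<sigma>3 (mv d q (crd d q + t)) x else 0)" for t x
      by (simp add: flown_def reach_plus[OF q])
    have mm: "mv d q (crd d q + t) \<in> mesh s" if "crd d q + t < s" for t
      using that by (intro mv_mesh[OF q]) auto
    have "\<sigma>3 (0, 0, 0) 111 = M" using s3 origin_mesh M by simp
    from den_Loop_capture[of \<sigma>3 M q "plus_dir d", OF this q, folded \<sigma>4_def]
    consider (no) "\<forall>t<M. flown (plus_dir d) t \<sigma>3 q 24 \<noteq> \<sigma>3 q 33" "\<forall>x\<in>{28, 29, 30, 31}. \<sigma>4 q x = \<sigma>2 q x"
      | (yes) t where "t < M" "flown (plus_dir d) t \<sigma>3 q 24 = \<sigma>3 q 33" "\<sigma>4 q 28 = 1"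
        "\<forall>x\<in>{29, 30, 31}. \<sigma>4 q x = flown (plus_dir d) t \<sigma>3 q (x - 4)"
      using s3(6)[OF q] by auto
    then show ?thesis
    proof cases
      case no
      have "crd d (ps i) < crd d q" if "i \<in> S" "?np i = q" for i
      proof (rule ccontr)
        assume "\<not> crd d (ps i) < crd d q"
        then have le: "crd d q \<le> crd d (ps i)" by simp
        define t where "t = crd d (ps i) - crd d q"
        have "crd d q = tgt i" using that by auto
        have "t < M" using tgt[OF that(1)] unfolding t_def by linarith
        moreover have eq: "mv d q (crd d q + t) = ps i" "crd d q + t = crd d (ps i)"
          using that(2) le by (auto simp: t_def)
        moreover have "ps i \<in> mesh s" using S that(1) by (auto simp: holds_def)
        moreover have "crd d q + t < s" using eq crd_mesh[OF \<open>ps i \<in> mesh s\<close>, of d] by simp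
        ultimately show False
          using no(1) fl[of t 24] s3(2) s3(1)[OF q] HS[OF that(1)] \<open>crd d q = tgt i\<close>
          by auto
      qed
      then show ?thesis using no(2) l1[OF q] by fastforce
    next
      case yes
      then have le: "crd d q + t < s" using fl s3(1)[OF q] by (metis add_is_0 one_neq_zero)
      then have "H (mv d q (crd d q + t)) = crd d q + 1"
        using yes(2) fl s3(1)[OF q] s3(2)[OF mm] by simp
      from hit[OF q mm[OF le] refl this]
      obtain i where i: "i \<in> S" "?np i = q" "mv d q (crd d q + t) = ps i"
        by auto
      have "\<sigma>3 (ps i) 25 = D i" "\<sigma>3 (ps i) 26 = K i" "\<sigma>3 (ps i) 27 = V i"
        using s3(3-5)[OF mm[OF le]] pay[OF i(1)] by (simp_all add: i(3))
      then show ?thesis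
        using yes(3,4) le i(1,2) by (intro disjI1 bexI[of _ i]) (simp_all add: fl i(3))
    qed
  qed
  have mesh: "?np i \<in> mesh s" if "i \<in> S" for i
    using S tgt[OF that] M(2) that by (intro mv_mesh) (auto simp: holds_def)
  have "\<sigma>5 (?np i) 20 = 1 \<and> \<sigma>5 (?np i) 21 = D i \<and> \<sigma>5 (?np i) 22 = K i \<and> \<sigma>5 (?np i) 23 = V i"
    if iS: "i \<in> S" for i
  proof -
    obtain j where "j \<in> S" "?np j = ?np i" and j: "\<sigma>4 (?np i) 28 = 1" "\<sigma>4 (?np i) 29 = D j"
        "\<sigma>4 (?np i) 30 = K j" "\<sigma>4 (?np i) 31 = V j"
      using l2[OF mesh[OF iS]] iS by blast
    moreover from this have "j = i" using inj iS by (simp add: inj_on_def)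
    ultimately show ?thesis using s5 by simp
  qed
  moreover have "\<sigma>5 q 20 = 0" if "q \<in> mesh s" "q \<notin> ?np ` S" for q
    using l2[OF that(1)] that(2) s5(1)[of q] by auto
  ultimately show ?thesis
    unfolding den holds_def using inj mesh by auto
qed

end

section \<open>Lexicographic addresses and routes without collisions\<close>

definition axes :: "nat \<Rightarrow> nat \<Rightarrow> nat \<Rightarrow> bool" where
  "axes a b c \<longleftrightarrow> a < 3 \<and> b < 3 \<and> c < 3 \<and> a \<noteq> b \<and> a \<noteq> c \<and> b \<noteq> c"

text \<open>Lexicographic address in a cube of side \<open>m\<close>, with major axis
  \<open>a\<close> and minor axis \<open>c\<close>; \<open>cell\<close> inverts it. The axes are
  parameters because the two factors are laid out with different roles of the axes.\<close>

definition lin :: "nat \<Rightarrow> nat \<Rightarrow> nat \<Rightarrow> nat \<Rightarrow> pos \<Rightarrow> nat" where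
  "lin a b c m q = (crd a q * m + crd b q) * m + crd c q"

definition cell :: "nat \<Rightarrow> nat \<Rightarrow> nat \<Rightarrow> nat \<Rightarrow> nat \<Rightarrow> pos" where
  "cell a b c m v = mv a (mv b (mv c (0, 0, 0) (v mod m)) (v div m mod m)) (v div (m * m))"

lemma axes_pos_eqI:
  "axes a b c \<Longrightarrow> crd a p = crd a q \<Longrightarrow> crd b p = crd b q \<Longrightarrow> crd c p = crd c q \<Longrightarrow> p = q"
  by (rule pos_eqI) (auto simp: axes_def numeral_3_eq_3 less_Suc_eq)

lemma crd_cell:
  assumes "axes a b c"
  shows "crd a (cell a b c m v) = v div (m * m)" "crd b (cell a b c m v) = v div m mod m"
    "crd c (cell a b c m v) = v mod m"
  using assms by (auto simp: axes_def cell_def crd_mv)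

lemma cell_mesh:
  assumes "axes a b c" and "v < m * m * m" and "m \<le> s"
  shows "cell a b c m v \<in> mesh s"
proof -
  have "0 < m" using assms(2) by (cases m) auto
  then have "v div (m * m) < m" "v div m mod m < m" "v mod m < m"
    using assms(2) by (auto simp: less_mult_imp_div_less ac_simps)
  moreover have "d = a \<or> d = b \<or> d = c" if "d < 3" for d
    using assms(1) that by (auto simp: axes_def numeral_3_eq_3 less_Suc_eq)
  ultimately show ?thesis
    using assms(3) unfolding mem_mesh_crd by (metis crd_cell[OF assms(1)] order_less_le_trans)
qed

lemma lin_less:
  assumes "crd a q < m" "crd b q < m" "crd c q < m"
  shows "lin a b c m q < m * m * m"
proof -
  have "crd a q * m + crd b q < m * m"
    using mult_le_mono1[of "crd a q" "m - 1" m] assms by (cases m) (auto simp: algebra_simps)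
  then have "(crd a q * m + crd b q + 1) * m \<le> m * m * m" by (intro mult_le_mono1) simp
  then show ?thesis using assms(3) by (simp add: lin_def algebra_simps)
qed

lemma lin_cell:
  assumes "axes a b c" and "v < m * m * m"
  shows "lin a b c m (cell a b c m v) = v"
proof -
  have "v div (m * m) * m + v div m mod m = v div m"
    by (simp add: div_mult2_eq mult.commute)
  then show ?thesis by (simp add: lin_def crd_cell[OF assms(1)])
qed

lemma cell_lin:
  assumes "axes a b c" and "crd a q < m" "crd b q < m" "crd c q < m"
  shows "cell a b c m (lin a b c m q) = q"
  by (rule axes_pos_eqI[OF assms(1)])
    (use assms in \<open>simp_all add: crd_cell lin_def div_mult2_eq\<close>)

lemma mod_eq_imp_diff_ge:
  "(x::nat) mod m = y mod m \<Longrightarrow> x < y \<Longrightarrow> m \<le> y - x"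
  by (metis dvd_imp_le less_imp_le_nat mod_eq_dvd_iff_nat zero_less_diff)

lemma div_eq_imp_diff_less:
  assumes "(x::nat) div m = y div m" and "0 < m"
  shows "y - x < m"
proof -
  have "y = y div m * m + y mod m" "x = y div m * m + x mod m"
    using assms(1) by (metis div_mult_mod_eq)+
  moreover have "y mod m < m" using assms(2) by simp
  ultimately show ?thesis by linarith
qed

text \<open>By symmetry, a collision may be assumed to happen between elements with
  \<open>h i < h j\<close>.\<close>

lemma inj_onI_less:
  fixes h :: "'i \<Rightarrow> nat"
  assumes "inj_on h S"
    and "\<And>i j. i \<in> S \<Longrightarrow> j \<in> S \<Longrightarrow> p i = p j \<Longrightarrow> h i < h j \<Longrightarrow> False"
  shows "inj_on p S"
proof (rule inj_onI)
  fix i j assume "i \<in> S" "j \<in> S" "p i = p j"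
  then have "h i = h j" using assms(2)[of i j] assms(2)[of j i] by (metis linorder_neqE_nat)
  then show "i = j" using assms(1) \<open>i \<in> S\<close> \<open>j \<in> S\<close> by (simp add: inj_on_def)
qed

text \<open>A contracting, order preserving map can be routed along the minor axis first without
  ever having two packets in one cell; an expanding one along the major axis first.\<close>

lemma minor_first_inj:
  assumes ax: "axes a b c" and inj: "inj_on D S"
    and crd: "\<And>i. i \<in> S \<Longrightarrow> crd a (ps i) < m \<and> crd b (ps i) < m \<and> crd c (ps i) < m"
    and "m \<le> M"
    and contr: "\<And>i j. i \<in> S \<Longrightarrow> j \<in> S \<Longrightarrow> D i < D j \<Longrightarrow>
      D j - D i \<le> lin a b c m (ps j) - lin a b c m (ps i)"
  shows "inj_on (\<lambda>i. mv c (ps i) (D i mod M)) S"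
    and "inj_on (\<lambda>i. mv b (mv c (ps i) (D i mod M)) (D i div M mod M)) S"
    and "inj_on (\<lambda>i. cell a b c M (D i)) S"
proof -
  have ax': "a < 3" "b < 3" "c < 3" "a \<noteq> b" "a \<noteq> c" "b \<noteq> c" using ax by (auto simp: axes_def)
  show "inj_on (\<lambda>i. mv c (ps i) (D i mod M)) S"
  proof (rule inj_onI_less[OF inj])
    \<comment> \<open>Colliding packets start in the same line, so their addresses differ by less
      than \<open>M\<close>. Their destinations are congruent modulo \<open>M\<close> and distinct,
      hence at least \<open>M\<close> apart, which contradicts \<open>contr\<close>.\<close>
    fix i j assume ij: "i \<in> S" "j \<in> S" "mv c (ps i) (D i mod M) = mv c (ps j) (D j mod M)" "D i < D j"
    have "D i mod M = D j mod M" "crd a (ps i) = crd a (ps j)" "crd b (ps i) = crd b (ps j)"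
      using arg_cong[OF ij(3), of "crd c"] arg_cong[OF ij(3), of "crd a"]
        arg_cong[OF ij(3), of "crd b"] ax' by (simp_all add: crd_mv)
    moreover have "crd c (ps j) < M" using crd[OF ij(2)] \<open>m \<le> M\<close> by simp
    ultimately show False
      using mod_eq_imp_diff_ge[of "D i" M "D j"] contr[OF ij(1,2,4)] ij(4) by (simp add: lin_def)
  qed
  show "inj_on (\<lambda>i. mv b (mv c (ps i) (D i mod M)) (D i div M mod M)) S"
  proof (rule inj_onI_less[OF inj])
    \<comment> \<open>The same argument one dimension up: the sources lie in one plane, at distance
      less than \<open>m * m\<close>, and the destinations are congruent modulo
      \<open>M * M\<close>.\<close>
    fix i j assume ij: "i \<in> S" "j \<in> S" "D i < D j"
      "mv b (mv c (ps i) (D i mod M)) (D i div M mod M) = mv b (mv c (ps j) (D j mod M)) (D j div M mod M)"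
    have eq: "D i mod M = D j mod M" "crd a (ps i) = crd a (ps j)" "D i div M mod M = D j div M mod M"
      using arg_cong[OF ij(4), of "crd c"] arg_cong[OF ij(4), of "crd a"]
        arg_cong[OF ij(4), of "crd b"] ax' by (simp_all add: crd_mv)
    then have "D i mod (M * M) = D j mod (M * M)" by (simp add: mod_mult2_eq)
    then have "M * M \<le> D j - D i" using ij(3) by (rule mod_eq_imp_diff_ge)
    moreover have "crd b (ps j) * m + crd c (ps j) < m * m"
      using lin_less[of c "(0, 0, 0)" m b] crd[OF ij(2)]
        mult_le_mono1[of "crd b (ps j)" "m - 1" m] by (cases m) (auto simp: algebra_simps)
    moreover have "m * m \<le> M * M" using \<open>m \<le> M\<close> by (simp add: mult_le_mono)
    ultimately show False
      using contr[OF ij(1,2,3)] ij(3) eq(2) by (simp add: lin_def algebra_simps)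
  qed
  show "inj_on (\<lambda>i. cell a b c M (D i)) S"
  proof (rule inj_onI_less[OF inj])
    fix i j assume ij: "i \<in> S" "j \<in> S" "cell a b c M (D i) = cell a b c M (D j)" "D i < D j"
    have "D i mod M = D j mod M" "D i div M mod M = D j div M mod M" "D i div (M * M) = D j div (M * M)"
      using ij(3) by (metis crd_cell[OF ax])+
    then have "D i = D j" by (metis div_mult_mod_eq mod_mult2_eq)
    then show False using ij(4) by simp
  qed
qed

text \<open>Dual to the contracting case: colliding packets have destinations in a common plane or
  line, hence close together, while their sources are congruent modulo \<open>M * M\<close> or
  \<open>M\<close>, hence far apart; \<open>exp\<close> forbids this.\<close>

lemma major_first_inj:
  assumes ax: "axes a b c" and inj: "inj_on ps S"
    and crd: "\<And>i. i \<in> S \<Longrightarrow> crd a (ps i) < M \<and> crd b (ps i) < M \<and> crd c (ps i) < M"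
    and exp: "\<And>i j. i \<in> S \<Longrightarrow> j \<in> S \<Longrightarrow> lin a b c M (ps i) < lin a b c M (ps j) \<Longrightarrow>
      lin a b c M (ps j) - lin a b c M (ps i) \<le> D j - D i"
  shows "inj_on (\<lambda>i. mv a (ps i) (D i div (M * M))) S"
    and "inj_on (\<lambda>i. mv b (mv a (ps i) (D i div (M * M))) (D i div M mod M)) S"
    and "inj_on (\<lambda>i. cell a b c M (D i)) S"
proof -
  have ax': "a < 3" "b < 3" "c < 3" "a \<noteq> b" "a \<noteq> c" "b \<noteq> c" using ax by (auto simp: axes_def)
  let ?l = "\<lambda>i. lin a b c M (ps i)"
  have injl: "inj_on ?l S"
  proof (rule inj_onI)
    fix i j assume ij: "i \<in> S" "j \<in> S" "?l i = ?l j"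
    have "ps i = ps j" using cell_lin[OF ax, of "ps i" M] cell_lin[OF ax, of "ps j" M] crd ij by metis
    then show "i = j" using inj ij by (simp add: inj_on_def)
  qed
  have M0: "0 < M" if "i \<in> S" for i using crd[OF that] by auto
  show "inj_on (\<lambda>i. mv a (ps i) (D i div (M * M))) S"
  proof (rule inj_onI_less[OF injl])
    fix i j assume ij: "i \<in> S" "j \<in> S" "?l i < ?l j"
      "mv a (ps i) (D i div (M * M)) = mv a (ps j) (D j div (M * M))"
    have eq: "D i div (M * M) = D j div (M * M)" "crd b (ps i) = crd b (ps j)" "crd c (ps i) = crd c (ps j)"
      using arg_cong[OF ij(4), of "crd c"] arg_cong[OF ij(4), of "crd a"]
        arg_cong[OF ij(4), of "crd b"] ax' by (simp_all add: crd_mv)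
    have "D j - D i < M * M" using eq(1) M0[OF ij(1)] by (intro div_eq_imp_diff_less) auto
    moreover have "?l i mod (M * M) = ?l j mod (M * M)"
      unfolding lin_def mod_mult2_eq using eq(2,3) crd[OF ij(1)] crd[OF ij(2)] by simp
    ultimately show False
      using mod_eq_imp_diff_ge[OF _ ij(3)] exp[OF ij(1,2,3)] by (metis leD order_trans)
  qed
  show "inj_on (\<lambda>i. mv b (mv a (ps i) (D i div (M * M))) (D i div M mod M)) S"
  proof (rule inj_onI_less[OF injl])
    fix i j assume ij: "i \<in> S" "j \<in> S" "?l i < ?l j"
      "mv b (mv a (ps i) (D i div (M * M))) (D i div M mod M) = mv b (mv a (ps j) (D j div (M * M))) (D j div M mod M)"
    have eq: "D i div (M * M) = D j div (M * M)" "D i div M mod M = D j div M mod M" "crd c (ps i) = crd c (ps j)"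
      using arg_cong[OF ij(4), of "crd c"] arg_cong[OF ij(4), of "crd a"]
        arg_cong[OF ij(4), of "crd b"] ax' by (simp_all add: crd_mv)
    have "D i div M = D j div M" using eq(1,2) by (metis div_mult2_eq div_mult_mod_eq)
    then have "D j - D i < M" using M0[OF ij(1)] by (rule div_eq_imp_diff_less)
    moreover have "?l i mod M = ?l j mod M" unfolding lin_def using eq(3) by simp
    ultimately show False
      using mod_eq_imp_diff_ge[OF _ ij(3)] exp[OF ij(1,2,3)] by (metis leD order_trans)
  qed
  show "inj_on (\<lambda>i. cell a b c M (D i)) S"
  proof (rule inj_onI_less[OF injl])
    fix i j assume ij: "i \<in> S" "j \<in> S" "cell a b c M (D i) = cell a b c M (D j)" "?l i < ?l j"
    have "D i mod M = D j mod M" "D i div M mod M = D j div M mod M" "D i div (M * M) = D j div (M * M)"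
      using ij(3) by (metis crd_cell[OF ax])+
    then have "D i = D j" by (metis div_mult_mod_eq mod_mult2_eq)
    then show False using exp[OF ij(1,2,4)] ij(4) by simp
  qed
qed

definition minor_target :: "instr list" where
  "minor_target = [Arith Mod 36 21 110]"

definition middle_target :: "instr list" where
  "middle_target = [Arith Div 36 21 110, Arith Mod 36 36 110]"

definition major_target :: "instr list" where
  "major_target = [Arith Mul 32 110 110, Arith Div 36 21 32]"

definition route_minor_first :: "nat \<Rightarrow> nat \<Rightarrow> nat \<Rightarrow> cmd" where
  "route_minor_first a b c =
     Block minor_target ;; gather c ;; Block middle_target ;; gather b ;; Block major_target ;; gather a"

definition route_major_first :: "nat \<Rightarrow> nat \<Rightarrow> nat \<Rightarrow> cmd" where
  "route_major_first a b c =
     Block major_target ;; gather a ;; Block middle_target ;; gather b ;; Block minor_target ;; gather c"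

lemmas code_defs = capture_def shift_def gather_def minor_target_def middle_target_def
  major_target_def route_minor_first_def route_major_first_def

text \<open>\<open>size\<close> makes every linear address a word. Together with
  \<open>two_le_s\<close> it gives \<open>8 < 2 ^ w\<close>, so that the small constants in the
  programs are not truncated.\<close>

locale word_machine = machine +
  assumes size: "s * s * s < 2 ^ w" and two_le_s: "2 \<le> s"
begin

lemma s_word: "s < 2 ^ w"
proof -
  have "s \<le> s * s * s" by simp
  then show ?thesis using size by linarith
qed

lemma ss_word: "s * s < 2 ^ w"
proof -
  have "s * s \<le> s * s * s" by simp
  then show ?thesis using size by linarith
qed

definition located :: "state \<Rightarrow> bool" where
  "located \<sigma> \<longleftrightarrow> (\<forall>q\<in>mesh s. \<forall>d<3. \<sigma> q d = crd d q)"

lemma located_den: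
  assumes "located \<sigma>" and "{0, 1, 2} \<inter> set (writes c) = {}"
  shows "located (den c \<sigma>)"
proof -
  have "den c \<sigma> q d = \<sigma> q d" if "d < 3" for q d
    using assms(2) that by (intro den_frame) (auto simp: numeral_3_eq_3 numeral_2_eq_2 less_Suc_eq)
  then show ?thesis using assms(1) by (simp add: located_def)
qed

lemma holds_gather_target:
  assumes "d < 3" and S: "holds S ps D K V \<sigma>" and "located \<sigma>"
    and M: "\<forall>q\<in>mesh s. \<sigma> q 110 = M" "M \<le> s"
    and tgt: "\<And>i. i \<in> S \<Longrightarrow> fold sem is \<sigma> (ps i) 36 = tgt i \<and> tgt i < M \<and> crd d (ps i) < M"
    and inj: "inj_on (\<lambda>i. mv d (ps i) (tgt i)) S"
    and "is": "target ` set is \<inter> {0, 1, 2, 20, 21, 22, 23, 110} = {}"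
  shows "holds S (\<lambda>i. mv d (ps i) (tgt i)) D K V (den (Block is ;; gather d) \<sigma>)"
    and "located (den (Block is ;; gather d) \<sigma>)"
    and "\<forall>q\<in>mesh s. den (Block is ;; gather d) \<sigma> q 110 = M"
proof -
  let ?\<tau> = "fold sem is \<sigma>"
  have fr: "?\<tau> q x = \<sigma> q x" if "x \<in> {0, 1, 2, 20, 21, 22, 23, 110}" for q x
    using "is" that by (intro fold_sem_frame) blast
  have loc: "located ?\<tau>" using located_den[OF \<open>located \<sigma>\<close>, of "Block is"] "is" by auto
  have "holds S ps D K V ?\<tau>" using S by (simp add: holds_def fr)
  then have "holds S (\<lambda>i. mv d (ps i) (tgt i)) D K V (den (gather d) ?\<tau>)"
    using tgt inj M loc \<open>d < 3\<close> origin_mesh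
    by (intro holds_gather[where M = M]) (auto simp: fr s_word located_def)
  then show "holds S (\<lambda>i. mv d (ps i) (tgt i)) D K V (den (Block is ;; gather d) \<sigma>)" by simp
  show "located (den (Block is ;; gather d) \<sigma>)"
    unfolding den.simps by (intro located_den loc) (simp add: code_defs)
  have "den (gather d) ?\<tau> q 110 = ?\<tau> q 110" for q
    by (intro den_frame) (simp add: code_defs)
  then show "\<forall>q\<in>mesh s. den (Block is ;; gather d) \<sigma> q 110 = M" using M(1) by (simp add: fr)
qed

text \<open>Injectivity of every intermediate placement is a premise here, which separates the
  behaviour of the code from the question whether the destinations contract or expand.\<close>

lemma holds_route:
  assumes ax: "axes a b c" and S: "holds S ps D K V \<sigma>" and loc: "located \<sigma>"
    and M: "\<forall>q\<in>mesh s. \<sigma> q 110 = M" "M \<le> s"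
    and D: "\<And>i. i \<in> S \<Longrightarrow> D i < M * M * M"
    and crd: "\<And>i d. i \<in> S \<Longrightarrow> d < 3 \<Longrightarrow> crd d (ps i) < M"
  shows
    "inj_on (\<lambda>i. mv c (ps i) (D i mod M)) S \<Longrightarrow>
     inj_on (\<lambda>i. mv b (mv c (ps i) (D i mod M)) (D i div M mod M)) S \<Longrightarrow>
     inj_on (\<lambda>i. cell a b c M (D i)) S \<Longrightarrow>
     holds S (\<lambda>i. cell a b c M (D i)) D K V (den (route_minor_first a b c) \<sigma>)"
    and
    "inj_on (\<lambda>i. mv a (ps i) (D i div (M * M))) S \<Longrightarrow>
     inj_on (\<lambda>i. mv b (mv a (ps i) (D i div (M * M))) (D i div M mod M)) S \<Longrightarrow>
     inj_on (\<lambda>i. cell a b c M (D i)) S \<Longrightarrow>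
     holds S (\<lambda>i. cell a b c M (D i)) D K V (den (route_major_first a b c) \<sigma>)"
proof -
  have ax': "a < 3" "b < 3" "c < 3" "a \<noteq> b" "a \<noteq> c" "b \<noteq> c" using ax by (auto simp: axes_def)
  have M0: "0 < M" if "i \<in> S" for i using D[OF that] by (cases M) auto
  have MM: "M * M < 2 ^ w" using mult_le_mono[OF M(2) M(2)] ss_word by simp
  have Mw: "M < 2 ^ w" using M(2) s_word by simp
  have MMM: "M * M * M < 2 ^ w"
    using mult_le_mono[OF mult_le_mono[OF M(2) M(2)] M(2)] size by simp
  have t1: "fold sem minor_target \<tau> (p i) 36 = D i mod M \<and> D i mod M < M"
    and t2: "fold sem middle_target \<tau> (p i) 36 = D i div M mod M \<and> D i div M mod M < M"
    and t3: "fold sem major_target \<tau> (p i) 36 = D i div (M * M) \<and> D i div (M * M) < M"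
    if "holds S p D K V \<tau>" "\<forall>q\<in>mesh s. \<tau> q 110 = M" "i \<in> S" for \<tau> p i
  proof -
    have *: "\<tau> (p i) 21 = D i" "\<tau> (p i) 110 = M" using that by (auto simp: holds_def)
    have lt: "D i < 2 ^ w" using D[OF that(3)] MMM by simp
    have "D i div M \<le> D i" "D i div (M * M) \<le> D i" by simp_all
    then have lt': "D i div M < 2 ^ w" "D i div (M * M) < 2 ^ w" using lt by linarith+
    show "fold sem minor_target \<tau> (p i) 36 = D i mod M \<and> D i mod M < M"
      using * M0[OF that(3)] Mw by (simp add: minor_target_def sem_apply)
        (meson Mw mod_less_divisor order_less_trans mod_less)
    show "fold sem middle_target \<tau> (p i) 36 = D i div M mod M \<and> D i div M mod M < M"
      using * M0[OF that(3)] Mw lt' by (simp add: middle_target_def sem_apply)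
        (meson Mw mod_less_divisor order_less_trans mod_less)
    show "fold sem major_target \<tau> (p i) 36 = D i div (M * M) \<and> D i div (M * M) < M"
      using * M0[OF that(3)] MM lt' D[OF that(3)]
      by (simp add: major_target_def sem_apply less_mult_imp_div_less ac_simps)
  qed
  show "holds S (\<lambda>i. cell a b c M (D i)) D K V (den (route_minor_first a b c) \<sigma>)"
    if inj: "inj_on (\<lambda>i. mv c (ps i) (D i mod M)) S"
     "inj_on (\<lambda>i. mv b (mv c (ps i) (D i mod M)) (D i div M mod M)) S"
     "inj_on (\<lambda>i. cell a b c M (D i)) S"
  proof -
    let ?p1 = "\<lambda>i. mv c (ps i) (D i mod M)"
    let ?p2 = "\<lambda>i. mv b (?p1 i) (D i div M mod M)"
    let ?p3 = "\<lambda>i. mv a (?p2 i) (D i div (M * M))"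
    have p3: "?p3 = (\<lambda>i. cell a b c M (D i))"
      by (rule ext, rule axes_pos_eqI[OF ax]) (use ax' in \<open>simp_all add: crd_cell[OF ax] crd_mv\<close>)
    define \<sigma>1 where "\<sigma>1 = den (Block minor_target ;; gather c) \<sigma>"
    define \<sigma>2 where "\<sigma>2 = den (Block middle_target ;; gather b) \<sigma>1"
    have 1: "holds S ?p1 D K V \<sigma>1" "located \<sigma>1" "\<forall>q\<in>mesh s. \<sigma>1 q 110 = M"
      unfolding \<sigma>1_def using t1[OF S M(1)] crd inj(1) ax'
      by (intro holds_gather_target[OF _ S loc M]; simp add: minor_target_def)+
    have 2: "holds S ?p2 D K V \<sigma>2" "located \<sigma>2" "\<forall>q\<in>mesh s. \<sigma>2 q 110 = M"
      unfolding \<sigma>2_def using t2[OF 1(1,3)] crd inj(2) ax'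
      by (intro holds_gather_target[OF _ 1 M(2)]; simp add: middle_target_def crd_mv)+
    have "holds S ?p3 D K V (den (Block major_target ;; gather a) \<sigma>2)"
      using t3[OF 2(1,3)] crd inj(3) ax' p3
      by (intro holds_gather_target[OF _ 2 M(2)]) (simp_all add: major_target_def crd_mv)
    then show ?thesis unfolding p3 by (simp add: route_minor_first_def \<sigma>1_def \<sigma>2_def)
  qed
  show "holds S (\<lambda>i. cell a b c M (D i)) D K V (den (route_major_first a b c) \<sigma>)"
    if inj: "inj_on (\<lambda>i. mv a (ps i) (D i div (M * M))) S"
     "inj_on (\<lambda>i. mv b (mv a (ps i) (D i div (M * M))) (D i div M mod M)) S"
     "inj_on (\<lambda>i. cell a b c M (D i)) S"
  proof -
    let ?p1 = "\<lambda>i. mv a (ps i) (D i div (M * M))"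
    let ?p2 = "\<lambda>i. mv b (?p1 i) (D i div M mod M)"
    let ?p3 = "\<lambda>i. mv c (?p2 i) (D i mod M)"
    have p3: "?p3 = (\<lambda>i. cell a b c M (D i))"
      by (rule ext, rule axes_pos_eqI[OF ax]) (use ax' in \<open>simp_all add: crd_cell[OF ax] crd_mv\<close>)
    define \<sigma>1 where "\<sigma>1 = den (Block major_target ;; gather a) \<sigma>"
    define \<sigma>2 where "\<sigma>2 = den (Block middle_target ;; gather b) \<sigma>1"
    have 1: "holds S ?p1 D K V \<sigma>1" "located \<sigma>1" "\<forall>q\<in>mesh s. \<sigma>1 q 110 = M"
      unfolding \<sigma>1_def using t3[OF S M(1)] crd inj(1) ax'
      by (intro holds_gather_target[OF _ S loc M]; simp add: major_target_def)+
    have 2: "holds S ?p2 D K V \<sigma>2" "located \<sigma>2" "\<forall>q\<in>mesh s. \<sigma>2 q 110 = M"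
      unfolding \<sigma>2_def using t2[OF 1(1,3)] crd inj(2) ax'
      by (intro holds_gather_target[OF _ 1 M(2)]; simp add: middle_target_def crd_mv)+
    have "holds S ?p3 D K V (den (Block minor_target ;; gather c) \<sigma>2)"
      using t1[OF 2(1,3)] crd inj(3) ax' p3
      by (intro holds_gather_target[OF _ 2 M(2)]) (simp_all add: minor_target_def crd_mv)
    then show ?thesis unfolding p3 by (simp add: route_major_first_def \<sigma>1_def \<sigma>2_def)
  qed
qed

text \<open>Each of the two loops has \<open>M\<close> rounds, with 17 instructions of
  \<open>capture\<close> and 5 of loop control.\<close>

lemma time_gather:
  assumes "\<sigma> (0, 0, 0) 110 = M"
  shows "time (gather d) \<sigma> \<le> 44 * M + 22"
proof -
  let ?b1 = "Block [Const 32 1, Arith Add 33 d 32, Arith Add 37 36 32, Const 38 0,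
    CMove 38 20 37, Const 28 0, Move 24 38, Move 25 21, Move 26 22, Move 27 23, Move 111 110]"
  let ?b2 = "Block [Move 24 38, Move 25 21, Move 26 22, Move 27 23, Move 111 110]"
  let ?l1 = "Loop 111 (capture (minus_dir d))" and ?l2 = "Loop 111 (capture (plus_dir d))"
  have tc: "time (capture dr) \<tau> \<le> 17" for dr \<tau> by (simp add: capture_def shift_def)
  have 1: "den ?b1 \<sigma> (0, 0, 0) 111 = M" using assms by (simp add: sem_apply)
  have "den ?l1 (den ?b1 \<sigma>) (0, 0, 0) 110 = den ?b1 \<sigma> (0, 0, 0) 110"
    by (intro den_frame) (simp add: code_defs)
  then have 2: "den ?b2 (den ?l1 (den ?b1 \<sigma>)) (0, 0, 0) 111 = M"
    using assms by (simp add: sem_apply)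
  have "time ?l1 (den ?b1 \<sigma>) \<le> M * (17 + 5) + 1"
    by (rule time_Loop_const) (rule 1, rule tc)
  moreover have "time ?l2 (den ?b2 (den ?l1 (den ?b1 \<sigma>))) \<le> M * (17 + 5) + 1"
    by (rule time_Loop_const) (rule 2, rule tc)
  ultimately show ?thesis unfolding gather_def time.simps(2) by simp
qed

lemma time_routes:
  assumes "\<sigma> (0, 0, 0) 110 = M"
  shows "time (route_minor_first a b c) \<sigma> \<le> 132 * M + 71"
    and "time (route_major_first a b c) \<sigma> \<le> 132 * M + 71"
proof -
  have fr: "den (gather d) \<tau> q 110 = \<tau> q 110" "den (Block minor_target) \<tau> q 110 = \<tau> q 110"
    "den (Block middle_target) \<tau> q 110 = \<tau> q 110" "den (Block major_target) \<tau> q 110 = \<tau> q 110"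
    for \<tau> q d
    by (intro den_frame; simp add: code_defs)+
  have g: "time (gather d) \<tau> \<le> 44 * M + 22" if "\<tau> (0, 0, 0) 110 = M" for d \<tau>
    using that by (rule time_gather)
  show "time (route_minor_first a b c) \<sigma> \<le> 132 * M + 71"
    using g[of "den (Block minor_target) \<sigma>" c]
      g[of "den (Block middle_target) (den (gather c) (den (Block minor_target) \<sigma>))" b]
      g[of "den (Block major_target) (den (gather b) (den (Block middle_target)
         (den (gather c) (den (Block minor_target) \<sigma>))))" a]
      assms fr
    by (simp add: route_minor_first_def minor_target_def middle_target_def major_target_def
        del: den.simps(1))
  show "time (route_major_first a b c) \<sigma> \<le> 132 * M + 71"
    using g[of "den (Block major_target) \<sigma>" a]
      g[of "den (Block middle_target) (den (gather a) (den (Block major_target) \<sigma>))" b]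
      g[of "den (Block minor_target) (den (gather b) (den (Block middle_target)
         (den (gather a) (den (Block major_target) \<sigma>))))" c]
      assms fr
    by (simp add: route_major_first_def minor_target_def middle_target_def major_target_def
        del: den.simps(1))
qed

end

section \<open>Prefix sums and radix sort\<close>

definition add_flow :: "dir \<Rightarrow> reg \<Rightarrow> cmd" where
  "add_flow dr r = Block (shift dr 48 @ [Arith Add r r 48])"

text \<open>Prefix sums (register 46) and totals (register 47) of register 45 along the lines of
  direction \<open>d\<close>.\<close>

definition scan :: "nat \<Rightarrow> cmd" where
  "scan d =
     Block [Move 48 45, Const 46 0, Move 111 110] ;; Loop 111 (add_flow (minus_dir d) 46) ;;
     Block [Move 48 45, Arith Add 47 46 45, Move 111 110] ;; Loop 111 (add_flow (plus_dir d) 47)"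

text \<open>Earlier packets are kept in the registers 40 to 42, and register 44 holds their number.\<close>

definition append_packets :: "nat \<Rightarrow> nat \<Rightarrow> nat \<Rightarrow> cmd" where
  "append_packets a b c =
     Block [Move 45 20] ;; scan c ;; Block [Move 43 46, Move 45 47] ;; scan b ;;
     Block [Arith Add 43 43 46, Move 45 47] ;; scan a ;;
     Block [Arith Add 43 43 46, Arith Add 21 43 44, Arith Add 44 44 47] ;;
     route_minor_first a b c ;;
     Block [CMove 41 20 22, CMove 42 20 23, CMove 40 20 20]"

lemmas code_defs' = code_defs add_flow_def scan_def append_packets_def

context word_machine
begin

lemma den_Loop_add_flow:
  fixes dr r \<sigma>
  defines "\<sigma>' \<equiv> den (Loop 111 (add_flow dr r)) \<sigma>"
  assumes "\<sigma> (0, 0, 0) 111 = N" and r: "r \<in> {46, 47}" and "q \<in> mesh s" and "\<And>q. \<sigma> q r < 2 ^ w"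
  shows "\<sigma>' q r = (\<sigma> q r + (\<Sum>u<N. flown dr (Suc u) \<sigma> q 48)) mod 2 ^ w"
proof -
  let ?I = "\<lambda>N \<tau>. \<forall>q\<in>mesh s. \<tau> q 48 = flown dr N \<sigma> q 48 \<and>
    \<tau> q r = (\<sigma> q r + (\<Sum>u<N. flown dr (Suc u) \<sigma> q 48)) mod 2 ^ w"
  have "?I N \<sigma>'"
    unfolding \<sigma>'_def
  proof (rule den_Loop[where I = ?I])
    show "\<sigma> (0, 0, 0) 111 = N" by fact
  next
    show "?I 0 \<sigma>" using assms by simp
  next
    fix t \<tau>
    assume I: "?I t \<tau>"
    show "?I (Suc t) (dec 111 (den (add_flow dr r) \<tau>))"
    proof
      fix q assume q: "q \<in> mesh s"
      have fl: "(case neighbour s dr q of None \<Rightarrow> 0 | Some q' \<Rightarrow> \<tau> q' 48) = flown dr (Suc t) \<sigma> q 48"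
        using I neighbour_mesh[OF q] unfolding flown_Suc by (auto split: option.split)
      have "dec 111 (den (add_flow dr r) \<tau>) q 48 = flown dr (Suc t) \<sigma> q 48"
        using r fl by (subst dec_frame) (auto simp: add_flow_def sem_shift sem_apply)
      moreover have "dec 111 (den (add_flow dr r) \<tau>) q r = (\<tau> q r + flown dr (Suc t) \<sigma> q 48) mod 2 ^ w"
        using r fl by (subst dec_frame) (auto simp: add_flow_def sem_shift sem_apply)
      ultimately show "dec 111 (den (add_flow dr r) \<tau>) q 48 = flown dr (Suc t) \<sigma> q 48 \<and>
        dec 111 (den (add_flow dr r) \<tau>) q r =
          (\<sigma> q r + (\<Sum>u<Suc t. flown dr (Suc u) \<sigma> q 48)) mod 2 ^ w"
        using I q by (simp add: mod_simps ac_simps)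
    qed
  qed
  then show ?thesis using assms by simp
qed

text \<open>\<open>M\<close> rounds can also bring in words from cells beyond \<open>M\<close>;
  \<open>zero\<close> makes them harmless. The total is composed of the prefix, the own word and the
  suffix.\<close>

lemma den_scan:
  assumes M: "\<sigma> (0, 0, 0) 110 = M" "M \<le> s" and q: "q \<in> mesh s" "crd d q < M"
    and zero: "\<And>v. M \<le> v \<Longrightarrow> v < s \<Longrightarrow> \<sigma> (mv d q v) 45 = 0"
  shows "den (scan d) \<sigma> q 46 = (\<Sum>v<crd d q. \<sigma> (mv d q v) 45) mod 2 ^ w"
    and "den (scan d) \<sigma> q 47 = (\<Sum>v<M. \<sigma> (mv d q v) 45) mod 2 ^ w"
proof -
  let ?c = "crd d q"
  define \<sigma>1 where "\<sigma>1 = den (Block [Move 48 45, Const 46 0, Move 111 110]) \<sigma>"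
  define \<sigma>2 where "\<sigma>2 = den (Loop 111 (add_flow (minus_dir d) 46)) \<sigma>1"
  define \<sigma>3 where "\<sigma>3 = den (Block [Move 48 45, Arith Add 47 46 45, Move 111 110]) \<sigma>2"
  define \<sigma>4 where "\<sigma>4 = den (Loop 111 (add_flow (plus_dir d) 47)) \<sigma>3"
  have den: "den (scan d) \<sigma> = \<sigma>4"
    by (simp add: scan_def \<sigma>1_def \<sigma>2_def \<sigma>3_def \<sigma>4_def)
  have s1: "\<sigma>1 q 48 = \<sigma> q 45" "\<sigma>1 q 46 = 0" "\<sigma>1 q 111 = \<sigma> q 110" "\<sigma>1 q 45 = \<sigma> q 45" "\<sigma>1 q 110 = \<sigma> q 110" for q
    by (simp_all add: \<sigma>1_def sem_apply)
  have fr2: "\<sigma>2 q x = \<sigma>1 q x" if "x \<in> {45, 110}" for q x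
    unfolding \<sigma>2_def using that by (intro den_frame) (auto simp: code_defs')
  have s3: "\<sigma>3 q 48 = \<sigma> q 45" "\<sigma>3 q 46 = \<sigma>2 q 46" "\<sigma>3 q 47 = (\<sigma>2 q 46 + \<sigma> q 45) mod 2 ^ w" "\<sigma>3 q 111 = \<sigma> q 110" for q
    using fr2 s1 by (simp_all add: \<sigma>3_def sem_apply)
  have fr4: "\<sigma>4 q 46 = \<sigma>3 q 46" for q
    unfolding \<sigma>4_def by (intro den_frame) (auto simp: code_defs')
  have fl1: "flown (minus_dir d) (Suc u) \<sigma>1 q 48 = (if u < ?c then \<sigma> (mv d q (?c - Suc u)) 45 else 0)" for u
    by (simp add: flown_def reach_minus s1 del: reach.simps)
  have "(\<Sum>u<M. flown (minus_dir d) (Suc u) \<sigma>1 q 48) = (\<Sum>u<?c. \<sigma> (mv d q (?c - Suc u)) 45)"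
    unfolding fl1 using q(2) by (intro sum.mono_neutral_cong_right) auto
  also have "\<dots> = (\<Sum>v<?c. \<sigma> (mv d q v) 45)"
    by (rule sum.nat_diff_reindex)
  finally have sum1: "(\<Sum>u<M. flown (minus_dir d) (Suc u) \<sigma>1 q 48) = (\<Sum>v<?c. \<sigma> (mv d q v) 45)" .
  have "\<sigma>2 q 46 = (\<sigma>1 q 46 + (\<Sum>u<M. flown (minus_dir d) (Suc u) \<sigma>1 q 48)) mod 2 ^ w"
    unfolding \<sigma>2_def by (rule den_Loop_add_flow) (use q s1 M in auto)
  then have p2: "\<sigma>2 q 46 = (\<Sum>v<?c. \<sigma> (mv d q v) 45) mod 2 ^ w" using sum1 s1 by simp
  then show "den (scan d) \<sigma> q 46 = (\<Sum>v<crd d q. \<sigma> (mv d q v) 45) mod 2 ^ w"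
    unfolding den fr4 s3 by simp
  have fl3: "flown (plus_dir d) (Suc u) \<sigma>3 q 48 = (if ?c + Suc u < M then \<sigma> (mv d q (?c + Suc u)) 45 else 0)" for u
    using zero[of "?c + Suc u"] M(2) unfolding flown_def reach_plus[OF q(1)] s3 by auto
  have "(\<Sum>u<M. flown (plus_dir d) (Suc u) \<sigma>3 q 48) = (\<Sum>u<M - Suc ?c. \<sigma> (mv d q (u + Suc ?c)) 45)"
    unfolding fl3 by (intro sum.mono_neutral_cong_right) (auto simp: add.commute)
  also have "\<dots> = (\<Sum>v = Suc ?c..<M. \<sigma> (mv d q v) 45)"
    using sum.shift_bounds_nat_ivl[of "\<lambda>v. \<sigma> (mv d q v) 45" 0 "Suc ?c" "M - Suc ?c"] q(2)
    by (simp add: atLeast0LessThan)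
  finally have sum3: "(\<Sum>u<M. flown (plus_dir d) (Suc u) \<sigma>3 q 48) = (\<Sum>v = Suc ?c..<M. \<sigma> (mv d q v) 45)" .
  have "\<sigma>4 q 47 = (\<sigma>3 q 47 + (\<Sum>u<M. flown (plus_dir d) (Suc u) \<sigma>3 q 48)) mod 2 ^ w"
    unfolding \<sigma>4_def by (rule den_Loop_add_flow) (use q s3 M in auto)
  also have "\<dots> = ((\<Sum>v<?c. \<sigma> (mv d q v) 45) + \<sigma> q 45 + (\<Sum>v = Suc ?c..<M. \<sigma> (mv d q v) 45)) mod 2 ^ w"
    unfolding sum3 s3 p2 by (simp add: mod_simps)
  also have "(\<Sum>v<?c. \<sigma> (mv d q v) 45) + \<sigma> q 45 + (\<Sum>v = Suc ?c..<M. \<sigma> (mv d q v) 45) = (\<Sum>v<M. \<sigma> (mv d q v) 45)"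
  proof -
    have "(\<Sum>v<M. \<sigma> (mv d q v) 45) = (\<Sum>v<Suc ?c. \<sigma> (mv d q v) 45) + (\<Sum>v = Suc ?c..<M. \<sigma> (mv d q v) 45)"
      using sum.atLeastLessThan_concat[of 0 "Suc ?c" M "\<lambda>v. \<sigma> (mv d q v) 45"] q(2)
      by (simp add: atLeast0LessThan)
    then show ?thesis by simp
  qed
  finally show "den (scan d) \<sigma> q 47 = (\<Sum>v<M. \<sigma> (mv d q v) 45) mod 2 ^ w" unfolding den .
qed

lemma time_scan:
  assumes "\<sigma> (0, 0, 0) 110 = M"
  shows "time (scan d) \<sigma> \<le> 18 * M + 8"
proof -
  let ?b1 = "Block [Move 48 45, Const 46 0, Move 111 110]"
  let ?b2 = "Block [Move 48 45, Arith Add 47 46 45, Move 111 110]"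
  let ?l1 = "Loop 111 (add_flow (minus_dir d) 46)" and ?l2 = "Loop 111 (add_flow (plus_dir d) 47)"
  have tc: "time (add_flow dr r) \<tau> \<le> 4" for dr r \<tau> by (simp add: add_flow_def shift_def)
  have 1: "den ?b1 \<sigma> (0, 0, 0) 111 = M" using assms by (simp add: sem_apply)
  have "den ?l1 (den ?b1 \<sigma>) (0, 0, 0) 110 = den ?b1 \<sigma> (0, 0, 0) 110"
    by (intro den_frame) (simp add: code_defs')
  then have 2: "den ?b2 (den ?l1 (den ?b1 \<sigma>)) (0, 0, 0) 111 = M"
    using assms by (simp add: sem_apply)
  have "time ?l1 (den ?b1 \<sigma>) \<le> M * (4 + 5) + 1"
    by (rule time_Loop_const) (rule 1, rule tc)
  moreover have "time ?l2 (den ?b2 (den ?l1 (den ?b1 \<sigma>))) \<le> M * (4 + 5) + 1"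
    by (rule time_Loop_const) (rule 2, rule tc)
  ultimately show ?thesis unfolding scan_def time.simps(2) by simp
qed

end

text \<open>The addresses below \<open>(A, B, C)\<close> form \<open>A\<close> full planes,
  \<open>B\<close> full lines of the next plane and \<open>C\<close> cells of the next line.
  \<open>A\<close> is not bounded by \<open>M\<close>, so that \<open>A = M\<close> and
  \<open>B = C = 0\<close> yield the sum over the whole cube.\<close>

lemma sum_lin_split:
  fixes h :: "nat \<Rightarrow> nat"
  assumes "\<And>A B C. B < M \<Longrightarrow> C < M \<Longrightarrow> h ((A * M + B) * M + C) = \<phi> A B C"
    and "B < M" "C \<le> M"
  shows "(\<Sum>u<(A * M + B) * M + C. h u) =
    (\<Sum>v<A. \<Sum>b<M. \<Sum>c<M. \<phi> v b c) + (\<Sum>b<B. \<Sum>c<M. \<phi> A b c) + (\<Sum>c<C. \<phi> A B c)"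
proof -
  have line: "(\<Sum>u<L * M. k u) = (\<Sum>l<L. \<Sum>c<M. k (l * M + c))" for k :: "nat \<Rightarrow> nat" and L
  proof -
    have "sum k {l * M..<l * M + M} = (\<Sum>c<M. k (l * M + c))" for l
      using sum.shift_bounds_nat_ivl[of k 0 "l * M" M] by (simp add: atLeast0LessThan add.commute)
    then show ?thesis using sum.nat_group[of k M L] by simp
  qed
  have "(\<Sum>u<(A * M + B) * M + C. h u) = (\<Sum>u<(A * M + B) * M. h u) + (\<Sum>c<C. h ((A * M + B) * M + c))"
    by (induction C) auto
  also have "(\<Sum>c<C. h ((A * M + B) * M + c)) = (\<Sum>c<C. \<phi> A B c)"
    using assms by (intro sum.cong) auto
  also have "(\<Sum>u<(A * M + B) * M. h u) = (\<Sum>l<A * M + B. \<Sum>c<M. h (l * M + c))" by (rule line)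
  also have "\<dots> = (\<Sum>l<A * M. \<Sum>c<M. h (l * M + c)) + (\<Sum>b<B. \<Sum>c<M. h ((A * M + b) * M + c))"
    by (induction B) auto
  also have "(\<Sum>b<B. \<Sum>c<M. h ((A * M + b) * M + c)) = (\<Sum>b<B. \<Sum>c<M. \<phi> A b c)"
    using assms by (intro sum.cong) auto
  also have "(\<Sum>l<A * M. \<Sum>c<M. h (l * M + c)) = (\<Sum>v<A. \<Sum>b<M. \<Sum>c<M. h ((v * M + b) * M + c))"
    by (rule line)
  also have "\<dots> = (\<Sum>v<A. \<Sum>b<M. \<Sum>c<M. \<phi> v b c)"
    using assms by (intro sum.cong) auto
  finally show ?thesis .
qed

context word_machine
begin

text \<open>The scan along \<open>c\<close> counts inside a line, the scan along \<open>b\<close>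
  adds up line totals and the scan along \<open>a\<close> plane totals. The three prefixes together
  count the packets at smaller addresses.\<close>

lemma den_rank:
  fixes \<sigma> a b c M
  defines "\<sigma>' \<equiv> den (Block [Move 45 20] ;; scan c ;; Block [Move 43 46, Move 45 47] ;; scan b ;;
     Block [Arith Add 43 43 46, Move 45 47] ;; scan a ;;
     Block [Arith Add 43 43 46, Arith Add 21 43 44, Arith Add 44 44 47]) \<sigma>"
    and "R \<equiv> \<lambda>v. \<Sum>u<v. \<sigma> (cell a b c M u) 20"
  assumes ax: "axes a b c" and M: "\<forall>q\<in>mesh s. \<sigma> q 110 = M" "M \<le> s"
    and le1: "\<And>q. q \<in> mesh s \<Longrightarrow> \<sigma> q 20 \<le> 1"
    and zero: "\<And>q d. q \<in> mesh s \<Longrightarrow> d < 3 \<Longrightarrow> M \<le> crd d q \<Longrightarrow> \<sigma> q 20 = 0"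
    and q: "crd a q < M" "crd b q < M" "crd c q < M"
  shows "\<sigma>' q 21 = (\<sigma> q 44 + R (lin a b c M q)) mod 2 ^ w"
    and "\<sigma>' q 44 = (\<sigma> q 44 + R (M * M * M)) mod 2 ^ w"
proof -
  have ax': "a < 3" "b < 3" "c < 3" "a \<noteq> b" "a \<noteq> c" "b \<noteq> c" using ax by (auto simp: axes_def)
  define pt where "pt A B C = mv a (mv b (mv c (0, 0, 0) C) B) A" for A B C
  have crd_pt: "crd a (pt A B C) = A" "crd b (pt A B C) = B" "crd c (pt A B C) = C" for A B C
    using ax' by (simp_all add: pt_def crd_mv)
  have mv_pt: "mv a (pt A B C) v = pt v B C" "mv b (pt A B C) v = pt A v C" "mv c (pt A B C) v = pt A B v"
    for A B C v
    by (rule axes_pos_eqI[OF ax]; use ax' in \<open>simp add: crd_mv crd_pt\<close>)+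
  have pt_mesh: "pt A B C \<in> mesh s" if "A < s" "B < s" "C < s" for A B C
    unfolding pt_def using that origin_mesh by (intro mv_mesh)
  define \<phi> where "\<phi> A B C = \<sigma> (pt A B C) 20" for A B C
  define \<phi>2 where "\<phi>2 A B = (\<Sum>v<M. \<phi> A B v)" for A B
  define \<phi>3 where "\<phi>3 A = (\<Sum>v<M. \<phi>2 A v)" for A
  \<comment> \<open>Flags are at most 1, so no partial count exceeds \<open>s * s * s\<close> and no
    truncation takes effect.\<close>
  have \<phi>1: "\<phi> A B C \<le> 1" if "A < s" "B < s" "C < s" for A B C
    unfolding \<phi>_def using le1 pt_mesh that by simp
  have \<phi>0: "\<phi> A B C = 0" if "A < s" "B < s" "C < s" "M \<le> A \<or> M \<le> B \<or> M \<le> C" for A B C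
    unfolding \<phi>_def using zero[OF pt_mesh] that ax' crd_pt by metis
  have \<phi>20: "\<phi>2 A B = 0" if "A < s" "B < s" "M \<le> A \<or> M \<le> B" for A B
    unfolding \<phi>2_def using \<phi>0 that M(2) by simp
  have \<phi>30: "\<phi>3 A = 0" if "A < s" "M \<le> A" for A
    unfolding \<phi>3_def using \<phi>20 that M(2) by simp
  have sum_le: "(\<Sum>v<k. F v) \<le> k * l" if "\<And>v. v < k \<Longrightarrow> F v \<le> l" for F :: "nat \<Rightarrow> nat" and k l
    using sum_bounded_above[of "{..<k}" F l] that by simp
  have s1: "(\<Sum>v<C. \<phi> A B v) < 2 ^ w" if "A < s" "B < s" "C \<le> M" for A B C
    using sum_le[of C "\<phi> A B" 1] \<phi>1 that M(2) s_word by fastforce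
  have \<phi>2_le: "\<phi>2 A B \<le> M" if "A < s" "B < s" for A B
    unfolding \<phi>2_def using sum_le[of M "\<phi> A B" 1] \<phi>1 that M(2) by fastforce
  have s2: "(\<Sum>v<B. \<phi>2 A v) < 2 ^ w" if "A < s" "B \<le> M" for A B
  proof -
    have "(\<Sum>v<B. \<phi>2 A v) \<le> B * M" using \<phi>2_le that M(2) by (intro sum_le) auto
    also have "\<dots> \<le> s * s" using that M(2) by (intro mult_le_mono) auto
    finally show ?thesis using ss_word by simp
  qed
  have \<phi>3_le: "\<phi>3 A \<le> M * M" if "A < s" for A
    unfolding \<phi>3_def using \<phi>2_le that M(2) by (intro sum_le) auto
  have s3: "(\<Sum>v<A. \<phi>3 v) < 2 ^ w" if "A \<le> M" for A
  proof -
    have "(\<Sum>v<A. \<phi>3 v) \<le> A * (M * M)" using \<phi>3_le that M(2) by (intro sum_le) auto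
    also have "\<dots> \<le> s * (s * s)" using that M(2) by (intro mult_le_mono) auto
    finally show ?thesis using size by (simp add: ac_simps)
  qed
  define \<sigma>0 where "\<sigma>0 = den (Block [Move 45 20]) \<sigma>"
  define \<sigma>1 where "\<sigma>1 = den (scan c) \<sigma>0"
  define \<sigma>2 where "\<sigma>2 = den (Block [Move 43 46, Move 45 47]) \<sigma>1"
  define \<sigma>3 where "\<sigma>3 = den (scan b) \<sigma>2"
  define \<sigma>4 where "\<sigma>4 = den (Block [Arith Add 43 43 46, Move 45 47]) \<sigma>3"
  define \<sigma>5 where "\<sigma>5 = den (scan a) \<sigma>4"
  have \<sigma>': "\<sigma>' = den (Block [Arith Add 43 43 46, Arith Add 21 43 44, Arith Add 44 44 47]) \<sigma>5"
    by (simp add: \<sigma>'_def \<sigma>0_def \<sigma>1_def \<sigma>2_def \<sigma>3_def \<sigma>4_def \<sigma>5_def)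
  have fr: "den (scan d) \<tau> q x = \<tau> q x" if "x \<in> {43, 44, 110}" for d \<tau> q x
    using that by (intro den_frame) (auto simp: code_defs')
  have e0: "\<sigma>0 q 45 = \<sigma> q 20" "\<sigma>0 q 44 = \<sigma> q 44" "\<sigma>0 q 110 = \<sigma> q 110" for q
    by (simp_all add: \<sigma>0_def sem_apply)
  have e2: "\<sigma>2 q 43 = \<sigma>1 q 46" "\<sigma>2 q 45 = \<sigma>1 q 47" "\<sigma>2 q 44 = \<sigma> q 44" "\<sigma>2 q 110 = \<sigma> q 110" for q
    using e0 by (simp_all add: \<sigma>2_def \<sigma>1_def fr sem_apply)
  have e4: "\<sigma>4 q 43 = (\<sigma>1 q 46 + \<sigma>3 q 46) mod 2 ^ w" "\<sigma>4 q 45 = \<sigma>3 q 47" "\<sigma>4 q 44 = \<sigma> q 44" "\<sigma>4 q 110 = \<sigma> q 110" for q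
    using e2 by (simp_all add: \<sigma>4_def \<sigma>3_def fr sem_apply)
  have e6: "\<sigma>' q 21 = (\<sigma>1 q 46 + \<sigma>3 q 46 + \<sigma>5 q 46 + \<sigma> q 44) mod 2 ^ w"
    "\<sigma>' q 44 = (\<sigma> q 44 + \<sigma>5 q 47) mod 2 ^ w" for q
    using e4 by (simp_all add: \<sigma>' \<sigma>5_def fr sem_apply mod_simps)
  have M0: "\<tau> (0, 0, 0) 110 = M" if "\<And>q. \<tau> q 110 = \<sigma> q 110" for \<tau> :: state
    using that M(1) origin_mesh by simp
  have v1: "\<sigma>1 (pt A B C) 46 = (\<Sum>v<C. \<phi> A B v)" "\<sigma>1 (pt A B C) 47 = \<phi>2 A B"
    if "A < s" "B < s" "C < M" for A B C
    using den_scan[of \<sigma>0 M "pt A B C" c, OF M0[of \<sigma>0] M(2) pt_mesh[of A B C]] e0 crd_pt mv_pt that M(2) \<phi>0 s1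
    by (simp_all add: \<sigma>1_def \<phi>_def \<phi>2_def)
  have v3: "\<sigma>3 (pt A B C) 46 = (\<Sum>v<B. \<phi>2 A v)" "\<sigma>3 (pt A B C) 47 = \<phi>3 A"
    if "A < s" "B < M" "C < M" for A B C
    using den_scan[of \<sigma>2 M "pt A B C" b, OF M0[of \<sigma>2] M(2) pt_mesh[of A B C]] e2 crd_pt mv_pt that M(2) \<phi>20 s2 v1
    by (simp_all add: \<sigma>3_def \<phi>3_def)
  have v5: "\<sigma>5 (pt A B C) 46 = (\<Sum>v<A. \<phi>3 v)" "\<sigma>5 (pt A B C) 47 = (\<Sum>v<M. \<phi>3 v)"
    if "A < M" "B < M" "C < M" for A B C
    using den_scan[of \<sigma>4 M "pt A B C" a, OF M0[of \<sigma>4] M(2) pt_mesh[of A B C]] e4 crd_pt mv_pt that M(2) \<phi>30 s3 v3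
    by (simp_all add: \<sigma>5_def)
  let ?A = "crd a q" and ?B = "crd b q" and ?C = "crd c q"
  have qpt: "q = pt ?A ?B ?C" by (rule axes_pos_eqI[OF ax]) (simp_all add: crd_pt)
  have h: "\<sigma> (cell a b c M ((A * M + B) * M + C)) 20 = \<phi> A B C" if "B < M" "C < M" for A B C
    using that unfolding \<phi>_def pt_def cell_def by (simp add: div_mult2_eq)
  have "R (lin a b c M q) = (\<Sum>v<?A. \<phi>3 v) + (\<Sum>v<?B. \<phi>2 ?A v) + (\<Sum>v<?C. \<phi> ?A ?B v)"
    unfolding R_def lin_def \<phi>3_def \<phi>2_def using q by (intro sum_lin_split h) auto
  then show "\<sigma>' q 21 = (\<sigma> q 44 + R (lin a b c M q)) mod 2 ^ w"
    using v1(1)[of ?A ?B ?C] v3(1)[of ?A ?B ?C] v5(1)[of ?A ?B ?C] q M(2) unfolding e6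
    by (simp add: qpt[symmetric] ac_simps)
  have "R ((M * M + 0) * M + 0) = (\<Sum>v<M. \<phi>3 v) + (\<Sum>v<0. \<phi>2 M v) + (\<Sum>v<0. \<phi> M 0 v)"
    unfolding R_def \<phi>3_def \<phi>2_def using q by (intro sum_lin_split h) auto
  then show "\<sigma>' q 44 = (\<sigma> q 44 + R (M * M * M)) mod 2 ^ w"
    using v5(2)[of ?A ?B ?C] q M(2) unfolding e6 by (simp add: qpt[symmetric] ac_simps)
qed

end

text \<open>The weight of the current bit is in register 112.\<close>

definition radix_pass :: "nat \<Rightarrow> nat \<Rightarrow> nat \<Rightarrow> cmd" where
  "radix_pass a b c =
     Block [Move 50 20, Move 51 22, Move 52 23, Const 54 2, Arith Div 53 22 112, Arith Mod 53 53 54,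
       Const 55 1, Arith Sub 55 55 53, Arith Mul 20 50 55, Const 40 0, Const 44 0] ;;
     append_packets a b c ;;
     Block [Move 22 51, Move 23 52, Arith Mul 20 50 53] ;;
     append_packets a b c ;;
     Block [Move 20 40, Move 22 41, Move 23 42, Arith Add 112 112 112]"

definition radix_sort :: "nat \<Rightarrow> nat \<Rightarrow> nat \<Rightarrow> cmd" where
  "radix_sort a b c = Block [Const 112 1, Move 113 114] ;; Loop 113 (radix_pass a b c)"

section \<open>Registers written by the phases, and correctness of the sort\<close>

lemma writes_gather: "set (writes (gather d)) \<subseteq> {20..38} \<union> {100, 101, 111}"
  by (simp add: code_defs)

lemma writes_routes:
  "set (writes (route_minor_first a b c)) \<subseteq> {20..38} \<union> {100, 101, 111}"
  "set (writes (route_major_first a b c)) \<subseteq> {20..38} \<union> {100, 101, 111}"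
  unfolding route_minor_first_def route_major_first_def writes.simps set_append
  by (intro Un_least writes_gather;
      simp add: minor_target_def middle_target_def major_target_def)+

lemma writes_scan: "set (writes (scan d)) \<subseteq> {35, 46, 47, 48, 100, 101, 111}"
  by (simp add: code_defs')

lemma writes_append_packets: "set (writes (append_packets a b c)) \<subseteq> {20..48} \<union> {100, 101, 111}"
  unfolding append_packets_def writes.simps set_append
  by (intro Un_least order_trans[OF writes_routes(1)] order_trans[OF writes_scan]) auto

lemma writes_radix_pass:
  "set (writes (radix_pass a b c)) \<subseteq> {20..55} \<union> {100, 101, 111, 112}"
  unfolding radix_pass_def writes.simps set_append
  by (intro Un_least order_trans[OF writes_append_packets]) auto

lemma writes_radix_sort:
  "set (writes (radix_sort a b c)) \<subseteq> {20..55} \<union> {100, 101, 111, 112, 113}"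
  using writes_radix_pass[of a b c] unfolding radix_sort_def by auto

lemma (in machine) den_frame_subset:
  "set (writes c) \<subseteq> A \<Longrightarrow> x \<notin> A \<Longrightarrow> den c \<sigma> q x = \<sigma> q x"
  by (intro den_frame) blast

context word_machine
begin

lemma located_den_subset:
  assumes "located \<sigma>" and "set (writes c) \<subseteq> A" and "0 \<notin> A" "1 \<notin> A" "2 \<notin> A"
  shows "located (den c \<sigma>)"
  using assms by (intro located_den) auto

text \<open>Counterpart of \<open>holds\<close> for packets that are already placed. They are
  described by linear addresses instead of positions, so that two batches are kept apart by disjoint
  ranges of numbers.\<close>

definition out :: "nat \<Rightarrow> nat \<Rightarrow> nat \<Rightarrow> nat \<Rightarrow> 'i set \<Rightarrow> ('i \<Rightarrow> nat) \<Rightarrow> ('i \<Rightarrow> nat) \<Rightarrow> ('i \<Rightarrow> nat) \<Rightarrow> state \<Rightarrow> bool"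
  where "out a b c M S E K V \<sigma> \<longleftrightarrow> inj_on E S \<and>
    (\<forall>i\<in>S. E i < M * M * M \<and> \<sigma> (cell a b c M (E i)) 40 = 1 \<and> \<sigma> (cell a b c M (E i)) 41 = K i \<and>
       \<sigma> (cell a b c M (E i)) 42 = V i) \<and>
    (\<forall>q\<in>mesh s - (\<lambda>i. cell a b c M (E i)) ` S. \<sigma> q 40 = 0)"

lemma finite_mesh: "finite (mesh m)"
  by (simp add: mesh_def)

lemma holds_finite: "holds S ps D K V \<sigma> \<Longrightarrow> finite S"
  unfolding holds_def by (meson finite_imageD finite_mesh finite_subset)

text \<open>The destination of a packet is \<open>B\<close> plus the number of packets at smaller
  addresses. As a cell holds at most one packet, these ranks contract distances, so the minor axis
  can be routed first. They also preserve the order inside the batch, which makes the radix sort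
  stable.\<close>

lemma append_packets:
  assumes ax: "axes a b c" and S: "holds S ps D0 K V \<sigma>" and loc: "located \<sigma>"
    and M: "\<forall>q\<in>mesh s. \<sigma> q 110 = M" "M \<le> s"
    and cube: "\<And>i d. i \<in> S \<Longrightarrow> d < 3 \<Longrightarrow> crd d (ps i) < M"
    and S0: "out a b c M S0 E K V \<sigma>" "\<And>i. i \<in> S0 \<Longrightarrow> E i < B" "S \<inter> S0 = {}"
    and B: "\<And>q. q \<in> mesh s \<Longrightarrow> (\<And>d. d < 3 \<Longrightarrow> crd d q < M) \<Longrightarrow> \<sigma> q 44 = B"
      "B + card S \<le> M * M * M"
  defines "\<sigma>' \<equiv> den (append_packets a b c) \<sigma>"
  obtains D where "inj_on D S" "\<And>i. i \<in> S \<Longrightarrow> B \<le> D i \<and> D i < B + card S"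
    "\<And>i j. i \<in> S \<Longrightarrow> j \<in> S \<Longrightarrow> lin a b c M (ps i) < lin a b c M (ps j) \<Longrightarrow> D i < D j"
    "out a b c M (S0 \<union> S) (\<lambda>i. if i \<in> S then D i else E i) K V \<sigma>'"
    "located \<sigma>'" "\<forall>q\<in>mesh s. \<sigma>' q 110 = M"
    "\<And>q. q \<in> mesh s \<Longrightarrow> (\<And>d. d < 3 \<Longrightarrow> crd d q < M) \<Longrightarrow> \<sigma>' q 44 = B + card S"
proof -
  have ax': "a < 3" "b < 3" "c < 3" using ax by (auto simp: axes_def)
  let ?l = "\<lambda>i. lin a b c M (ps i)"
  let ?C = "cell a b c M"
  define h where "h u = \<sigma> (?C u) 20" for u
  define R where "R v = (\<Sum>u<v. h u)" for v
  define D where "D i = B + R (?l i)" for i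
  have fin: "finite S" using holds_finite[OF S] .
  have MMM: "M * M * M < 2 ^ w"
    using mult_le_mono[OF mult_le_mono[OF M(2) M(2)] M(2)] size by simp
  have le1: "\<sigma> q 20 \<le> 1" if "q \<in> mesh s" for q
    using S that unfolding holds_def by (cases "q \<in> ps ` S") auto
  have zero: "\<sigma> q 20 = 0" if "q \<in> mesh s" "d < 3" "M \<le> crd d q" for q d
  proof -
    have "q \<notin> ps ` S" using cube that(2,3) leD by blast
    then show ?thesis using S that(1) unfolding holds_def by blast
  qed
  have crd3: "crd a (ps i) < M \<and> crd b (ps i) < M \<and> crd c (ps i) < M" if "i \<in> S" for i
    using cube[OF that] ax' by simp
  have l: "?l i < M * M * M" if "i \<in> S" for i
    using crd3[OF that] lin_less by blast
  have cl: "?C (?l i) = ps i" if "i \<in> S" for i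
    using crd3[OF that] cell_lin[OF ax] by blast
  have injl: "inj_on ?l S"
  proof (rule inj_onI)
    fix i j assume ij: "i \<in> S" "j \<in> S" "?l i = ?l j"
    then have "ps i = ps j" using cl[OF ij(1)] cl[OF ij(2)] by metis
    moreover have "inj_on ps S" using S by (simp add: holds_def)
    ultimately show "i = j" using ij by (blast dest: inj_onD)
  qed
  have h1: "h (?l i) = 1" if "i \<in> S" for i
    unfolding h_def cl[OF that] using S that by (simp add: holds_def)
  have h0: "h u = 0" if "u < M * M * M" "u \<notin> ?l ` S" for u
  proof -
    have "?C u \<notin> ps ` S" using lin_cell[OF ax that(1)] that(2) by (metis image_iff)
    then show ?thesis using S cell_mesh[OF ax that(1) M(2)] unfolding h_def holds_def by simp
  qed
  have R_Suc: "R (Suc v) = R v + h v" for v by (simp add: R_def)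
  have R_mono: "R u \<le> R v" if "u \<le> v" for u v
    unfolding R_def using that by (intro sum_mono2) auto
  have R_contr: "R (u + k) \<le> R u + k" if "u + k \<le> M * M * M" for u k
    using that
  proof (induction k)
    case (Suc k)
    have "h (u + k) \<le> 1" unfolding h_def using Suc.prems by (intro le1 cell_mesh[OF ax _ M(2)]) simp
    then show ?case using Suc by (simp add: R_Suc)
  qed simp
  have R_card: "R (M * M * M) = card S"
  proof -
    have "R (M * M * M) = (\<Sum>u\<in>?l ` S. h u)"
      unfolding R_def using l h0 by (intro sum.mono_neutral_right) auto
    also have "\<dots> = (\<Sum>i\<in>S. 1)" using injl h1 by (simp add: sum.reindex)
    finally show ?thesis by simp
  qed
  have D_less: "D i < D j" if "i \<in> S" "j \<in> S" "?l i < ?l j" for i j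
  proof -
    have "R (Suc (?l i)) \<le> R (?l j)" using that(3) by (intro R_mono) simp
    then show ?thesis using h1[OF that(1)] by (simp add: D_def R_Suc)
  qed
  have D_range: "B \<le> D i \<and> D i < B + card S" if "i \<in> S" for i
  proof -
    have "R (Suc (?l i)) \<le> R (M * M * M)" using l[OF that] by (intro R_mono) simp
    then show ?thesis using h1[OF that] by (simp add: D_def R_Suc R_card)
  qed
  have D_inj: "inj_on D S"
    using D_less injl by (intro inj_onI) (metis (no_types, lifting) inj_onD linorder_neqE_nat less_irrefl)
  have D_contr: "D j - D i \<le> ?l j - ?l i" if "i \<in> S" "j \<in> S" "D i < D j" for i j
  proof -
    have "?l i \<le> ?l j" using D_less[OF that(2,1)] that(3) by (meson leI less_asym)
    then show ?thesis using R_contr[of "?l i" "?l j - ?l i"] l[OF that(2)] by (simp add: D_def)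
  qed
  let ?rank = "Block [Move 45 20] ;; scan c ;; Block [Move 43 46, Move 45 47] ;; scan b ;;
     Block [Arith Add 43 43 46, Move 45 47] ;; scan a ;;
     Block [Arith Add 43 43 46, Arith Add 21 43 44, Arith Add 44 44 47]"
  define \<sigma>1 where "\<sigma>1 = den ?rank \<sigma>"
  define \<sigma>2 where "\<sigma>2 = den (route_minor_first a b c) \<sigma>1"
  have \<sigma>': "\<sigma>' = den (Block [CMove 41 20 22, CMove 42 20 23, CMove 40 20 20]) \<sigma>2"
    by (simp add: \<sigma>'_def append_packets_def \<sigma>2_def \<sigma>1_def)
  have fr1: "\<sigma>1 q x = \<sigma> q x" if "x \<in> {0, 1, 2, 20, 22, 23, 40, 41, 42, 110}" for q x
  proof -
    have "set (writes ?rank) \<subseteq> {21, 35, 43, 44, 45, 46, 47, 48, 100, 101, 111}"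
      unfolding writes.simps set_append by (intro Un_least order_trans[OF writes_scan]) auto
    then show ?thesis unfolding \<sigma>1_def by (rule den_frame_subset) (use that in auto)
  qed
  have fr2: "\<sigma>2 q x = \<sigma>1 q x" if "x \<in> {40, 41, 42, 44, 110}" for q x
    unfolding \<sigma>2_def by (rule den_frame_subset[OF writes_routes(1)]) (use that in auto)
  have rank: "\<sigma>1 q 21 = (\<sigma> q 44 + R (lin a b c M q)) mod 2 ^ w"
    "\<sigma>1 q 44 = (\<sigma> q 44 + R (M * M * M)) mod 2 ^ w"
    if "crd a q < M" "crd b q < M" "crd c q < M" for q
    unfolding \<sigma>1_def R_def h_def by (rule den_rank; fact ax M le1 zero that)+
  have r21: "\<sigma>1 (ps i) 21 = D i" if "i \<in> S" for i
  proof -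
    have m: "ps i \<in> mesh s" using S that by (auto simp: holds_def)
    have "\<sigma> (ps i) 44 = B" using B(1)[OF m] cube[OF that] by blast
    then have "\<sigma>1 (ps i) 21 = D i mod 2 ^ w"
      using rank(1)[of "ps i"] cube[OF that] ax' by (simp add: D_def)
    then show ?thesis using D_range[OF that] B(2) MMM by simp
  qed
  have r44: "\<sigma>1 q 44 = B + card S" if "q \<in> mesh s" "\<And>d. d < 3 \<Longrightarrow> crd d q < M" for q
  proof -
    have "\<sigma>1 q 44 = (B + card S) mod 2 ^ w"
      using rank(2)[of q] that ax' B(1)[of q] R_card by simp
    then show ?thesis using B(2) MMM by simp
  qed
  have S1: "holds S ps D K V \<sigma>1" using S r21 by (simp add: holds_def fr1)
  have loc1: "located \<sigma>1" unfolding \<sigma>1_def by (intro located_den loc) (simp add: code_defs')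
  have M1: "\<forall>q\<in>mesh s. \<sigma>1 q 110 = M" using M(1) by (simp add: fr1)
  have DM: "D i < M * M * M" if "i \<in> S" for i using D_range[OF that] B(2) by simp
  have inj: "inj_on (\<lambda>i. mv c (ps i) (D i mod M)) S"
    "inj_on (\<lambda>i. mv b (mv c (ps i) (D i mod M)) (D i div M mod M)) S"
    "inj_on (\<lambda>i. ?C (D i)) S"
    by (rule minor_first_inj[where a = a and b = b and c = c and D = D and S = S and ps = ps
          and m = M and M = M]; use ax D_inj crd3 D_contr in blast)+
  have S2: "holds S (\<lambda>i. ?C (D i)) D K V \<sigma>2"
    unfolding \<sigma>2_def
    by (rule holds_route(1)[where ps = ps]; (fact | use DM cube in blast))
  have v: "\<sigma>' q 40 = (if \<sigma>2 q 20 \<noteq> 0 then \<sigma>2 q 20 else \<sigma> q 40)"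
    "\<sigma>' q 41 = (if \<sigma>2 q 20 \<noteq> 0 then \<sigma>2 q 22 else \<sigma> q 41)"
    "\<sigma>' q 42 = (if \<sigma>2 q 20 \<noteq> 0 then \<sigma>2 q 23 else \<sigma> q 42)"
    "\<sigma>' q 44 = \<sigma>1 q 44" "\<sigma>' q 110 = \<sigma> q 110" for q
    by (simp_all add: \<sigma>' sem_apply fr1 fr2)
  have "out a b c M (S0 \<union> S) (\<lambda>i. if i \<in> S then D i else E i) K V \<sigma>'"
    (is "out _ _ _ _ _ ?E _ _ _")
  proof -
    have "inj_on ?E (S0 \<union> S)"
    proof (rule inj_onI)
      fix i j assume ij: "i \<in> S0 \<union> S" "j \<in> S0 \<union> S" "?E i = ?E j"
      have ne: "E k \<noteq> D l" if "k \<in> S0" "l \<in> S" for k l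
        using S0(2)[OF that(1)] D_range[OF that(2)] by simp
      have E0: "inj_on E S0" using S0(1) by (simp add: out_def)
      consider "i \<in> S" "j \<in> S" | "i \<in> S" "j \<notin> S" "j \<in> S0" | "i \<notin> S" "i \<in> S0" "j \<in> S"
        | "i \<notin> S" "i \<in> S0" "j \<notin> S" "j \<in> S0" using ij(1,2) by blast
      then show "i = j"
      proof cases
        case 1
        then show ?thesis using inj_onD[OF D_inj] ij(3) by simp
      next
        case 2
        then show ?thesis using ne[of j i] ij(3) by simp
      next
        case 3
        then show ?thesis using ne[of i j] ij(3) by simp
      next
        case 4
        then show ?thesis using inj_onD[OF E0] ij(3) by simp
      qed
    qed
    moreover have "?E i < M * M * M \<and> \<sigma>' (?C (?E i)) 40 = 1 \<and> \<sigma>' (?C (?E i)) 41 = K i \<and>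
       \<sigma>' (?C (?E i)) 42 = V i" if i: "i \<in> S0 \<union> S" for i
    proof (cases "i \<in> S")
      case True
      then show ?thesis using S2 DM v by (simp add: holds_def)
    next
      case False
      then have "i \<in> S0" using i by simp
      have "E i < M * M * M" using S0(1) \<open>i \<in> S0\<close> by (simp add: out_def)
      \<comment> \<open>Older addresses lie below \<open>B\<close> and new ones do not, so the final
        \<open>CMove\<close> instructions overwrite no older packet.\<close>
      have "?C (E i) \<noteq> ?C (D j)" if "j \<in> S" for j
        using lin_cell[OF ax \<open>E i < M * M * M\<close>] lin_cell[OF ax DM[OF that]] S0(2)[OF \<open>i \<in> S0\<close>]
          D_range[OF that] by force
      then have "\<sigma>2 (?C (E i)) 20 = 0"
        using S2 cell_mesh[OF ax \<open>E i < M * M * M\<close> M(2)] unfolding holds_def by blast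
      then show ?thesis using S0(1) \<open>i \<in> S0\<close> False v by (simp add: out_def)
    qed
    moreover have "\<sigma>' q 40 = 0" if "q \<in> mesh s" "q \<notin> (\<lambda>i. ?C (?E i)) ` (S0 \<union> S)" for q
    proof -
      have "q \<notin> (\<lambda>i. ?C (D i)) ` S"
      proof
        assume "q \<in> (\<lambda>i. ?C (D i)) ` S"
        then obtain i where "i \<in> S" "q = ?C (?E i)" by auto
        then show False using that(2) by blast
      qed
      moreover have "q \<notin> (\<lambda>i. ?C (E i)) ` S0"
      proof
        assume "q \<in> (\<lambda>i. ?C (E i)) ` S0"
        then obtain i where i: "i \<in> S0" "q = ?C (E i)" by auto
        then have "i \<notin> S" using S0(3) by blast
        then have "q = ?C (?E i)" using i(2) by simp
        then show False using that(2) i(1) by blast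
      qed
      ultimately show ?thesis using S2 S0(1) that(1) v(1)[of q] by (simp add: holds_def out_def)
    qed
    ultimately show ?thesis by (simp add: out_def)
  qed
  moreover have "located \<sigma>'" unfolding \<sigma>'_def by (rule located_den_subset[OF loc writes_append_packets]) auto
  moreover have "\<forall>q\<in>mesh s. \<sigma>' q 110 = M" using M(1) v(5) by simp
  moreover have "\<sigma>' q 44 = B + card S" if "q \<in> mesh s" "\<And>d. d < 3 \<Longrightarrow> crd d q < M" for q
    using r44 v(4) that by simp
  ultimately show thesis using that[OF D_inj D_range D_less] by blast
qed

lemma time_append_packets:
  assumes "\<sigma> (0, 0, 0) 110 = M"
  shows "time (append_packets a b c) \<sigma> \<le> 186 * M + 106"
proof -
  have fr: "den (scan d) \<tau> q 110 = \<tau> q 110" for d \<tau> q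
    by (rule den_frame_subset[OF writes_scan]) simp
  let ?b1 = "Block [Move 45 20]" and ?b2 = "Block [Move 43 46, Move 45 47]"
  let ?b3 = "Block [Arith Add 43 43 46, Move 45 47]"
  let ?b4 = "Block [Arith Add 43 43 46, Arith Add 21 43 44, Arith Add 44 44 47]"
  have 1: "den ?b1 \<sigma> (0, 0, 0) 110 = M" using assms by (simp add: sem_apply)
  have 2: "den ?b2 (den (scan c) (den ?b1 \<sigma>)) (0, 0, 0) 110 = M" using 1 fr by (simp add: sem_apply)
  have 3: "den ?b3 (den (scan b) (den ?b2 (den (scan c) (den ?b1 \<sigma>)))) (0, 0, 0) 110 = M"
    using 2 fr by (simp add: sem_apply)
  have 4: "den ?b4 (den (scan a) (den ?b3 (den (scan b) (den ?b2 (den (scan c) (den ?b1 \<sigma>)))))) (0, 0, 0) 110 = M"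
    using 3 fr by (simp add: sem_apply)
  show ?thesis
    using time_scan[of "den ?b1 \<sigma>" M c, OF 1]
      time_scan[of "den ?b2 (den (scan c) (den ?b1 \<sigma>))" M b, OF 2]
      time_scan[of "den ?b3 (den (scan b) (den ?b2 (den (scan c) (den ?b1 \<sigma>))))" M a, OF 3]
      time_routes(1)[of "den ?b4 (den (scan a) (den ?b3 (den (scan b) (den ?b2 (den (scan c) (den ?b1 \<sigma>))))))" M a b c, OF 4]
    by (simp add: append_packets_def)
qed

end

context word_machine
begin

lemma holds_subset:
  assumes "holds S ps D K V \<sigma>" and "T \<subseteq> S"
    and "\<And>i. i \<in> T \<Longrightarrow> \<tau> (ps i) 20 = 1 \<and> \<tau> (ps i) 22 = K i \<and> \<tau> (ps i) 23 = V i"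
    and "\<And>q. q \<in> mesh s \<Longrightarrow> q \<notin> ps ` T \<Longrightarrow> \<tau> q 20 = 0"
  shows "holds T ps (\<lambda>i. \<tau> (ps i) 21) K V \<tau>"
proof -
  have "inj_on ps T" "ps ` T \<subseteq> mesh s"
    using assms(1,2) by (auto simp: holds_def intro: inj_on_subset)
  then show ?thesis using assms(3,4) by (simp add: holds_def)
qed

text \<open>Packets with bit 0 are appended first and those with bit 1 behind them. Inside each
  class the order given by the lower bits survives, because the addresses assigned by
  \<open>append_packets\<close> are monotone in the old ones.\<close>

lemma radix_pass:
  assumes ax: "axes a b c" and S: "holds S ps D0 K V \<sigma>" and loc: "located \<sigma>"
    and M: "\<forall>q\<in>mesh s. \<sigma> q 110 = M" "M \<le> s" and card: "card S \<le> M * M * M"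
    and cube: "\<And>i d. i \<in> S \<Longrightarrow> d < 3 \<Longrightarrow> crd d (ps i) < M"
    and t: "\<forall>q\<in>mesh s. \<sigma> q 112 = 2 ^ t" "2 ^ t < 2 ^ w"
    and K: "\<And>i. i \<in> S \<Longrightarrow> K i < 2 ^ w"
    and order: "\<And>i j. i \<in> S \<Longrightarrow> j \<in> S \<Longrightarrow> K i mod 2 ^ t < K j mod 2 ^ t \<Longrightarrow>
      lin a b c M (ps i) < lin a b c M (ps j)"
  defines "\<sigma>' \<equiv> den (radix_pass a b c) \<sigma>"
  obtains E where "inj_on E S" "\<And>i. i \<in> S \<Longrightarrow> E i < card S"
    "\<And>i j. i \<in> S \<Longrightarrow> j \<in> S \<Longrightarrow> K i mod 2 ^ Suc t < K j mod 2 ^ Suc t \<Longrightarrow> E i < E j"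
    "holds S (\<lambda>i. cell a b c M (E i)) (\<lambda>i. \<sigma>' (cell a b c M (E i)) 21) K V \<sigma>'"
    "located \<sigma>'" "\<forall>q\<in>mesh s. \<sigma>' q 110 = M" "\<forall>q\<in>mesh s. \<sigma>' q 112 = 2 ^ Suc t mod 2 ^ w"
proof -
  let ?C = "cell a b c M"
  define bit where "bit i = K i div 2 ^ t mod 2" for i
  define Z where "Z = {i \<in> S. bit i = 0}"
  define Y where "Y = {i \<in> S. bit i = 1}"
  have ZY: "Z \<union> Y = S" "Z \<inter> Y = {}" by (auto simp: Z_def Y_def bit_def)
  have fin: "finite S" using holds_finite[OF S] .
  have cards: "card S = card Z + card Y"
    using ZY fin by (metis card_Un_disjoint finite_Un)
  let ?b1 = "Block [Move 50 20, Move 51 22, Move 52 23, Const 54 2, Arith Div 53 22 112, Arith Mod 53 53 54,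
       Const 55 1, Arith Sub 55 55 53, Arith Mul 20 50 55, Const 40 0, Const 44 0]"
  let ?b2 = "Block [Move 22 51, Move 23 52, Arith Mul 20 50 53]"
  let ?b3 = "Block [Move 20 40, Move 22 41, Move 23 42, Arith Add 112 112 112]"
  define \<sigma>1 where "\<sigma>1 = den ?b1 \<sigma>"
  define \<sigma>2 where "\<sigma>2 = den (append_packets a b c) \<sigma>1"
  define \<sigma>3 where "\<sigma>3 = den ?b2 \<sigma>2"
  define \<sigma>4 where "\<sigma>4 = den (append_packets a b c) \<sigma>3"
  have \<sigma>': "\<sigma>' = den ?b3 \<sigma>4"
    by (simp add: \<sigma>'_def radix_pass_def \<sigma>1_def \<sigma>2_def \<sigma>3_def \<sigma>4_def)
  have two: "4 < (2::nat) ^ w"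
  proof -
    have "2 * 2 * 2 \<le> s * s * s" using two_le_s by (intro mult_le_mono) auto
    then show ?thesis using size by simp
  qed
  have Sd: "\<sigma> (ps i) 20 = 1" "\<sigma> (ps i) 22 = K i" "\<sigma> (ps i) 23 = V i" "ps i \<in> mesh s" if "i \<in> S" for i
    using S that by (auto simp: holds_def)
  have S0: "\<sigma> q 20 = 0" if "q \<in> mesh s" "q \<notin> ps ` S" for q using S that by (auto simp: holds_def)
  have Kb: "K i div 2 ^ t mod 2 mod 2 ^ w = bit i" "K i div 2 ^ t mod 2 ^ w = K i div 2 ^ t" if "i \<in> S" for i
  proof -
    have "K i div 2 ^ t \<le> K i" by simp
    then have "K i div 2 ^ t < 2 ^ w" using K[OF that] by linarith
    then show "K i div 2 ^ t mod 2 ^ w = K i div 2 ^ t" by simp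
    have "K i div 2 ^ t mod 2 < 2" by simp
    then have "K i div 2 ^ t mod 2 < 2 ^ w" using two by linarith
    then show "K i div 2 ^ t mod 2 mod 2 ^ w = bit i" by (simp add: bit_def)
  qed
  have b01: "bit i = 0 \<or> bit i = 1" for i by (auto simp: bit_def)
  have v1: "\<sigma>1 q 50 = \<sigma> q 20" "\<sigma>1 q 51 = \<sigma> q 22" "\<sigma>1 q 52 = \<sigma> q 23" "\<sigma>1 q 40 = 0" "\<sigma>1 q 44 = 0"
    "\<sigma>1 q 22 = \<sigma> q 22" "\<sigma>1 q 23 = \<sigma> q 23" "\<sigma>1 q 110 = \<sigma> q 110" "\<sigma>1 q 112 = \<sigma> q 112"
    "\<sigma>1 q 53 = (\<sigma> q 22 div \<sigma> q 112 mod 2 ^ w) mod 2 mod 2 ^ w"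
    "\<sigma>1 q 20 = \<sigma> q 20 * (1 - (\<sigma> q 22 div \<sigma> q 112 mod 2 ^ w) mod 2 mod 2 ^ w) mod 2 ^ w" for q
    using two w_pos by (simp_all add: \<sigma>1_def sem_apply mod_simps)
  have bit1: "\<sigma>1 (ps i) 53 = bit i" "\<sigma>1 (ps i) 20 = 1 - bit i" if "i \<in> S" for i
    using v1(10,11)[of "ps i"] Sd[OF that] t(1) Kb[OF that] b01[of i] two by auto
  have H1: "holds Z ps (\<lambda>i. \<sigma>1 (ps i) 21) K V \<sigma>1"
  proof -
    have "\<sigma>1 q 20 = 0" if q: "q \<in> mesh s" "q \<notin> ps ` Z" for q
    proof (cases "q \<in> ps ` S")
      case True
      then obtain i where i: "i \<in> S" "q = ps i" by auto
      then have "bit i = 1" using q(2) b01[of i] by (auto simp: Z_def)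
      then show ?thesis using bit1 i by simp
    next
      case False
      then show ?thesis using v1(11)[of q] S0[OF q(1)] by simp
    qed
    moreover have "Z \<subseteq> S" by (auto simp: Z_def)
    moreover have "\<sigma>1 (ps i) 20 = 1 \<and> \<sigma>1 (ps i) 22 = K i \<and> \<sigma>1 (ps i) 23 = V i" if "i \<in> Z" for i
      using that bit1[of i] v1(6,7)[of "ps i"] Sd[of i] by (simp add: Z_def)
    ultimately show ?thesis by (intro holds_subset[OF S]) blast+
  qed
  have loc1: "located \<sigma>1" unfolding \<sigma>1_def by (intro located_den loc) simp
  have M1: "\<forall>q\<in>mesh s. \<sigma>1 q 110 = M" using M(1) v1 by simp
  have out1: "out a b c M {} (\<lambda>_. 0) K V \<sigma>1" using v1 by (simp add: out_def)
  have cubeZ: "crd d (ps i) < M" if "i \<in> Z" "d < 3" for i d using cube that by (simp add: Z_def)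
  have cubeY: "crd d (ps i) < M" if "i \<in> Y" "d < 3" for i d using cube that by (simp add: Y_def)
  have "0 + card Z \<le> M * M * M" using card cards by simp
  then obtain D1 where D1: "inj_on D1 Z" "\<And>i. i \<in> Z \<Longrightarrow> 0 \<le> D1 i \<and> D1 i < 0 + card Z"
    "\<And>i j. i \<in> Z \<Longrightarrow> j \<in> Z \<Longrightarrow> lin a b c M (ps i) < lin a b c M (ps j) \<Longrightarrow> D1 i < D1 j"
    "out a b c M ({} \<union> Z) (\<lambda>i. if i \<in> Z then D1 i else 0) K V \<sigma>2"
    and loc2: "located \<sigma>2" and M2: "\<forall>q\<in>mesh s. \<sigma>2 q 110 = M"
    and B2: "\<And>q. q \<in> mesh s \<Longrightarrow> (\<And>d. d < 3 \<Longrightarrow> crd d q < M) \<Longrightarrow> \<sigma>2 q 44 = 0 + card Z"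
    using append_packets[OF ax H1 loc1 M1 M(2) cubeZ out1 _ _ v1(5), folded \<sigma>2_def] by blast
  have fr2: "\<sigma>2 q x = \<sigma>1 q x" if "x \<in> {50, 51, 52, 53, 112}" for q x
    unfolding \<sigma>2_def by (rule den_frame_subset[OF writes_append_packets]) (use that in auto)
  have v3: "\<sigma>3 q 22 = \<sigma> q 22" "\<sigma>3 q 23 = \<sigma> q 23" "\<sigma>3 q 20 = \<sigma> q 20 * \<sigma>1 q 53 mod 2 ^ w"
    "\<sigma>3 q 110 = \<sigma>2 q 110" "\<sigma>3 q 112 = \<sigma> q 112" "\<sigma>3 q 44 = \<sigma>2 q 44"
    "\<sigma>3 q 40 = \<sigma>2 q 40" "\<sigma>3 q 41 = \<sigma>2 q 41" "\<sigma>3 q 42 = \<sigma>2 q 42" for q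
    using v1 by (simp_all add: \<sigma>3_def sem_apply fr2)
  have bit3: "\<sigma>3 (ps i) 20 = bit i" if "i \<in> S" for i
    using v3(3)[of "ps i"] Sd[OF that] bit1[OF that] b01[of i] w_pos by auto
  have H3: "holds Y ps (\<lambda>i. \<sigma>3 (ps i) 21) K V \<sigma>3"
  proof -
    have "\<sigma>3 q 20 = 0" if q: "q \<in> mesh s" "q \<notin> ps ` Y" for q
    proof (cases "q \<in> ps ` S")
      case True
      then obtain i where i: "i \<in> S" "q = ps i" by auto
      then have "bit i = 0" using q(2) b01[of i] by (auto simp: Y_def)
      then show ?thesis using bit3 i by simp
    next
      case False
      then show ?thesis using v3(3)[of q] S0[OF q(1)] by simp
    qed
    moreover have "Y \<subseteq> S" by (auto simp: Y_def)
    moreover have "\<sigma>3 (ps i) 20 = 1 \<and> \<sigma>3 (ps i) 22 = K i \<and> \<sigma>3 (ps i) 23 = V i" if "i \<in> Y" for i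
      using that bit3[of i] v3(1,2)[of "ps i"] Sd[of i] by (simp add: Y_def)
    ultimately show ?thesis by (intro holds_subset[OF S]) blast+
  qed
  have loc3: "located \<sigma>3" unfolding \<sigma>3_def by (intro located_den loc2) simp
  have M3: "\<forall>q\<in>mesh s. \<sigma>3 q 110 = M" using M2 v3 by simp
  have out3: "out a b c M Z D1 K V \<sigma>3"
  proof -
    have "out a b c M Z D1 K V \<sigma>2"
      using D1(1,4) unfolding out_def by (simp add: image_iff)
    then show ?thesis by (simp add: out_def v3)
  qed
  have B3: "\<sigma>3 q 44 = card Z" if "q \<in> mesh s" "\<And>d. d < 3 \<Longrightarrow> crd d q < M" for q
    using B2 v3 that by simp
  have D1c: "D1 i < card Z" if "i \<in> Z" for i using D1(2)[OF that] by simp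
  have "Y \<inter> Z = {}" "card Z + card Y \<le> M * M * M" using ZY cards card by auto
  note this' = this
  obtain D2 where D2: "inj_on D2 Y" "\<And>i. i \<in> Y \<Longrightarrow> card Z \<le> D2 i \<and> D2 i < card Z + card Y"
    "\<And>i j. i \<in> Y \<Longrightarrow> j \<in> Y \<Longrightarrow> lin a b c M (ps i) < lin a b c M (ps j) \<Longrightarrow> D2 i < D2 j"
    "out a b c M (Z \<union> Y) (\<lambda>i. if i \<in> Y then D2 i else D1 i) K V \<sigma>4"
    and loc4: "located \<sigma>4" and M4: "\<forall>q\<in>mesh s. \<sigma>4 q 110 = M"
  proof (rule append_packets[OF ax H3 loc3 M3 M(2) cubeY out3 D1c this'(1) B3 this'(2), folded \<sigma>4_def])
  qed (assumption | rule that)+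
  define E where "E i = (if i \<in> Y then D2 i else D1 i)" for i
  have fr4: "\<sigma>4 q 112 = \<sigma> q 112" for q
    unfolding v3(5)[symmetric] \<sigma>4_def by (rule den_frame_subset[OF writes_append_packets]) simp
  have v5: "\<sigma>' q 20 = \<sigma>4 q 40" "\<sigma>' q 22 = \<sigma>4 q 41" "\<sigma>' q 23 = \<sigma>4 q 42" "\<sigma>' q 110 = \<sigma>4 q 110"
    "\<sigma>' q 112 = (\<sigma> q 112 + \<sigma> q 112) mod 2 ^ w" for q
    by (simp_all add: \<sigma>' sem_apply fr4)
  have O4: "out a b c M S E K V \<sigma>4" using D2(4) ZY by (simp add: E_def[abs_def])
  have Einj: "inj_on E S" and EM: "\<And>i. i \<in> S \<Longrightarrow> E i < M * M * M" using O4 by (auto simp: out_def)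
  have Ecard: "E i < card S" if "i \<in> S" for i
    using D1(2)[of i] D2(2)[of i] that cards ZY(1) by (auto simp: E_def)
  have Eord: "E i < E j" if ij: "i \<in> S" "j \<in> S" "K i mod 2 ^ Suc t < K j mod 2 ^ Suc t" for i j
  proof -
    \<comment> \<open>Comparison modulo \<open>2 ^ Suc t\<close> is lexicographic: first bit
      \<open>t\<close>, then the remainder modulo \<open>2 ^ t\<close>.\<close>
    have split: "K i mod 2 ^ Suc t = 2 ^ t * bit i + K i mod 2 ^ t" for i
      by (simp add: bit_def mod_mult2_eq mult.commute[of 2])
    have lt: "K i mod 2 ^ t < 2 ^ t" for i by simp
    show ?thesis
    proof (cases "bit i = bit j")
      case True
      then have "lin a b c M (ps i) < lin a b c M (ps j)"
        using ij split[of i] split[of j] by (intro order) auto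
      then show ?thesis
        using D1(3)[of i j] D2(3)[of i j] True ij(1,2) b01[of i] by (auto simp: E_def Z_def Y_def)
    next
      case False
      have "\<not> (bit i = 1 \<and> bit j = 0)"
      proof
        assume "bit i = 1 \<and> bit j = 0"
        then have "2 ^ t + K i mod 2 ^ t < K j mod 2 ^ t"
          using ij(3) unfolding split by simp
        then show False using lt[of j] by linarith
      qed
      then have "bit i = 0" "bit j = 1" using False b01[of i] b01[of j] by auto
      then have "i \<in> Z" "j \<in> Y" "i \<notin> Y" using ij by (auto simp: Z_def Y_def)
      then show ?thesis using D1(2)[of i] D2(2)[of j] by (simp add: E_def)
    qed
  qed
  have Cinj: "inj_on (\<lambda>i. ?C (E i)) S"
    using Einj lin_cell[OF ax EM] unfolding inj_on_def by metis
  have "holds S (\<lambda>i. ?C (E i)) (\<lambda>i. \<sigma>' (?C (E i)) 21) K V \<sigma>'"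
    using O4 Cinj cell_mesh[OF ax EM M(2)] unfolding holds_def out_def v5 by auto
  moreover have "located \<sigma>'" unfolding \<sigma>' by (intro located_den loc4) simp
  moreover have "\<forall>q\<in>mesh s. \<sigma>' q 110 = M" using M4 v5 by simp
  moreover have "\<forall>q\<in>mesh s. \<sigma>' q 112 = 2 ^ Suc t mod 2 ^ w" using t(1) v5 by (simp add: mult_2)
  ultimately show thesis using that[OF Einj Ecard Eord] by blast
qed

text \<open>After \<open>t\<close> passes the placement respects the keys modulo
  \<open>2 ^ t\<close>, and after \<open>L\<close> passes this is the whole key. The packing into
  the first \<open>card S\<close> cells is produced by a pass, hence \<open>0 < L\<close>.\<close>

lemma radix_sort:
  assumes ax: "axes a b c" and S: "holds S ps D0 K V \<sigma>" and loc: "located \<sigma>"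
    and M: "\<forall>q\<in>mesh s. \<sigma> q 110 = M" "M \<le> s" and card: "card S \<le> M * M * M"
    and cube: "\<And>i d. i \<in> S \<Longrightarrow> d < 3 \<Longrightarrow> crd d (ps i) < M"
    and L: "\<sigma> (0, 0, 0) 114 = L" "0 < L" "\<And>t. t < L \<Longrightarrow> (2::nat) ^ t < 2 ^ w"
    and K: "\<And>i. i \<in> S \<Longrightarrow> K i < 2 ^ w \<and> K i < 2 ^ L"
  defines "\<sigma>' \<equiv> den (radix_sort a b c) \<sigma>"
  obtains E D where "inj_on E S" "\<And>i. i \<in> S \<Longrightarrow> E i < card S"
    "\<And>i j. i \<in> S \<Longrightarrow> j \<in> S \<Longrightarrow> K i < K j \<Longrightarrow> E i < E j"
    "holds S (\<lambda>i. cell a b c M (E i)) D K V \<sigma>'"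
    "located \<sigma>'" "\<forall>q\<in>mesh s. \<sigma>' q 110 = M"
proof -
  define \<sigma>1 where "\<sigma>1 = den (Block [Const 112 1, Move 113 114]) \<sigma>"
  have v1: "\<sigma>1 q 112 = 1" "\<sigma>1 q 113 = \<sigma> q 114" "\<sigma>1 q 110 = \<sigma> q 110"
    "\<And>x. x \<in> {20, 21, 22, 23} \<Longrightarrow> \<sigma>1 q x = \<sigma> q x" for q
    using w_pos by (auto simp: \<sigma>1_def sem_apply)
  \<comment> \<open>The weight in register 112 may wrap to 0 after the last pass, hence the
    truncated power; \<open>L(3)\<close> makes it exact for every pass that is executed.\<close>
  let ?I = "\<lambda>t \<tau>. located \<tau> \<and> (\<forall>q\<in>mesh s. \<tau> q 110 = M) \<and> (\<forall>q\<in>mesh s. \<tau> q 112 = 2 ^ t mod 2 ^ w) \<and>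
    (\<exists>p D. holds S p D K V \<tau> \<and> (\<forall>i\<in>S. \<forall>d<3. crd d (p i) < M) \<and>
      (\<forall>i\<in>S. \<forall>j\<in>S. K i mod 2 ^ t < K j mod 2 ^ t \<longrightarrow> lin a b c M (p i) < lin a b c M (p j)) \<and>
      (0 < t \<longrightarrow> (\<exists>E. inj_on E S \<and> (\<forall>i\<in>S. E i < card S \<and> p i = cell a b c M (E i)))))"
  have "?I L (den (Loop 113 (radix_pass a b c)) \<sigma>1)"
  proof (rule den_Loop[where I = ?I])
    show "\<sigma>1 (0, 0, 0) 113 = L" using v1 L by simp
  next
    have "located \<sigma>1" unfolding \<sigma>1_def by (intro located_den loc) simp
    moreover have "holds S ps D0 K V \<sigma>1" using S v1(4) by (simp add: holds_def)
    ultimately show "?I 0 \<sigma>1" using cube M v1 w_pos by auto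
  next
    fix t \<tau>
    assume t: "t < L" and I: "?I t \<tau>"
    then obtain p D where p: "holds S p D K V \<tau>" "\<forall>i\<in>S. \<forall>d<3. crd d (p i) < M"
      "\<forall>i\<in>S. \<forall>j\<in>S. K i mod 2 ^ t < K j mod 2 ^ t \<longrightarrow> lin a b c M (p i) < lin a b c M (p j)" by blast
    have I': "located \<tau>" "\<forall>q\<in>mesh s. \<tau> q 110 = M" "\<forall>q\<in>mesh s. \<tau> q 112 = 2 ^ t"
      using I L(3)[OF t] by auto
    let ?\<tau> = "den (radix_pass a b c) \<tau>"
    obtain E where E: "inj_on E S" "\<And>i. i \<in> S \<Longrightarrow> E i < card S"
      "\<And>i j. i \<in> S \<Longrightarrow> j \<in> S \<Longrightarrow> K i mod 2 ^ Suc t < K j mod 2 ^ Suc t \<Longrightarrow> E i < E j"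
      "holds S (\<lambda>i. cell a b c M (E i)) (\<lambda>i. ?\<tau> (cell a b c M (E i)) 21) K V ?\<tau>"
      "located ?\<tau>" "\<forall>q\<in>mesh s. ?\<tau> q 110 = M" "\<forall>q\<in>mesh s. ?\<tau> q 112 = 2 ^ Suc t mod 2 ^ w"
      by (rule radix_pass[OF ax p(1) I'(1,2) M(2) card, of t]) (use p(2,3) I'(3) L(3)[OF t] K in blast)+
    have dec: "dec 113 ?\<tau> q x = ?\<tau> q x" if "x \<in> {0, 1, 2, 20, 21, 22, 23, 110, 112}" for q x
      using that by (intro dec_frame) auto
    have EM: "E i < M * M * M" if "i \<in> S" for i using E(2)[OF that] card by simp
    have "crd d (cell a b c M (E i)) < M" if "i \<in> S" "d < 3" for i d
      using cell_mesh[OF ax EM[OF that(1)] order_refl] that(2) by (simp add: mem_mesh_crd)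
    moreover have "lin a b c M (cell a b c M (E i)) = E i" if "i \<in> S" for i
      using lin_cell[OF ax EM[OF that]] .
    moreover have "holds S (\<lambda>i. cell a b c M (E i)) (\<lambda>i. ?\<tau> (cell a b c M (E i)) 21) K V (dec 113 ?\<tau>)"
      using E(4) by (simp add: holds_def dec)
    moreover have "located (dec 113 ?\<tau>)"
      using E(5) by (auto simp: located_def dec numeral_3_eq_3 numeral_2_eq_2 less_Suc_eq)
    ultimately show "?I (Suc t) (dec 113 ?\<tau>)"
      using E by (intro conjI exI[of _ "\<lambda>i. cell a b c M (E i)"] exI[of _ "\<lambda>i. ?\<tau> (cell a b c M (E i)) 21"])
        (auto simp: dec)
  qed
  then have I: "?I L \<sigma>'" by (simp add: \<sigma>'_def radix_sort_def \<sigma>1_def)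
  then obtain p D where p: "holds S p D K V \<sigma>'"
      "\<forall>i\<in>S. \<forall>j\<in>S. K i mod 2 ^ L < K j mod 2 ^ L \<longrightarrow> lin a b c M (p i) < lin a b c M (p j)"
      "\<exists>E. inj_on E S \<and> (\<forall>i\<in>S. E i < card S \<and> p i = cell a b c M (E i))"
    using L(2) by blast
  then obtain E where E: "inj_on E S" "\<forall>i\<in>S. E i < card S \<and> p i = cell a b c M (E i)" by blast
  have "E i < E j" if "i \<in> S" "j \<in> S" "K i < K j" for i j
  proof -
    have "lin a b c M (p i) < lin a b c M (p j)" using p(2) that K by simp
    then show ?thesis using E(2) that card lin_cell[OF ax] by (metis order_less_le_trans)
  qed
  moreover have "holds S (\<lambda>i. cell a b c M (E i)) D K V \<sigma>'"
    using p(1) E(2) unfolding holds_def by (auto simp: inj_on_def)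
  ultimately show thesis using that[OF E(1)] E(2) I by blast
qed

lemma time_radix_sort:
  assumes "\<sigma> (0, 0, 0) 110 = M" and "\<sigma> (0, 0, 0) 114 = L"
  shows "time (radix_sort a b c) \<sigma> \<le> L * (372 * M + 235) + 3"
proof -
  let ?b1 = "Block [Move 50 20, Move 51 22, Move 52 23, Const 54 2, Arith Div 53 22 112, Arith Mod 53 53 54,
       Const 55 1, Arith Sub 55 55 53, Arith Mul 20 50 55, Const 40 0, Const 44 0]"
  let ?b2 = "Block [Move 22 51, Move 23 52, Arith Mul 20 50 53]"
  let ?b0 = "Block [Const 112 1, Move 113 114]"
  have fr: "den (append_packets a b c) \<tau> q 110 = \<tau> q 110" "den (radix_pass a b c) \<tau> q 110 = \<tau> q 110" for \<tau> q
    by (rule den_frame_subset[OF writes_append_packets] den_frame_subset[OF writes_radix_pass]; simp)+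
  have pass: "time (radix_pass a b c) \<tau> \<le> 372 * M + 230" if "\<tau> (0, 0, 0) 110 = M" for \<tau>
  proof -
    have 1: "den ?b1 \<tau> (0, 0, 0) 110 = M" using that by (simp add: sem_apply)
    have 2: "den ?b2 (den (append_packets a b c) (den ?b1 \<tau>)) (0, 0, 0) 110 = M"
      using that by (simp add: sem_apply fr)
    show ?thesis
      using time_append_packets[of "den ?b1 \<tau>" M a b c, OF 1]
        time_append_packets[of "den ?b2 (den (append_packets a b c) (den ?b1 \<tau>))" M a b c, OF 2]
      by (simp add: radix_pass_def)
  qed
  have "time (Loop 113 (radix_pass a b c)) (den ?b0 \<sigma>) \<le> L * (372 * M + 230 + 5) + 1"
    by (rule time_Loop[where I = "\<lambda>_ \<tau>. \<tau> (0, 0, 0) 110 = M"])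
      (use assms pass in \<open>auto simp: sem_apply dec_frame fr\<close>)
  then show ?thesis by (simp add: radix_sort_def algebra_simps)
qed

end

section \<open>Distribution of the tiles\<close>

text \<open>The coordinates of the tile are in the registers 120 and 121.  Register 114 holds the number of
  bits of a sorting key, and the registers 115 and 116 hold \<open>corner_side n\<close> and \<open>tile_side n s\<close>.\<close>

definition load :: "reg \<Rightarrow> nat \<Rightarrow> nat \<Rightarrow> nat \<Rightarrow> cmd" where
  "load r a b c =
     Block [Arith Div 36 (r + 1) 3, Arith Div 37 (r + 2) 3, Arith Div 38 36 116, Arith Div 39 37 116,
       Arith Eq 38 38 120, Arith Eq 39 39 121, Arith Mul 38 38 39, Arith Mul 20 r 38,
       Arith Mod 36 36 116, Arith Mod 37 37 116, Arith Mul 36 36 116, Arith Add 36 36 37,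
       Arith Mul 36 36 3, Arith Mod 37 (r + 1) 3, Arith Add 36 36 37,
       Arith Mul 36 36 3, Arith Mod 37 (r + 2) 3, Arith Add 22 36 37, Move 23 (r + 3), Move 110 115] ;;
     radix_sort a b c ;;
     Block [Arith Mul 21 a 115, Arith Add 21 21 b, Arith Mul 21 21 115, Arith Add 21 21 c, Move 110 3] ;;
     route_minor_first a b c ;;
     Block [Move 21 22] ;;
     route_major_first a b c"

text \<open>\<open>E\<close> maps \<open>S\<close> onto an initial segment in the order of the keys.
  So the ranks in \<open>{E i<..E j}\<close> belong to distinct keys in
  \<open>{\<kappa> i<..\<kappa> j}\<close>: keys are at least as far apart as ranks, and the move
  from ranks to keys is expanding.\<close>

lemma rank_diff_le:
  fixes E \<kappa> :: "'i \<Rightarrow> nat"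
  assumes fin: "finite S" and "inj_on E S" and range: "\<And>i. i \<in> S \<Longrightarrow> E i < card S"
    and mono: "\<And>i j. i \<in> S \<Longrightarrow> j \<in> S \<Longrightarrow> \<kappa> i < \<kappa> j \<Longrightarrow> E i < E j" and "inj_on \<kappa> S"
    and ij: "i \<in> S" "j \<in> S"
  shows "E j - E i \<le> \<kappa> j - \<kappa> i"
proof -
  have surj: "E ` S = {..<card S}"
    using assms(2) range by (intro card_subset_eq) (auto simp: card_image)
  let ?U = "{u \<in> S. \<kappa> i < \<kappa> u \<and> \<kappa> u \<le> \<kappa> j}"
  have refl: "\<kappa> u < \<kappa> v" if uv: "u \<in> S" "v \<in> S" "E u < E v" for u v
  proof (rule ccontr)
    assume "\<not> \<kappa> u < \<kappa> v"
    then consider "\<kappa> v < \<kappa> u" | "\<kappa> u = \<kappa> v" by linarith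
    then show False
    proof cases
      case 1
      then show False using mono[OF uv(2,1)] uv(3) by simp
    next
      case 2
      then have "u = v" using inj_onD[OF \<open>inj_on \<kappa> S\<close>] uv by blast
      then show False using uv(3) by simp
    qed
  qed
  have "{E i<..E j} \<subseteq> E ` ?U"
  proof
    fix v assume v: "v \<in> {E i<..E j}"
    then have "v \<in> E ` S" unfolding surj using range[OF ij(2)] by simp
    then obtain u where u: "u \<in> S" "v = E u" by auto
    have "\<kappa> i < \<kappa> u" using refl[OF ij(1) u(1)] v u(2) by simp
    moreover have "\<kappa> u \<le> \<kappa> j" using mono[OF ij(2) u(1)] v u(2) by (force simp: not_less[symmetric])
    ultimately show "v \<in> E ` ?U" using u by blast
  qed
  moreover have finU: "finite ?U" using fin by simp
  ultimately have "card {E i<..E j} \<le> card (E ` ?U)" by (intro card_mono) auto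
  also have "\<dots> \<le> card ?U" using finU by (rule card_image_le)
  also have "card ?U = card (\<kappa> ` ?U)"
    using \<open>inj_on \<kappa> S\<close> by (intro card_image[symmetric]) (auto intro: inj_on_subset)
  also have "\<dots> \<le> card {\<kappa> i<..\<kappa> j}" by (intro card_mono) auto
  finally show ?thesis by simp
qed

lemma corner_side_bound: "n ^ 2 \<le> corner_side n ^ 3"
  unfolding corner_side_def
proof (rule LeastI)
  show "n ^ 2 \<le> n ^ 3" by (cases n) (auto simp: power_increasing)
qed

lemma corner_side_le: "n ^ 2 \<le> s ^ 3 \<Longrightarrow> corner_side n \<le> s"
  unfolding corner_side_def by (rule Least_le)

lemma lt_mult_add: "(a::nat) < k \<Longrightarrow> b < s \<Longrightarrow> a * s + b < k * s"
  using mult_le_mono1[of "a + 1" k s] by simp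

lemma writes_load: "set (writes (load r a b c)) \<subseteq> {20..55} \<union> {100, 101, 110, 111, 112, 113}"
  unfolding load_def writes.simps set_append
  by (intro Un_least order_trans[OF writes_radix_sort] order_trans[OF writes_routes(1)]
      order_trans[OF writes_routes(2)]) auto

context word_machine
begin

text \<open>Without the congruence rule the simplifier would evaluate both branches of each of the nested
  conditionals.\<close>

lemmas block_simps = den.simps(1,2) fold_simps sem_apply arith.simps rel_simps num.distinct num.inject
  if_True if_False simp_thms arith_simps numeral_plus_one one_plus_numeral
  zero_neq_numeral zero_neq_numeral[symmetric] one_eq_numeral_iff numeral_eq_one_iff
  zero_neq_one zero_neq_one[symmetric]

text \<open>Entry \<open>(i, k)\<close> belongs in the cell with coordinate \<open>i mod s\<close>
  on axis \<open>b\<close>, \<open>k mod s\<close> on axis \<open>c\<close> and, on axis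
  \<open>a\<close>, the pair of its block numbers inside the tile. The sorting key is the linear
  address of that cell. The sorted entries are first sent to the cells of the full mesh with their
  ranks as addresses, and from there to their keys.\<close>

lemma den_load:
  fixes A :: "nat \<Rightarrow> nat \<Rightarrow> nat" and a b c tr tc n b1 r :: nat
  assumes ax: "axes a b c" and r: "r = 5 \<or> r = 9" and st: "stored s n r A (\<lambda>q. (0, \<sigma> q))"
    and corner: "\<And>q. q \<in> mesh s \<Longrightarrow> \<sigma> q r = 1 \<Longrightarrow> q \<in> mesh (corner_side n)"
    and n: "n ^ 2 \<le> s ^ 3" and loc: "located \<sigma>"
    and par: "\<And>q. q \<in> mesh s \<Longrightarrow> \<sigma> q 3 = s \<and> \<sigma> q 115 = corner_side n \<and> \<sigma> q 116 = b1 \<and>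
      \<sigma> q 120 = tr \<and> \<sigma> q 121 = tc"
    and L: "\<sigma> (0, 0, 0) 114 = L" "0 < L" "\<And>t. t < L \<Longrightarrow> (2::nat) ^ t < 2 ^ w" "s * s * s \<le> 2 ^ L"
    and b1: "b1 * b1 \<le> s" "0 < b1"
  defines "\<sigma>' \<equiv> den (load r a b c) \<sigma>"
  assumes q: "q \<in> mesh s"
  defines "i \<equiv> (tr * b1 + crd a q div b1) * s + crd b q"
    and "k \<equiv> (tc * b1 + crd a q mod b1) * s + crd c q"
  shows "\<sigma>' q 20 = of_bool (crd a q < b1 * b1 \<and> i < n \<and> k < n)"
    and "crd a q < b1 * b1 \<Longrightarrow> i < n \<Longrightarrow> k < n \<Longrightarrow> \<sigma>' q 23 = A i k"
proof -
  have ax': "a < 3" "b < 3" "c < 3" using ax by (auto simp: axes_def)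
  let ?m = "corner_side n"
  have m: "?m \<le> s" using n by (rule corner_side_le)
  define S where "S = {(i, k). i < n \<and> k < n \<and> i div s div b1 = tr \<and> k div s div b1 = tc}"
  define \<kappa> where "\<kappa> = (\<lambda>(i, k). ((i div s mod b1 * b1 + k div s mod b1) * s + i mod s) * s + k mod s)"
  define ps where "ps = (\<lambda>(i, k). THE q. q \<in> mesh s \<and> \<sigma> q r = 1 \<and> \<sigma> q (r + 1) = i \<and> \<sigma> q (r + 2) = k)"
  have ps: "ps (i, k) \<in> mesh s \<and> \<sigma> (ps (i, k)) r = 1 \<and> \<sigma> (ps (i, k)) (r + 1) = i \<and> \<sigma> (ps (i, k)) (r + 2) = k"
    if "i < n" "k < n" for i k
  proof -
    have "\<exists>!q. q \<in> mesh s \<and> \<sigma> q r = 1 \<and> \<sigma> q (r + 1) = i \<and> \<sigma> q (r + 2) = k"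
      using st that by (simp add: stored_def)
    from theI'[OF this] show ?thesis by (simp add: ps_def)
  qed
  have ps_eq: "q = ps (\<sigma> q (r + 1), \<sigma> q (r + 2))"
    if "q \<in> mesh s" "\<sigma> q r = 1" "\<sigma> q (r + 1) < n" "\<sigma> q (r + 2) < n" for q
  proof -
    have "\<exists>!q'. q' \<in> mesh s \<and> \<sigma> q' r = 1 \<and> \<sigma> q' (r + 1) = \<sigma> q (r + 1) \<and> \<sigma> q' (r + 2) = \<sigma> q (r + 2)"
      using st that(3,4) by (simp add: stored_def)
    then show ?thesis using ps[OF that(3,4)] that(1,2) by blast
  qed
  have flag: "\<sigma> q r = 0 \<or> \<sigma> q r = 1 \<and> \<sigma> q (r + 1) < n \<and> \<sigma> q (r + 2) < n \<and>
      \<sigma> q (r + 3) = A (\<sigma> q (r + 1)) (\<sigma> q (r + 2))" if "q \<in> mesh s" for q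
    using st that by (simp add: stored_def)
  have Sn: "i < n" "k < n" if "(i, k) \<in> S" for i k using that by (auto simp: S_def)
  have \<kappa>_lt: "\<kappa> p < s * s * s" for p
  proof -
    obtain i k where p: "p = (i, k)" by fastforce
    have "i div s mod b1 * b1 + k div s mod b1 < b1 * b1" using b1(2) by (intro lt_mult_add) auto
    then have "i div s mod b1 * b1 + k div s mod b1 < s" using b1(1) by simp
    then show ?thesis unfolding \<kappa>_def p prod.case by (intro lt_mult_add) (use s_pos in auto)
  qed
  have \<kappa>_cell: "crd a (cell a b c s (\<kappa> (i, k))) = i div s mod b1 * b1 + k div s mod b1"
    "crd b (cell a b c s (\<kappa> (i, k))) = i mod s" "crd c (cell a b c s (\<kappa> (i, k))) = k mod s" for i k
    using s_pos unfolding crd_cell[OF ax] \<kappa>_def by (simp_all add: div_mult2_eq)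
  have \<kappa>_inv: "i = (tr * b1 + crd a q div b1) * s + crd b q \<and> k = (tc * b1 + crd a q mod b1) * s + crd c q"
    if "(i, k) \<in> S" "q = cell a b c s (\<kappa> (i, k))" for i k q
  proof -
    have "crd a q div b1 = i div s mod b1" "crd a q mod b1 = k div s mod b1"
      using that(2) \<kappa>_cell(1)[of i k] b1(2) by simp_all
    moreover have "tr * b1 + i div s mod b1 = i div s" "tc * b1 + k div s mod b1 = k div s"
      using that(1) by (auto simp: S_def)
    ultimately show ?thesis using that(2) \<kappa>_cell(2,3)[of i k] by simp
  qed
  have \<kappa>_inj: "inj_on \<kappa> S"
  proof (rule inj_onI)
    fix p p' assume "p \<in> S" "p' \<in> S" "\<kappa> p = \<kappa> p'"
    then show "p = p'" using \<kappa>_inv by (cases p; cases p') metis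
  qed
  have fin: "finite S" and card: "card S \<le> n ^ 2"
  proof -
    have sub: "S \<subseteq> {..<n} \<times> {..<n}" by (auto simp: S_def)
    show "finite S" using sub by (rule finite_subset) simp
    have "card S \<le> card ({..<n} \<times> {..<n})" using sub by (intro card_mono) auto
    then show "card S \<le> n ^ 2" by (simp add: power2_eq_square)
  qed
  have cardm: "card S \<le> ?m * ?m * ?m"
    using card corner_side_bound[of n] by (simp add: power3_eq_cube)
  define V where "V = (\<lambda>(i, k). A i k)"
  have lt: "x < 2 ^ w" if "x < s * s * s" for x using that size by simp
  have one: "(1::nat) < 2 ^ w" using w_pos by (intro one_less_power) auto
  let ?b1 = "[Arith Div 36 (r + 1) 3, Arith Div 37 (r + 2) 3, Arith Div 38 36 116, Arith Div 39 37 116,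
       Arith Eq 38 38 120, Arith Eq 39 39 121, Arith Mul 38 38 39, Arith Mul 20 r 38,
       Arith Mod 36 36 116, Arith Mod 37 37 116, Arith Mul 36 36 116, Arith Add 36 36 37,
       Arith Mul 36 36 3, Arith Mod 37 (r + 1) 3, Arith Add 36 36 37,
       Arith Mul 36 36 3, Arith Mod 37 (r + 2) 3, Arith Add 22 36 37, Move 23 (r + 3), Move 110 115]"
  define \<sigma>1 where "\<sigma>1 = den (Block ?b1) \<sigma>"
  define \<sigma>2 where "\<sigma>2 = den (radix_sort a b c) \<sigma>1"
  define \<sigma>3 where "\<sigma>3 = den (Block [Arith Mul 21 a 115, Arith Add 21 21 b, Arith Mul 21 21 115,
    Arith Add 21 21 c, Move 110 3]) \<sigma>2"
  define \<sigma>4 where "\<sigma>4 = den (route_minor_first a b c) \<sigma>3"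
  define \<sigma>5 where "\<sigma>5 = den (Block [Move 21 22]) \<sigma>4"
  have \<sigma>': "\<sigma>' = den (route_major_first a b c) \<sigma>5"
    by (simp add: \<sigma>'_def load_def \<sigma>1_def \<sigma>2_def \<sigma>3_def \<sigma>4_def \<sigma>5_def)
  have v1: "\<sigma>1 q 22 = (((\<sigma> q (r + 1) div \<sigma> q 3 mod 2 ^ w mod \<sigma> q 116 * \<sigma> q 116 +
      \<sigma> q (r + 2) div \<sigma> q 3 mod 2 ^ w mod \<sigma> q 116) * \<sigma> q 3 + \<sigma> q (r + 1) mod \<sigma> q 3) * \<sigma> q 3 +
      \<sigma> q (r + 2) mod \<sigma> q 3) mod 2 ^ w"
    "\<sigma>1 q 20 = \<sigma> q r * (of_bool (\<sigma> q (r + 1) div \<sigma> q 3 mod 2 ^ w div \<sigma> q 116 mod 2 ^ w = \<sigma> q 120) *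
       of_bool (\<sigma> q (r + 2) div \<sigma> q 3 mod 2 ^ w div \<sigma> q 116 mod 2 ^ w = \<sigma> q 121)) mod 2 ^ w"
    "\<sigma>1 q 23 = \<sigma> q (r + 3)" "\<sigma>1 q 110 = \<sigma> q 115" "\<sigma>1 q 114 = \<sigma> q 114" for q
  proof -
    \<comment> \<open>Truncations that pass only through sums and products merge into the outermost
      one. A quotient that is divided or reduced further keeps its \<open>mod 2 ^ w\<close>, which
      \<open>dv\<close> removes later.\<close>
    have *: "\<sigma>1 q 22 = (((\<sigma> q (r + 1) div \<sigma> q 3 mod 2 ^ w mod \<sigma> q 116 mod 2 ^ w * \<sigma> q 116 mod 2 ^ w +
        \<sigma> q (r + 2) div \<sigma> q 3 mod 2 ^ w mod \<sigma> q 116 mod 2 ^ w) mod 2 ^ w * \<sigma> q 3 mod 2 ^ w +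
        \<sigma> q (r + 1) mod \<sigma> q 3 mod 2 ^ w) mod 2 ^ w * \<sigma> q 3 mod 2 ^ w +
        \<sigma> q (r + 2) mod \<sigma> q 3 mod 2 ^ w) mod 2 ^ w \<and>
      \<sigma>1 q 20 = \<sigma> q r * (of_bool (\<sigma> q (r + 1) div \<sigma> q 3 mod 2 ^ w div \<sigma> q 116 mod 2 ^ w = \<sigma> q 120) mod 2 ^ w *
        (of_bool (\<sigma> q (r + 2) div \<sigma> q 3 mod 2 ^ w div \<sigma> q 116 mod 2 ^ w = \<sigma> q 121) mod 2 ^ w) mod 2 ^ w) mod 2 ^ w \<and>
      \<sigma>1 q 23 = \<sigma> q (r + 3) \<and> \<sigma>1 q 110 = \<sigma> q 115 \<and> \<sigma>1 q 114 = \<sigma> q 114"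
      using r unfolding \<sigma>1_def
      by (elim disjE; hypsubst) (simp_all only: block_simps cong: if_weak_cong)
    then show "\<sigma>1 q 23 = \<sigma> q (r + 3)" "\<sigma>1 q 110 = \<sigma> q 115" "\<sigma>1 q 114 = \<sigma> q 114" by blast+
    show "\<sigma>1 q 22 = (((\<sigma> q (r + 1) div \<sigma> q 3 mod 2 ^ w mod \<sigma> q 116 * \<sigma> q 116 +
      \<sigma> q (r + 2) div \<sigma> q 3 mod 2 ^ w mod \<sigma> q 116) * \<sigma> q 3 + \<sigma> q (r + 1) mod \<sigma> q 3) * \<sigma> q 3 +
      \<sigma> q (r + 2) mod \<sigma> q 3) mod 2 ^ w"
      unfolding conjunct1[OF *] by (simp only: mod_simps)
    show "\<sigma>1 q 20 = \<sigma> q r * (of_bool (\<sigma> q (r + 1) div \<sigma> q 3 mod 2 ^ w div \<sigma> q 116 mod 2 ^ w = \<sigma> q 120) *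
       of_bool (\<sigma> q (r + 2) div \<sigma> q 3 mod 2 ^ w div \<sigma> q 116 mod 2 ^ w = \<sigma> q 121)) mod 2 ^ w"
      unfolding conjunct1[OF conjunct2[OF *]] by (simp only: mod_simps)
  qed
  have nw: "n < 2 ^ w"
  proof -
    have "n \<le> n ^ 2" by (simp add: power2_eq_square)
    then show ?thesis using n size by (simp add: power3_eq_cube)
  qed
  have dv: "x div y mod 2 ^ w = x div y" if "x < 2 ^ w" for x y :: nat
    using that div_le_dividend[of x y] by (intro mod_less) linarith
  have at_entry: "\<sigma>1 q 22 = \<kappa> (i, k)" "\<sigma>1 q 20 = of_bool ((i, k) \<in> S)" "\<sigma>1 q 23 = V (i, k)"
    if q: "q \<in> mesh s" and e: "\<sigma> q r = 1" "\<sigma> q (r + 1) = i" "\<sigma> q (r + 2) = k" for q i k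
  proof -
    have ik: "i < n" "k < n" and A: "\<sigma> q (r + 3) = A i k" using flag[OF q] e by auto
    have w1: "i < 2 ^ w" "k < 2 ^ w" using ik nw by auto
    then have w2: "i div s < 2 ^ w" "k div s < 2 ^ w"
      using div_le_dividend[of i s] div_le_dividend[of k s] by linarith+
    show "\<sigma>1 q 22 = \<kappa> (i, k)"
      unfolding v1 e using par[OF q] lt[OF \<kappa>_lt[of "(i, k)"]] w1 by (simp add: \<kappa>_def dv)
    show "\<sigma>1 q 20 = of_bool ((i, k) \<in> S)"
      unfolding v1 e using par[OF q] w1 w2 ik one by (simp add: S_def dv)
    show "\<sigma>1 q 23 = V (i, k)" unfolding v1 V_def using A by simp
  qed
  have S1: "holds S ps (\<lambda>i. \<sigma>1 (ps i) 21) \<kappa> V \<sigma>1"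
  proof -
    have inj: "inj_on ps S"
    proof (rule inj_onI)
      fix p p' assume "p \<in> S" "p' \<in> S" "ps p = ps p'"
      then show "p = p'" using ps Sn by (cases p; cases p') metis
    qed
    have in_mesh: "ps p \<in> mesh s" and e: "\<sigma>1 (ps p) 20 = 1 \<and> \<sigma>1 (ps p) 22 = \<kappa> p \<and> \<sigma>1 (ps p) 23 = V p"
      if "p \<in> S" for p
    proof -
      obtain i k where p: "p = (i, k)" by fastforce
      have P: "ps (i, k) \<in> mesh s" "\<sigma> (ps (i, k)) r = 1" "\<sigma> (ps (i, k)) (r + 1) = i" "\<sigma> (ps (i, k)) (r + 2) = k"
        using ps[of i k] Sn that p by auto
      show "ps p \<in> mesh s" using P(1) p by simp
      show "\<sigma>1 (ps p) 20 = 1 \<and> \<sigma>1 (ps p) 22 = \<kappa> p \<and> \<sigma>1 (ps p) 23 = V p"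
        using at_entry[OF P] that p by simp
    qed
    have z: "\<sigma>1 q 20 = 0" if q: "q \<in> mesh s" "q \<notin> ps ` S" for q
    proof (cases "\<sigma> q r = 0")
      case True
      then show ?thesis by (simp add: v1)
    next
      case False
      then have f: "\<sigma> q r = 1" "\<sigma> q (r + 1) < n" "\<sigma> q (r + 2) < n" using flag[OF q(1)] by auto
      have "(\<sigma> q (r + 1), \<sigma> q (r + 2)) \<notin> S" using ps_eq[OF q(1) f] q(2) by blast
      then show ?thesis using at_entry(2)[OF q(1) f(1) refl refl] by simp
    qed
    show ?thesis unfolding holds_def using inj in_mesh e z by auto
  qed
  have cube: "crd d (ps p) < ?m" if "p \<in> S" "d < 3" for p d
  proof -
    obtain i k where p: "p = (i, k)" by fastforce
    have "ps (i, k) \<in> mesh ?m" using ps[of i k] Sn that(1) p corner by blast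
    then show ?thesis using that(2) p by (simp add: mem_mesh_crd)
  qed
  have loc1: "located \<sigma>1" unfolding \<sigma>1_def by (intro located_den loc) simp
  have M1: "\<forall>q\<in>mesh s. \<sigma>1 q 110 = ?m" using par v1 by simp
  have L1: "\<sigma>1 (0, 0, 0) 114 = L" using L v1 by simp
  have K1: "\<kappa> p < 2 ^ w \<and> \<kappa> p < 2 ^ L" if "p \<in> S" for p
    using lt[OF \<kappa>_lt[of p]] \<kappa>_lt[of p] L(4) by simp
  obtain E D where E: "inj_on E S" "\<And>i. i \<in> S \<Longrightarrow> E i < card S"
    "\<And>i j. i \<in> S \<Longrightarrow> j \<in> S \<Longrightarrow> \<kappa> i < \<kappa> j \<Longrightarrow> E i < E j"
    and H2: "holds S (\<lambda>i. cell a b c ?m (E i)) D \<kappa> V \<sigma>2"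
    and loc2: "located \<sigma>2" and M2: "\<forall>q\<in>mesh s. \<sigma>2 q 110 = ?m"
    by (rule radix_sort[OF ax S1 loc1 M1 m cardm cube L1 L(2,3) K1, folded \<sigma>2_def]) blast+
  have Em: "E p < ?m * ?m * ?m" if "p \<in> S" for p using E(2)[OF that] cardm by simp
  have mmm: "?m * ?m * ?m \<le> s * s * s" using m by (intro mult_le_mono) auto
  have Es: "E p < s * s * s" if "p \<in> S" for p using Em[OF that] mmm by simp
  have fr2: "\<sigma>2 q x = \<sigma> q x" if "x \<in> {3, 115}" for q x
  proof -
    have "\<sigma>2 q x = \<sigma>1 q x"
      unfolding \<sigma>2_def by (rule den_frame_subset[OF writes_radix_sort]) (use that in auto)
    also have "\<dots> = \<sigma> q x" unfolding \<sigma>1_def by (rule den_frame) (use that r in auto)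
    finally show ?thesis .
  qed
  have v3: "\<sigma>3 q 21 = lin a b c (\<sigma> q 115) q mod 2 ^ w" "\<sigma>3 q 110 = \<sigma> q 3"
    "\<And>x. x \<in> {20, 22, 23} \<Longrightarrow> \<sigma>3 q x = \<sigma>2 q x" if "q \<in> mesh s" for q
    using loc2 that ax' by (auto simp: \<sigma>3_def sem_apply fr2 located_def lin_def mod_simps)
  have cellm: "cell a b c ?m (E p) \<in> mesh s" if "p \<in> S" for p
    by (rule cell_mesh[OF ax Em[OF that] m])
  \<comment> \<open>A sorted packet sits in the cell whose address is its rank, so the rank can be
    computed from the coordinates of the cell.\<close>
  have "\<sigma>3 (cell a b c ?m (E p)) 21 = E p" if "p \<in> S" for p
    using v3(1)[OF cellm[OF that]] par[OF cellm[OF that]] lin_cell[OF ax Em[OF that]] lt[OF Es[OF that]]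
    by simp
  then have H3: "holds S (\<lambda>i. cell a b c ?m (E i)) E \<kappa> V \<sigma>3"
    using H2 v3(3) unfolding holds_def by (simp add: image_subset_iff)
  have loc3: "located \<sigma>3" unfolding \<sigma>3_def by (intro located_den loc2) (use ax' in auto)
  have M3: "\<forall>q\<in>mesh s. \<sigma>3 q 110 = s" using v3(2) par by simp
  have crdm: "crd d (cell a b c ?m (E p)) < ?m" if "p \<in> S" "d < 3" for p d
    using cell_mesh[OF ax Em[OF that(1)] order_refl] that(2) by (simp add: mem_mesh_crd)
  \<comment> \<open>The addresses in the corner are the ranks themselves, so moving to the same
    numbers in the cube of side \<open>s\<close> keeps all distances, which is the borderline case
    of contraction.\<close>
  have contr: "E j - E i \<le> lin a b c ?m (cell a b c ?m (E j)) - lin a b c ?m (cell a b c ?m (E i))"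
    if "i \<in> S" "j \<in> S" "E i < E j" for i j
    using lin_cell[OF ax Em[OF that(1)]] lin_cell[OF ax Em[OF that(2)]] by simp
  have crdm': "crd a (cell a b c ?m (E p)) < ?m \<and> crd b (cell a b c ?m (E p)) < ?m \<and> crd c (cell a b c ?m (E p)) < ?m"
    if "p \<in> S" for p using crdm[OF that] ax' by simp
  have crds0: "crd d (cell a b c ?m (E p)) < s" if "p \<in> S" "d < 3" for p d
    using crdm[OF that] m by simp
  have injs: "inj_on (\<lambda>i. mv c (cell a b c ?m (E i)) (E i mod s)) S"
    "inj_on (\<lambda>i. mv b (mv c (cell a b c ?m (E i)) (E i mod s)) (E i div s mod s)) S"
    "inj_on (\<lambda>i. cell a b c s (E i)) S"
    by (rule minor_first_inj[where a = a and b = b and c = c and D = E and S = S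
          and ps = "\<lambda>i. cell a b c ?m (E i)" and m = ?m and M = s];
        use ax E(1) crdm' contr m in blast)+
  have H4: "holds S (\<lambda>i. cell a b c s (E i)) E \<kappa> V \<sigma>4"
    unfolding \<sigma>4_def
    by (rule holds_route(1)[OF ax H3 loc3 M3 order_refl]; (fact | use Es crds0 in blast))
  have loc4: "located \<sigma>4" unfolding \<sigma>4_def by (rule located_den_subset[OF loc3 writes_routes(1)]) auto
  have M4: "\<sigma>4 q 110 = \<sigma>3 q 110" for q
    unfolding \<sigma>4_def by (rule den_frame_subset[OF writes_routes(1)]) simp
  have v5: "\<sigma>5 q 20 = \<sigma>4 q 20" "\<sigma>5 q 22 = \<sigma>4 q 22" "\<sigma>5 q 23 = \<sigma>4 q 23" "\<sigma>5 q 21 = \<sigma>4 q 22" "\<sigma>5 q 110 = \<sigma>4 q 110" for q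
    by (simp_all add: \<sigma>5_def sem_apply)
  have H5: "holds S (\<lambda>i. cell a b c s (E i)) \<kappa> \<kappa> V \<sigma>5"
    using H4 by (simp add: holds_def v5)
  have loc5: "located \<sigma>5" unfolding \<sigma>5_def by (intro located_den loc4) simp
  have M5: "\<forall>q\<in>mesh s. \<sigma>5 q 110 = s" using M3 M4 v5 by simp
  have crds: "crd d (cell a b c s (E p)) < s" if "p \<in> S" "d < 3" for p d
    using cell_mesh[OF ax Es[OF that(1)] order_refl] that(2) by (simp add: mem_mesh_crd)
  have crds': "crd a (cell a b c s (E p)) < s \<and> crd b (cell a b c s (E p)) < s \<and> crd c (cell a b c s (E p)) < s"
    if "p \<in> S" for p using crds[OF that] ax' by simp
  have exp: "lin a b c s (cell a b c s (E j)) - lin a b c s (cell a b c s (E i)) \<le> \<kappa> j - \<kappa> i"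
    if "i \<in> S" "j \<in> S" for i j
    using rank_diff_le[OF fin E \<kappa>_inj that] lin_cell[OF ax Es[OF that(1)]] lin_cell[OF ax Es[OF that(2)]]
    by simp
  have injt: "inj_on (\<lambda>i. mv a (cell a b c s (E i)) (\<kappa> i div (s * s))) S"
    "inj_on (\<lambda>i. mv b (mv a (cell a b c s (E i)) (\<kappa> i div (s * s))) (\<kappa> i div s mod s)) S"
    "inj_on (\<lambda>i. cell a b c s (\<kappa> i)) S"
    by (rule major_first_inj[where a = a and b = b and c = c and D = \<kappa> and S = S
          and ps = "\<lambda>i. cell a b c s (E i)" and M = s];
        use ax injs(3) crds' exp in blast)+
  have H: "holds S (\<lambda>i. cell a b c s (\<kappa> i)) \<kappa> \<kappa> V \<sigma>'"
    unfolding \<sigma>'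
    by (rule holds_route(2)[OF ax H5 loc5 M5 order_refl]; (fact | use \<kappa>_lt crds in blast))
  have iff: "q \<in> (\<lambda>i. cell a b c s (\<kappa> i)) ` S \<longleftrightarrow> crd a q < b1 * b1 \<and> i < n \<and> k < n"
    and eq: "crd a q < b1 * b1 \<Longrightarrow> i < n \<Longrightarrow> k < n \<Longrightarrow> (i, k) \<in> S \<and> q = cell a b c s (\<kappa> (i, k))"
  proof -
    have crdq: "crd b q < s" "crd c q < s" using crd_mesh[OF q] by auto
    show *: "(i, k) \<in> S \<and> q = cell a b c s (\<kappa> (i, k))" if "crd a q < b1 * b1" "i < n" "k < n"
    proof -
      have "crd a q div b1 < b1" using that(1) by (simp add: less_mult_imp_div_less)
      then have d: "i div s = tr * b1 + crd a q div b1" "k div s = tc * b1 + crd a q mod b1"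
        "i mod s = crd b q" "k mod s = crd c q" "i div s div b1 = tr" "k div s div b1 = tc"
        "i div s mod b1 = crd a q div b1" "k div s mod b1 = crd a q mod b1"
        using crdq b1(2) s_pos by (simp_all add: i_def k_def)
      then have "(i, k) \<in> S" using that by (simp add: S_def)
      moreover have "q = cell a b c s (\<kappa> (i, k))"
        by (rule axes_pos_eqI[OF ax]) (simp_all only: \<kappa>_cell d(3,4,7,8) div_mult_mod_eq)
      ultimately show ?thesis by blast
    qed
    show "q \<in> (\<lambda>i. cell a b c s (\<kappa> i)) ` S \<longleftrightarrow> crd a q < b1 * b1 \<and> i < n \<and> k < n"
    proof
      assume "q \<in> (\<lambda>i. cell a b c s (\<kappa> i)) ` S"
      then obtain i' k' where p: "(i', k') \<in> S" "q = cell a b c s (\<kappa> (i', k'))" by auto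
      have "crd a q < b1 * b1"
        using p(2) \<kappa>_cell(1)[of i' k'] b1(2) by (simp add: lt_mult_add)
      moreover have "i = i'" "k = k'" using \<kappa>_inv[OF p] by (auto simp: i_def k_def)
      ultimately show "crd a q < b1 * b1 \<and> i < n \<and> k < n" using Sn[OF p(1)] by simp
    next
      assume "crd a q < b1 * b1 \<and> i < n \<and> k < n"
      then show "q \<in> (\<lambda>i. cell a b c s (\<kappa> i)) ` S" using * by blast
    qed
  qed
  show "\<sigma>' q 20 = of_bool (crd a q < b1 * b1 \<and> i < n \<and> k < n)"
  proof (cases "q \<in> (\<lambda>i. cell a b c s (\<kappa> i)) ` S")
    case True
    then have "\<sigma>' q 20 = 1" using H by (auto simp: holds_def)
    then show ?thesis using iff True by simp
  next
    case False
    then have "\<sigma>' q 20 = 0" using H q by (simp add: holds_def)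
    then show ?thesis using iff False by simp
  qed
  show "\<sigma>' q 23 = A i k" if "crd a q < b1 * b1" "i < n" "k < n"
    using eq[OF that] H by (auto simp: holds_def V_def)
qed

lemma time_load:
  assumes m: "\<sigma> (0, 0, 0) 115 = m" and L: "\<sigma> (0, 0, 0) 114 = L" and s: "\<sigma> (0, 0, 0) 3 = s" and r: "r < 100"
  shows "time (load r a b c) \<sigma> \<le> L * (372 * m + 235) + 264 * s + 171"
proof -
  let ?b1 = "Block [Arith Div 36 (r + 1) 3, Arith Div 37 (r + 2) 3, Arith Div 38 36 116, Arith Div 39 37 116,
       Arith Eq 38 38 120, Arith Eq 39 39 121, Arith Mul 38 38 39, Arith Mul 20 r 38,
       Arith Mod 36 36 116, Arith Mod 37 37 116, Arith Mul 36 36 116, Arith Add 36 36 37,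
       Arith Mul 36 36 3, Arith Mod 37 (r + 1) 3, Arith Add 36 36 37,
       Arith Mul 36 36 3, Arith Mod 37 (r + 2) 3, Arith Add 22 36 37, Move 23 (r + 3), Move 110 115]"
  let ?b2 = "Block [Arith Mul 21 a 115, Arith Add 21 21 b, Arith Mul 21 21 115, Arith Add 21 21 c, Move 110 3]"
  let ?b3 = "Block [Move 21 22]"
  have fr: "den (radix_sort a b c) \<tau> q 3 = \<tau> q 3" "den (route_minor_first a b c) \<tau> q 110 = \<tau> q 110" for \<tau> q
    by (rule den_frame_subset[OF writes_radix_sort] den_frame_subset[OF writes_routes(1)]; simp)+
  have fr1: "den ?b1 \<sigma> q 3 = \<sigma> q 3" "den ?b1 \<sigma> q 114 = \<sigma> q 114" "den ?b1 \<sigma> q 110 = \<sigma> q 115" for q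
    by (simp_all add: sem_apply)
  have fr2: "den ?b2 \<tau> q 110 = \<tau> q 3" "den ?b3 \<tau> q 110 = \<tau> q 110" for \<tau> q
    by (simp_all add: sem_apply)
  have "time (radix_sort a b c) (den ?b1 \<sigma>) \<le> L * (372 * m + 235) + 3"
    by (rule time_radix_sort) (simp_all only: fr1 m L)
  moreover have "time (route_minor_first a b c) (den ?b2 (den (radix_sort a b c) (den ?b1 \<sigma>))) \<le> 132 * s + 71"
    by (rule time_routes) (simp only: fr fr1 fr2 s)
  moreover have "time (route_major_first a b c) (den ?b3 (den (route_minor_first a b c)
      (den ?b2 (den (radix_sort a b c) (den ?b1 \<sigma>))))) \<le> 132 * s + 71"
    by (rule time_routes) (simp only: fr fr1 fr2 s)
  ultimately show ?thesis unfolding load_def time.simps(1,2) list.size by linarith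
qed

end

section \<open>Systolic multiplication\<close>

text \<open>Register 122 is the clock and 78 the delay \<open>x + z + s\<close>. The operand with
  index \<open>\<tau>\<close> leaves its owner, the cell with \<open>y = row_of b \<tau>\<close>, so
  as to be at \<open>y = 0\<close> at tick \<open>\<tau> + x + z + s\<close>; the summand
  \<open>s\<close> keeps the departure nonnegative. The index computed here is constant along the
  way.\<close>

definition select_a :: "instr list" where
  "select_a = [Arith Add 82 122 1, Arith Sub 82 82 78, Arith Div 83 82 116, Arith Mod 83 83 116,
     Arith Mul 83 83 116, Arith Div 84 82 117, Arith Add 83 83 84, Arith Eq 83 83 1]"

text \<open>The lane 66, 67 runs towards \<open>y = 0\<close> and the lane 68, 69 back from there,
  with the turn made within one tick. So an operand visits all cells of its line at times that do
  not depend on the place of its owner.\<close>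

definition move_a :: "instr list" where
  "move_a = shift YPlus 66 @ shift YPlus 67 @ [CMove 66 83 60, CMove 67 83 61] @
     shift YMinus 68 @ shift YMinus 69 @
     [Const 85 0, Arith Eq 85 1 85, CMove 68 85 66, CMove 69 85 67]"

definition select_b :: "instr list" where
  "select_b = [Arith Add 82 122 0, Arith Sub 82 82 79, Arith Div 83 82 117, Arith Mul 83 83 116,
     Arith Mod 84 82 116, Arith Add 83 83 84, Arith Eq 83 83 0]"

definition move_b :: "instr list" where
  "move_b = shift XPlus 70 @ shift XPlus 71 @ [CMove 70 83 62, CMove 71 83 63] @
     shift XMinus 72 @ shift XMinus 73 @
     [Const 85 0, Arith Eq 85 0 85, CMove 72 85 70, CMove 73 85 71]"

text \<open>The pair 74, 75 is a partial sum on its way to larger \<open>z\<close>. Register 88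
  tells whether a product exists, 89 whether there is also a sum to its left; the outcome of
  \<open>Oplus\<close> is used only in the latter case, with the older sum as left argument.\<close>

definition multiply_add :: "instr list" where
  "multiply_add = shift ZMinus 74 @ shift ZMinus 75 @
     [Otimes 86 69 73, Oplus 87 75 86, Arith Mul 88 68 72, Arith Mul 89 88 74,
      CMove 75 88 86, CMove 75 89 87, CMove 74 88 88]"

text \<open>A sum is complete at \<open>z = s - 1\<close> at tick
  \<open>\<tau> + x + y + 2 * s - 1\<close> and turns around there. The way down to height
  \<open>z\<close> takes \<open>s - 1 - z\<close> further ticks, which explains the
  \<open>3 * s - 2\<close> in register 81.\<close>

definition return_sum :: "instr list" where
  "return_sum = shift ZPlus 76 @ shift ZPlus 77 @
     [Const 85 1, Arith Add 85 2 85, Arith Eq 85 85 3, CMove 76 85 74, CMove 77 85 75]"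

text \<open>The sum with index \<open>\<tau>\<close> is kept at height
  \<open>\<tau> mod (b * b)\<close>. Sums before the first and behind the last index would spoil an
  accumulator and are excluded by explicit tests; stray words in the other lanes need no such
  test.\<close>

definition select_c :: "instr list" where
  "select_c = [Arith Add 82 122 2, Arith Less 83 82 81, Arith Sub 82 82 81, Arith Less 84 82 118,
     Arith Mod 85 82 117, Arith Eq 85 85 2, Const 86 1, Arith Sub 86 86 83, Arith Mul 84 84 85,
     Arith Mul 84 84 86]"

definition accumulate :: "instr list" where
  "accumulate = [Arith Mul 84 84 76, Oplus 87 65 77, Arith Mul 88 84 64, CMove 65 84 77,
     CMove 65 88 87, CMove 64 84 84, Const 123 1, Arith Add 122 122 123]"

definition tick :: cmd where
  "tick = Block select_a ;; Block move_a ;; Block select_b ;; Block move_b ;; Block multiply_add ;;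
     Block return_sum ;; Block select_c ;; Block accumulate"

lemmas tick_defs = select_a_def move_a_def select_b_def move_b_def multiply_add_def return_sum_def
  select_c_def accumulate_def

text \<open>As \<open>0 < c\<close>, at most one \<open>k\<close> satisfies
  \<open>k * c + d = t\<close>. It exceeds those counted before and therefore goes to the end of the
  list.\<close>

lemma filter_upt_step:
  assumes "0 < (c::nat)"
  shows "filter (\<lambda>k. k * c + d < Suc t) [0..<b] = filter (\<lambda>k. k * c + d < t) [0..<b] @
    (if \<exists>k<b. k * c + d = t then [(t - d) div c] else [])"
proof (induction b)
  case (Suc b)
  have "k * c < b * c" if "k < b" for k using that assms by simp
  then show ?case using Suc assms by (auto simp: less_Suc_eq)
qed simp

section \<open>Effect of the instruction blocks of one tick\<close>

definition opt :: "nat \<Rightarrow> nat \<Rightarrow> nat option" where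
  "opt a v = (if a = 0 then None else Some v)"

text \<open>\<open>None\<close> plays the neutral element that \<open>f\<close> may lack.\<close>

definition join :: "('a \<Rightarrow> 'a \<Rightarrow> 'a) \<Rightarrow> 'a option \<Rightarrow> 'a option \<Rightarrow> 'a option" where
  "join f a b = (case a of None \<Rightarrow> b | Some u \<Rightarrow> (case b of None \<Rightarrow> a | Some v \<Rightarrow> Some (f u v)))"

context word_machine
begin

lemma den_select_a:
  assumes "\<sigma> (x, y, z) 122 + y = \<tau> + \<sigma> (x, y, z) 78" and "\<tau> < b * b * b" and "b * b \<le> s"
    and "\<sigma> (x, y, z) 1 = y" "\<sigma> (x, y, z) 116 = b" "\<sigma> (x, y, z) 117 = b * b"
    and "\<sigma> (x, y, z) 122 + y < 2 ^ w"
  shows "fold sem select_a \<sigma> (x, y, z) 83 = of_bool (\<tau> div b mod b * b + \<tau> div (b * b) = y)"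
proof -
  have b: "0 < b" using assms(2) by (cases b) auto
  have "\<tau> div (b * b) < b" using assms(2) by (simp add: less_mult_imp_div_less ac_simps)
  moreover have "\<tau> div b mod b < b" using b by simp
  ultimately have e: "\<tau> div b mod b * b + \<tau> div (b * b) < b * b" by (rule lt_mult_add[rotated])
  have bw: "b * b < 2 ^ w" using assms(3) s_word by simp
  have le: "b \<le> b * b" by simp
  have \<tau>: "\<tau> < 2 ^ w" using assms(1,7) by simp
  have m: "\<tau> div b mod 2 ^ w = \<tau> div b" "\<tau> div b mod b mod 2 ^ w = \<tau> div b mod b"
    "\<tau> div b mod b * b mod 2 ^ w = \<tau> div b mod b * b" "\<tau> div (b * b) mod 2 ^ w = \<tau> div (b * b)"
    "(\<tau> div b mod b * b + \<tau> div (b * b)) mod 2 ^ w = \<tau> div b mod b * b + \<tau> div (b * b)"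
  proof -
    have "\<tau> div b \<le> \<tau>" by simp
    then show "\<tau> div b mod 2 ^ w = \<tau> div b" using \<tau> by (intro mod_less) linarith
    show "\<tau> div b mod b mod 2 ^ w = \<tau> div b mod b"
      using \<open>\<tau> div b mod b < b\<close> le bw by (intro mod_less) linarith
    show "\<tau> div b mod b * b mod 2 ^ w = \<tau> div b mod b * b"
      using e bw by (intro mod_less) linarith
    show "\<tau> div (b * b) mod 2 ^ w = \<tau> div (b * b)"
      using \<open>\<tau> div (b * b) < b\<close> le bw by (intro mod_less) linarith
    show "(\<tau> div b mod b * b + \<tau> div (b * b)) mod 2 ^ w = \<tau> div b mod b * b + \<tau> div (b * b)"
      using e bw by (intro mod_less) linarith
  qed
  have t: "(\<sigma> (x, y, z) 122 + y) mod 2 ^ w - \<sigma> (x, y, z) 78 = \<tau>"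
    using assms(1,7) by simp
  have "(1::nat) < 2 ^ w" using w_pos by (intro one_less_power) auto
  then show ?thesis
    by (simp only: select_a_def block_simps assms(4-6) cong: if_weak_cong) (simp add: t m mod_less[OF \<tau>])
qed

lemma den_select_b:
  assumes "\<sigma> (x, y, z) 122 + x = \<tau> + \<sigma> (x, y, z) 79" and "\<tau> < b * b * b" and "b * b \<le> s"
    and "\<sigma> (x, y, z) 0 = x" "\<sigma> (x, y, z) 116 = b" "\<sigma> (x, y, z) 117 = b * b"
    and "\<sigma> (x, y, z) 122 + x < 2 ^ w"
  shows "fold sem select_b \<sigma> (x, y, z) 83 = of_bool (\<tau> div (b * b) * b + \<tau> mod b = x)"
proof -
  have b: "0 < b" using assms(2) by (cases b) auto
  have "\<tau> div (b * b) < b" using assms(2) by (simp add: less_mult_imp_div_less ac_simps)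
  moreover have "\<tau> mod b < b" using b by simp
  ultimately have e: "\<tau> div (b * b) * b + \<tau> mod b < b * b" by (rule lt_mult_add)
  have bw: "b * b < 2 ^ w" using assms(3) s_word by simp
  have le: "b \<le> b * b" by simp
  have \<tau>: "\<tau> < 2 ^ w" using assms(1,7) by simp
  have m: "\<tau> mod b mod 2 ^ w = \<tau> mod b" "\<tau> div (b * b) * b mod 2 ^ w = \<tau> div (b * b) * b"
    "\<tau> div (b * b) mod 2 ^ w = \<tau> div (b * b)"
    "(\<tau> div (b * b) * b + \<tau> mod b) mod 2 ^ w = \<tau> div (b * b) * b + \<tau> mod b"
  proof -
    show "\<tau> mod b mod 2 ^ w = \<tau> mod b"
      using \<open>\<tau> mod b < b\<close> le bw by (intro mod_less) linarith
    show "\<tau> div (b * b) * b mod 2 ^ w = \<tau> div (b * b) * b"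
      using e bw by (intro mod_less) linarith
    show "\<tau> div (b * b) mod 2 ^ w = \<tau> div (b * b)"
      using \<open>\<tau> div (b * b) < b\<close> le bw by (intro mod_less) linarith
    show "(\<tau> div (b * b) * b + \<tau> mod b) mod 2 ^ w = \<tau> div (b * b) * b + \<tau> mod b"
      using e bw by (intro mod_less) linarith
  qed
  have t: "(\<sigma> (x, y, z) 122 + x) mod 2 ^ w - \<sigma> (x, y, z) 79 = \<tau>"
    using assms(1,7) by simp
  have "(1::nat) < 2 ^ w" using w_pos by (intro one_less_power) auto
  then show ?thesis
    by (simp only: select_b_def block_simps assms(4-6) cong: if_weak_cong) (simp add: t m mod_less[OF \<tau>])
qed

lemma den_select_c:
  assumes "\<sigma> (x, y, z) 122 + z < 2 ^ w"
    and "\<sigma> (x, y, z) 2 = z" "\<sigma> (x, y, z) 117 = c" "\<sigma> (x, y, z) 118 = d"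
  shows "fold sem select_c \<sigma> (x, y, z) 84 = of_bool (\<sigma> (x, y, z) 81 \<le> \<sigma> (x, y, z) 122 + z \<and>
    \<sigma> (x, y, z) 122 + z - \<sigma> (x, y, z) 81 < d \<and> (\<sigma> (x, y, z) 122 + z - \<sigma> (x, y, z) 81) mod c = z)"
proof -
  let ?\<tau> = "\<sigma> (x, y, z) 122 + z - \<sigma> (x, y, z) 81"
  have \<tau>: "?\<tau> < 2 ^ w" using assms(1) by simp
  have "?\<tau> mod c \<le> ?\<tau>" by simp
  then have m: "?\<tau> mod c mod 2 ^ w = ?\<tau> mod c" using \<tau> by (intro mod_less) linarith
  have "(1::nat) < 2 ^ w" using w_pos by (intro one_less_power) auto
  then show ?thesis
    by (simp only: select_c_def block_simps assms(2-4) cong: if_weak_cong)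
      (simp add: mod_less[OF assms(1)] mod_less[OF \<tau>] m of_bool_def not_less w_pos)
qed

lemma den_move_a:
  fixes \<sigma> x y z
  defines "\<sigma>' \<equiv> fold sem move_a \<sigma>"
  assumes "\<sigma> (x, y, z) 1 = y"
  shows "\<sigma>' (x, y, z) 66 = (if \<sigma> (x, y, z) 83 \<noteq> 0 then \<sigma> (x, y, z) 60 else if y + 1 < s then \<sigma> (x, y + 1, z) 66 else 0)"
    and "\<sigma>' (x, y, z) 67 = (if \<sigma> (x, y, z) 83 \<noteq> 0 then \<sigma> (x, y, z) 61 else if y + 1 < s then \<sigma> (x, y + 1, z) 67 else 0)"
    and "\<sigma>' (x, y, z) 68 = (if y = 0 then \<sigma>' (x, y, z) 66 else \<sigma> (x, y - 1, z) 68)"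
    and "\<sigma>' (x, y, z) 69 = (if y = 0 then \<sigma>' (x, y, z) 67 else \<sigma> (x, y - 1, z) 69)"
proof -
  have one: "(1::nat) < 2 ^ w" using w_pos by (intro one_less_power) auto
  then have a: "\<sigma>' (x, y, z) 66 = (if \<sigma> (x, y, z) 83 \<noteq> 0 then \<sigma> (x, y, z) 60 else if y + 1 < s then \<sigma> (x, y + 1, z) 66 else 0)"
    "\<sigma>' (x, y, z) 67 = (if \<sigma> (x, y, z) 83 \<noteq> 0 then \<sigma> (x, y, z) 61 else if y + 1 < s then \<sigma> (x, y + 1, z) 67 else 0)"
    using assms(2)
    by (simp_all only: \<sigma>'_def move_a_def shift_def append.simps neighbour.simps block_simps cong: if_weak_cong)
      (auto simp: sem_apply)
  show "\<sigma>' (x, y, z) 68 = (if y = 0 then \<sigma>' (x, y, z) 66 else \<sigma> (x, y - 1, z) 68)"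
    "\<sigma>' (x, y, z) 69 = (if y = 0 then \<sigma>' (x, y, z) 67 else \<sigma> (x, y - 1, z) 69)"
    using one assms(2) unfolding a
    by (simp_all only: \<sigma>'_def move_a_def shift_def append.simps neighbour.simps block_simps cong: if_weak_cong)
      (auto simp: sem_apply)
  show "\<sigma>' (x, y, z) 66 = (if \<sigma> (x, y, z) 83 \<noteq> 0 then \<sigma> (x, y, z) 60 else if y + 1 < s then \<sigma> (x, y + 1, z) 66 else 0)"
    "\<sigma>' (x, y, z) 67 = (if \<sigma> (x, y, z) 83 \<noteq> 0 then \<sigma> (x, y, z) 61 else if y + 1 < s then \<sigma> (x, y + 1, z) 67 else 0)"
    using a by simp_all
qed

lemma den_move_b:
  fixes \<sigma> x y z
  defines "\<sigma>' \<equiv> fold sem move_b \<sigma>"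
  assumes "\<sigma> (x, y, z) 0 = x"
  shows "\<sigma>' (x, y, z) 70 = (if \<sigma> (x, y, z) 83 \<noteq> 0 then \<sigma> (x, y, z) 62 else if x + 1 < s then \<sigma> (x + 1, y, z) 70 else 0)"
    and "\<sigma>' (x, y, z) 71 = (if \<sigma> (x, y, z) 83 \<noteq> 0 then \<sigma> (x, y, z) 63 else if x + 1 < s then \<sigma> (x + 1, y, z) 71 else 0)"
    and "\<sigma>' (x, y, z) 72 = (if x = 0 then \<sigma>' (x, y, z) 70 else \<sigma> (x - 1, y, z) 72)"
    and "\<sigma>' (x, y, z) 73 = (if x = 0 then \<sigma>' (x, y, z) 71 else \<sigma> (x - 1, y, z) 73)"
proof -
  have one: "(1::nat) < 2 ^ w" using w_pos by (intro one_less_power) auto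
  then have a: "\<sigma>' (x, y, z) 70 = (if \<sigma> (x, y, z) 83 \<noteq> 0 then \<sigma> (x, y, z) 62 else if x + 1 < s then \<sigma> (x + 1, y, z) 70 else 0)"
    "\<sigma>' (x, y, z) 71 = (if \<sigma> (x, y, z) 83 \<noteq> 0 then \<sigma> (x, y, z) 63 else if x + 1 < s then \<sigma> (x + 1, y, z) 71 else 0)"
    using assms(2)
    by (simp_all only: \<sigma>'_def move_b_def shift_def append.simps neighbour.simps block_simps cong: if_weak_cong)
      (auto simp: sem_apply)
  show "\<sigma>' (x, y, z) 72 = (if x = 0 then \<sigma>' (x, y, z) 70 else \<sigma> (x - 1, y, z) 72)"
    "\<sigma>' (x, y, z) 73 = (if x = 0 then \<sigma>' (x, y, z) 71 else \<sigma> (x - 1, y, z) 73)"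
    using one assms(2) unfolding a
    by (simp_all only: \<sigma>'_def move_b_def shift_def append.simps neighbour.simps block_simps cong: if_weak_cong)
      (auto simp: sem_apply)
  show "\<sigma>' (x, y, z) 70 = (if \<sigma> (x, y, z) 83 \<noteq> 0 then \<sigma> (x, y, z) 62 else if x + 1 < s then \<sigma> (x + 1, y, z) 70 else 0)"
    "\<sigma>' (x, y, z) 71 = (if \<sigma> (x, y, z) 83 \<noteq> 0 then \<sigma> (x, y, z) 63 else if x + 1 < s then \<sigma> (x + 1, y, z) 71 else 0)"
    using a by simp_all
qed

lemma den_multiply_add:
  fixes \<sigma> x y z
  defines "\<sigma>' \<equiv> fold sem multiply_add \<sigma>"
  assumes "\<sigma> (x, y, z) 68 \<le> 1" "\<sigma> (x, y, z) 72 \<le> 1" "z \<noteq> 0 \<Longrightarrow> \<sigma> (x, y, z - 1) 74 \<le> 1"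
  shows "\<sigma>' (x, y, z) 74 \<le> 1"
    and "opt (\<sigma>' (x, y, z) 74) (\<sigma>' (x, y, z) 75) =
      join f (if z = 0 then None else opt (\<sigma> (x, y, z - 1) 74) (\<sigma> (x, y, z - 1) 75))
        (if \<sigma> (x, y, z) 68 \<noteq> 0 \<and> \<sigma> (x, y, z) 72 \<noteq> 0 then Some (g (\<sigma> (x, y, z) 69) (\<sigma> (x, y, z) 73)) else None)"
proof -
  have one: "(1::nat) < 2 ^ w" using w_pos by (intro one_less_power) auto
  define F where "F = (if z = 0 then 0 else \<sigma> (x, y, z - 1) 74)"
  define V where "V = (if z = 0 then 0 else \<sigma> (x, y, z - 1) 75)"
  define c where "c = \<sigma> (x, y, z) 68 * \<sigma> (x, y, z) 72"
  have F: "F \<le> 1" using assms(4) by (simp add: F_def)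
  have c: "c = 0 \<or> c = 1" "c \<noteq> 0 \<longleftrightarrow> \<sigma> (x, y, z) 68 \<noteq> 0 \<and> \<sigma> (x, y, z) 72 \<noteq> 0"
    using assms(2,3) by (auto simp: c_def le_Suc_eq)
  have w: "\<sigma>' (x, y, z) 74 = (if c mod 2 ^ w \<noteq> 0 then c mod 2 ^ w else F)"
    "\<sigma>' (x, y, z) 75 = (if (c mod 2 ^ w) * F mod 2 ^ w \<noteq> 0 then f V (g (\<sigma> (x, y, z) 69) (\<sigma> (x, y, z) 73))
       else if c mod 2 ^ w \<noteq> 0 then g (\<sigma> (x, y, z) 69) (\<sigma> (x, y, z) 73) else V)"
    by (simp_all only: \<sigma>'_def multiply_add_def shift_def append.simps neighbour.simps block_simps cong: if_weak_cong)
      (auto simp: sem_apply F_def V_def c_def)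
  have v: "\<sigma>' (x, y, z) 74 = (if c \<noteq> 0 then 1 else F)"
    "\<sigma>' (x, y, z) 75 = (if c * F \<noteq> 0 then f V (g (\<sigma> (x, y, z) 69) (\<sigma> (x, y, z) 73))
       else if c \<noteq> 0 then g (\<sigma> (x, y, z) 69) (\<sigma> (x, y, z) 73) else V)"
  proof -
    have "F = 0 \<or> F = 1" using F by linarith
    then show "\<sigma>' (x, y, z) 74 = (if c \<noteq> 0 then 1 else F)"
      "\<sigma>' (x, y, z) 75 = (if c * F \<noteq> 0 then f V (g (\<sigma> (x, y, z) 69) (\<sigma> (x, y, z) 73))
       else if c \<noteq> 0 then g (\<sigma> (x, y, z) 69) (\<sigma> (x, y, z) 73) else V)"
      using w c(1) one w_pos by (elim disjE; simp)+
  qed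
  show "\<sigma>' (x, y, z) 74 \<le> 1" using v F by simp
  show "opt (\<sigma>' (x, y, z) 74) (\<sigma>' (x, y, z) 75) =
      join f (if z = 0 then None else opt (\<sigma> (x, y, z - 1) 74) (\<sigma> (x, y, z - 1) 75))
        (if \<sigma> (x, y, z) 68 \<noteq> 0 \<and> \<sigma> (x, y, z) 72 \<noteq> 0 then Some (g (\<sigma> (x, y, z) 69) (\<sigma> (x, y, z) 73)) else None)"
    unfolding v c(2)[symmetric] by (auto simp: opt_def join_def F_def V_def)
qed

lemma den_return_sum:
  fixes \<sigma> x y z
  defines "\<sigma>' \<equiv> fold sem return_sum \<sigma>"
  assumes "\<sigma> (x, y, z) 2 = z" "\<sigma> (x, y, z) 3 = s" "z < s"
  shows "\<sigma>' (x, y, z) 76 = (if z + 1 < s then \<sigma> (x, y, z + 1) 76 else \<sigma> (x, y, z) 74)"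
    and "\<sigma>' (x, y, z) 77 = (if z + 1 < s then \<sigma> (x, y, z + 1) 77 else \<sigma> (x, y, z) 75)"
proof -
  have one: "(1::nat) mod 2 ^ w = 1" using w_pos by (intro mod_less one_less_power) auto
  have n: "(z + 1) mod 2 ^ w = z + 1" using assms(4) s_word by (intro mod_less) linarith
  have c: "z + 1 < s \<longleftrightarrow> z + 1 \<noteq> s" using assms(4) by linarith
  show "\<sigma>' (x, y, z) 76 = (if z + 1 < s then \<sigma> (x, y, z + 1) 76 else \<sigma> (x, y, z) 74)"
    "\<sigma>' (x, y, z) 77 = (if z + 1 < s then \<sigma> (x, y, z + 1) 77 else \<sigma> (x, y, z) 75)"
    using w_pos unfolding c \<sigma>'_def
    by (simp_all only: return_sum_def shift_def append.simps neighbour.simps block_simps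
        assms(2,3) one n cong: if_weak_cong) (simp_all add: sem_apply c[simplified])
qed

lemma den_accumulate:
  fixes \<sigma> x y z
  defines "\<sigma>' \<equiv> fold sem accumulate \<sigma>"
  assumes "\<sigma> (x, y, z) 84 \<le> 1" "\<sigma> (x, y, z) 84 \<noteq> 0 \<Longrightarrow> \<sigma> (x, y, z) 76 \<le> 1" "\<sigma> (x, y, z) 64 \<le> 1"
  shows "\<sigma>' (x, y, z) 64 \<le> 1"
    and "opt (\<sigma>' (x, y, z) 64) (\<sigma>' (x, y, z) 65) =
      (if \<sigma> (x, y, z) 84 \<noteq> 0 then join f (opt (\<sigma> (x, y, z) 64) (\<sigma> (x, y, z) 65))
         (opt (\<sigma> (x, y, z) 76) (\<sigma> (x, y, z) 77)) else opt (\<sigma> (x, y, z) 64) (\<sigma> (x, y, z) 65))"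
    and "\<sigma>' (x, y, z) 122 = (\<sigma> (x, y, z) 122 + 1) mod 2 ^ w"
proof -
  have one: "(1::nat) < 2 ^ w" using w_pos by (intro one_less_power) auto
  let ?c = "\<sigma> (x, y, z) 84 * \<sigma> (x, y, z) 76" and ?F = "\<sigma> (x, y, z) 64"
  have c: "?c \<le> 1" using assms(2,3) by (cases "\<sigma> (x, y, z) 84") auto
  have c': "?c < 2 ^ w" "?c * ?F < 2 ^ w"
    using c one mult_le_mono[OF c assms(4)] by linarith+
  have v: "\<sigma>' (x, y, z) 64 = (if ?c \<noteq> 0 then ?c else ?F)"
    "\<sigma>' (x, y, z) 65 = (if ?c * ?F \<noteq> 0 then f (\<sigma> (x, y, z) 65) (\<sigma> (x, y, z) 77)
       else if ?c \<noteq> 0 then \<sigma> (x, y, z) 77 else \<sigma> (x, y, z) 65)"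
    by (simp_all only: \<sigma>'_def accumulate_def block_simps mod_less[OF c'(1)] mod_less[OF c'(2)] cong: if_weak_cong)
      (auto simp: sem_apply mod_less[OF c'(1)] mod_less[OF c'(2)])
  show "\<sigma>' (x, y, z) 122 = (\<sigma> (x, y, z) 122 + 1) mod 2 ^ w"
    using one by (simp add: \<sigma>'_def accumulate_def sem_apply mod_simps)
  show "\<sigma>' (x, y, z) 64 \<le> 1" using v c assms(4) by simp
  show "opt (\<sigma>' (x, y, z) 64) (\<sigma>' (x, y, z) 65) =
      (if \<sigma> (x, y, z) 84 \<noteq> 0 then join f (opt (\<sigma> (x, y, z) 64) (\<sigma> (x, y, z) 65))
         (opt (\<sigma> (x, y, z) 76) (\<sigma> (x, y, z) 77)) else opt (\<sigma> (x, y, z) 64) (\<sigma> (x, y, z) 65))"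
    unfolding v by (auto simp: opt_def join_def)
qed

end

text \<open>Write \<open>\<tau> = k * (b * b) + u * b + v\<close> with digits below
  \<open>b\<close>: \<open>u\<close> and \<open>v\<close> are the row block and the column block of
  the output, and \<open>k\<close> is the block of the inner index. Then \<open>row_of\<close> is
  \<open>u * b + k\<close> and \<open>col_of\<close> is \<open>k * b + v\<close>, the coordinates at
  which \<open>load\<close> puts these blocks of the two factors.\<close>

definition row_of :: "nat \<Rightarrow> nat \<Rightarrow> nat" where
  "row_of b \<tau> = \<tau> div b mod b * b + \<tau> div (b * b)"

definition col_of :: "nat \<Rightarrow> nat \<Rightarrow> nat" where
  "col_of b \<tau> = \<tau> div (b * b) * b + \<tau> mod b"

lemma row_of_less: "\<tau> < b * b * b \<Longrightarrow> row_of b \<tau> < b * b"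
  unfolding row_of_def
  by (rule lt_mult_add) (cases b; auto simp: less_mult_imp_div_less ac_simps)+

lemma col_of_less: "\<tau> < b * b * b \<Longrightarrow> col_of b \<tau> < b * b"
  unfolding col_of_def
  by (rule lt_mult_add) (cases b; auto simp: less_mult_imp_div_less ac_simps)+

section \<open>Timetable of the pipeline\<close>

locale multiplication = word_machine +
  fixes b :: nat and FA VA FB VB :: "nat \<Rightarrow> nat \<Rightarrow> nat \<Rightarrow> nat"
    and acc0 :: "nat \<Rightarrow> nat \<Rightarrow> nat \<Rightarrow> nat option"
  assumes b: "0 < b" "b * b \<le> s"
    and FA1: "\<And>x y z. x < s \<Longrightarrow> y < s \<Longrightarrow> z < s \<Longrightarrow> FA x y z \<le> 1"
    and FB1: "\<And>x y z. x < s \<Longrightarrow> y < s \<Longrightarrow> z < s \<Longrightarrow> FB x y z \<le> 1"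
begin

definition params :: "state \<Rightarrow> bool" where
  "params \<sigma> \<longleftrightarrow> (\<forall>x<s. \<forall>y<s. \<forall>z<s. \<sigma> (x, y, z) 0 = x \<and> \<sigma> (x, y, z) 1 = y \<and> \<sigma> (x, y, z) 2 = z \<and>
     \<sigma> (x, y, z) 3 = s \<and> \<sigma> (x, y, z) 116 = b \<and> \<sigma> (x, y, z) 117 = b * b \<and> \<sigma> (x, y, z) 118 = b * b * b \<and>
     \<sigma> (x, y, z) 78 = x + z + s \<and> \<sigma> (x, y, z) 79 = y + z + s \<and> \<sigma> (x, y, z) 81 = x + y + (3 * s - 2) \<and>
     \<sigma> (x, y, z) 60 = FA x y z \<and> \<sigma> (x, y, z) 61 = VA x y z \<and>
     \<sigma> (x, y, z) 62 = FB x y z \<and> \<sigma> (x, y, z) 63 = VB x y z)"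

definition product :: "nat \<Rightarrow> nat \<Rightarrow> nat \<Rightarrow> nat \<Rightarrow> nat option" where
  "product \<tau> x y z = (if FA x (row_of b \<tau>) z \<noteq> 0 \<and> FB (col_of b \<tau>) y z \<noteq> 0
     then Some (g (VA x (row_of b \<tau>) z) (VB (col_of b \<tau>) y z)) else None)"

definition line_sum :: "nat \<Rightarrow> nat \<Rightarrow> nat \<Rightarrow> nat \<Rightarrow> nat option" where
  "line_sum \<tau> x y k = foldl (join f) None (map (product \<tau> x y) [0..<k])"

text \<open>The state after \<open>t\<close> ticks.  The operand with index \<open>\<tau>\<close> passes the cell \<open>(x, y, z)\<close> at the
  tick \<open>\<tau> + x + y + z + s\<close>.\<close>

definition lanes :: "nat \<Rightarrow> state \<Rightarrow> bool" where
  "lanes t \<sigma> \<longleftrightarrow> (\<forall>x<s. \<forall>y<s. \<forall>z<s.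
    (\<forall>\<tau><b * b * b.
      (t + y = \<tau> + x + z + s + 1 \<longrightarrow> y \<le> row_of b \<tau> \<longrightarrow>
        \<sigma> (x, y, z) 66 = FA x (row_of b \<tau>) z \<and> \<sigma> (x, y, z) 67 = VA x (row_of b \<tau>) z) \<and>
      (t = \<tau> + x + y + z + s + 1 \<longrightarrow>
        \<sigma> (x, y, z) 68 = FA x (row_of b \<tau>) z \<and> \<sigma> (x, y, z) 69 = VA x (row_of b \<tau>) z) \<and>
      (t + x = \<tau> + y + z + s + 1 \<longrightarrow> x \<le> col_of b \<tau> \<longrightarrow>
        \<sigma> (x, y, z) 70 = FB (col_of b \<tau>) y z \<and> \<sigma> (x, y, z) 71 = VB (col_of b \<tau>) y z) \<and>
      (t = \<tau> + x + y + z + s + 1 \<longrightarrow>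
        \<sigma> (x, y, z) 72 = FB (col_of b \<tau>) y z \<and> \<sigma> (x, y, z) 73 = VB (col_of b \<tau>) y z) \<and>
      (t = \<tau> + x + y + z + s + 1 \<longrightarrow>
        \<sigma> (x, y, z) 74 \<le> 1 \<and> opt (\<sigma> (x, y, z) 74) (\<sigma> (x, y, z) 75) = line_sum \<tau> x y (Suc z)) \<and>
      (t + z = \<tau> + x + y + (3 * s - 2) + 1 \<longrightarrow>
        \<sigma> (x, y, z) 76 \<le> 1 \<and> opt (\<sigma> (x, y, z) 76) (\<sigma> (x, y, z) 77) = line_sum \<tau> x y s)) \<and>
    \<sigma> (x, y, z) 64 \<le> 1 \<and> opt (\<sigma> (x, y, z) 64) (\<sigma> (x, y, z) 65) = (if z < b * b
       then foldl (join f) (acc0 x y z) (map (\<lambda>k. line_sum (k * (b * b) + z) x y s)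
         (filter (\<lambda>k. k * (b * b) + (x + y + (3 * s - 2)) < t) [0..<b])) else acc0 x y z))"

lemma lanesD:
  assumes "lanes t \<sigma>" "x < s" "y < s" "z < s"
  shows "\<tau> < b * b * b \<Longrightarrow> t + y = \<tau> + x + z + s + 1 \<Longrightarrow> y \<le> row_of b \<tau> \<Longrightarrow>
        \<sigma> (x, y, z) 66 = FA x (row_of b \<tau>) z \<and> \<sigma> (x, y, z) 67 = VA x (row_of b \<tau>) z"
    and "\<tau> < b * b * b \<Longrightarrow> t = \<tau> + x + y + z + s + 1 \<Longrightarrow>
        \<sigma> (x, y, z) 68 = FA x (row_of b \<tau>) z \<and> \<sigma> (x, y, z) 69 = VA x (row_of b \<tau>) z"
    and "\<tau> < b * b * b \<Longrightarrow> t + x = \<tau> + y + z + s + 1 \<Longrightarrow> x \<le> col_of b \<tau> \<Longrightarrow>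
        \<sigma> (x, y, z) 70 = FB (col_of b \<tau>) y z \<and> \<sigma> (x, y, z) 71 = VB (col_of b \<tau>) y z"
    and "\<tau> < b * b * b \<Longrightarrow> t = \<tau> + x + y + z + s + 1 \<Longrightarrow>
        \<sigma> (x, y, z) 72 = FB (col_of b \<tau>) y z \<and> \<sigma> (x, y, z) 73 = VB (col_of b \<tau>) y z"
    and "\<tau> < b * b * b \<Longrightarrow> t = \<tau> + x + y + z + s + 1 \<Longrightarrow>
        \<sigma> (x, y, z) 74 \<le> 1 \<and> opt (\<sigma> (x, y, z) 74) (\<sigma> (x, y, z) 75) = line_sum \<tau> x y (Suc z)"
    and "\<tau> < b * b * b \<Longrightarrow> t + z = \<tau> + x + y + (3 * s - 2) + 1 \<Longrightarrow>
        \<sigma> (x, y, z) 76 \<le> 1 \<and> opt (\<sigma> (x, y, z) 76) (\<sigma> (x, y, z) 77) = line_sum \<tau> x y s"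
    and "\<sigma> (x, y, z) 64 \<le> 1 \<and> opt (\<sigma> (x, y, z) 64) (\<sigma> (x, y, z) 65) = (if z < b * b
       then foldl (join f) (acc0 x y z) (map (\<lambda>k. line_sum (k * (b * b) + z) x y s)
         (filter (\<lambda>k. k * (b * b) + (x + y + (3 * s - 2)) < t) [0..<b])) else acc0 x y z)"
  using assms unfolding lanes_def by blast+

lemma lanesI:
  assumes "\<And>x y z \<tau>. x < s \<Longrightarrow> y < s \<Longrightarrow> z < s \<Longrightarrow> \<tau> < b * b * b \<Longrightarrow> t + y = \<tau> + x + z + s + 1 \<Longrightarrow> y \<le> row_of b \<tau> \<Longrightarrow>
        \<sigma> (x, y, z) 66 = FA x (row_of b \<tau>) z \<and> \<sigma> (x, y, z) 67 = VA x (row_of b \<tau>) z"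
    and "\<And>x y z \<tau>. x < s \<Longrightarrow> y < s \<Longrightarrow> z < s \<Longrightarrow> \<tau> < b * b * b \<Longrightarrow> t = \<tau> + x + y + z + s + 1 \<Longrightarrow>
        \<sigma> (x, y, z) 68 = FA x (row_of b \<tau>) z \<and> \<sigma> (x, y, z) 69 = VA x (row_of b \<tau>) z"
    and "\<And>x y z \<tau>. x < s \<Longrightarrow> y < s \<Longrightarrow> z < s \<Longrightarrow> \<tau> < b * b * b \<Longrightarrow> t + x = \<tau> + y + z + s + 1 \<Longrightarrow> x \<le> col_of b \<tau> \<Longrightarrow>
        \<sigma> (x, y, z) 70 = FB (col_of b \<tau>) y z \<and> \<sigma> (x, y, z) 71 = VB (col_of b \<tau>) y z"
    and "\<And>x y z \<tau>. x < s \<Longrightarrow> y < s \<Longrightarrow> z < s \<Longrightarrow> \<tau> < b * b * b \<Longrightarrow> t = \<tau> + x + y + z + s + 1 \<Longrightarrow>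
        \<sigma> (x, y, z) 72 = FB (col_of b \<tau>) y z \<and> \<sigma> (x, y, z) 73 = VB (col_of b \<tau>) y z"
    and "\<And>x y z \<tau>. x < s \<Longrightarrow> y < s \<Longrightarrow> z < s \<Longrightarrow> \<tau> < b * b * b \<Longrightarrow> t = \<tau> + x + y + z + s + 1 \<Longrightarrow>
        \<sigma> (x, y, z) 74 \<le> 1 \<and> opt (\<sigma> (x, y, z) 74) (\<sigma> (x, y, z) 75) = line_sum \<tau> x y (Suc z)"
    and "\<And>x y z \<tau>. x < s \<Longrightarrow> y < s \<Longrightarrow> z < s \<Longrightarrow> \<tau> < b * b * b \<Longrightarrow> t + z = \<tau> + x + y + (3 * s - 2) + 1 \<Longrightarrow>
        \<sigma> (x, y, z) 76 \<le> 1 \<and> opt (\<sigma> (x, y, z) 76) (\<sigma> (x, y, z) 77) = line_sum \<tau> x y s"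
    and "\<And>x y z. x < s \<Longrightarrow> y < s \<Longrightarrow> z < s \<Longrightarrow> \<sigma> (x, y, z) 64 \<le> 1 \<and> opt (\<sigma> (x, y, z) 64) (\<sigma> (x, y, z) 65) = (if z < b * b
       then foldl (join f) (acc0 x y z) (map (\<lambda>k. line_sum (k * (b * b) + z) x y s)
         (filter (\<lambda>k. k * (b * b) + (x + y + (3 * s - 2)) < t) [0..<b])) else acc0 x y z)"
  shows "lanes t \<sigma>"
  using assms unfolding lanes_def by simp

lemma paramsD:
  assumes "params \<sigma>" "x < s" "y < s" "z < s"
  shows "\<sigma> (x, y, z) 0 = x" "\<sigma> (x, y, z) 1 = y" "\<sigma> (x, y, z) 2 = z"
     "\<sigma> (x, y, z) 3 = s" "\<sigma> (x, y, z) 116 = b" "\<sigma> (x, y, z) 117 = b * b" "\<sigma> (x, y, z) 118 = b * b * b"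
     "\<sigma> (x, y, z) 78 = x + z + s" "\<sigma> (x, y, z) 79 = y + z + s" "\<sigma> (x, y, z) 81 = x + y + (3 * s - 2)"
     "\<sigma> (x, y, z) 60 = FA x y z" "\<sigma> (x, y, z) 61 = VA x y z"
     "\<sigma> (x, y, z) 62 = FB x y z" "\<sigma> (x, y, z) 63 = VB x y z"
  using assms unfolding params_def by blast+

text \<open>Clock and coordinate enter each clause of \<open>lanes\<close> through an expression
  that a moving word keeps constant. So a clause after the tick comes from the clause of the
  neighbour before it, or from the place where the word is injected or turns around.\<close>

lemma lanes_tick:
  assumes P: "params \<sigma>" and I: "lanes t \<sigma>" and t: "\<And>q. q \<in> mesh s \<Longrightarrow> \<sigma> q 122 = t" "t + s < 2 ^ w"
  defines "\<sigma>' \<equiv> den tick \<sigma>"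
  shows "lanes (Suc t) \<sigma>'" and "\<And>q. q \<in> mesh s \<Longrightarrow> \<sigma>' q 122 = Suc t"
proof -
  define \<sigma>1 where "\<sigma>1 = fold sem select_a \<sigma>"
  define \<sigma>2 where "\<sigma>2 = fold sem move_a \<sigma>1"
  define \<sigma>3 where "\<sigma>3 = fold sem select_b \<sigma>2"
  define \<sigma>4 where "\<sigma>4 = fold sem move_b \<sigma>3"
  define \<sigma>5 where "\<sigma>5 = fold sem multiply_add \<sigma>4"
  define \<sigma>6 where "\<sigma>6 = fold sem return_sum \<sigma>5"
  define \<sigma>7 where "\<sigma>7 = fold sem select_c \<sigma>6"
  have \<sigma>': "\<sigma>' = fold sem accumulate \<sigma>7"
    by (simp only: \<sigma>'_def tick_def den.simps \<sigma>1_def \<sigma>2_def \<sigma>3_def \<sigma>4_def \<sigma>5_def \<sigma>6_def \<sigma>7_def)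
  have fr1: "\<sigma>1 q r = \<sigma> q r" if "r \<notin> {82, 83, 84}" for q r
    unfolding \<sigma>1_def using that by (intro fold_sem_frame) (auto simp: select_a_def)
  have fr2: "\<sigma>2 q r = \<sigma>1 q r" if "r \<notin> {66, 67, 68, 69, 85, 35}" for q r
    unfolding \<sigma>2_def using that by (intro fold_sem_frame) (auto simp: move_a_def shift_def)
  have fr3: "\<sigma>3 q r = \<sigma>2 q r" if "r \<notin> {82, 83, 84}" for q r
    unfolding \<sigma>3_def using that by (intro fold_sem_frame) (auto simp: select_b_def)
  have fr4: "\<sigma>4 q r = \<sigma>3 q r" if "r \<notin> {70, 71, 72, 73, 85, 35}" for q r
    unfolding \<sigma>4_def using that by (intro fold_sem_frame) (auto simp: move_b_def shift_def)
  have fr5: "\<sigma>5 q r = \<sigma>4 q r" if "r \<notin> {74, 75, 86, 87, 88, 89, 35}" for q r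
    unfolding \<sigma>5_def using that by (intro fold_sem_frame) (auto simp: multiply_add_def shift_def)
  have fr6: "\<sigma>6 q r = \<sigma>5 q r" if "r \<notin> {76, 77, 85, 35}" for q r
    unfolding \<sigma>6_def using that by (intro fold_sem_frame) (auto simp: return_sum_def shift_def)
  have fr7: "\<sigma>7 q r = \<sigma>6 q r" if "r \<notin> {82, 83, 84, 85, 86}" for q r
    unfolding \<sigma>7_def using that by (intro fold_sem_frame) (auto simp: select_c_def)
  have fr8: "\<sigma>' q r = \<sigma>7 q r" if "r \<notin> {84, 87, 88, 65, 64, 123, 122}" for q r
    unfolding \<sigma>' using that by (intro fold_sem_frame) (auto simp: accumulate_def)
  note fr = fr1 fr2 fr3 fr4 fr5 fr6 fr7 fr8
  have tq: "\<sigma> (x, y, z) 122 = t" if "x < s" "y < s" "z < s" for x y z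
    using t(1)[of "(x, y, z)"] that by (simp add: mesh_def)
  note Pd = paramsD[OF P]
  have bs: "row_of b \<tau> < s" "col_of b \<tau> < s" if "\<tau> < b * b * b" for \<tau>
    using row_of_less[OF that] col_of_less[OF that] b(2) by linarith+
  have al: "\<sigma>2 (x, y, z) 66 = FA x (row_of b \<tau>) z \<and> \<sigma>2 (x, y, z) 67 = VA x (row_of b \<tau>) z"
    if xyz: "x < s" "y < s" "z < s" and \<tau>: "\<tau> < b * b * b" and e: "t + y = \<tau> + x + z + s" "y \<le> row_of b \<tau>"
    for x y z \<tau>
  proof -
    have "\<sigma> (x, y, z) 122 + y < 2 ^ w" using tq[OF xyz] t(2) xyz(2) by simp
    then have sel: "\<sigma>1 (x, y, z) 83 = of_bool (row_of b \<tau> = y)"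
      unfolding \<sigma>1_def row_of_def using e(1) tq[OF xyz] Pd[OF xyz] \<tau> b(2)
      by (intro den_select_a) simp_all
    \<comment> \<open>The owner injects its entry, and a cell below it passes on what comes from
      \<open>y + 1\<close>. A cell in between cannot inject by mistake, since it computes the same
      index \<open>\<tau>\<close>.\<close>
    show ?thesis
    proof (cases "row_of b \<tau> = y")
      case True
      then show ?thesis
        using den_move_a(1,2)[of \<sigma>1 x y z] sel Pd[OF xyz] by (simp add: \<sigma>2_def[symmetric] fr)
    next
      case False
      then have y: "y + 1 \<le> row_of b \<tau>" "y + 1 < s" using e(2) bs[OF \<tau>] by simp_all
      have "t + (y + 1) = \<tau> + x + z + s + 1" using e(1) by simp
      then have "\<sigma> (x, y + 1, z) 66 = FA x (row_of b \<tau>) z \<and> \<sigma> (x, y + 1, z) 67 = VA x (row_of b \<tau>) z"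
        by (rule lanesD(1)[OF I xyz(1) y(2) xyz(3) \<tau> _ y(1)])
      then show ?thesis
        using den_move_a(1,2)[of \<sigma>1 x y z] sel Pd[OF xyz] False y(2) by (simp add: \<sigma>2_def[symmetric] fr)
    qed
  qed
  have ar: "\<sigma>2 (x, y, z) 68 = FA x (row_of b \<tau>) z \<and> \<sigma>2 (x, y, z) 69 = VA x (row_of b \<tau>) z"
    if xyz: "x < s" "y < s" "z < s" and \<tau>: "\<tau> < b * b * b" and e: "t = \<tau> + x + y + z + s" for x y z \<tau>
  proof (cases "y = 0")
    case True
    have "\<sigma>2 (x, y, z) 66 = FA x (row_of b \<tau>) z \<and> \<sigma>2 (x, y, z) 67 = VA x (row_of b \<tau>) z"
      using e True by (intro al[OF xyz \<tau>]) simp_all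
    then show ?thesis
      using den_move_a(3,4)[of \<sigma>1 x y z] Pd[OF xyz] True by (simp add: \<sigma>2_def[symmetric] fr)
  next
    case False
    have "\<sigma> (x, y - 1, z) 68 = FA x (row_of b \<tau>) z \<and> \<sigma> (x, y - 1, z) 69 = VA x (row_of b \<tau>) z"
      using e False xyz by (intro lanesD(2)[OF I _ _ _ \<tau>]) simp_all
    then show ?thesis
      using den_move_a(3,4)[of \<sigma>1 x y z] Pd[OF xyz] False by (simp add: \<sigma>2_def[symmetric] fr)
  qed
  have bl: "\<sigma>4 (x, y, z) 70 = FB (col_of b \<tau>) y z \<and> \<sigma>4 (x, y, z) 71 = VB (col_of b \<tau>) y z"
    if xyz: "x < s" "y < s" "z < s" and \<tau>: "\<tau> < b * b * b" and e: "t + x = \<tau> + y + z + s" "x \<le> col_of b \<tau>"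
    for x y z \<tau>
  proof -
    have "\<sigma>2 (x, y, z) 122 + x < 2 ^ w" using tq[OF xyz] t(2) xyz(1) by (simp add: fr)
    then have sel: "\<sigma>3 (x, y, z) 83 = of_bool (col_of b \<tau> = x)"
      unfolding \<sigma>3_def col_of_def using e(1) tq[OF xyz] Pd[OF xyz] \<tau> b(2)
      by (intro den_select_b) (simp_all add: fr)
    show ?thesis
    proof (cases "col_of b \<tau> = x")
      case True
      then show ?thesis
        using den_move_b(1,2)[of \<sigma>3 x y z] sel Pd[OF xyz] by (simp add: \<sigma>4_def[symmetric] fr)
    next
      case False
      then have x: "x + 1 \<le> col_of b \<tau>" "x + 1 < s" using e(2) bs[OF \<tau>] by simp_all
      have "t + (x + 1) = \<tau> + y + z + s + 1" using e(1) by simp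
      then have "\<sigma> (x + 1, y, z) 70 = FB (col_of b \<tau>) y z \<and> \<sigma> (x + 1, y, z) 71 = VB (col_of b \<tau>) y z"
        by (rule lanesD(3)[OF I x(2) xyz(2) xyz(3) \<tau> _ x(1)])
      then show ?thesis
        using den_move_b(1,2)[of \<sigma>3 x y z] sel Pd[OF xyz] False x(2) by (simp add: \<sigma>4_def[symmetric] fr)
    qed
  qed
  have br: "\<sigma>4 (x, y, z) 72 = FB (col_of b \<tau>) y z \<and> \<sigma>4 (x, y, z) 73 = VB (col_of b \<tau>) y z"
    if xyz: "x < s" "y < s" "z < s" and \<tau>: "\<tau> < b * b * b" and e: "t = \<tau> + x + y + z + s" for x y z \<tau>
  proof (cases "x = 0")
    case True
    have "\<sigma>4 (x, y, z) 70 = FB (col_of b \<tau>) y z \<and> \<sigma>4 (x, y, z) 71 = VB (col_of b \<tau>) y z"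
      using e True by (intro bl[OF xyz \<tau>]) simp_all
    then show ?thesis
      using den_move_b(3,4)[of \<sigma>3 x y z] Pd[OF xyz] True by (simp add: \<sigma>4_def[symmetric] fr)
  next
    case False
    have "\<sigma> (x - 1, y, z) 72 = FB (col_of b \<tau>) y z \<and> \<sigma> (x - 1, y, z) 73 = VB (col_of b \<tau>) y z"
      using e False xyz by (intro lanesD(4)[OF I _ _ _ \<tau>]) simp_all
    then show ?thesis
      using den_move_b(3,4)[of \<sigma>3 x y z] Pd[OF xyz] False by (simp add: \<sigma>4_def[symmetric] fr)
  qed
  have su: "\<sigma>5 (x, y, z) 74 \<le> 1 \<and> opt (\<sigma>5 (x, y, z) 74) (\<sigma>5 (x, y, z) 75) = line_sum \<tau> x y (Suc z)"
    if xyz: "x < s" "y < s" "z < s" and \<tau>: "\<tau> < b * b * b" and e: "t = \<tau> + x + y + z + s" for x y z \<tau>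
  proof -
    have A: "\<sigma>4 (x, y, z) 68 = FA x (row_of b \<tau>) z" "\<sigma>4 (x, y, z) 69 = VA x (row_of b \<tau>) z"
      using ar[OF xyz \<tau> e] by (simp_all add: fr)
    have B: "\<sigma>4 (x, y, z) 72 = FB (col_of b \<tau>) y z" "\<sigma>4 (x, y, z) 73 = VB (col_of b \<tau>) y z"
      using br[OF xyz \<tau> e] by simp_all
    have prev: "\<sigma>4 (x, y, z - 1) 74 \<le> 1 \<and> opt (\<sigma>4 (x, y, z - 1) 74) (\<sigma>4 (x, y, z - 1) 75) = line_sum \<tau> x y z"
      if "z \<noteq> 0"
    proof -
      have "\<sigma> (x, y, z - 1) 74 \<le> 1 \<and> opt (\<sigma> (x, y, z - 1) 74) (\<sigma> (x, y, z - 1) 75) = line_sum \<tau> x y (Suc (z - 1))"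
        using e that xyz by (intro lanesD(5)[OF I _ _ _ \<tau>]) simp_all
      then show ?thesis using that by (simp add: fr)
    qed
    have "FA x (row_of b \<tau>) z \<le> 1" "FB (col_of b \<tau>) y z \<le> 1"
      using FA1 FB1 xyz bs[OF \<tau>] by auto
    note M = den_multiply_add[of \<sigma>4 x y z, folded \<sigma>5_def, unfolded A B, OF this conjunct1[OF prev]]
    have "line_sum \<tau> x y (Suc z) = join f (line_sum \<tau> x y z) (product \<tau> x y z)"
      by (simp add: line_sum_def)
    moreover have "line_sum \<tau> x y 0 = None" by (simp add: line_sum_def)
    ultimately show ?thesis using M prev by (cases "z = 0") (simp_all add: product_def)
  qed
  have re: "\<sigma>6 (x, y, z) 76 \<le> 1 \<and> opt (\<sigma>6 (x, y, z) 76) (\<sigma>6 (x, y, z) 77) = line_sum \<tau> x y s"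
    if xyz: "x < s" "y < s" "z < s" and \<tau>: "\<tau> < b * b * b" and e: "t + z = \<tau> + x + y + (3 * s - 2)" for x y z \<tau>
  proof -
    have c: "\<sigma>5 (x, y, z) 2 = z" "\<sigma>5 (x, y, z) 3 = s" using Pd[OF xyz] by (simp_all add: fr)
    note R = den_return_sum[of \<sigma>5 x y z, OF c xyz(3), folded \<sigma>6_def]
    show ?thesis
    proof (cases "z + 1 < s")
      case True
      have "\<sigma> (x, y, z + 1) 76 \<le> 1 \<and> opt (\<sigma> (x, y, z + 1) 76) (\<sigma> (x, y, z + 1) 77) = line_sum \<tau> x y s"
        using e True xyz by (intro lanesD(6)[OF I _ _ _ \<tau>]) simp_all
      then show ?thesis using R True by (simp add: fr)
    next
      case False
      then have z: "Suc z = s" using xyz(3) by simp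
      have "t = \<tau> + x + y + z + s" using e z by simp
      from su[OF xyz \<tau> this] show ?thesis using R z by simp
    qed
  qed
  have ac: "\<sigma>' (x, y, z) 64 \<le> 1 \<and> opt (\<sigma>' (x, y, z) 64) (\<sigma>' (x, y, z) 65) = (if z < b * b
       then foldl (join f) (acc0 x y z) (map (\<lambda>k. line_sum (k * (b * b) + z) x y s)
         (filter (\<lambda>k. k * (b * b) + (x + y + (3 * s - 2)) < Suc t) [0..<b])) else acc0 x y z)"
    if xyz: "x < s" "y < s" "z < s" for x y z
  proof -
    let ?off = "x + y + (3 * s - 2)"
    let ?\<tau> = "t + z - ?off"
    let ?sel = "?off \<le> t + z \<and> ?\<tau> < b * b * b \<and> ?\<tau> mod (b * b) = z"
    have c: "\<sigma>6 (x, y, z) 122 = t" "\<sigma>6 (x, y, z) 2 = z" "\<sigma>6 (x, y, z) 117 = b * b"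
      "\<sigma>6 (x, y, z) 118 = b * b * b" "\<sigma>6 (x, y, z) 81 = ?off"
      using Pd[OF xyz] tq[OF xyz] by (simp_all add: fr)
    have "t + z < 2 ^ w" using t(2) xyz(3) by simp
    then have sel: "\<sigma>7 (x, y, z) 84 = of_bool ?sel"
      using den_select_c[of \<sigma>6 x y z "b * b" "b * b * b"] c by (simp add: \<sigma>7_def)
    have D: "\<sigma>7 (x, y, z) 76 \<le> 1 \<and> opt (\<sigma>7 (x, y, z) 76) (\<sigma>7 (x, y, z) 77) = line_sum ?\<tau> x y s" if ?sel
      using re[OF xyz, of ?\<tau>] that by (simp add: fr7)
    have old: "\<sigma>7 (x, y, z) 64 = \<sigma> (x, y, z) 64" "\<sigma>7 (x, y, z) 65 = \<sigma> (x, y, z) 65"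
      by (simp_all add: fr1 fr2 fr3 fr4 fr5 fr6 fr7)
    note J = lanesD(7)[OF I xyz]
    have A: "\<sigma>' (x, y, z) 64 \<le> 1"
      "opt (\<sigma>' (x, y, z) 64) (\<sigma>' (x, y, z) 65) =
      (if ?sel then join f (opt (\<sigma> (x, y, z) 64) (\<sigma> (x, y, z) 65)) (line_sum ?\<tau> x y s)
       else opt (\<sigma> (x, y, z) 64) (\<sigma> (x, y, z) 65))"
    proof -
      define P where "P \<longleftrightarrow> ?sel"
      have p: "\<sigma>7 (x, y, z) 84 = of_bool P" using sel by (simp only: P_def)
      have d: "\<sigma>7 (x, y, z) 76 \<le> 1" "opt (\<sigma>7 (x, y, z) 76) (\<sigma>7 (x, y, z) 77) = line_sum ?\<tau> x y s" if P
        using D that unfolding P_def by blast+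
      have "\<sigma>7 (x, y, z) 84 \<le> 1" "\<sigma>7 (x, y, z) 84 \<noteq> 0 \<Longrightarrow> \<sigma>7 (x, y, z) 76 \<le> 1" "\<sigma>7 (x, y, z) 64 \<le> 1"
        using p d(1) J unfolding old(1) by (cases P; simp)+
      note A = den_accumulate(1,2)[of \<sigma>7 x y z, OF this, folded \<sigma>', unfolded p old]
      show "\<sigma>' (x, y, z) 64 \<le> 1" by (rule A(1))
      show "opt (\<sigma>' (x, y, z) 64) (\<sigma>' (x, y, z) 65) =
        (if ?sel then join f (opt (\<sigma> (x, y, z) 64) (\<sigma> (x, y, z) 65)) (line_sum ?\<tau> x y s)
         else opt (\<sigma> (x, y, z) 64) (\<sigma> (x, y, z) 65))"
        using A(2) d(2) unfolding P_def[symmetric] by (cases P) simp_all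
    qed
    show ?thesis
    proof (cases "z < b * b")
      case True
      \<comment> \<open>\<open>?sel\<close> holds exactly at the ticks at which some
        \<open>k\<close> is due at this height, and that \<open>k\<close> is
        \<open>?\<tau> div (b * b)\<close>.\<close>
      have step: "filter (\<lambda>k. k * (b * b) + ?off < Suc t) [0..<b] = filter (\<lambda>k. k * (b * b) + ?off < t) [0..<b] @
          (if ?sel then [?\<tau> div (b * b)] else [])"
      proof -
        have "(\<exists>k<b. k * (b * b) + ?off = t) \<longleftrightarrow> ?sel"
        proof
          assume "\<exists>k<b. k * (b * b) + ?off = t"
          then obtain k where k: "k < b" "k * (b * b) + ?off = t" by auto
          then have "?\<tau> = k * (b * b) + z" by simp
          moreover have "k * (b * b) + z < b * (b * b)" using k(1) True by (rule lt_mult_add)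
          ultimately show ?sel using k(2) True by (simp add: mult.assoc)
        next
          assume sel: ?sel
          then have "?\<tau> div (b * b) < b" by (simp add: less_mult_imp_div_less ac_simps)
          moreover have "?\<tau> div (b * b) * (b * b) + z = ?\<tau>" using sel by (metis div_mult_mod_eq)
          ultimately show "\<exists>k<b. k * (b * b) + ?off = t" using sel
            by (intro exI[of _ "?\<tau> div (b * b)"]) linarith
        qed
        moreover have "(t - ?off) div (b * b) = ?\<tau> div (b * b)" if ex: "\<exists>k<b. k * (b * b) + ?off = t"
        proof -
          obtain k where k: "k * (b * b) + ?off = t" using ex by auto
          then have "t - ?off = k * (b * b)" "?\<tau> = k * (b * b) + z" by simp_all
          then show ?thesis using True by simp
        qed
        ultimately show ?thesis using filter_upt_step[of "b * b" ?off t b] b(1) by simp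
      qed
      have "?\<tau> div (b * b) * (b * b) + z = ?\<tau>" if ?sel using that by (metis div_mult_mod_eq)
      then show ?thesis using A J True unfolding step by auto
    next
      case False
      have "?\<tau> mod (b * b) < b * b" using b(1) by simp
      then have ns: "\<not> ?sel" using False by linarith
      show ?thesis using A(1) A(2)[unfolded if_not_P[OF ns]] J False by simp
    qed
  qed
  show "lanes (Suc t) \<sigma>'"
  proof (rule lanesI)
    fix x y z \<tau>
    assume xyz: "x < s" "y < s" "z < s" and \<tau>: "\<tau> < b * b * b"
    show "\<sigma>' (x, y, z) 66 = FA x (row_of b \<tau>) z \<and> \<sigma>' (x, y, z) 67 = VA x (row_of b \<tau>) z"
      if "Suc t + y = \<tau> + x + z + s + 1" "y \<le> row_of b \<tau>"
      using al[OF xyz \<tau> _ that(2)] that(1) by (simp add: fr3 fr4 fr5 fr6 fr7 fr8)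
    show "\<sigma>' (x, y, z) 70 = FB (col_of b \<tau>) y z \<and> \<sigma>' (x, y, z) 71 = VB (col_of b \<tau>) y z"
      if "Suc t + x = \<tau> + y + z + s + 1" "x \<le> col_of b \<tau>"
      using bl[OF xyz \<tau> _ that(2)] that(1) by (simp add: fr5 fr6 fr7 fr8)
    show "\<sigma>' (x, y, z) 76 \<le> 1 \<and> opt (\<sigma>' (x, y, z) 76) (\<sigma>' (x, y, z) 77) = line_sum \<tau> x y s"
      if "Suc t + z = \<tau> + x + y + (3 * s - 2) + 1"
      using re[OF xyz \<tau>] that by (simp add: fr7 fr8)
    assume e: "Suc t = \<tau> + x + y + z + s + 1"
    then have e': "t = \<tau> + x + y + z + s" by simp
    show "\<sigma>' (x, y, z) 68 = FA x (row_of b \<tau>) z \<and> \<sigma>' (x, y, z) 69 = VA x (row_of b \<tau>) z"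
      using ar[OF xyz \<tau> e'] by (simp add: fr3 fr4 fr5 fr6 fr7 fr8)
    show "\<sigma>' (x, y, z) 72 = FB (col_of b \<tau>) y z \<and> \<sigma>' (x, y, z) 73 = VB (col_of b \<tau>) y z"
      using br[OF xyz \<tau> e'] by (simp add: fr5 fr6 fr7 fr8)
    show "\<sigma>' (x, y, z) 74 \<le> 1 \<and> opt (\<sigma>' (x, y, z) 74) (\<sigma>' (x, y, z) 75) = line_sum \<tau> x y (Suc z)"
      using su[OF xyz \<tau> e'] by (simp add: fr6 fr7 fr8)
  qed (use ac in blast)
  show "\<sigma>' q 122 = Suc t" if q: "q \<in> mesh s" for q
  proof -
    obtain x y z where q': "q = (x, y, z)" by (cases q)
    then have xyz: "x < s" "y < s" "z < s" using q by (auto simp: mesh_def)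
    have "\<sigma>7 (x, y, z) 122 = t" using tq[OF xyz] by (simp add: fr1 fr2 fr3 fr4 fr5 fr6 fr7)
    moreover have "t + 1 < 2 ^ w" using t(2) two_le_s by simp
    moreover have "\<sigma>' (x, y, z) 122 = (\<sigma>7 (x, y, z) 122 + 1) mod 2 ^ w"
      unfolding \<sigma>' by (simp add: accumulate_def sem_apply mod_simps)
    ultimately show ?thesis using q' by simp
  qed
qed

end

text \<open>The last sum is stored at tick \<open>(b - 1) * (b * b) + x + y + (3 * s - 2)\<close>,
  which is less than \<open>b * b * b + 5 * s\<close>, the number of ticks put into register
  124.\<close>

definition start_ticks :: "instr list" where
  "start_ticks = [Arith Add 78 0 2, Arith Add 78 78 3, Arith Add 79 1 2, Arith Add 79 79 3, Const 85 3,
     Arith Mul 81 85 3, Const 85 2, Arith Sub 81 81 85, Arith Add 80 0 1, Arith Add 81 80 81,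
     Const 122 0, Const 125 5, Arith Mul 125 125 3, Arith Add 124 118 125]"

definition multiply :: cmd where
  "multiply = Block start_ticks ;; Loop 124 tick"

lemma writes_tick: "set (writes tick) \<subseteq> {35} \<union> {64..77} \<union> {82..89} \<union> {122, 123}"
  by (simp add: tick_def tick_defs shift_def)

lemma writes_multiply:
  "set (writes multiply) \<subseteq> {35} \<union> {64..89} \<union> {100, 101, 122, 123, 124, 125}"
  using writes_tick unfolding multiply_def start_ticks_def by auto

lemma (in machine) time_tick: "time tick \<sigma> = 93"
  by (simp add: tick_def tick_defs shift_def)

context multiplication
begin

lemma params_tick:
  assumes "params \<sigma>"
  shows "params (dec 124 (den tick \<sigma>))"
proof -
  have "dec 124 (den tick \<sigma>) q r = \<sigma> q r"
    if "r \<in> {0, 1, 2, 3, 116, 117, 118, 78, 79, 81, 60, 61, 62, 63}" for q r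
  proof -
    have "dec 124 (den tick \<sigma>) q r = den tick \<sigma> q r" using that by (intro dec_frame) auto
    also have "\<dots> = \<sigma> q r" by (rule den_frame_subset[OF writes_tick]) (use that in auto)
    finally show ?thesis .
  qed
  then show ?thesis using assms by (simp add: params_def)
qed

lemma lanes_dec: "lanes t \<sigma> \<Longrightarrow> lanes t (dec 124 \<sigma>)"
proof -
  have "dec 124 \<sigma> q r = \<sigma> q r" if "r \<in> {64..77}" for q r
    using that by (intro dec_frame) auto
  then show "lanes t \<sigma> \<Longrightarrow> lanes t (dec 124 \<sigma>)" by (simp add: lanes_def)
qed

text \<open>Before the first tick all clauses about moving words are vacuous, because the delays
  \<open>s\<close> and \<open>3 * s - 2\<close> exceed every single coordinate. So nothing is
  required of the initial contents of the lanes.\<close>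

lemma lanes_0:
  assumes "\<And>x y z. x < s \<Longrightarrow> y < s \<Longrightarrow> z < s \<Longrightarrow>
    \<sigma> (x, y, z) 64 \<le> 1 \<and> opt (\<sigma> (x, y, z) 64) (\<sigma> (x, y, z) 65) = acc0 x y z"
  shows "lanes 0 \<sigma>"
  by (rule lanesI) (use assms in auto)

lemma den_Loop_tick:
  assumes P: "params \<sigma>" and T: "\<sigma> (0, 0, 0) 124 = b * b * b + 5 * s"
    and t0: "\<And>q. q \<in> mesh s \<Longrightarrow> \<sigma> q 122 = 0" and bound: "b * b * b + 6 * s < 2 ^ w"
    and acc: "\<And>x y z. x < s \<Longrightarrow> y < s \<Longrightarrow> z < s \<Longrightarrow>
      \<sigma> (x, y, z) 64 \<le> 1 \<and> opt (\<sigma> (x, y, z) 64) (\<sigma> (x, y, z) 65) = acc0 x y z"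
    and xyz: "x < s" "y < s" "z < s"
  defines "\<sigma>' \<equiv> den (Loop 124 tick) \<sigma>"
  shows "\<sigma>' (x, y, z) 64 \<le> 1"
    and "opt (\<sigma>' (x, y, z) 64) (\<sigma>' (x, y, z) 65) = (if z < b * b
       then foldl (join f) (acc0 x y z) (map (\<lambda>k. line_sum (k * (b * b) + z) x y s) [0..<b])
       else acc0 x y z)"
proof -
  let ?T = "b * b * b + 5 * s"
  let ?I = "\<lambda>t \<tau>. params \<tau> \<and> lanes t \<tau> \<and> (\<forall>q\<in>mesh s. \<tau> q 122 = t)"
  have I: "?I ?T \<sigma>'"
    unfolding \<sigma>'_def
  proof (rule den_Loop[where I = ?I])
    show "?I 0 \<sigma>" using P t0 lanes_0[OF acc] by simp
  next
    fix t \<tau> assume t: "t < ?T" and I: "?I t \<tau>"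
    have tw: "t + s < 2 ^ w" using t bound by simp
    have P': "params \<tau>" "lanes t \<tau>" "\<And>q. q \<in> mesh s \<Longrightarrow> \<tau> q 122 = t" using I by auto
    have "\<forall>q\<in>mesh s. dec 124 (den tick \<tau>) q 122 = Suc t"
      using lanes_tick(2)[OF P' tw] by (simp add: dec_frame)
    then show "?I (Suc t) (dec 124 (den tick \<tau>))"
      using params_tick[OF P'(1)] lanes_dec[OF lanes_tick(1)[OF P' tw]] by blast
  qed (fact T)
  have "k * (b * b) + (x + y + (3 * s - 2)) < ?T" if "k < b" for k
  proof -
    have "k * (b * b) + b * b \<le> b * (b * b)" using that mult_le_mono1[of "Suc k" b "b * b"] by simp
    moreover have "0 < b * b" using b by simp
    ultimately show ?thesis using xyz by (simp add: mult.assoc)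
  qed
  then have "filter (\<lambda>k. k * (b * b) + (x + y + (3 * s - 2)) < ?T) [0..<b] = [0..<b]"
    by (intro filter_True) auto
  then show "\<sigma>' (x, y, z) 64 \<le> 1"
    "opt (\<sigma>' (x, y, z) 64) (\<sigma>' (x, y, z) 65) = (if z < b * b
       then foldl (join f) (acc0 x y z) (map (\<lambda>k. line_sum (k * (b * b) + z) x y s) [0..<b])
       else acc0 x y z)"
    using lanesD(7)[OF _ xyz, of ?T \<sigma>'] I by simp_all
qed

lemma den_multiply:
  assumes bound: "b * b * b + 6 * s < 2 ^ w"
    and P: "\<And>x y z. x < s \<Longrightarrow> y < s \<Longrightarrow> z < s \<Longrightarrow> \<sigma> (x, y, z) 0 = x \<and> \<sigma> (x, y, z) 1 = y \<and> \<sigma> (x, y, z) 2 = z \<and>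
     \<sigma> (x, y, z) 3 = s \<and> \<sigma> (x, y, z) 116 = b \<and> \<sigma> (x, y, z) 117 = b * b \<and> \<sigma> (x, y, z) 118 = b * b * b \<and>
     \<sigma> (x, y, z) 60 = FA x y z \<and> \<sigma> (x, y, z) 61 = VA x y z \<and>
     \<sigma> (x, y, z) 62 = FB x y z \<and> \<sigma> (x, y, z) 63 = VB x y z"
    and acc: "\<And>x y z. x < s \<Longrightarrow> y < s \<Longrightarrow> z < s \<Longrightarrow>
      \<sigma> (x, y, z) 64 \<le> 1 \<and> opt (\<sigma> (x, y, z) 64) (\<sigma> (x, y, z) 65) = acc0 x y z"
    and xyz: "x < s" "y < s" "z < s"
  defines "\<sigma>' \<equiv> den multiply \<sigma>"
  shows "\<sigma>' (x, y, z) 64 \<le> 1"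
    and "opt (\<sigma>' (x, y, z) 64) (\<sigma>' (x, y, z) 65) = (if z < b * b
       then foldl (join f) (acc0 x y z) (map (\<lambda>k. line_sum (k * (b * b) + z) x y s) [0..<b])
       else acc0 x y z)"
    and "time multiply \<sigma> \<le> (b * b * b + 5 * s) * 98 + 15"
proof -
  define \<sigma>1 where "\<sigma>1 = fold sem start_ticks \<sigma>"
  have \<sigma>': "\<sigma>' = den (Loop 124 tick) \<sigma>1" by (simp add: \<sigma>'_def multiply_def \<sigma>1_def)
  have six: "6 * s < 2 ^ w" using bound by simp
  have v: "\<sigma>1 (x, y, z) 78 = x + z + s \<and> \<sigma>1 (x, y, z) 79 = y + z + s \<and> \<sigma>1 (x, y, z) 81 = x + y + (3 * s - 2) \<and>
      \<sigma>1 (x, y, z) 122 = 0 \<and> \<sigma>1 (x, y, z) 124 = b * b * b + 5 * s"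
    if xyz: "x < s" "y < s" "z < s" for x y z
  proof -
    have "(x + z + s) mod 2 ^ w = x + z + s" "(y + z + s) mod 2 ^ w = y + z + s"
      "(x + y + (3 * s - 2)) mod 2 ^ w = x + y + (3 * s - 2)" "3 * s mod 2 ^ w = 3 * s" "3 mod 2 ^ w = (3::nat)"
      "2 mod 2 ^ w = (2::nat)" "(3 * s - 2) mod 2 ^ w = 3 * s - 2" "5 mod 2 ^ w = (5::nat)" "5 * s mod 2 ^ w = 5 * s"
      "(b * b * b + 5 * s) mod 2 ^ w = b * b * b + 5 * s" "(x + z) mod 2 ^ w = x + z" "(y + z) mod 2 ^ w = y + z"
      "(x + y) mod 2 ^ w = x + y" "(0::nat) mod 2 ^ w = 0"
      using xyz six bound two_le_s by (intro mod_less; linarith)+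
    note m = this
    have p: "\<sigma> (x, y, z) 0 = x" "\<sigma> (x, y, z) 1 = y" "\<sigma> (x, y, z) 2 = z" "\<sigma> (x, y, z) 3 = s" "\<sigma> (x, y, z) 118 = b * b * b"
      using P[OF xyz] by auto
    show ?thesis
      unfolding \<sigma>1_def by (simp only: start_ticks_def block_simps p m cong: if_weak_cong)
  qed
  have fr: "\<sigma>1 q r = \<sigma> q r" if "r \<in> {0, 1, 2, 3, 116, 117, 118, 60, 61, 62, 63, 64, 65}" for q r
    unfolding \<sigma>1_def using that by (intro fold_sem_frame) (auto simp: start_ticks_def)
  have P1: "params \<sigma>1" unfolding params_def using P v by (simp add: fr)
  have T: "\<sigma>1 (0, 0, 0) 124 = b * b * b + 5 * s" using v s_pos by simp
  have t0: "\<sigma>1 q 122 = 0" if "q \<in> mesh s" for q using v that by (cases q) (auto simp: mesh_def)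
  have acc1: "\<sigma>1 (x, y, z) 64 \<le> 1 \<and> opt (\<sigma>1 (x, y, z) 64) (\<sigma>1 (x, y, z) 65) = acc0 x y z"
    if "x < s" "y < s" "z < s" for x y z using acc[OF that] by (simp add: fr)
  show "\<sigma>' (x, y, z) 64 \<le> 1"
    "opt (\<sigma>' (x, y, z) 64) (\<sigma>' (x, y, z) 65) = (if z < b * b
       then foldl (join f) (acc0 x y z) (map (\<lambda>k. line_sum (k * (b * b) + z) x y s) [0..<b])
       else acc0 x y z)"
    using den_Loop_tick[OF P1 T t0 bound acc1 xyz] unfolding \<sigma>' by blast+
  have "time (Loop 124 tick) \<sigma>1 \<le> (b * b * b + 5 * s) * (93 + 5) + 1"
    by (rule time_Loop_const) (use T time_tick in simp_all)
  then show "time multiply \<sigma> \<le> (b * b * b + 5 * s) * 98 + 15"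
    by (simp add: multiply_def \<sigma>1_def start_ticks_def)
qed

end

text \<open>Structured programs have no conditional, so both loops run for a fixed number of rounds
  and add results of comparisons. The first counts up to \<open>corner_side n\<close>, which is at
  most \<open>s\<close>; the second counts the halvings of \<open>s * s * s\<close> until it
  vanishes, where \<open>4 * s\<close> rounds suffice because
  \<open>s * s * s < 2 ^ (4 * s)\<close>.\<close>

definition prelude :: cmd where
  "prelude =
     Block [Const 126 1, Arith Add 127 4 3, Arith Sub 127 127 126, Arith Div 127 127 3,
       Arith Add 127 127 126, Const 128 2, Arith Div 116 127 128, Arith Mul 117 116 116,
       Arith Mul 118 117 116, Const 115 0, Arith Mul 129 4 4, Move 130 3] ;;
     Loop 130 (Block [Arith Mul 131 115 115, Arith Mul 131 131 115, Arith Less 131 131 129,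
       Arith Add 115 115 131]) ;;
     Block [Const 114 0, Arith Mul 132 3 3, Arith Mul 132 132 3, Const 133 4, Arith Mul 134 133 3] ;;
     Loop 134 (Block [Const 135 0, Arith Less 135 135 132, Arith Add 114 114 135, Arith Div 132 132 128])"

text \<open>Half of the number of rows per processor, so that a tile of \<open>tile_side n s\<close> squared
  entries per line fits into the line even if \<open>n ^ 2 = s ^ 3\<close>.\<close>

definition tile_side :: "nat \<Rightarrow> nat \<Rightarrow> nat" where
  "tile_side n s = ((n + s - 1) div s + 1) div 2"

lemma writes_prelude: "set (writes prelude) \<subseteq> {100, 101} \<union> {114..118} \<union> {126..135}"
  by (simp add: prelude_def)

context word_machine
begin

lemma den_prelude:
  assumes n: "2 \<le> n" "n ^ 2 \<le> s ^ 3"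
    and P: "\<And>q. q \<in> mesh s \<Longrightarrow> \<sigma> q 3 = s \<and> \<sigma> q 4 = n"
    and bound: "tile_side n s * tile_side n s * tile_side n s + 6 * s < 2 ^ w" and ns: "n + s < 2 ^ w"
  defines "\<sigma>' \<equiv> den prelude \<sigma>" and "b \<equiv> tile_side n s"
  obtains L where "0 < L" "\<And>t. t < L \<Longrightarrow> (2::nat) ^ t < 2 ^ w" "s * s * s \<le> 2 ^ L" "2 ^ (L - 1) \<le> s * s * s"
    "\<And>q. q \<in> mesh s \<Longrightarrow> \<sigma>' q 114 = L \<and> \<sigma>' q 115 = corner_side n \<and> \<sigma>' q 116 = b \<and>
      \<sigma>' q 117 = b * b \<and> \<sigma>' q 118 = b * b * b"
    "time prelude \<sigma> \<le> 45 * s + 19"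
proof -
  let ?b1 = "[Const 126 1, Arith Add 127 4 3, Arith Sub 127 127 126, Arith Div 127 127 3,
       Arith Add 127 127 126, Const 128 2, Arith Div 116 127 128, Arith Mul 117 116 116,
       Arith Mul 118 117 116, Const 115 0, Arith Mul 129 4 4, Move 130 3]"
  let ?c1 = "Block [Arith Mul 131 115 115, Arith Mul 131 131 115, Arith Less 131 131 129, Arith Add 115 115 131]"
  let ?b2 = "[Const 114 0, Arith Mul 132 3 3, Arith Mul 132 132 3, Const 133 4, Arith Mul 134 133 3]"
  let ?c2 = "Block [Const 135 0, Arith Less 135 135 132, Arith Add 114 114 135, Arith Div 132 132 128]"
  define \<sigma>1 where "\<sigma>1 = fold sem ?b1 \<sigma>"
  define \<sigma>2 where "\<sigma>2 = den (Loop 130 ?c1) \<sigma>1"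
  define \<sigma>3 where "\<sigma>3 = fold sem ?b2 \<sigma>2"
  have \<sigma>': "\<sigma>' = den (Loop 134 ?c2) \<sigma>3"
    by (simp only: \<sigma>'_def prelude_def den.simps(1,2) \<sigma>1_def \<sigma>2_def \<sigma>3_def)
  have six: "6 * s < 2 ^ w" using bound by simp
  have nn: "n * n < 2 ^ w" using n(2) size by (simp add: power2_eq_square power3_eq_cube)
  have bb: "b * b * b < 2 ^ w" using bound by (simp add: b_def)
  have bb2: "b * b < 2 ^ w"
  proof -
    have "b * b \<le> b * b * b" by (cases b) auto
    then show ?thesis using bb by linarith
  qed
  have s0: "0 < s" by (rule s_pos)
  have v1: "\<sigma>1 q 116 = b" "\<sigma>1 q 117 = b * b" "\<sigma>1 q 118 = b * b * b" "\<sigma>1 q 115 = 0" "\<sigma>1 q 129 = n * n"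
    "\<sigma>1 q 130 = s" "\<sigma>1 q 128 = 2" if q: "q \<in> mesh s" for q
  proof -
    have d: "(n + s - 1) div s \<le> n + s - 1" "((n + s - 1) div s + 1) div 2 \<le> (n + s - 1) div s + 1"
      by (rule div_le_dividend)+
    have "(1::nat) mod 2 ^ w = 1" "(2::nat) mod 2 ^ w = 2" "(n + s) mod 2 ^ w = n + s"
      "(n + s - 1) mod 2 ^ w = n + s - 1" "(n + s - 1) div s mod 2 ^ w = (n + s - 1) div s"
      "((n + s - 1) div s + 1) mod 2 ^ w = (n + s - 1) div s + 1"
      "((n + s - 1) div s + 1) div 2 mod 2 ^ w = ((n + s - 1) div s + 1) div 2" "(0::nat) mod 2 ^ w = 0"
      "n * n mod 2 ^ w = n * n"
      using d ns n(1) s0 nn by (intro mod_less; linarith)+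
    note m = this
    have "b mod 2 ^ w = b" by (simp only: b_def tile_side_def m)
    then have m': "b mod 2 ^ w = b" "b * b mod 2 ^ w = b * b" "b * b * b mod 2 ^ w = b * b * b"
      using bb bb2 by simp_all
    have p: "\<sigma> q 3 = s" "\<sigma> q 4 = n" using P[OF q] by auto
    show "\<sigma>1 q 116 = b" "\<sigma>1 q 117 = b * b" "\<sigma>1 q 118 = b * b * b" "\<sigma>1 q 115 = 0" "\<sigma>1 q 129 = n * n"
      "\<sigma>1 q 130 = s" "\<sigma>1 q 128 = 2"
      unfolding \<sigma>1_def
      by (simp_all only: block_simps p m b_def[unfolded tile_side_def, symmetric] m' cong: if_weak_cong)
  qed
  let ?m = "corner_side n"
  have m_le: "?m \<le> s" using n(2) by (rule corner_side_le)
  let ?I1 = "\<lambda>t (\<tau> :: state). \<forall>q\<in>mesh s. \<tau> q 115 = min t ?m \<and> \<tau> q 129 = n * n"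
  have I1: "?I1 s \<sigma>2"
    unfolding \<sigma>2_def
  proof (rule den_Loop[where I = ?I1])
    show "\<sigma>1 (0, 0, 0) 130 = s" using v1 origin_mesh by simp
    show "?I1 0 \<sigma>1" using v1 by simp
    fix t \<tau> assume t: "t < s" and I: "?I1 t \<tau>"
    show "?I1 (Suc t) (dec 130 (den ?c1 \<tau>))"
    proof
      fix q assume q: "q \<in> mesh s"
      let ?k = "min t ?m"
      have k: "\<tau> q 115 = ?k" "\<tau> q 129 = n * n" using I q by auto
      have le: "?k * ?k * ?k \<le> s * s * s" "?k * ?k \<le> s * s" using t by (intro mult_le_mono; simp)+
      then have w: "?k * ?k * ?k < 2 ^ w" "?k * ?k < 2 ^ w" "?k + 1 < 2 ^ w"
        using size ss_word t six by linarith+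
      have less: "?k * ?k * ?k < n * n \<longleftrightarrow> t < ?m"
      proof
        assume "t < ?m"
        have "\<not> n ^ 2 \<le> t ^ 3"
          using \<open>t < ?m\<close> unfolding corner_side_def by (rule not_less_Least)
        moreover have "?k = t" using \<open>t < ?m\<close> by simp
        ultimately show "?k * ?k * ?k < n * n" by (simp add: power2_eq_square power3_eq_cube)
      next
        assume "?k * ?k * ?k < n * n"
        show "t < ?m"
        proof (rule ccontr)
          assume "\<not> t < ?m"
          then have "?k = ?m" by simp
          then show False using \<open>?k * ?k * ?k < n * n\<close> corner_side_bound[of n]
            by (simp add: power2_eq_square power3_eq_cube)
        qed
      qed
      have "of_bool P mod 2 ^ w = (of_bool P :: nat)" for P using w_pos by simp
      then have "dec 130 (den ?c1 \<tau>) q 115 = ?k + of_bool (t < ?m)"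
        using k w w_pos by (simp add: dec_frame sem_apply less)
      moreover have "dec 130 (den ?c1 \<tau>) q 129 = n * n" using k by (simp add: dec_frame sem_apply)
      ultimately show "dec 130 (den ?c1 \<tau>) q 115 = min (Suc t) ?m \<and> dec 130 (den ?c1 \<tau>) q 129 = n * n"
        by auto
    qed
  qed
  have fr2: "\<sigma>2 q r = \<sigma>1 q r" if "r \<in> {3, 116, 117, 118, 128}" for q r
    unfolding \<sigma>2_def using that by (intro den_frame) auto
  have fr1: "\<sigma>1 q 3 = \<sigma> q 3" for q unfolding \<sigma>1_def by (intro fold_sem_frame) simp
  have fr3: "\<sigma>3 q r = \<sigma>2 q r" if "r \<in> {115, 116, 117, 118, 128}" for q r
    unfolding \<sigma>3_def using that by (intro fold_sem_frame) auto
  have fr4: "\<sigma>' q r = \<sigma>3 q r" if "r \<in> {115, 116, 117, 118}" for q r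
    unfolding \<sigma>' using that by (intro den_frame) auto
  let ?Q = "s * s * s"
  have v3: "\<sigma>3 q 114 = 0" "\<sigma>3 q 132 = ?Q" "\<sigma>3 q 134 = 4 * s" "\<sigma>3 q 128 = 2" if q: "q \<in> mesh s" for q
  proof -
    have "s * s mod 2 ^ w = s * s" "?Q mod 2 ^ w = ?Q" "(4::nat) mod 2 ^ w = 4" "4 * s mod 2 ^ w = 4 * s"
      "(0::nat) mod 2 ^ w = 0"
      using ss_word size six two_le_s by (intro mod_less; linarith)+
    note m = this
    have p: "\<sigma>2 q 3 = s" using P[OF q] by (simp add: fr2 fr1)
    show "\<sigma>3 q 114 = 0" "\<sigma>3 q 132 = ?Q" "\<sigma>3 q 134 = 4 * s"
      unfolding \<sigma>3_def by (simp_all only: block_simps p m cong: if_weak_cong)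
    show "\<sigma>3 q 128 = 2" using v1(7)[OF q] by (simp add: fr2 fr3)
  qed
  \<comment> \<open>While the quotient is positive the counter equals the number of rounds;
    afterwards it is frozen at the bit length of \<open>s * s * s\<close>.\<close>
  let ?ok = "\<lambda>t L. (0 < ?Q div 2 ^ t \<longrightarrow> L = t) \<and>
    (?Q div 2 ^ t = 0 \<longrightarrow> 0 < L \<and> ?Q < 2 ^ L \<and> 2 ^ (L - 1) \<le> ?Q)"
  let ?I2 = "\<lambda>t (\<tau> :: state). (\<exists>L\<le>t. ?ok t L \<and> (\<forall>q\<in>mesh s. \<tau> q 114 = L)) \<and>
    (\<forall>q\<in>mesh s. \<tau> q 132 = ?Q div 2 ^ t \<and> \<tau> q 128 = 2)"
  have four: "4 * s + 1 < 2 ^ w" using six s0 by linarith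
  have I2: "?I2 (4 * s) \<sigma>'"
    unfolding \<sigma>'
  proof (rule den_Loop[where I = ?I2])
    show "\<sigma>3 (0, 0, 0) 134 = 4 * s" using v3 origin_mesh by simp
    show "?I2 0 \<sigma>3" using v3 s0 by auto
    fix t \<tau> assume t: "t < 4 * s" and I: "?I2 t \<tau>"
    from conjunct1[OF I] obtain L where "L \<le> t \<and> ?ok t L \<and> (\<forall>q\<in>mesh s. \<tau> q 114 = L)" ..
    then have L: "L \<le> t" "?ok t L" "\<forall>q\<in>mesh s. \<tau> q 114 = L" by simp_all
    have Q: "\<tau> q 132 = ?Q div 2 ^ t" "\<tau> q 128 = 2" if "q \<in> mesh s" for q using I that by auto
    let ?L = "L + of_bool (0 < ?Q div 2 ^ t)"
    have ob: "of_bool P mod 2 ^ w = (of_bool P :: nat)" for P using w_pos by simp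
    have "?Q div 2 ^ Suc t \<le> ?Q" by simp
    then have Qw: "?Q div 2 ^ Suc t mod 2 ^ w = ?Q div 2 ^ Suc t" using size by (intro mod_less) linarith
    have Lw: "?L mod 2 ^ w = ?L" using L(1) t four by (intro mod_less) (auto simp: of_bool_def)
    have div: "?Q div 2 ^ t div 2 = ?Q div 2 ^ Suc t" by (simp add: div_mult2_eq[symmetric] mult.commute)
    have val: "dec 134 (den ?c2 \<tau>) q 114 = ?L" "dec 134 (den ?c2 \<tau>) q 132 = ?Q div 2 ^ Suc t"
      "dec 134 (den ?c2 \<tau>) q 128 = 2" if q: "q \<in> mesh s" for q
    proof -
      have z: "(0::nat) mod 2 ^ w = 0" by simp
      have l: "\<tau> q 114 = L" using L(3) q by blast
      have d: "dec 134 \<rho> q r = \<rho> q r" if "r \<in> {114, 132, 128}" for \<rho> r using that by (intro dec_frame) auto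
      show "dec 134 (den ?c2 \<tau>) q 114 = ?L" "dec 134 (den ?c2 \<tau>) q 132 = ?Q div 2 ^ Suc t"
        "dec 134 (den ?c2 \<tau>) q 128 = 2"
        using d by (simp_all only: block_simps Q[OF q] l z ob Lw div Qw insert_iff cong: if_weak_cong)
    qed
    have "?ok (Suc t) ?L"
    proof (cases "?Q div 2 ^ t = 0")
      case True
      then have "?Q div 2 ^ Suc t = 0" using div by simp
      then show ?thesis using L(2) True by simp
    next
      case False
      then have "L = t" "2 ^ t \<le> ?Q" using L(2) by (auto simp: div_eq_0_iff)
      then show ?thesis using False by (auto simp: div_eq_0_iff)
    qed
    then show "?I2 (Suc t) (dec 134 (den ?c2 \<tau>))"
      using val L(1) by (intro conjI exI[of _ ?L]) auto
  qed
  from conjunct1[OF I2] obtain L where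
    "L \<le> 4 * s \<and> ?ok (4 * s) L \<and> (\<forall>q\<in>mesh s. \<sigma>' q 114 = L)" ..
  then have L: "?ok (4 * s) L" "\<forall>q\<in>mesh s. \<sigma>' q 114 = L" by simp_all
  have "?Q < 2 ^ (4 * s)"
  proof -
    have "s < 2 ^ s" by (rule less_exp)
    then have "s * s * s \<le> 2 ^ s * 2 ^ s * 2 ^ s" by (intro mult_le_mono) auto
    also have "\<dots> = 2 ^ (3 * s)" by (simp add: power_add[symmetric])
    also have "\<dots> < 2 ^ (4 * s)" using s0 by (intro power_strict_increasing) auto
    finally show ?thesis .
  qed
  then have "?Q div 2 ^ (4 * s) = 0" by simp
  then have L': "0 < L" "?Q < 2 ^ L" "2 ^ (L - 1) \<le> ?Q" using L(1) by auto
  have "time (Loop 130 ?c1) \<sigma>1 \<le> s * (4 + 5) + 1"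
    using v1(6)[OF origin_mesh] by (intro time_Loop_const) simp_all
  moreover have "time (Loop 134 ?c2) \<sigma>3 \<le> 4 * s * (4 + 5) + 1"
    using v3(3)[OF origin_mesh] by (intro time_Loop_const) simp_all
  ultimately have time: "time prelude \<sigma> \<le> 45 * s + 19"
    unfolding prelude_def time.simps(1,2) den.simps(1,2) \<sigma>1_def[symmetric] \<sigma>2_def[symmetric] \<sigma>3_def[symmetric]
    by simp
  show thesis
  proof (rule that)
    show "0 < L" "2 ^ (L - 1) \<le> ?Q" "?Q \<le> 2 ^ L" using L' by simp_all
    show "(2::nat) ^ t < 2 ^ w" if "t < L" for t
    proof -
      have "(2::nat) ^ t \<le> 2 ^ (L - 1)" using that by (intro power_increasing) auto
      then show ?thesis using L'(3) size by linarith
    qed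
    show "\<sigma>' q 114 = L \<and> \<sigma>' q 115 = ?m \<and> \<sigma>' q 116 = b \<and> \<sigma>' q 117 = b * b \<and> \<sigma>' q 118 = b * b * b"
      if "q \<in> mesh s" for q
      using L(2) I1 v1[OF that] that m_le by (simp add: fr2 fr3 fr4)
    show "time prelude \<sigma> \<le> 45 * s + 19" by (rule time)
  qed
qed

end

text \<open>Adds one half of the inner index range to the accumulators. \<open>A\<close> is laid out
  with block pairs along \<open>y\<close>, rows along \<open>x\<close> and the inner index along
  \<open>z\<close>; \<open>B\<close> with block pairs along \<open>x\<close>, the inner index along
  \<open>z\<close> and columns along \<open>y\<close>. So both factors share the axis of
  summation.\<close>

definition half :: "nat \<Rightarrow> nat \<Rightarrow> nat \<Rightarrow> cmd" where
  "half ti tj tk =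
     Block [Const 120 ti, Const 121 tk] ;; load 5 1 0 2 ;;
     Block [Move 60 20, Move 61 23, Const 120 tk, Const 121 tj] ;; load 9 0 2 1 ;;
     Block [Move 62 20, Move 63 23] ;; multiply"

text \<open>Row and column travel as the single key \<open>i * n + j\<close>. The results of earlier
  tiles rest in the registers 90 to 93, since the sorting in \<open>load\<close> overwrites the
  registers 40 to 44.\<close>

definition pack :: "nat \<Rightarrow> nat \<Rightarrow> instr list" where
  "pack ti tj =
     [Arith Div 36 2 116, Arith Mod 37 2 116, Const 38 ti, Arith Mul 38 38 116, Arith Add 36 36 38,
      Arith Mul 36 36 3, Arith Add 36 36 0, Const 38 tj, Arith Mul 38 38 116, Arith Add 37 37 38,
      Arith Mul 37 37 3, Arith Add 37 37 1, Arith Mul 36 36 4, Arith Add 22 36 37,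
      Move 20 64, Move 23 65, Move 40 90, Move 41 91, Move 42 92, Move 44 93, Move 110 3]"

text \<open>Different tiles accumulate in the same cells, but a processor may hold only one entry of
  the product; hence the results of all tiles are compacted into consecutive cells. The half 0
  precedes the half 1 because the order of summation matters.\<close>

definition tile :: "nat \<Rightarrow> nat \<Rightarrow> cmd" where
  "tile ti tj =
     Block [Const 64 0, Const 65 0] ;; half ti tj 0 ;; half ti tj 1 ;;
     Block (pack ti tj) ;; append_packets 0 1 2 ;;
     Block [Move 90 40, Move 91 41, Move 92 42, Move 93 44]"

definition main :: cmd where
  "main = prelude ;; Block [Const 90 0, Const 93 0] ;;
     tile 0 0 ;; tile 0 1 ;; tile 1 0 ;; tile 1 1 ;;
     Block [Move 13 90, Arith Div 14 91 4, Arith Mod 15 91 4, Move 16 92]"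

lemma writes_half:
  "set (writes (half ti tj tk)) \<subseteq> {20..89} \<union> {100, 101, 110, 111, 112, 113, 120, 121, 122, 123, 124, 125}"
  unfolding half_def writes.simps set_append
  by (intro Un_least order_trans[OF writes_load] order_trans[OF writes_multiply]) auto

text \<open>With \<open>c\<close> the rounded up \<open>n / s\<close> and \<open>u = c - 1\<close>,
  the inequality \<open>u * s < n\<close> gives \<open>u * u < s\<close>, whereas
  \<open>c * c\<close> may exceed \<open>s\<close>. Halving repairs this, as
  \<open>(u + 2) div 2 \<le> u\<close> for \<open>u \<ge> 2\<close>, at the price of two tiles per
  dimension.\<close>

lemma tile_side_bounds:
  assumes "1 \<le> n" "n ^ 2 \<le> s ^ 3" "1 \<le> s"
  shows "0 < tile_side n s" "tile_side n s * tile_side n s \<le> s" "n \<le> 2 * tile_side n s * s"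
proof -
  define c where "c = (n + s - 1) div s"
  define u where "u = c - 1"
  have s0: "0 < s" using assms by simp
  have lo: "n \<le> c * s"
  proof -
    have "(n + s - 1) mod s < s" using s0 by simp
    then show ?thesis using div_mult_mod_eq[of "n + s - 1" s] assms unfolding c_def by linarith
  qed
  have hi: "c * s \<le> n + s - 1" unfolding c_def by (metis div_times_less_eq_dividend)
  have c1: "1 \<le> c" using lo assms by (cases c) auto
  have us: "u * s < n"
  proof -
    have "c * s = u * s + s" using c1 by (cases c) (auto simp: u_def)
    then show ?thesis using hi s0 assms by linarith
  qed
  have "(u * s) ^ 2 < s ^ 3" using us assms(2) power_strict_mono[of "u * s" n 2] by simp
  then have "u * u * (s * s) < s * (s * s)" by (simp add: power2_eq_square power3_eq_cube ac_simps)
  then have uu: "u * u < s" using s0 by simp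
  have b: "tile_side n s = (u + 2) div 2" 
    unfolding tile_side_def c_def[symmetric] using c1 by (simp add: u_def)
  show "0 < tile_side n s" unfolding b by simp
  have b2: "2 * ((u + 2) div 2) \<le> u + 2" "u + 1 \<le> 2 * ((u + 2) div 2)" by simp_all
  show "tile_side n s * tile_side n s \<le> s"
  proof (cases "u \<le> 1")
    case True
    then have "(u + 2) div 2 = 1" by (cases u) auto
    then show ?thesis unfolding b using s0 by simp
  next
    case False
    then have "(u + 2) div 2 \<le> u" by linarith
    then have "(u + 2) div 2 * ((u + 2) div 2) \<le> u * u" by (rule mult_le_mono) fact
    then show ?thesis unfolding b using uu by simp
  qed
  have "c \<le> 2 * tile_side n s" unfolding b using b2(2) c1 by (simp add: u_def)
  then show "n \<le> 2 * tile_side n s * s" using lo mult_le_mono1 order_trans by blast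
qed

text \<open>For \<open>s \<ge> 3\<close> the first sum is at most
  \<open>s * s + 6 * s \<le> s * s * s\<close>. For \<open>s = 2\<close> this estimate fails, but
  then \<open>n = 2\<close>, the tile side is 1, and \<open>8 < 2 ^ w\<close> forces
  \<open>16 \<le> 2 ^ w\<close>.\<close>

lemma word_bounds:
  assumes n: "2 \<le> n" "n ^ 2 \<le> s ^ 3" and s: "2 \<le> s" and w: "s * s * s < 2 ^ w"
  shows "tile_side n s * tile_side n s * tile_side n s + 6 * s < 2 ^ w" and "n + s < 2 ^ w"
proof -
  let ?b = "tile_side n s"
  have b: "0 < ?b" "?b * ?b \<le> s" using tile_side_bounds[of n s] n s by auto
  have "n \<le> s * s"
  proof (rule ccontr)
    assume "\<not> n \<le> s * s"
    then have "s * s * (s * s) < n * n" by (intro mult_strict_mono) auto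
    moreover have "s \<le> s * s" by simp
    then have "s * s * s \<le> s * s * (s * s)" by (rule mult_le_mono2)
    moreover have "n * n \<le> s * s * s" using n(2) by (simp add: power2_eq_square power3_eq_cube)
    ultimately show False by linarith
  qed
  moreover have "s * s + s \<le> s * s * s"
  proof -
    have "s * s + s \<le> s * s * 2" using s by simp
    also have "\<dots> \<le> s * s * s" using s by (intro mult_le_mono) auto
    finally show ?thesis .
  qed
  ultimately show "n + s < 2 ^ w" using w by linarith
  show "?b * ?b * ?b + 6 * s < 2 ^ w"
  proof (cases "s = 2")
    case True
    have "n < 3"
    proof (rule ccontr)
      assume "\<not> n < 3"
      then have "3 ^ 2 \<le> n ^ 2" by (intro power_mono) auto
      then show False using n(2) True by simp
    qed
    then have "n = 2" using n(1) by simp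
    then have "?b = 1" using True by (simp add: tile_side_def)
    moreover have "4 \<le> w"
    proof (rule ccontr)
      assume "\<not> 4 \<le> w"
      then have "(2::nat) ^ w \<le> 2 ^ 3" by (intro power_increasing) auto
      then show False using w True by simp
    qed
    moreover from this have "(2::nat) ^ 4 \<le> 2 ^ w" by (intro power_increasing) auto
    ultimately show ?thesis using True by simp
  next
    case False
    have "?b \<le> ?b * ?b" using b(1) by simp
    then have "?b \<le> s" using b(2) by linarith
    then have "?b * ?b * ?b \<le> s * s" using b(2) by (intro mult_le_mono)
    moreover have "s * s + 6 * s \<le> s * s * s"
    proof -
      have "3 \<le> s" using False s by simp
      then have "s + 6 \<le> 3 * s" by simp
      also have "\<dots> \<le> s * s" using \<open>3 \<le> s\<close> by (intro mult_le_mono) auto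
      finally have "(s + 6) * s \<le> s * s * s" by (rule mult_le_mono1)
      then show ?thesis by (simp add: algebra_simps)
    qed
    ultimately show ?thesis using w by linarith
  qed
qed

section \<open>Sums with absent terms, and half a tile product\<close>

locale matrices = word_machine +
  fixes n L :: nat and A B :: "nat \<Rightarrow> nat \<Rightarrow> nat"
  assumes n: "2 \<le> n" "n ^ 2 \<le> s ^ 3"
    and L: "0 < L" "\<And>t. t < L \<Longrightarrow> (2::nat) ^ t < 2 ^ w" "s * s * s \<le> 2 ^ L"
    and ops: "word_ops w f g" and AB: "word_matrix w n A" "word_matrix w n B"
begin

abbreviation "b \<equiv> tile_side n s"

lemma b0: "0 < b" and bb: "b * b \<le> s" and n_le: "n \<le> 2 * b * s"
  using tile_side_bounds[of n s] n two_le_s by auto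

lemma bound: "b * b * b + 6 * s < 2 ^ w"
  using word_bounds(1)[OF n two_le_s size] .

lemma nn: "n * n \<le> s * s * s"
  using n(2) by (simp add: power2_eq_square power3_eq_cube)

text \<open>Collects the facts about the registers 0 to 12 and 114 to 118, which no phase after
  \<open>prelude\<close> writes. It contains the input, because the matrices are loaded anew for
  every pair of tiles.\<close>

definition env :: "state \<Rightarrow> bool" where
  "env \<sigma> \<longleftrightarrow> located \<sigma> \<and> (\<forall>q\<in>mesh s. \<sigma> q 3 = s \<and> \<sigma> q 4 = n \<and> \<sigma> q 114 = L \<and>
     \<sigma> q 115 = corner_side n \<and> \<sigma> q 116 = b \<and> \<sigma> q 117 = b * b \<and> \<sigma> q 118 = b * b * b \<and>
     (\<sigma> q 5 = 1 \<longrightarrow> q \<in> mesh (corner_side n)) \<and> (\<sigma> q 9 = 1 \<longrightarrow> q \<in> mesh (corner_side n))) \<and>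
     stored s n 5 A (\<lambda>q. (0, \<sigma> q)) \<and> stored s n 9 B (\<lambda>q. (0, \<sigma> q))"

lemma env_den:
  assumes "env \<sigma>" and W: "set (writes c) \<subseteq> W" "W \<inter> ({0..12} \<union> {114..118}) = {}"
  shows "env (den c \<sigma>)"
proof -
  have fr: "den c \<sigma> q r = \<sigma> q r" if "r \<in> {0..12} \<union> {114..118}" for q r
    by (rule den_frame_subset[OF W(1)]) (use W(2) that in blast)
  have "located (den c \<sigma>)" using assms(1) fr by (simp add: env_def located_def)
  then show ?thesis using assms(1) by (simp add: env_def fr stored_def)
qed

text \<open>Terms beyond the matrix are \<open>None\<close>, because the range
  \<open>2 * b * s\<close> covered by two tiles may exceed \<open>n\<close>.\<close>

definition entry :: "nat \<Rightarrow> nat \<Rightarrow> nat \<Rightarrow> nat option" where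
  "entry i j k = (if i < n \<and> j < n \<and> k < n then Some (g (A i k) (B k j)) else None)"

definition partial :: "nat \<Rightarrow> nat \<Rightarrow> nat \<Rightarrow> nat option" where
  "partial i j m = foldl (join f) None (map (entry i j) [0..<m])"

text \<open>Associativity of \<open>f\<close> is granted on words only, so every regrouping has to
  know that its terms are words.\<close>

definition word :: "nat option \<Rightarrow> bool" where
  "word u \<longleftrightarrow> (\<forall>v. u = Some v \<longrightarrow> v < 2 ^ w)"

lemma word_join: "word u \<Longrightarrow> word v \<Longrightarrow> word (join f u v)"
  using ops by (auto simp: word_def join_def word_ops_def split: option.splits)

lemma join_assoc: "word u \<Longrightarrow> word v \<Longrightarrow> word x \<Longrightarrow> join f (join f u v) x = join f u (join f v x)"
  using ops by (auto simp: word_def join_def word_ops_def split: option.splits)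

lemma word_entry: "word (entry i j k)"
  using ops AB by (auto simp: word_def entry_def word_ops_def word_matrix_def)

lemma word_foldl: "word u \<Longrightarrow> \<forall>v\<in>set vs. word v \<Longrightarrow> word (foldl (join f) u vs)"
  by (induction vs arbitrary: u) (auto simp: word_join)

lemma join_foldl:
  "word u \<Longrightarrow> word v \<Longrightarrow> \<forall>x\<in>set xs. word x \<Longrightarrow>
    join f u (foldl (join f) v xs) = foldl (join f) (join f u v) xs"
  by (induction xs arbitrary: v) (auto simp: join_assoc word_join)

lemma join_None [simp]: "join f u None = u" "join f None u = u"
  by (auto simp: join_def split: option.split)

lemma word_partial: "word (partial i j m)"
  unfolding partial_def by (rule word_foldl) (auto simp: word_entry, simp add: word_def)

text \<open>A line sum is folded on its own and joined to the accumulated value afterwards. Here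
  associativity enters and turns this into one left fold.\<close>

lemma partial_add:
  "join f (partial i j m) (foldl (join f) None (map (entry i j) [m..<m + l])) = partial i j (m + l)"
proof -
  let ?xs = "map (entry i j) [m..<m + l]"
  have split: "[0..<m + l] = [0..<m] @ [m..<m + l]" by (rule upt_add_eq_append) simp
  have "word None" by (simp add: word_def)
  moreover have "\<forall>x\<in>set ?xs. word x" using word_entry by simp
  ultimately have "join f (partial i j m) (foldl (join f) None ?xs) =
      foldl (join f) (join f (partial i j m) None) ?xs"
    by (intro join_foldl word_partial)
  also have "\<dots> = partial i j (m + l)"
    unfolding partial_def split map_append foldl_append join_None ..
  finally show ?thesis .
qed

lemma partial_complete:
  assumes "i < n" "j < n" "n \<le> m"
  shows "partial i j m = Some (gen_matrix_prod f g n A B i j)"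
proof -
  have small: "partial i j (Suc m) = Some (big_oplus f (\<lambda>k. g (A i k) (B k j)) m)" if "m < n" for m
    using that
  proof (induction m)
    case (Suc m)
    then have "partial i j (Suc (Suc m)) = join f (partial i j (Suc m)) (entry i j (Suc m))"
      by (simp add: partial_def)
    then show ?case using Suc assms by (simp add: entry_def join_def)
  qed (use assms n in \<open>simp add: partial_def entry_def\<close>)
  have "foldl (join f) None (map (entry i j) [n..<n + l]) = None" for l
    by (induction l) (simp_all add: entry_def)
  then have "partial i j (n + l) = partial i j n" for l
    using partial_add[of i j n l] by simp
  from this[of "m - n"] show ?thesis
    using small[of "n - 1"] assms n by (simp add: gen_matrix_prod_def)
qed

lemma partial_None: "\<not> (i < n \<and> j < n) \<Longrightarrow> partial i j m = None"
  by (induction m) (auto simp: partial_def entry_def)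

text \<open>The digits of \<open>z\<close> in base \<open>b\<close> are the row block and the column
  block of the entry accumulated at height \<open>z\<close>.\<close>

definition row_at :: "nat \<Rightarrow> nat \<Rightarrow> nat \<Rightarrow> nat" where
  "row_at ti x z = (ti * b + z div b) * s + x"

definition col_at :: "nat \<Rightarrow> nat \<Rightarrow> nat \<Rightarrow> nat" where
  "col_at tj y z = (tj * b + z mod b) * s + y"

lemma den_load':
  assumes env: "env \<sigma>" and r: "r = 5 \<and> M = A \<or> r = 9 \<and> M = B" and ax: "axes a d c"
    and T: "\<And>q. q \<in> mesh s \<Longrightarrow> \<sigma> q 120 = tr \<and> \<sigma> q 121 = tc"
    and q: "q \<in> mesh s"
  defines "\<sigma>' \<equiv> den (load r a d c) \<sigma>"
    and "i \<equiv> (tr * b + crd a q div b) * s + crd d q"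
    and "k \<equiv> (tc * b + crd a q mod b) * s + crd c q"
  shows "\<sigma>' q 20 = of_bool (crd a q < b * b \<and> i < n \<and> k < n)"
    and "crd a q < b * b \<Longrightarrow> i < n \<Longrightarrow> k < n \<Longrightarrow> \<sigma>' q 23 = M i k"
proof -
  have r': "r = 5 \<or> r = 9" using r by blast
  have st: "stored s n r M (\<lambda>q. (0, \<sigma> q))" using env r by (auto simp: env_def)
  have co: "q \<in> mesh (corner_side n)" if "q \<in> mesh s" "\<sigma> q r = 1" for q
    using env r that by (auto simp: env_def)
  have loc: "located \<sigma>" using env by (simp add: env_def)
  have par: "\<sigma> q 3 = s \<and> \<sigma> q 115 = corner_side n \<and> \<sigma> q 116 = b \<and> \<sigma> q 120 = tr \<and> \<sigma> q 121 = tc"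
    if "q \<in> mesh s" for q using env T that by (simp add: env_def)
  have L0: "\<sigma> (0, 0, 0) 114 = L" using env origin_mesh by (simp add: env_def)
  note * = den_load[OF ax r' st co n(2) loc par L0 L bb b0 q]
  show "\<sigma>' q 20 = of_bool (crd a q < b * b \<and> i < n \<and> k < n)"
    unfolding \<sigma>'_def i_def k_def by (rule *)
  show "crd a q < b * b \<Longrightarrow> i < n \<Longrightarrow> k < n \<Longrightarrow> \<sigma>' q 23 = M i k"
    unfolding \<sigma>'_def i_def k_def by (rule *)
qed

text \<open>The line sums with block number \<open>k\<close> cover the inner indices from
  \<open>(tk * b + k) * s\<close> on, \<open>s\<close> at a time. So the accumulation over
  \<open>k < b\<close> continues the partial sum from \<open>tk * b * s\<close> to
  \<open>Suc tk * b * s\<close> without gap and in order.\<close>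

lemma den_half:
  assumes env: "env \<sigma>" and T: "ti < 2" "tj < 2" "tk < 2"
    and acc: "\<And>x y z. x < s \<Longrightarrow> y < s \<Longrightarrow> z < s \<Longrightarrow> \<sigma> (x, y, z) 64 \<le> 1 \<and>
      opt (\<sigma> (x, y, z) 64) (\<sigma> (x, y, z) 65) =
        (if z < b * b then partial (row_at ti x z) (col_at tj y z) (tk * b * s) else None)"
  defines "\<sigma>' \<equiv> den (half ti tj tk) \<sigma>"
  shows "env \<sigma>'"
    and "\<And>x y z. x < s \<Longrightarrow> y < s \<Longrightarrow> z < s \<Longrightarrow> \<sigma>' (x, y, z) 64 \<le> 1 \<and>
      opt (\<sigma>' (x, y, z) 64) (\<sigma>' (x, y, z) 65) =
        (if z < b * b then partial (row_at ti x z) (col_at tj y z) (Suc tk * b * s) else None)"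
    and "time (half ti tj tk) \<sigma> \<le> 2 * (L * (372 * corner_side n + 235) + 264 * s + 171) +
      (b * b * b + 5 * s) * 98 + 23"
proof -
  show env': "env \<sigma>'" unfolding \<sigma>'_def by (rule env_den[OF env writes_half]) auto
  define \<sigma>1 where "\<sigma>1 = den (Block [Const 120 ti, Const 121 tk]) \<sigma>"
  define \<sigma>2 where "\<sigma>2 = den (load 5 1 0 2) \<sigma>1"
  define \<sigma>3 where "\<sigma>3 = den (Block [Move 60 20, Move 61 23, Const 120 tk, Const 121 tj]) \<sigma>2"
  define \<sigma>4 where "\<sigma>4 = den (load 9 0 2 1) \<sigma>3"
  define \<sigma>5 where "\<sigma>5 = den (Block [Move 62 20, Move 63 23]) \<sigma>4"
  have \<sigma>': "\<sigma>' = den multiply \<sigma>5"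
    by (simp add: \<sigma>'_def half_def \<sigma>1_def \<sigma>2_def \<sigma>3_def \<sigma>4_def \<sigma>5_def)
  have two: "(2::nat) < 2 ^ w" using two_le_s size mult_le_mono[of 2 s 2 s] ss_word by linarith
  have Tw: "ti mod 2 ^ w = ti" "tj mod 2 ^ w = tj" "tk mod 2 ^ w = tk" using T two by auto
  have e1: "env \<sigma>1" unfolding \<sigma>1_def by (rule env_den[OF env order_refl]) auto
  have e2: "env \<sigma>2" unfolding \<sigma>2_def by (rule env_den[OF e1 writes_load]) auto
  have e3: "env \<sigma>3" unfolding \<sigma>3_def by (rule env_den[OF e2 order_refl]) auto
  have e4: "env \<sigma>4" unfolding \<sigma>4_def by (rule env_den[OF e3 writes_load]) auto
  have e5: "env \<sigma>5" unfolding \<sigma>5_def by (rule env_den[OF e4 order_refl]) auto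
  have t1: "\<sigma>1 q 120 = ti \<and> \<sigma>1 q 121 = tk" for q by (simp add: \<sigma>1_def sem_apply Tw)
  have t3: "\<sigma>3 q 120 = tk \<and> \<sigma>3 q 121 = tj" for q by (simp add: \<sigma>3_def sem_apply Tw)
  have ax: "axes 1 0 2" "axes 0 2 1" by (simp_all add: axes_def)
  have fr4: "\<sigma>4 q r = \<sigma>3 q r" if "r \<in> {60, 61, 64, 65}" for q r
    unfolding \<sigma>4_def by (rule den_frame_subset[OF writes_load]) (use that in auto)
  have fr2: "\<sigma>2 q r = \<sigma>1 q r" if "r \<in> {64, 65}" for q r
    unfolding \<sigma>2_def by (rule den_frame_subset[OF writes_load]) (use that in auto)
  have v5: "\<sigma>5 q 60 = \<sigma>2 q 20" "\<sigma>5 q 61 = \<sigma>2 q 23" "\<sigma>5 q 62 = \<sigma>4 q 20" "\<sigma>5 q 63 = \<sigma>4 q 23"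
    "\<sigma>5 q 64 = \<sigma> q 64" "\<sigma>5 q 65 = \<sigma> q 65" for q
    by (simp_all add: \<sigma>5_def sem_apply fr4) (simp_all add: \<sigma>3_def sem_apply fr2 \<sigma>1_def)
  define FA where "FA x y z = \<sigma>5 (x, y, z) 60" for x y z
  define VA where "VA x y z = \<sigma>5 (x, y, z) 61" for x y z
  define FB where "FB x y z = \<sigma>5 (x, y, z) 62" for x y z
  define VB where "VB x y z = \<sigma>5 (x, y, z) 63" for x y z
  define acc0 where "acc0 x y z = opt (\<sigma> (x, y, z) 64) (\<sigma> (x, y, z) 65)" for x y z
  have FA: "FA x y z = of_bool (y < b * b \<and> (ti * b + y div b) * s + x < n \<and> (tk * b + y mod b) * s + z < n)"
    and VA: "y < b * b \<Longrightarrow> (ti * b + y div b) * s + x < n \<Longrightarrow> (tk * b + y mod b) * s + z < n \<Longrightarrow>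
      VA x y z = A ((ti * b + y div b) * s + x) ((tk * b + y mod b) * s + z)"
    if "x < s" "y < s" "z < s" for x y z
    using den_load'[OF e1 _ ax(1) t1, of 5 A "(x, y, z)", folded \<sigma>2_def] that
    by (simp_all add: FA_def VA_def v5 mesh_def)
  have FB: "FB x y z = of_bool (x < b * b \<and> (tk * b + x div b) * s + z < n \<and> (tj * b + x mod b) * s + y < n)"
    and VB: "x < b * b \<Longrightarrow> (tk * b + x div b) * s + z < n \<Longrightarrow> (tj * b + x mod b) * s + y < n \<Longrightarrow>
      VB x y z = B ((tk * b + x div b) * s + z) ((tj * b + x mod b) * s + y)"
    if "x < s" "y < s" "z < s" for x y z
    using den_load'[OF e3 _ ax(2) t3, of 9 B "(x, y, z)", folded \<sigma>4_def] that
    by (simp_all add: FB_def VB_def v5 mesh_def)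
  \<comment> \<open>The flags and values of the pipeline are taken to be whatever the two loads left
    in the registers 60 to 63.\<close>
  interpret mu: multiplication w s f g b FA VA FB VB acc0
    by unfold_locales (use b0 bb FA FB in auto)
  have P: "\<sigma>5 (x, y, z) 0 = x \<and> \<sigma>5 (x, y, z) 1 = y \<and> \<sigma>5 (x, y, z) 2 = z \<and>
     \<sigma>5 (x, y, z) 3 = s \<and> \<sigma>5 (x, y, z) 116 = b \<and> \<sigma>5 (x, y, z) 117 = b * b \<and> \<sigma>5 (x, y, z) 118 = b * b * b \<and>
     \<sigma>5 (x, y, z) 60 = FA x y z \<and> \<sigma>5 (x, y, z) 61 = VA x y z \<and>
     \<sigma>5 (x, y, z) 62 = FB x y z \<and> \<sigma>5 (x, y, z) 63 = VB x y z"
    if "x < s" "y < s" "z < s" for x y z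
  proof -
    have m: "(x, y, z) \<in> mesh s" using that by (simp add: mesh_def)
    then have "\<sigma>5 (x, y, z) d = crd d (x, y, z)" if "d < 3" for d
      using e5 that by (simp add: env_def located_def)
    from this[of 0] this[of 1] this[of 2] show ?thesis
      using e5 m by (simp add: env_def FA_def VA_def FB_def VB_def)
  qed
  have acc5: "\<sigma>5 (x, y, z) 64 \<le> 1 \<and> opt (\<sigma>5 (x, y, z) 64) (\<sigma>5 (x, y, z) 65) = acc0 x y z"
    if "x < s" "y < s" "z < s" for x y z
    using acc[OF that] by (simp add: v5 acc0_def)
  \<comment> \<open>For the index \<open>k * (b * b) + z\<close> the owners in the line over
    \<open>(x, y)\<close> hold matching factors: height \<open>z'\<close> contributes the term with
    inner index \<open>(tk * b + k) * s + z'\<close>.\<close>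
  have line: "mu.line_sum (k * (b * b) + z) x y s =
      foldl (join f) None (map (entry (row_at ti x z) (col_at tj y z)) [(tk * b + k) * s..<(tk * b + k) * s + s])"
    if xyz: "x < s" "y < s" "z < b * b" "k < b" for x y z k
  proof -
    have zb: "z div b < b" "z mod b < b" using xyz(3) b0 by (simp_all add: less_mult_imp_div_less)
    have zk: "(k * (b * b) + z) div b = k * b + z div b"
      using b0 by (simp add: mult.assoc[symmetric])
    have row: "row_of b (k * (b * b) + z) = z div b * b + k"
      using zb xyz(3) b0 by (simp add: row_of_def zk)
    have col: "col_of b (k * (b * b) + z) = k * b + z mod b"
    proof -
      have "(k * (b * b) + z) div (b * b) = k"
        using div_mult_self3[of "b * b" k z] div_less[OF xyz(3)] b0 by simp
      moreover have "(k * (b * b) + z) mod b = z mod b"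
        using mod_mult_self3[of "k * b" b z] by (simp add: mult.assoc)
      ultimately show ?thesis by (simp add: col_of_def)
    qed
    have rl: "z div b * b + k < b * b" "(z div b * b + k) div b = z div b" "(z div b * b + k) mod b = k"
      using xyz(4) zb b0 by (simp_all add: lt_mult_add)
    have cl: "k * b + z mod b < b * b" "(k * b + z mod b) div b = k" "(k * b + z mod b) mod b = z mod b"
      using xyz(4) zb b0 by (simp_all add: lt_mult_add)
    have rs: "z div b * b + k < s" "k * b + z mod b < s" using rl(1) cl(1) bb by linarith+
    have "mu.product (k * (b * b) + z) x y z' = entry (row_at ti x z) (col_at tj y z) ((tk * b + k) * s + z')"
      if "z' < s" for z'
      unfolding mu.product_def row col entry_def row_at_def col_at_def
      using FA[OF xyz(1) rs(1) that] FB[OF rs(2) xyz(2) that] VA[OF xyz(1) rs(1) that] VB[OF rs(2) xyz(2) that]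
        rl cl by (simp del: mult_Suc mult_Suc_right)
    then have "map (mu.product (k * (b * b) + z) x y) [0..<s] =
        map (entry (row_at ti x z) (col_at tj y z)) (map (\<lambda>z'. z' + (tk * b + k) * s) [0..<s])"
      by (simp add: add.commute)
    then show ?thesis by (simp add: mu.line_sum_def map_add_upt add.commute)
  qed
  show "\<sigma>' (x, y, z) 64 \<le> 1 \<and> opt (\<sigma>' (x, y, z) 64) (\<sigma>' (x, y, z) 65) =
        (if z < b * b then partial (row_at ti x z) (col_at tj y z) (Suc tk * b * s) else None)"
    if xyz: "x < s" "y < s" "z < s" for x y z
  proof (cases "z < b * b")
    case True
    let ?i = "row_at ti x z" and ?j = "col_at tj y z"
    have "foldl (join f) (partial ?i ?j (tk * b * s)) (map (\<lambda>k. mu.line_sum (k * (b * b) + z) x y s) [0..<l]) =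
        partial ?i ?j ((tk * b + l) * s)" if "l \<le> b" for l
      using that
    proof (induction l)
      case (Suc l)
      then have "foldl (join f) (partial ?i ?j (tk * b * s)) (map (\<lambda>k. mu.line_sum (k * (b * b) + z) x y s) [0..<Suc l]) =
        join f (partial ?i ?j ((tk * b + l) * s)) (mu.line_sum (l * (b * b) + z) x y s)" by simp
      also have "\<dots> = partial ?i ?j ((tk * b + l) * s + s)"
        using line[OF xyz(1,2) True, of l] Suc.prems partial_add by simp
      finally show ?case by (simp add: algebra_simps)
    qed simp
    from this[of b] have "foldl (join f) (acc0 x y z) (map (\<lambda>k. mu.line_sum (k * (b * b) + z) x y s) [0..<b]) =
        partial ?i ?j (Suc tk * b * s)"
      using acc[OF xyz] True by (simp add: acc0_def add.commute)
    then show ?thesis using mu.den_multiply(1,2)[OF bound P acc5 xyz] True by (simp add: \<sigma>')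
  next
    case False
    then show ?thesis
      using mu.den_multiply(1,2)[OF bound P acc5 xyz] acc[OF xyz] by (simp add: \<sigma>' acc0_def)
  qed
  have sc: "\<tau> (0, 0, 0) 115 = corner_side n" "\<tau> (0, 0, 0) 114 = L" "\<tau> (0, 0, 0) 3 = s" if "env \<tau>" for \<tau>
    using that origin_mesh by (simp_all add: env_def)
  have arith: "t1 \<le> X \<Longrightarrow> t2 \<le> X \<Longrightarrow> t3 \<le> Y + 15 \<Longrightarrow> 2 + (t1 + (4 + (t2 + (2 + t3)))) \<le> 2 * X + Y + 23"
    for t1 t2 t3 X Y :: nat by simp
  have half: "time (half ti tj tk) \<sigma> =
      2 + (time (load 5 1 0 2) \<sigma>1 + (4 + (time (load 9 0 2 1) \<sigma>3 + (2 + time multiply \<sigma>5))))"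
    unfolding half_def time.simps(2) \<sigma>1_def[symmetric] \<sigma>2_def[symmetric] \<sigma>3_def[symmetric]
      \<sigma>4_def[symmetric] \<sigma>5_def[symmetric] by simp
  show "time (half ti tj tk) \<sigma> \<le> 2 * (L * (372 * corner_side n + 235) + 264 * s + 171) +
      (b * b * b + 5 * s) * 98 + 23"
    unfolding half
  proof (rule arith)
    show "time (load 5 1 0 2) \<sigma>1 \<le> L * (372 * corner_side n + 235) + 264 * s + 171"
      by (rule time_load) (use sc[OF e1] in simp_all)
    show "time (load 9 0 2 1) \<sigma>3 \<le> L * (372 * corner_side n + 235) + 264 * s + 171"
      by (rule time_load) (use sc[OF e3] in simp_all)
    show "time multiply \<sigma>5 \<le> (b * b * b + 5 * s) * 98 + 15"
      by (rule mu.den_multiply(3)[OF bound P acc5 s_pos s_pos s_pos])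
  qed
qed

end

section \<open>Assembling the product\<close>

definition tile_cost :: "nat \<Rightarrow> nat \<Rightarrow> nat \<Rightarrow> nat" where
  "tile_cost s n L = 2 * (2 * (L * (372 * corner_side n + 235) + 264 * s + 171) +
     (tile_side n s * tile_side n s * tile_side n s + 5 * s) * 98 + 23) + (186 * s + 106) + 27"

context matrices
begin

definition completed :: "(nat \<times> nat) set \<Rightarrow> (nat \<times> nat) set" where
  "completed T = {(i, j). i < n \<and> j < n \<and> (i div s div b, j div s div b) \<in> T}"

definition index :: "nat \<times> nat \<Rightarrow> nat" where
  "index = (\<lambda>(i, j). i * n + j)"

definition result :: "nat \<times> nat \<Rightarrow> nat" where
  "result = (\<lambda>(i, j). gen_matrix_prod f g n A B i j)"

text \<open>Between tiles the packets rest in the registers 90 to 92, while \<open>out\<close>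
  speaks about 40 to 42; the offset 50 bridges the two.\<close>

definition saved :: "state \<Rightarrow> state" where
  "saved \<sigma> = (\<lambda>q r. \<sigma> q (r + 50))"

definition collected :: "(nat \<times> nat) set \<Rightarrow> (nat \<times> nat \<Rightarrow> nat) \<Rightarrow> state \<Rightarrow> bool" where
  "collected T E \<sigma> \<longleftrightarrow> env \<sigma> \<and> out 0 1 2 s (completed T) E index result (saved \<sigma>) \<and>
     (\<forall>p\<in>completed T. E p < card (completed T)) \<and> (\<forall>q\<in>mesh s. \<sigma> q 93 = card (completed T))"

lemma completed_subset: "completed T \<subseteq> {..<n} \<times> {..<n}"
  by (auto simp: completed_def)

lemma card_completed: "card (completed T) \<le> s * s * s"
proof -
  have "card (completed T) \<le> card ({..<n} \<times> {..<n})"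
    by (intro card_mono completed_subset) auto
  then show ?thesis using nn by simp
qed

lemma finite_completed: "finite (completed T)"
  using completed_subset by (rule finite_subset) auto

lemma out_cong:
  "(\<And>q r. r \<in> {40, 41, 42} \<Longrightarrow> \<sigma> q r = \<tau> q r) \<Longrightarrow>
    out a' b' c' M S E K V \<sigma> \<longleftrightarrow> out a' b' c' M S E K V \<tau>"
  by (simp add: out_def)

lemma den_tile:
  assumes C: "collected T E \<sigma>" and T: "ti < 2" "tj < 2" "(ti, tj) \<notin> T"
  shows "\<exists>E'. collected (insert (ti, tj) T) E' (den (tile ti tj) \<sigma>)"
    and "time (tile ti tj) \<sigma> \<le> tile_cost s n L"
proof -
  have e: "env \<sigma>" using C by (simp add: collected_def)
  define \<sigma>0 where "\<sigma>0 = den (Block [Const 64 0, Const 65 0]) \<sigma>"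
  define \<sigma>1 where "\<sigma>1 = den (half ti tj 0) \<sigma>0"
  define \<sigma>2 where "\<sigma>2 = den (half ti tj 1) \<sigma>1"
  define \<sigma>3 where "\<sigma>3 = fold sem (pack ti tj) \<sigma>2"
  define \<sigma>4 where "\<sigma>4 = den (append_packets 0 1 2) \<sigma>3"
  define \<sigma>5 where "\<sigma>5 = den (Block [Move 90 40, Move 91 41, Move 92 42, Move 93 44]) \<sigma>4"
  have den: "den (tile ti tj) \<sigma> = \<sigma>5"
    by (simp only: tile_def den.simps(1,2) \<sigma>0_def \<sigma>1_def \<sigma>2_def \<sigma>3_def \<sigma>4_def \<sigma>5_def)
  have e0: "env \<sigma>0" unfolding \<sigma>0_def by (rule env_den[OF e order_refl]) auto
  have a0: "\<sigma>0 (x, y, z) 64 \<le> 1 \<and> opt (\<sigma>0 (x, y, z) 64) (\<sigma>0 (x, y, z) 65) =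
        (if z < b * b then partial (row_at ti x z) (col_at tj y z) (0 * b * s) else None)" for x y z
    by (simp add: \<sigma>0_def sem_apply opt_def partial_def)
  note h1 = den_half[OF e0 T(1,2) zero_less_numeral a0, folded \<sigma>1_def]
  have a1: "\<sigma>1 (x, y, z) 64 \<le> 1 \<and> opt (\<sigma>1 (x, y, z) 64) (\<sigma>1 (x, y, z) 65) =
        (if z < b * b then partial (row_at ti x z) (col_at tj y z) (1 * b * s) else None)"
    if "x < s" "y < s" "z < s" for x y z using h1(2)[OF that] by simp
  have lt1: "1 < (2::nat)" by simp
  note half2 = den_half[OF h1(1) T(1,2) lt1, folded \<sigma>2_def]
  have h2: "env \<sigma>2" "time (half ti tj 1) \<sigma>1 \<le> 2 * (L * (372 * corner_side n + 235) + 264 * s + 171) +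
      (b * b * b + 5 * s) * 98 + 23"
    by (rule half2; use a1 in blast)+
  have a2: "\<sigma>2 (x, y, z) 64 \<le> 1" "opt (\<sigma>2 (x, y, z) 64) (\<sigma>2 (x, y, z) 65) =
        (if z < b * b then partial (row_at ti x z) (col_at tj y z) (2 * b * s) else None)"
    if "x < s" "y < s" "z < s" for x y z
  proof -
    have "\<sigma>2 (x, y, z) 64 \<le> 1 \<and> opt (\<sigma>2 (x, y, z) 64) (\<sigma>2 (x, y, z) 65) =
        (if z < b * b then partial (row_at ti x z) (col_at tj y z) (Suc 1 * b * s) else None)"
      by (rule half2(2)) (use a1 that in blast)+
    then show "\<sigma>2 (x, y, z) 64 \<le> 1" "opt (\<sigma>2 (x, y, z) 64) (\<sigma>2 (x, y, z) 65) =
        (if z < b * b then partial (row_at ti x z) (col_at tj y z) (2 * b * s) else None)"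
      by (simp_all add: numeral_2_eq_2)
  qed
  have two: "(2::nat) < 2 ^ w" using two_le_s size mult_le_mono[of 2 s 2 s] ss_word by linarith
  have Tw: "ti mod 2 ^ w = ti" "tj mod 2 ^ w = tj" using T two by auto
  have p2: "\<sigma>2 (x, y, z) 0 = x" "\<sigma>2 (x, y, z) 1 = y" "\<sigma>2 (x, y, z) 2 = z" "\<sigma>2 (x, y, z) 3 = s"
    "\<sigma>2 (x, y, z) 4 = n" "\<sigma>2 (x, y, z) 116 = b" if "x < s" "y < s" "z < s" for x y z
  proof -
    have m: "(x, y, z) \<in> mesh s" using that by (simp add: mesh_def)
    then have "\<sigma>2 (x, y, z) d = crd d (x, y, z)" if "d < 3" for d
      using h2(1) that by (simp add: env_def located_def)
    from this[of 0] this[of 1] this[of 2]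
    show "\<sigma>2 (x, y, z) 0 = x" "\<sigma>2 (x, y, z) 1 = y" "\<sigma>2 (x, y, z) 2 = z" "\<sigma>2 (x, y, z) 3 = s"
      "\<sigma>2 (x, y, z) 4 = n" "\<sigma>2 (x, y, z) 116 = b"
      using h2(1) m by (simp_all add: env_def)
  qed
  have v3: "\<sigma>3 q 20 = \<sigma>2 q 64" "\<sigma>3 q 23 = \<sigma>2 q 65" "\<sigma>3 q 40 = \<sigma>2 q 90" "\<sigma>3 q 41 = \<sigma>2 q 91"
    "\<sigma>3 q 42 = \<sigma>2 q 92" "\<sigma>3 q 44 = \<sigma>2 q 93" "\<sigma>3 q 110 = \<sigma>2 q 3" for q
    unfolding \<sigma>3_def by (simp_all only: pack_def block_simps cong: if_weak_cong)
  have v22: "\<sigma>3 (x, y, z) 22 = (row_at ti x z * n + col_at tj y z) mod 2 ^ w"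
    if "x < s" "y < s" "z < s" for x y z
  proof -
    have "\<sigma>3 (x, y, z) 22 = (((z div b mod 2 ^ w + ti * b mod 2 ^ w) mod 2 ^ w * s mod 2 ^ w + x) mod 2 ^ w * n mod 2 ^ w +
        ((z mod b mod 2 ^ w + tj * b mod 2 ^ w) mod 2 ^ w * s mod 2 ^ w + y) mod 2 ^ w) mod 2 ^ w"
      unfolding \<sigma>3_def by (simp only: pack_def block_simps p2[OF that] Tw cong: if_weak_cong)
    also have "\<dots> = (((z div b + ti * b) * s + x) * n + ((z mod b + tj * b) * s + y)) mod 2 ^ w"
      by (simp only: mod_simps)
    finally show ?thesis by (simp add: row_at_def col_at_def add.commute)
  qed
  have fr2: "\<sigma>2 q r = \<sigma> q r" if "r \<in> {90, 91, 92, 93}" for q r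
  proof -
    have "\<sigma>2 q r = \<sigma>1 q r" unfolding \<sigma>2_def by (rule den_frame_subset[OF writes_half]) (use that in auto)
    also have "\<dots> = \<sigma>0 q r" unfolding \<sigma>1_def by (rule den_frame_subset[OF writes_half]) (use that in auto)
    also have "\<dots> = \<sigma> q r" unfolding \<sigma>0_def using that by (intro den_frame) auto
    finally show ?thesis .
  qed
  define S where "S = completed {(ti, tj)}"
  \<comment> \<open>The cell in which the entry \<open>(i, j)\<close> of this tile was accumulated,
    inverse to \<open>row_at\<close> and \<open>col_at\<close>.\<close>
  define ps where "ps = (\<lambda>(i, j). (i mod s, j mod s, i div s mod b * b + j div s mod b))"
  have psd: "ps (i, j) = (x, y, z) \<Longrightarrow> x < s \<and> y < s \<and> z < b * b \<and> z < s \<and> row_at ti x z = i \<and> col_at tj y z = j"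
    if ij: "(i, j) \<in> S" for i j x y z
  proof -
    assume "ps (i, j) = (x, y, z)"
    then have xyz: "x = i mod s" "y = j mod s" "z = i div s mod b * b + j div s mod b"
      by (auto simp: ps_def)
    have z: "z < b * b" unfolding xyz using b0 by (intro lt_mult_add) auto
    have "z div b = i div s mod b" "z mod b = j div s mod b" unfolding xyz using b0 by simp_all
    moreover have "ti * b + i div s mod b = i div s" "tj * b + j div s mod b = j div s"
      using ij by (auto simp: S_def completed_def div_mult_mod_eq)
    ultimately show ?thesis
      using z bb s_pos by (simp add: row_at_def col_at_def xyz(1,2))
  qed
  have ps_at: "(row_at ti x z, col_at tj y z) \<in> S \<and> ps (row_at ti x z, col_at tj y z) = (x, y, z)"
    if "x < s" "y < s" "z < b * b" "row_at ti x z < n" "col_at tj y z < n" for x y z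
  proof -
    have zb: "z div b < b" "z mod b < b" using that(3) b0 by (simp_all add: less_mult_imp_div_less)
    have "row_at ti x z div s = ti * b + z div b" "row_at ti x z mod s = x"
      "col_at tj y z div s = tj * b + z mod b" "col_at tj y z mod s = y"
      using that(1,2) by (simp_all add: row_at_def col_at_def)
    then show ?thesis using that zb b0 by (simp add: S_def completed_def ps_def div_mult_mod_eq)
  qed
  have entryS: "\<sigma>3 (ps p) 20 = 1 \<and> \<sigma>3 (ps p) 22 = index p \<and> \<sigma>3 (ps p) 23 = result p \<and> ps p \<in> mesh s"
    if p: "p \<in> S" for p
  proof -
    obtain i j where ij: "p = (i, j)" by fastforce
    obtain x y z where xyz: "ps (i, j) = (x, y, z)" by (metis prod_cases3)
    note d = psd[OF p[unfolded ij] xyz]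
    have lt: "i < n" "j < n" using p ij by (auto simp: S_def completed_def)
    have "partial i j (2 * b * s) = Some (gen_matrix_prod f g n A B i j)"
      by (rule partial_complete[OF lt n_le])
    then have o: "opt (\<sigma>2 (x, y, z) 64) (\<sigma>2 (x, y, z) 65) = Some (result p)" "\<sigma>2 (x, y, z) 64 \<le> 1"
      using a2[of x y z] d by (simp_all add: result_def ij)
    have "i * n + j < n * n" by (rule lt_mult_add[OF lt])
    then have "(i * n + j) mod 2 ^ w = i * n + j" using nn size by (intro mod_less) linarith
    then have "\<sigma>3 (x, y, z) 22 = index p" using v22[of x y z] d by (simp add: index_def ij)
    moreover have "(x, y, z) \<in> mesh s" using d by (simp add: mesh_def)
    ultimately show ?thesis
      using o by (simp add: ij xyz v3 opt_def split: if_splits)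
  qed
  have Hin: "holds S ps (\<lambda>p. \<sigma>3 (ps p) 21) index result \<sigma>3"
  proof -
    have inj: "inj_on ps S"
    proof (rule inj_onI)
      fix p p' assume p: "p \<in> S" "p' \<in> S" "ps p = ps p'"
      obtain i j where ij: "p = (i, j)" by fastforce
      obtain i' j' where ij': "p' = (i', j')" by fastforce
      obtain x y z where xyz: "ps (i, j) = (x, y, z)" by (metis prod_cases3)
      show "p = p'"
        using psd[OF p(1)[unfolded ij] xyz] psd[of i' j' x y z] p(2,3) xyz by (simp add: ij ij')
    qed
    \<comment> \<open>A cell without an entry of the tile lies at height \<open>b * b\<close> or
      above, or belongs to the padding; in both cases its accumulator is \<open>None\<close> and its
      flag is 0.\<close>
    have z: "\<sigma>3 q 20 = 0" if q: "q \<in> mesh s" "q \<notin> ps ` S" for q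
    proof -
      obtain x y z where xyz: "q = (x, y, z)" by (metis prod_cases3)
      have lt: "x < s" "y < s" "z < s" using q(1) xyz by (auto simp: mesh_def)
      have "\<not> (z < b * b \<and> row_at ti x z < n \<and> col_at tj y z < n)"
        using ps_at[of x y z] lt q(2) xyz by force
      then have "opt (\<sigma>2 q 64) (\<sigma>2 q 65) = None"
        using a2(2)[OF lt] partial_None xyz by auto
      then show ?thesis by (simp add: v3 opt_def split: if_splits)
    qed
    have "ps ` S \<subseteq> mesh s" using entryS by blast
    moreover have "\<forall>i\<in>S. \<sigma>3 (ps i) 20 = 1 \<and> \<sigma>3 (ps i) 21 = \<sigma>3 (ps i) 21 \<and> \<sigma>3 (ps i) 22 = index i \<and> \<sigma>3 (ps i) 23 = result i"
      using entryS by blast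
    moreover have "\<forall>q\<in>mesh s - ps ` S. \<sigma>3 q 20 = 0" using z by blast
    ultimately show ?thesis using inj unfolding holds_def by blast
  qed
  have e3: "env \<sigma>3"
  proof -
    have W: "set (writes (Block (pack ti tj))) \<subseteq> {20..44} \<union> {110}" by (simp add: pack_def)
    have "env (den (Block (pack ti tj)) \<sigma>2)" by (rule env_den[OF h2(1) W]) auto
    then show ?thesis by (simp only: \<sigma>3_def den.simps)
  qed
  have loc3: "located \<sigma>3" using e3 by (simp add: env_def)
  have M3: "\<forall>q\<in>mesh s. \<sigma>3 q 110 = s" using h2(1) by (simp add: v3 env_def)
  have out3: "out 0 1 2 s (completed T) E index result \<sigma>3"
  proof -
    have "out 0 1 2 s (completed T) E index result \<sigma>3 \<longleftrightarrow>
        out 0 1 2 s (completed T) E index result (saved \<sigma>)"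
      by (rule out_cong) (auto simp: v3 fr2 saved_def)
    then show ?thesis using C by (simp add: collected_def)
  qed
  have dis: "S \<inter> completed T = {}" using T(3) by (auto simp: S_def completed_def)
  have ins: "completed (insert (ti, tj) T) = completed T \<union> S"
    by (auto simp: S_def completed_def)
  have cards: "card (completed (insert (ti, tj) T)) = card (completed T) + card S"
    unfolding ins using dis finite_completed S_def by (intro card_Un_disjoint) auto
  have cube: "crd d (ps p) < s" if "p \<in> S" "d < 3" for p d
    using entryS[OF that(1)] that(2) by (simp add: mem_mesh_crd)
  have B3: "\<sigma>3 q 44 = card (completed T)" if "q \<in> mesh s" for q
    using C that by (simp add: collected_def v3 fr2)
  have Elt: "E p < card (completed T)" if "p \<in> completed T" for p
    using C that by (simp add: collected_def)
  have tot: "card (completed T) + card S \<le> s * s * s"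
    using card_completed[of "insert (ti, tj) T"] cards by simp
  have ax: "axes 0 1 2" by (simp add: axes_def)
  obtain D where D: "inj_on D S" "\<And>i. i \<in> S \<Longrightarrow> card (completed T) \<le> D i \<and> D i < card (completed T) + card S"
    "\<And>i j. i \<in> S \<Longrightarrow> j \<in> S \<Longrightarrow> lin 0 1 2 s (ps i) < lin 0 1 2 s (ps j) \<Longrightarrow> D i < D j"
    and out4: "out 0 1 2 s (completed T \<union> S) (\<lambda>i. if i \<in> S then D i else E i) index result \<sigma>4"
    and loc4: "located \<sigma>4" and M4: "\<forall>q\<in>mesh s. \<sigma>4 q 110 = s"
    and B4: "\<And>q. q \<in> mesh s \<Longrightarrow> (\<And>d. d < 3 \<Longrightarrow> crd d q < s) \<Longrightarrow> \<sigma>4 q 44 = card (completed T) + card S"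
  proof (rule append_packets[OF ax Hin loc3 M3 order_refl cube out3 Elt dis B3 tot, folded \<sigma>4_def])
  qed (assumption | rule that | blast)+
  have e4: "env \<sigma>4" unfolding \<sigma>4_def by (rule env_den[OF e3 writes_append_packets]) auto
  have e5: "env \<sigma>5" unfolding \<sigma>5_def by (rule env_den[OF e4 order_refl]) auto
  have v5: "saved \<sigma>5 q r = \<sigma>4 q r" if "r \<in> {40, 41, 42}" for q r
    using that by (auto simp: saved_def \<sigma>5_def sem_apply)
  have v93: "\<sigma>5 q 93 = \<sigma>4 q 44" for q by (simp add: \<sigma>5_def sem_apply)
  let ?E = "\<lambda>i. if i \<in> S then D i else E i"
  have "collected (insert (ti, tj) T) ?E \<sigma>5"
    unfolding collected_def
  proof (intro conjI ballI)
    show "env \<sigma>5" by (rule e5)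
    show "out 0 1 2 s (completed (insert (ti, tj) T)) ?E index result (saved \<sigma>5)"
      using out4 out_cong[of "saved \<sigma>5" \<sigma>4] v5 unfolding ins by blast
    show "?E p < card (completed (insert (ti, tj) T))" if "p \<in> completed (insert (ti, tj) T)" for p
      using D(2)[of p] Elt[of p] that unfolding cards unfolding ins by auto
    show "\<sigma>5 q 93 = card (completed (insert (ti, tj) T))" if "q \<in> mesh s" for q
      unfolding v93 cards using B4[OF that] that by (simp add: mem_mesh_crd)
  qed
  then show "\<exists>E'. collected (insert (ti, tj) T) E' (den (tile ti tj) \<sigma>)" unfolding den by blast
  have arith: "t1 \<le> X \<Longrightarrow> t2 \<le> X \<Longrightarrow> t3 \<le> Y \<Longrightarrow> 2 + (t1 + (t2 + (21 + (t3 + 4)))) \<le> 2 * X + Y + 27"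
    for t1 t2 t3 X Y :: nat by simp
  have tile: "time (tile ti tj) \<sigma> = 2 + (time (half ti tj 0) \<sigma>0 + (time (half ti tj 1) \<sigma>1 +
      (21 + (time (append_packets 0 1 2) \<sigma>3 + 4))))"
    unfolding tile_def time.simps(2) den.simps(1)[of "pack ti tj"] \<sigma>0_def[symmetric] \<sigma>1_def[symmetric]
      \<sigma>2_def[symmetric] \<sigma>3_def[symmetric] \<sigma>4_def[symmetric] by (simp add: pack_def)
  show "time (tile ti tj) \<sigma> \<le> tile_cost s n L"
    unfolding tile tile_cost_def
    by (rule arith[OF h1(3) h2(2)], rule time_append_packets) (use M3 origin_mesh in simp)
qed

end

lemma tile_divs:
  assumes "i < n" "n \<le> 2 * b * s"
  shows "i div s div b < (2::nat)"
  using assms by (simp add: less_mult_imp_div_less ac_simps)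

context word_machine
begin

lemma den_main:
  assumes n: "2 \<le> n" "n ^ 2 \<le> s ^ 3"
    and ops: "word_ops w f g" and AB: "word_matrix w n A" "word_matrix w n B"
    and loc: "located \<sigma>" and P: "\<And>q. q \<in> mesh s \<Longrightarrow> \<sigma> q 3 = s \<and> \<sigma> q 4 = n"
    and st: "stored s n 5 A (\<lambda>q. (0, \<sigma> q))" "stored s n 9 B (\<lambda>q. (0, \<sigma> q))"
    and co: "\<And>q. q \<in> mesh s \<Longrightarrow> \<sigma> q 5 = 1 \<or> \<sigma> q 9 = 1 \<Longrightarrow> q \<in> mesh (corner_side n)"
  defines "\<sigma>' \<equiv> den main \<sigma>"
  shows "stored s n regC (gen_matrix_prod f g n A B) (\<lambda>q. (pc, \<sigma>' q))"
    and "\<exists>L. 0 < L \<and> 2 ^ (L - 1) \<le> s * s * s \<and> time main \<sigma> \<le> 4 * tile_cost s n L + 45 * s + 25"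
proof -
  note wb = word_bounds[OF n two_le_s size]
  obtain L where L: "0 < L" "\<And>t. t < L \<Longrightarrow> (2::nat) ^ t < 2 ^ w" "s * s * s \<le> 2 ^ L" "2 ^ (L - 1) \<le> s * s * s"
    and v1: "\<And>q. q \<in> mesh s \<Longrightarrow> den prelude \<sigma> q 114 = L \<and> den prelude \<sigma> q 115 = corner_side n \<and>
      den prelude \<sigma> q 116 = tile_side n s \<and> den prelude \<sigma> q 117 = tile_side n s * tile_side n s \<and>
      den prelude \<sigma> q 118 = tile_side n s * tile_side n s * tile_side n s"
    and t1: "time prelude \<sigma> \<le> 45 * s + 19"
  proof (rule den_prelude[OF n P wb])
  qed (assumption | rule that)+
  interpret m: matrices w s f g n L A B
    by unfold_locales (fact n L ops AB)+
  define \<sigma>1 where "\<sigma>1 = den prelude \<sigma>"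
  define \<sigma>2 where "\<sigma>2 = den (Block [Const 90 0, Const 93 0]) \<sigma>1"
  define \<sigma>3 where "\<sigma>3 = den (tile 0 0) \<sigma>2"
  define \<sigma>4 where "\<sigma>4 = den (tile 0 1) \<sigma>3"
  define \<sigma>5 where "\<sigma>5 = den (tile 1 0) \<sigma>4"
  define \<sigma>6 where "\<sigma>6 = den (tile 1 1) \<sigma>5"
  have \<sigma>': "\<sigma>' = den (Block [Move 13 90, Arith Div 14 91 4, Arith Mod 15 91 4, Move 16 92]) \<sigma>6"
    by (simp only: \<sigma>'_def main_def den.simps(2) \<sigma>1_def \<sigma>2_def \<sigma>3_def \<sigma>4_def \<sigma>5_def \<sigma>6_def)
  have fr1: "\<sigma>1 q r = \<sigma> q r" if "r \<in> {0..12}" for q r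
    unfolding \<sigma>1_def by (rule den_frame_subset[OF writes_prelude]) (use that in auto)
  have loc1: "located \<sigma>1" unfolding \<sigma>1_def by (rule located_den_subset[OF loc writes_prelude]) auto
  have e1: "m.env \<sigma>1"
    unfolding m.env_def using loc1 v1 P co st by (auto simp: fr1 stored_def \<sigma>1_def[symmetric])
  have e2: "m.env \<sigma>2" unfolding \<sigma>2_def by (rule m.env_den[OF e1 order_refl]) auto
  have "m.completed {} = {}" by (simp add: m.completed_def)
  then have "m.collected {} (\<lambda>_. 0) \<sigma>2"
    using e2 by (simp add: m.collected_def out_def m.saved_def \<sigma>2_def sem_apply)
  note c2 = m.den_tile[OF this, of 0 0, folded \<sigma>3_def, simplified]
  then obtain E3 where "m.collected {(0, 0)} E3 \<sigma>3" by blast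
  note c3 = m.den_tile[OF this, of 0 1, folded \<sigma>4_def, simplified]
  then obtain E4 where "m.collected {(0, 1), (0, 0)} E4 \<sigma>4" by (auto simp: One_nat_def)
  note c4 = m.den_tile[OF this, of 1 0, folded \<sigma>5_def, simplified]
  then obtain E5 where "m.collected {(1, 0), (0, 1), (0, 0)} E5 \<sigma>5" by (auto simp: One_nat_def)
  note c5 = m.den_tile[OF this, of 1 1, folded \<sigma>6_def, simplified]
  then obtain E where C: "m.collected {(1, 1), (1, 0), (0, 1), (0, 0)} E \<sigma>6" by (auto simp: One_nat_def)
  \<comment> \<open>By \<open>n_le\<close> only 0 and 1 occur as tile numbers, so the four tiles
    exhaust the matrix.\<close>
  have all: "m.completed {(1, 1), (1, 0), (0, 1), (0, 0)} = {..<n} \<times> {..<n}"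
  proof -
    have "i div s div tile_side n s = 0 \<or> i div s div tile_side n s = 1" if "i < n" for i
      using tile_divs[OF that m.n_le] by linarith
    then show ?thesis unfolding m.completed_def by fastforce
  qed
  let ?C = "\<lambda>p. cell 0 1 2 s (E p)"
  have out: "inj_on E ({..<n} \<times> {..<n})"
    "\<And>p. p \<in> {..<n} \<times> {..<n} \<Longrightarrow> E p < s * s * s \<and> \<sigma>6 (?C p) 90 = 1 \<and> \<sigma>6 (?C p) 91 = m.index p \<and>
      \<sigma>6 (?C p) 92 = m.result p"
    "\<And>q. q \<in> mesh s \<Longrightarrow> q \<notin> ?C ` ({..<n} \<times> {..<n}) \<Longrightarrow> \<sigma>6 q 90 = 0"
    using C unfolding m.collected_def out_def all by (auto simp: m.saved_def)
  have e6: "\<And>q. q \<in> mesh s \<Longrightarrow> \<sigma>6 q 4 = n" using C by (simp add: m.collected_def m.env_def)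
  have ax: "axes 0 1 2" by (simp add: axes_def)
  have nw: "n < 2 ^ w" using wb(2) by simp
  have v: "\<sigma>' q 13 = \<sigma>6 q 90" "\<sigma>' q 14 = \<sigma>6 q 91 div \<sigma>6 q 4 mod 2 ^ w"
    "\<sigma>' q 15 = \<sigma>6 q 91 mod \<sigma>6 q 4 mod 2 ^ w" "\<sigma>' q 16 = \<sigma>6 q 92" for q
    unfolding \<sigma>' by (simp_all add: sem_apply)
  have fin: "?C (i, j) \<in> mesh s \<and> \<sigma>' (?C (i, j)) 13 = 1 \<and> \<sigma>' (?C (i, j)) 14 = i \<and> \<sigma>' (?C (i, j)) 15 = j \<and>
      \<sigma>' (?C (i, j)) 16 = gen_matrix_prod f g n A B i j" if ij: "i < n" "j < n" for i j
  proof -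
    have o: "E (i, j) < s * s * s" "\<sigma>6 (?C (i, j)) 90 = 1" "\<sigma>6 (?C (i, j)) 91 = i * n + j"
      "\<sigma>6 (?C (i, j)) 92 = gen_matrix_prod f g n A B i j"
      using out(2)[of "(i, j)"] ij by (auto simp: m.index_def m.result_def)
    have me: "?C (i, j) \<in> mesh s" by (rule cell_mesh[OF ax o(1) order_refl])
    then show ?thesis using o ij nw e6[OF me] by (simp add: v)
  qed
  show "stored s n regC (gen_matrix_prod f g n A B) (\<lambda>q. (pc, \<sigma>' q))"
    unfolding stored_def snd_conv
  proof (intro conjI ballI allI impI)
    fix q assume q: "q \<in> mesh s"
    show "\<sigma>' q regC = 0 \<or> \<sigma>' q regC = 1 \<and> \<sigma>' q (regC + 1) < n \<and> \<sigma>' q (regC + 2) < n \<and>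
        \<sigma>' q (regC + 3) = gen_matrix_prod f g n A B (\<sigma>' q (regC + 1)) (\<sigma>' q (regC + 2))"
    proof (cases "q \<in> ?C ` ({..<n} \<times> {..<n})")
      case True
      then obtain i j where "i < n" "j < n" "q = ?C (i, j)" by auto
      then show ?thesis using fin[of i j] by simp
    next
      case False
      then show ?thesis using out(3)[OF q] v(1) by simp
    qed
  next
    fix i j assume ij: "i < n" "j < n"
    show "\<exists>!q. q \<in> mesh s \<and> \<sigma>' q regC = 1 \<and> \<sigma>' q (regC + 1) = i \<and> \<sigma>' q (regC + 2) = j"
    proof (rule ex1I[of _ "?C (i, j)"])
      show "?C (i, j) \<in> mesh s \<and> \<sigma>' (?C (i, j)) regC = 1 \<and> \<sigma>' (?C (i, j)) (regC + 1) = i \<and>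
          \<sigma>' (?C (i, j)) (regC + 2) = j"
        using fin[OF ij] by simp
      fix q assume q: "q \<in> mesh s \<and> \<sigma>' q regC = 1 \<and> \<sigma>' q (regC + 1) = i \<and> \<sigma>' q (regC + 2) = j"
      then have "q \<in> ?C ` ({..<n} \<times> {..<n})" using out(3)[of q] v(1)[of q] by auto
      then obtain i' j' where "i' < n" "j' < n" "q = ?C (i', j')" by auto
      then show "q = ?C (i, j)" using fin[of i' j'] q by simp
    qed
  qed
  have "time main \<sigma> = time prelude \<sigma> + (2 + (time (tile 0 0) \<sigma>2 + (time (tile 0 1) \<sigma>3 +
      (time (tile 1 0) \<sigma>4 + (time (tile 1 1) \<sigma>5 + 4)))))"
    unfolding main_def time.simps(2) \<sigma>1_def[symmetric] \<sigma>2_def[symmetric] \<sigma>3_def[symmetric]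
      \<sigma>4_def[symmetric] \<sigma>5_def[symmetric] \<sigma>6_def[symmetric] by simp
  then have "time main \<sigma> \<le> 4 * tile_cost s n L + 45 * s + 25"
    using t1 c2(2) c3(2) c4(2) c5(2) by simp
  then show "\<exists>L. 0 < L \<and> 2 ^ (L - 1) \<le> s * s * s \<and> time main \<sigma> \<le> 4 * tile_cost s n L + 45 * s + 25"
    using L by blast
qed

end

section \<open>The lower bound\<close>

lemma halted_run:
  assumes "halted s P c" and "q \<in> mesh s"
  shows "run w s f g P t c q = c q"
proof -
  have "\<forall>q\<in>mesh s. run w s f g P t c q = c q"
    unfolding run_def
  proof (induction t)
    case (Suc t)
    have "step w s f g P d q = d q" if "d q = c q" "q \<in> mesh s" for d q
      using that assms(1) by (auto simp: step_def halted_def)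
    then show ?case using Suc by simp
  qed simp
  then show ?thesis using assms(2) by blast
qed

lemma stored_cong:
  assumes "\<And>q. q \<in> mesh s \<Longrightarrow> snd (c q) = snd (d q)"
  shows "stored s n r M c \<longleftrightarrow> stored s n r M d"
proof -
  have "(\<lambda>q. q \<in> mesh s \<and> snd (c q) r = 1 \<and> snd (c q) (r + 1) = i \<and> snd (c q) (r + 2) = j) =
      (\<lambda>q. q \<in> mesh s \<and> snd (d q) r = 1 \<and> snd (d q) (r + 1) = i \<and> snd (d q) (r + 2) = j)" for i j
    using assms by auto
  then show ?thesis unfolding stored_def using assms by simp
qed

text \<open>\<open>Otimes\<close> is the only instruction that evaluates \<open>g\<close>, so a
  processor makes at most one query per step; the counting bound rests on this.\<close>

definition query :: "program \<Rightarrow> config \<Rightarrow> pos \<Rightarrow> (nat \<times> nat) option" where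
  "query P c q = (if fst (c q) < length P then
     (case P ! fst (c q) of Otimes r x y \<Rightarrow> Some (snd (c q) x, snd (c q) y) | _ \<Rightarrow> None) else None)"

text \<open>The cubes \<open>mesh k\<close> serve as balls around the input corner: one exchange
  between neighbours crosses at most one layer.\<close>

lemma neighbour_bound:
  "neighbour s d q = Some q' \<Longrightarrow> q \<in> mesh s \<Longrightarrow> q' \<in> mesh s \<and>
    (q \<in> mesh k \<longrightarrow> q' \<in> mesh (Suc k)) \<and> (q' \<in> mesh k \<longrightarrow> q \<in> mesh (Suc k))"
  by (cases "(s, d, q)" rule: neighbour.cases) (auto simp: mesh_def split: if_splits)

lemma step_cong:
  assumes "c q = c' q" and "\<And>d q'. neighbour s d q = Some q' \<Longrightarrow> c q' = c' q'"
    and "\<And>x y. query P c q = Some (x, y) \<Longrightarrow> g x y = g' x y"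
  shows "step w s f g P c q = step w s f g' P c' q"
proof -
  obtain pc R where "c q = (pc, R)" by fastforce
  then have R: "c q = (pc, R)" "c' q = (pc, R)" using assms(1) by simp_all
  show ?thesis
    using assms(2,3) R
    by (cases "P ! pc") (auto simp: step_def query_def split: option.split)
qed

lemma run_Suc: "run w s f g P (Suc t) c = step w s f g P (run w s f g P t c)"
  by (simp add: run_def)

text \<open>A processor depends only on the processors within distance \<open>t\<close>, and a change of \<open>g\<close> that is
  not queried there goes unnoticed.\<close>

lemma run_inward:
  assumes "\<And>q u x y. q \<in> mesh (k + t) \<Longrightarrow> q \<in> mesh s \<Longrightarrow> u < t \<Longrightarrow>
      query P (run w s f g P u c) q = Some (x, y) \<Longrightarrow> g x y = g' x y"
  shows "q \<in> mesh k \<Longrightarrow> q \<in> mesh s \<Longrightarrow> run w s f g P t c q = run w s f g' P t c q"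
proof -
  have "\<forall>q\<in>mesh (k + (t - u)) \<inter> mesh s. run w s f g P u c q = run w s f g' P u c q" if "u \<le> t" for u
    using that
  proof (induction u)
    case (Suc u)
    show ?case
      unfolding run_Suc
    proof
      fix q assume q: "q \<in> mesh (k + (t - Suc u)) \<inter> mesh s"
      have e: "Suc (k + (t - Suc u)) = k + (t - u)" using Suc.prems by simp
      have sub: "mesh (k + (t - Suc u)) \<subseteq> mesh (k + (t - u))" "mesh (k + (t - u)) \<subseteq> mesh (k + t)"
        by (auto simp: mesh_def)
      have IH: "\<forall>q\<in>mesh (k + (t - u)) \<inter> mesh s. run w s f g P u c q = run w s f g' P u c q"
        using Suc by simp
      show "step w s f g P (run w s f g P u c) q = step w s f g' P (run w s f g' P u c) q"
      proof (rule step_cong)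
        show "run w s f g P u c q = run w s f g' P u c q" using IH q sub by blast
        show "run w s f g P u c q' = run w s f g' P u c q'" if "neighbour s d q = Some q'" for d q'
          using neighbour_bound[OF that, of "k + (t - Suc u)"] q IH unfolding e by blast
        show "g x y = g' x y" if "query P (run w s f g P u c) q = Some (x, y)" for x y
          using assms[OF _ _ _ that] q sub Suc.prems by auto
      qed
    qed
  qed (simp add: run_def)
  from this[of t] show "q \<in> mesh k \<Longrightarrow> q \<in> mesh s \<Longrightarrow> run w s f g P t c q = run w s f g' P t c q"
    by simp
qed

text \<open>Both runs use the same \<open>g\<close> and may differ initially only inside
  \<open>mesh m\<close>; the influence of the difference spreads by one layer per step.\<close>

lemma run_outward:
  assumes "\<And>q. q \<in> mesh s \<Longrightarrow> q \<notin> mesh m \<Longrightarrow> c q = c' q"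
  shows "q \<in> mesh s \<Longrightarrow> q \<notin> mesh (m + t) \<Longrightarrow> run w s f g P t c q = run w s f g P t c' q"
proof (induction t arbitrary: q)
  case (Suc t)
  show ?case
    unfolding run_Suc
  proof (rule step_cong)
    have "mesh (m + t) \<subseteq> mesh (m + Suc t)" by (auto simp: mesh_def)
    then show "run w s f g P t c q = run w s f g P t c' q" using Suc by blast
    show "run w s f g P t c q' = run w s f g P t c' q'" if "neighbour s d q = Some q'" for d q'
      using neighbour_bound[OF that, of "m + t"] Suc by auto
  qed simp
qed (use assms in \<open>simp add: run_def\<close>)

text \<open>On the values 0 and 1 the operation \<open>max\<close> is a disjunction, so a single
  altered product becomes visible in the result.\<close>

lemma big_oplus_max:
  "big_oplus max h m = 0 \<longleftrightarrow> (\<forall>k\<le>m. h k = 0)"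
  "(\<And>k. k \<le> m \<Longrightarrow> h k \<le> 1) \<Longrightarrow> big_oplus max h m \<le> 1"
proof -
  show "big_oplus max h m = 0 \<longleftrightarrow> (\<forall>k\<le>m. h k = 0)"
    by (induction m) (auto simp: le_Suc_eq max_def)
  show "(\<And>k. k \<le> m \<Longrightarrow> h k \<le> 1) \<Longrightarrow> big_oplus max h m \<le> 1"
    by (induction m) auto
qed

section \<open>A concrete placement of the input\<close>

definition number :: "nat \<Rightarrow> pos \<Rightarrow> nat" where
  "number m = (\<lambda>(x, y, z). (x * m + y) * m + z)"

definition occupied :: "nat \<Rightarrow> nat \<Rightarrow> pos \<Rightarrow> bool" where
  "occupied m n q \<longleftrightarrow> q \<in> mesh m \<and> number m q < n * n"

text \<open>Row-major placement in the corner. The time is a worst case over all placements, so one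
  admissible placement is enough for a lower bound.\<close>

definition placed :: "nat \<Rightarrow> nat \<Rightarrow> (nat \<Rightarrow> nat \<Rightarrow> nat) \<Rightarrow> (nat \<Rightarrow> nat \<Rightarrow> nat) \<Rightarrow> config" where
  "placed s n A B q = (let m = corner_side n; v = number m q; b = occupied m n q in
     (0, \<lambda>r. if r = 0 then fst q else if r = 1 then fst (snd q) else if r = 2 then snd (snd q)
       else if r = 3 then s else if r = 4 then n
       else if \<not> b then 0 else if r = 5 \<or> r = 9 then 1 else if r = 6 \<or> r = 10 then v div n
       else if r = 7 \<or> r = 11 then v mod n else if r = 8 then A (v div n) (v mod n)
       else if r = 12 then B (v div n) (v mod n) else 0))"

lemma number_eq:
  assumes "v < m * m * m"
  shows "\<exists>!q. q \<in> mesh m \<and> number m q = v"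
proof (rule ex1I[of _ "(v div (m * m), v div m mod m, v mod m)"])
  have m: "0 < m" using assms by (cases m) auto
  then have "v div (m * m) < m" "v div m mod m < m" "v mod m < m"
    using assms by (auto simp: less_mult_imp_div_less ac_simps)
  moreover have "(v div (m * m) * m + v div m mod m) * m + v mod m = v"
    by (metis div_mult2_eq div_mult_mod_eq)
  ultimately show "(v div (m * m), v div m mod m, v mod m) \<in> mesh m \<and>
      number m (v div (m * m), v div m mod m, v mod m) = v"
    by (simp add: mesh_def number_def)
  fix q assume q: "q \<in> mesh m \<and> number m q = v"
  obtain x y z where xyz: "q = (x, y, z)" by (metis prod_cases3)
  then have lt: "x < m" "y < m" "z < m" and v: "v = (x * m + y) * m + z"
    using q by (auto simp: mesh_def number_def)
  have "v mod m = z" "v div m = x * m + y" unfolding v using lt by simp_all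
  moreover from this have "v div (m * m) = x" "v div m mod m = y" using lt by (simp_all add: div_mult2_eq)
  ultimately show "q = (v div (m * m), v div m mod m, v mod m)" using xyz by simp
qed

lemma placed_stored:
  assumes n: "n ^ 2 \<le> s ^ 3" "1 \<le> n"
  shows "stored s n regA A (placed s n A B)" "stored s n regB B (placed s n A B)"
proof -
  let ?m = "corner_side n"
  have m: "n * n \<le> ?m * ?m * ?m" "?m \<le> s"
  proof -
    have "n ^ 2 \<le> ?m ^ 3" unfolding corner_side_def
      by (rule LeastI[of _ n]) (cases n; simp add: power_increasing)
    then show "n * n \<le> ?m * ?m * ?m" by (simp add: power2_eq_square power3_eq_cube)
    show "?m \<le> s" unfolding corner_side_def using n(1) by (rule Least_le)
  qed
  have sub: "mesh ?m \<subseteq> mesh s" using m(2) by (auto simp: mesh_def)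
  have div: "v div n < n" "v mod n < n" if "v < n * n" for v
    using that n(2) by (auto simp: less_mult_imp_div_less)
  have ex: "\<exists>!q. q \<in> mesh s \<and> occupied ?m n q \<and> number ?m q div n = i \<and> number ?m q mod n = j"
    if "i < n" "j < n" for i j
  proof -
    have "i * n + j < n * n" using that mult_le_mono1[of "Suc i" n n] by simp
    then have lt: "i * n + j < ?m * ?m * ?m" using m(1) by linarith
    have iff: "q \<in> mesh s \<and> occupied ?m n q \<and> number ?m q div n = i \<and> number ?m q mod n = j \<longleftrightarrow>
        q \<in> mesh ?m \<and> number ?m q = i * n + j" for q
      using \<open>i * n + j < n * n\<close> that sub by (auto simp: occupied_def)
    show ?thesis unfolding iff by (rule number_eq[OF lt])
  qed
  have vals: "snd (placed s n A B q) 5 = of_bool (occupied ?m n q)"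
    "snd (placed s n A B q) 9 = of_bool (occupied ?m n q)"
    "snd (placed s n A B q) 6 = (if occupied ?m n q then number ?m q div n else 0)"
    "snd (placed s n A B q) 10 = (if occupied ?m n q then number ?m q div n else 0)"
    "snd (placed s n A B q) 7 = (if occupied ?m n q then number ?m q mod n else 0)"
    "snd (placed s n A B q) 11 = (if occupied ?m n q then number ?m q mod n else 0)"
    "occupied ?m n q \<Longrightarrow> snd (placed s n A B q) 8 = A (number ?m q div n) (number ?m q mod n)"
    "occupied ?m n q \<Longrightarrow> snd (placed s n A B q) 12 = B (number ?m q div n) (number ?m q mod n)" for q
    by (simp_all add: placed_def Let_def)
  have occ: "number ?m q < n * n" if "occupied ?m n q" for q using that by (simp add: occupied_def)
  have cell: "snd (placed s n A B q) 5 = 0 \<or> snd (placed s n A B q) 5 = 1 \<and> snd (placed s n A B q) 6 < n \<and>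
      snd (placed s n A B q) 7 < n \<and> snd (placed s n A B q) 8 = A (snd (placed s n A B q) 6) (snd (placed s n A B q) 7)"
    "snd (placed s n A B q) 9 = 0 \<or> snd (placed s n A B q) 9 = 1 \<and> snd (placed s n A B q) 10 < n \<and>
      snd (placed s n A B q) 11 < n \<and> snd (placed s n A B q) 12 = B (snd (placed s n A B q) 10) (snd (placed s n A B q) 11)" for q
    using div[OF occ[of q]] by (cases "occupied ?m n q"; simp add: vals)+
  have eq: "(q \<in> mesh s \<and> snd (placed s n A B q) 5 = 1 \<and> snd (placed s n A B q) 6 = i \<and> snd (placed s n A B q) 7 = j) \<longleftrightarrow>
      (q \<in> mesh s \<and> occupied ?m n q \<and> number ?m q div n = i \<and> number ?m q mod n = j)"
    "(q \<in> mesh s \<and> snd (placed s n A B q) 9 = 1 \<and> snd (placed s n A B q) 10 = i \<and> snd (placed s n A B q) 11 = j) \<longleftrightarrow>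
      (q \<in> mesh s \<and> occupied ?m n q \<and> number ?m q div n = i \<and> number ?m q mod n = j)" for q i j
    by (cases "occupied ?m n q"; simp add: vals)+
  have exA: "\<exists>!q. q \<in> mesh s \<and> snd (placed s n A B q) regA = 1 \<and> snd (placed s n A B q) (regA + 1) = i \<and>
      snd (placed s n A B q) (regA + 2) = j" if "i < n" "j < n" for i j
    using ex[OF that] unfolding eq(1)[symmetric] by simp
  have exB: "\<exists>!q. q \<in> mesh s \<and> snd (placed s n A B q) regB = 1 \<and> snd (placed s n A B q) (regB + 1) = i \<and>
      snd (placed s n A B q) (regB + 2) = j" if "i < n" "j < n" for i j
    using ex[OF that] unfolding eq(2)[symmetric] by simp
  show "stored s n regA A (placed s n A B)"
    unfolding stored_def using cell(1) exA by simp
  show "stored s n regB B (placed s n A B)"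
    unfolding stored_def using cell(2) exB by simp
qed

lemma placed_instance:
  assumes n: "n ^ 2 \<le> s ^ 3" "1 \<le> n"
    and "word_ops w f g" "word_matrix w n A" "word_matrix w n B"
  shows "gmm_instance w s n f g A B (placed s n A B)"
proof -
  have "occupied (corner_side n) n q \<Longrightarrow> q \<in> mesh (corner_side n)" for q by (simp add: occupied_def)
  then show ?thesis
    using placed_stored(1)[OF n, where A = A and B = B] placed_stored(2)[OF n, where A = A and B = B] assms
    unfolding gmm_instance_def initial_input_def
    by (auto simp: placed_def Let_def)
qed

lemma placed_outside:
  "q \<notin> mesh (corner_side n) \<Longrightarrow> placed s n A B q = placed s n A' B' q"
  by (auto simp: placed_def Let_def occupied_def)

text \<open>As the entries of \<open>A\<close> are distinct, the \<open>n ^ 3\<close> pairs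
  \<open>(A i k, A k j)\<close> are distinct. Each of them has to be queried before time
  \<open>T\<close> by a processor in the intersection, and a processor makes at most one query per
  step.\<close>

theorem query_count:
  assumes comp: "computes_gmm W S P" and n: "1 \<le> n" "n ^ 2 \<le> S n ^ 3" and W: "word_length W"
  defines "T \<equiv> run_time W S P n" and "m \<equiv> corner_side n"
  shows "n ^ 3 \<le> T * card (mesh (m + 2 * T) \<inter> mesh (S n))"
proof -
  define s where "s = S n"
  define w where "w = W (s ^ 3)"
  have size: "s ^ 3 < 2 ^ w" using W by (simp add: word_length_def w_def)
  have n': "n ^ 2 \<le> s ^ 3" using n(2) by (simp add: s_def)
  have w0: "1 < (2::nat) ^ w"
  proof -
    have "1 \<le> n ^ 2" using n(1) by simp
    then show ?thesis using n' size by linarith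
  qed
  obtain t where t: "\<And>f g A B c. gmm_instance w s n f g A B c \<Longrightarrow>
      halted s P (run w s f g P t c) \<and> stored s n regC (gen_matrix_prod f g n A B) (run w s f g P t c)"
    using comp n(1) unfolding computes_gmm_def w_def s_def by blast
  have T: "halted s P (run w s f g P T c)" if "gmm_instance w s n f g A B c" for f g A B c
  proof -
    have "\<forall>f g A B c. gmm_instance w s n f g A B c \<longrightarrow> halted s P (run w s f g P T c)"
      unfolding T_def run_time_def w_def s_def
      by (rule LeastI[of _ t]) (use t in \<open>auto simp: w_def s_def\<close>)
    then show ?thesis using that by blast
  qed
  have Tt: "T \<le> t"
    unfolding T_def run_time_def by (rule Least_le) (use t in \<open>auto simp: w_def s_def\<close>)
  \<comment> \<open>Correctness is promised at the time \<open>t\<close> only. All processors have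
    halted by \<open>T \<le> t\<close>, so their registers no longer change and the result is
    already there at time \<open>T\<close>.\<close>
  have st: "stored s n regC (gen_matrix_prod f g n A B) (run w s f g P T c)"
    if i: "gmm_instance w s n f g A B c" for f g A B c
  proof -
    have "run w s f g P t c = run w s f g P (t - T) (run w s f g P T c)"
      unfolding run_def using Tt by (metis comp_apply funpow_add le_add_diff_inverse2)
    then have "run w s f g P t c q = run w s f g P T c q" if "q \<in> mesh s" for q
      using halted_run[OF T[OF i] that] by simp
    then show ?thesis
      using t[OF i] stored_cong[of s "run w s f g P t c" "run w s f g P T c"] by simp
  qed
  \<comment> \<open>The values are distinct, and they are words because they lie below
    \<open>n ^ 2 \<le> s ^ 3 < 2 ^ w\<close>.\<close>
  define A where "A = (\<lambda>i j. i * n + j)"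
  define g0 :: "nat \<Rightarrow> nat \<Rightarrow> nat" where "g0 = (\<lambda>_ _. 0)"
  let ?R = "\<lambda>g u c. run w s max g P u c"
  let ?N = "mesh (m + 2 * T) \<inter> mesh s"
  have lt: "i * n + j < n ^ 2" if "i < n" "j < n" for i j
    using that mult_le_mono1[of "Suc i" n n] by (simp add: power2_eq_square)
  have AW: "word_matrix w n A"
    unfolding word_matrix_def A_def using lt n' size by (meson order_less_le_trans order_less_trans)
  have max_ops: "word_ops w max g" if "\<And>x y. g x y \<le> 1" for g
  proof -
    have "g x y < 2 ^ w" for x y using that[of x y] w0 by linarith
    then show ?thesis by (simp add: word_ops_def max.assoc)
  qed
  have key: "\<exists>u<T. \<exists>q\<in>?N. query P (?R g0 u (placed s n A A)) q = Some (A i k, A k j)"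
    if ijk: "i < n" "j < n" "k < n" for i j k
  proof (rule ccontr)
    assume no: "\<not> (\<exists>u<T. \<exists>q\<in>?N. query P (?R g0 u (placed s n A A)) q = Some (A i k, A k j))"
    define g1 where "g1 = (\<lambda>x y. if x = A i k \<and> y = A k j then 1 else 0 :: nat)"
    \<comment> \<open>Chosen different from \<open>A i k\<close>, so that \<open>g1 e e = 0\<close>
      and the constant matrix has zero product under \<open>g1\<close> too.\<close>
    define e where "e = (if A i k = 0 then 1 else 0 :: nat)"
    have g0i: "gmm_instance w s n max g0 A A (placed s n A A)"
      using AW by (intro placed_instance n' n(1) max_ops) (simp_all add: g0_def)
    have g1i: "gmm_instance w s n max g1 A A (placed s n A A)"
      using AW by (intro placed_instance n' n(1) max_ops) (simp_all add: g1_def)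
    have ei: "gmm_instance w s n max g1 (\<lambda>_ _. e) (\<lambda>_ _. e) (placed s n (\<lambda>_ _. e) (\<lambda>_ _. e))"
      using w0 by (intro placed_instance n' n(1) max_ops) (simp_all add: g1_def word_matrix_def e_def)
    have c0: "gen_matrix_prod max g0 n A A i j = 0"
      by (simp add: gen_matrix_prod_def big_oplus_max(1) g0_def)
    have ce: "gen_matrix_prod max g1 n (\<lambda>_ _. e) (\<lambda>_ _. e) i j = 0"
      by (simp add: gen_matrix_prod_def big_oplus_max(1) g1_def e_def)
    have c1: "gen_matrix_prod max g1 n A A i j \<noteq> 0"
      unfolding gen_matrix_prod_def big_oplus_max(1) using ijk(3)
      by (auto intro!: exI[of _ k] simp: g1_def)
    obtain q where q: "q \<in> mesh s" "snd (?R g1 T (placed s n A A) q) regC = 1"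
      "snd (?R g1 T (placed s n A A) q) (regC + 1) = i" "snd (?R g1 T (placed s n A A) q) (regC + 2) = j"
      using st[OF g1i] ijk unfolding stored_def by blast
    have val: "snd (?R g1 T (placed s n A A) q) (regC + 3) \<noteq> 0"
    proof -
      have "snd (?R g1 T (placed s n A A) q) (regC + 3) = gen_matrix_prod max g1 n A A i j"
        using st[OF g1i] q unfolding stored_def by fastforce
      then show ?thesis using c1 by simp
    qed
    \<comment> \<open>A near processor depends only on cells in \<open>mesh (m + 2 * T)\<close>,
      where the altered pair is not queried, so it answers as under \<open>g0\<close>. A far one
      cannot have learnt the matrices, so it answers as for the constant matrix. Either answer is
      0.\<close>
    show False
    proof (cases "q \<in> mesh (m + T)")
      case True
      have "?R g0 T (placed s n A A) q = ?R g1 T (placed s n A A) q"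
      proof (rule run_inward[OF _ True q(1)])
        fix q' u x y
        assume "q' \<in> mesh (m + T + T)" "q' \<in> mesh s" "u < T"
          "query P (?R g0 u (placed s n A A)) q' = Some (x, y)"
        then have "(x, y) \<noteq> (A i k, A k j)" using no by (auto simp: mult_2 add.assoc)
        then show "g0 x y = g1 x y" by (auto simp: g0_def g1_def)
      qed
      then have "snd (?R g1 T (placed s n A A) q) (regC + 3) = gen_matrix_prod max g0 n A A i j"
        using st[OF g0i] q unfolding stored_def by fastforce
      then show False using val c0 by simp
    next
      case False
      have "?R g1 T (placed s n (\<lambda>_ _. e) (\<lambda>_ _. e)) q = ?R g1 T (placed s n A A) q"
        by (rule run_outward[OF _ q(1) False]) (use placed_outside m_def in blast)
      then have "snd (?R g1 T (placed s n A A) q) (regC + 3) =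
          gen_matrix_prod max g1 n (\<lambda>_ _. e) (\<lambda>_ _. e) i j"
        using st[OF ei] q unfolding stored_def by fastforce
      then show False using val ce by simp
    qed
  qed
  define Q where "Q = (\<lambda>(i, j, k). (A i k, A k j))"
  define H where "H = (\<lambda>(u, q). the (query P (?R g0 u (placed s n A A)) q))"
  let ?I = "{..<n} \<times> {..<n} \<times> {..<n}"
  have dec: "i = i' \<and> j = j'" if "i * n + j = i' * n + j'" "j < n" "j' < n" for i j i' j'
  proof -
    have "(a * n + c) div n = a \<and> (a * n + c) mod n = c" if "c < n" for a c
      using that by simp
    then show ?thesis using that by metis
  qed
  have "inj_on Q ?I"
  proof (rule inj_onI)
    fix p p' assume p: "p \<in> ?I" "p' \<in> ?I" "Q p = Q p'"
    obtain i j k where ijk: "p = (i, j, k)" by (metis prod_cases3)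
    obtain i' j' k' where ijk': "p' = (i', j', k')" by (metis prod_cases3)
    have "i * n + k = i' * n + k'" "k * n + j = k' * n + j'"
      using p(3) by (simp_all add: Q_def A_def ijk ijk')
    then show "p = p'" using p(1,2) dec[of i k i' k'] dec[of k j k' j'] by (simp add: ijk ijk')
  qed
  then have "card (Q ` ?I) = n ^ 3" by (simp add: card_image card_cartesian_product power3_eq_cube)
  moreover have "Q ` ?I \<subseteq> H ` ({..<T} \<times> ?N)"
  proof
    fix x assume "x \<in> Q ` ?I"
    then obtain i j k where ijk: "i < n" "j < n" "k < n" "x = (A i k, A k j)" by (auto simp: Q_def)
    from key[OF this(1-3)] obtain u q where u: "u < T" "q \<in> ?N"
      "query P (?R g0 u (placed s n A A)) q = Some (A i k, A k j)" by blast
    then have "x = H (u, q)" by (simp add: H_def ijk(4))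
    then show "x \<in> H ` ({..<T} \<times> ?N)" using u(1,2) by blast
  qed
  moreover have fin: "finite ?N" by (simp add: mesh_def)
  ultimately have "n ^ 3 \<le> card (H ` ({..<T} \<times> ?N))"
    by (metis card_mono finite_SigmaI finite_imageI finite_lessThan)
  also have "\<dots> \<le> card ({..<T} \<times> ?N)" using fin by (intro card_image_le) auto
  finally show ?thesis by (simp add: card_cartesian_product s_def)
qed

lemma card_mesh: "card (mesh k) = k ^ 3"
  by (simp add: mesh_def card_cartesian_product power3_eq_cube)

text \<open>The second bound does not mention the size of the mesh, which makes optimality hold for
  meshes of any size.\<close>

corollary run_time_ge:
  assumes "computes_gmm W S P" and "1 \<le> n" "n ^ 2 \<le> S n ^ 3" and "word_length W"
  shows "n ^ 3 \<le> run_time W S P n * S n ^ 3"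
    and "n ^ 3 \<le> run_time W S P n * (corner_side n + 2 * run_time W S P n) ^ 3"
proof -
  have fin: "finite (mesh k)" for k by (simp add: mesh_def)
  let ?N = "mesh (corner_side n + 2 * run_time W S P n) \<inter> mesh (S n)"
  have "card ?N \<le> S n ^ 3" "card ?N \<le> (corner_side n + 2 * run_time W S P n) ^ 3"
    using card_mono[OF fin, of ?N "S n"] card_mono[OF fin, of ?N "corner_side n + 2 * run_time W S P n"]
    by (simp_all add: card_mesh)
  then show "n ^ 3 \<le> run_time W S P n * S n ^ 3"
    "n ^ 3 \<le> run_time W S P n * (corner_side n + 2 * run_time W S P n) ^ 3"
    using query_count[OF assms] by (meson mult_le_mono2 order_trans)+
qed

text \<open>The case \<open>n = 1\<close> is separate, since the mesh may then be a single processor with words of one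
  bit, which do not hold the constants of \<open>main\<close>.\<close>

definition product_cmd :: cmd where
  "product_cmd =
     Block [Const 140 1, Arith Eq 141 4 140, Arith Sub 142 140 141] ;;
     Loop 141 (Block [Otimes 16 8 12, Move 13 5]) ;;
     Loop 142 main"

definition product_program :: program where
  "product_program = comp 0 product_cmd"

section \<open>The complete program on the machine\<close>

lemma writes_tile:
  "set (writes (tile ti tj)) \<subseteq> {20..93} \<union> {100, 101, 110, 111, 112, 113, 120, 121, 122, 123, 124, 125}"
  unfolding tile_def writes.simps(2) set_append
  by (intro Un_least order_trans[OF writes_half] order_trans[OF writes_append_packets]; auto simp: pack_def)

lemma writes_main: "142 \<notin> set (writes main)"
proof -
  have "set (writes main) \<subseteq> {13..93} \<union> {100, 101} \<union> {110..135}"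
    unfolding main_def writes.simps(2) set_append
    by (intro Un_least order_trans[OF writes_prelude] order_trans[OF writes_tile]; auto)
  then show ?thesis by auto
qed

lemma well_formed_gather: "well_formed (gather d)"
  by (simp add: code_defs scalar_def)

lemma well_formed_routes: "well_formed (route_minor_first a b c)" "well_formed (route_major_first a b c)"
  unfolding route_minor_first_def route_major_first_def
  by (simp_all add: well_formed_gather minor_target_def middle_target_def major_target_def scalar_def)

lemma well_formed_scan: "well_formed (scan d)"
  by (simp add: scan_def add_flow_def shift_def scalar_def)

lemma well_formed_append_packets: "well_formed (append_packets a b c)"
  unfolding append_packets_def
  by (simp add: well_formed_scan well_formed_routes scalar_def)

lemma well_formed_radix_sort: "well_formed (radix_sort a b c)"
proof -
  have "113 \<notin> set (writes (radix_pass a b c))" using writes_radix_pass[of a b c] by auto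
  then show ?thesis
    by (simp add: radix_sort_def radix_pass_def well_formed_append_packets scalar_def)
qed

lemma well_formed_load: "r < 50 \<Longrightarrow> well_formed (load r a b c)"
  unfolding load_def by (simp add: well_formed_radix_sort well_formed_routes scalar_def)

lemma well_formed_multiply: "well_formed multiply"
proof -
  have "124 \<notin> set (writes tick)" using writes_tick by auto
  then show ?thesis
    by (simp add: multiply_def start_ticks_def tick_def tick_defs shift_def scalar_def)
qed

lemma well_formed_main: "well_formed main"
  by (simp add: main_def prelude_def tile_def half_def pack_def well_formed_load well_formed_multiply
      well_formed_append_packets scalar_def)

lemma well_formed_product: "well_formed product_cmd"
  using writes_main by (simp add: product_cmd_def well_formed_main scalar_def)

text \<open>The number of bits \<open>L\<close> is known only existentially; this bound depends on
  \<open>s\<close> alone and makes the cost a function of \<open>s\<close> and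
  \<open>n\<close>.\<close>

definition log_cost :: "nat \<Rightarrow> nat" where
  "log_cost s = nat \<lfloor>log 2 (real (s * s * s))\<rfloor> + 1"

definition total_cost :: "nat \<Rightarrow> nat \<Rightarrow> nat" where
  "total_cost s n = 4 * tile_cost s n (log_cost s) + 45 * s + 40"

lemma log_cost: "2 ^ (L - 1) \<le> s * s * s \<Longrightarrow> L \<le> log_cost s"
proof -
  assume le: "2 ^ (L - 1) \<le> s * s * s"
  then have pos: "0 < s * s * s" by (metis le_zero_eq not_gr_zero power_not_zero zero_neq_numeral)
  have "real (2 ^ (L - 1)) \<le> real (s * s * s)" using le by (simp only: of_nat_le_iff)
  then have "log 2 (2 ^ (L - 1)) \<le> log 2 (real (s * s * s))" using pos by (intro log_mono) auto
  then have "real (L - 1) \<le> log 2 (real (s * s * s))" by simp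
  then have "L - 1 \<le> nat \<lfloor>log 2 (real (s * s * s))\<rfloor>" by (rule le_nat_floor)
  then show ?thesis by (simp add: log_cost_def)
qed

lemma tile_cost_mono: "L \<le> L' \<Longrightarrow> tile_cost s n L \<le> tile_cost s n L'"
  unfolding tile_cost_def by (intro add_mono mult_le_mono) auto

lemma gmm_instanceD:
  assumes "gmm_instance w s n f g A B c" and "q \<in> mesh s"
  shows "fst (c q) = 0" "snd (c q) 0 = crd 0 q" "snd (c q) 1 = crd 1 q" "snd (c q) 2 = crd 2 q"
    "snd (c q) 3 = s" "snd (c q) 4 = n" "\<forall>r\<ge>regC. snd (c q) r = 0"
proof -
  obtain x y z where q: "q = (x, y, z)" by (metis prod_cases3)
  have *: "fst (c (x, y, z)) = 0 \<and>
        snd (c (x, y, z)) 0 = x \<and> snd (c (x, y, z)) 1 = y \<and> snd (c (x, y, z)) 2 = z \<and>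
        snd (c (x, y, z)) 3 = s \<and> snd (c (x, y, z)) 4 = n \<and>
        (\<forall>r\<ge>regC. snd (c (x, y, z)) r = 0)"
    using assms unfolding q gmm_instance_def initial_input_def by blast
  then show "fst (c q) = 0" "snd (c q) 0 = crd 0 q" "snd (c q) 1 = crd 1 q" "snd (c q) 2 = crd 2 q"
    "snd (c q) 3 = s" "snd (c q) 4 = n" "\<forall>r\<ge>regC. snd (c q) r = 0"
    unfolding q by simp_all
qed

context machine
begin

lemma run_product:
  assumes inst: "gmm_instance w s n f g A B c" and n: "n < 2 ^ w" "s < 2 ^ w"
    and wf: "well_formed product_cmd"
    and cost: "time product_cmd (\<lambda>q. snd (c q)) \<le> T"
    and res: "stored s n regC (gen_matrix_prod f g n A B)
      (\<lambda>q. (0, den product_cmd (\<lambda>q. snd (c q)) q))"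
  shows "halted s product_program (run w s f g product_program T c)"
    and "stored s n regC (gen_matrix_prod f g n A B) (run w s f g product_program T c)"
proof -
  let ?\<sigma> = "\<lambda>q. snd (c q)" and ?P = product_program
  have init: "fst (c q) = 0 \<and> snd (c q) 3 = s \<and> snd (c q) 4 = n \<and> (\<forall>r\<ge>regC. snd (c q) r = 0)"
    if "q \<in> mesh s" for q
    using gmm_instanceD[OF inst that] by blast
  have s0: "sync (length []) ?\<sigma> c" using init by (auto simp: sync_def prod_eq_iff)
  \<comment> \<open>Registers 3 and 4 hold the given \<open>s\<close> and \<open>n\<close>, and all
    other scalars start as 0.\<close>
  have uni: "uniform ?\<sigma>"
    unfolding uniform_def
  proof (intro allI impI conjI ballI)
    fix r assume "scalar r"
    then have "r = 3 \<or> r = 4 \<or> regC \<le> r" by (auto simp: scalar_def)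
    then show "snd (c (0, 0, 0)) r < 2 ^ w" "\<And>q. q \<in> mesh s \<Longrightarrow> snd (c q) r = snd (c (0, 0, 0)) r"
      using init origin_mesh n by fastforce+
  qed
  have P: "?P = [] @ comp (length []) product_cmd @ []" by (simp add: product_program_def)
  have fin: "sync (length ?P) (den product_cmd ?\<sigma>) (go ?P (time product_cmd ?\<sigma>) c)"
    using go_comp[OF s0 P wf uni] by (simp add: product_program_def)
  define c' where "c' = go ?P (time product_cmd ?\<sigma>) c"
  have h: "halted s ?P c'" using fin by (simp add: halted_def sync_def c'_def)
  have run: "go ?P T c = go ?P (T - time product_cmd ?\<sigma>) c'"
    using cost go_add[of ?P "time product_cmd ?\<sigma>" "T - time product_cmd ?\<sigma>" c] by (simp add: c'_def)
  have eq: "go ?P T c q = (length ?P, den product_cmd ?\<sigma> q)" if "q \<in> mesh s" for q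
    using halted_run[OF h that] fin that unfolding run by (simp add: sync_def c'_def)
  show "halted s ?P (go ?P T c)" using eq by (simp add: halted_def)
  show "stored s n regC (gen_matrix_prod f g n A B) (go ?P T c)"
    using res stored_cong[of s "go ?P T c" "\<lambda>q. (0, den product_cmd ?\<sigma> q)"] eq by simp
qed

lemma dec_once:
  "101 < r \<Longrightarrow> \<sigma> (0, 0, 0) r = 1 \<Longrightarrow> den (Loop r c) \<sigma> = dec r (den c \<sigma>)"
  by simp

lemma dec_none: "\<sigma> (0, 0, 0) r = 0 \<Longrightarrow> den (Loop r c) \<sigma> = \<sigma>"
  by simp

end

text \<open>The counters 141 and 142 are complementary and at most 1, so the two loops act as a
  conditional on \<open>n = 1\<close>.\<close>

lemma run_product_program:
  assumes inst: "gmm_instance w s n f g A B c" and n: "1 \<le> n" "n ^ 2 \<le> s ^ 3"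
    and s: "s * s * s < 2 ^ w" "n = 1 \<Longrightarrow> s = 1"
  shows "halted s product_program (run w s f g product_program (total_cost s n) c)"
    and "stored s n regC (gen_matrix_prod f g n A B)
      (run w s f g product_program (total_cost s n) c)"
proof -
  let ?\<sigma> = "\<lambda>q. snd (c q)"
  have s0: "0 < s" using n by (cases s) auto
  have w0: "0 < w" using s s0 by (cases w) auto
  interpret machine w s f g by unfold_locales (fact w0 s0)+
  have s_le: "s \<le> s * s * s" by simp
  then have sw: "s < 2 ^ w" using s(1) by linarith
  have nw: "n < 2 ^ w"
  proof -
    have "n \<le> n * n" by simp
    moreover have "n * n \<le> s * s * s" using n(2) by (simp add: power2_eq_square power3_eq_cube)
    ultimately show ?thesis using s(1) by linarith
  qed
  have one: "(1::nat) mod 2 ^ w = 1" using w0 by (intro mod_less one_less_power) auto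
  have init: "snd (c q) d = crd d q" if "q \<in> mesh s" "d < 3" for q d
    using gmm_instanceD(2-4)[OF inst that(1)] that(2)
    by (auto simp: numeral_3_eq_3 numeral_2_eq_2 less_Suc_eq)
  have init': "snd (c q) 3 = s" "snd (c q) 4 = n" "\<forall>r\<ge>regC. snd (c q) r = 0" if "q \<in> mesh s" for q
    using gmm_instanceD[OF inst that] by blast+
  have st: "stored s n regA A c" "stored s n regB B c"
    and co: "\<And>q b. q \<in> mesh s \<Longrightarrow> b \<in> {regA, regB} \<Longrightarrow> snd (c q) b = 1 \<Longrightarrow> q \<in> mesh (corner_side n)"
    using inst unfolding gmm_instance_def initial_input_def by blast+
  define \<sigma>1 where "\<sigma>1 = den (Block [Const 140 1, Arith Eq 141 4 140, Arith Sub 142 140 141]) ?\<sigma>"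
  define \<sigma>2 where "\<sigma>2 = den (Loop 141 (Block [Otimes 16 8 12, Move 13 5])) \<sigma>1"
  have den: "den product_cmd ?\<sigma> = den (Loop 142 main) \<sigma>2"
    by (simp only: product_cmd_def den.simps(2) \<sigma>1_def \<sigma>2_def)
  have time: "time product_cmd ?\<sigma> = 3 + (time (Loop 141 (Block [Otimes 16 8 12, Move 13 5])) \<sigma>1 +
      time (Loop 142 main) \<sigma>2)"
    unfolding product_cmd_def time.simps(2) \<sigma>1_def[symmetric] \<sigma>2_def[symmetric] by simp
  have v1: "\<sigma>1 q 141 = of_bool (n = 1)" "\<sigma>1 q 142 = of_bool (n \<noteq> 1)" if "q \<in> mesh s" for q
    using init'[OF that] one by (auto simp: \<sigma>1_def sem_apply)
  have fr1: "\<sigma>1 q r = snd (c q) r" if "r < 140" for q r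
    using that by (simp add: \<sigma>1_def sem_apply)
  have "stored s n regC (gen_matrix_prod f g n A B) (\<lambda>q. (0, den product_cmd ?\<sigma> q)) \<and>
      time product_cmd ?\<sigma> \<le> total_cost s n \<and> well_formed product_cmd"
  proof (cases "n = 1")
    case True
    then have s1: "s = 1" and n1: "n = 1" using s(2) by auto
    have q0: "q = (0, 0, 0)" if "q \<in> mesh s" for q using that s1 by (cases q) (auto simp: mesh_def)
    have o: "(0, 0, 0) \<in> mesh s" by (rule origin_mesh)
    have A0: "snd (c (0, 0, 0)) 5 = 1" "snd (c (0, 0, 0)) 8 = A 0 0"
    proof -
      have "\<exists>q. q \<in> mesh s \<and> snd (c q) 5 = 1" using st(1) n1 unfolding stored_def by blast
      then show a: "snd (c (0, 0, 0)) 5 = 1" using q0 by metis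
      then show "snd (c (0, 0, 0)) 8 = A 0 0" using st(1) o n1 unfolding stored_def by fastforce
    qed
    have B0: "snd (c (0, 0, 0)) 12 = B 0 0"
    proof -
      have "\<exists>q. q \<in> mesh s \<and> snd (c q) 9 = 1" using st(2) n1 unfolding stored_def by blast
      then have "snd (c (0, 0, 0)) 9 = 1" using q0 by metis
      then show "snd (c (0, 0, 0)) 12 = B 0 0" using st(2) o n1 unfolding stored_def by fastforce
    qed
    have \<sigma>2: "\<sigma>2 = dec 141 (den (Block [Otimes 16 8 12, Move 13 5]) \<sigma>1)"
      unfolding \<sigma>2_def using v1(1)[OF o] n1 by (intro dec_once) simp_all
    have z: "\<sigma>2 (0, 0, 0) 142 = 0"
      using v1(2)[OF o] n1 unfolding \<sigma>2 by (simp add: dec_apply sem_apply)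
    have fin: "den product_cmd ?\<sigma> = \<sigma>2" unfolding den using z by (rule dec_none)
    \<comment> \<open>The untouched registers 14 and 15 are 0, which is the index pair of the only
      entry.\<close>
    have c0: "snd (c (0, 0, 0)) 14 = 0" "snd (c (0, 0, 0)) 15 = 0" using init'(3)[OF o] by simp_all
    have r: "\<sigma>2 (0, 0, 0) 13 = 1" "\<sigma>2 (0, 0, 0) 14 = 0" "\<sigma>2 (0, 0, 0) 15 = 0" "\<sigma>2 (0, 0, 0) 16 = g (A 0 0) (B 0 0)"
      using A0 B0 c0 unfolding \<sigma>2 by (simp_all add: dec_apply sem_apply fr1)
    have "stored s n regC (gen_matrix_prod f g n A B) (\<lambda>q. (0, \<sigma>2 q))"
      unfolding stored_def
    proof (intro conjI ballI allI impI)
      fix q assume "q \<in> mesh s"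
      then have "q = (0, 0, 0)" by (rule q0)
      then show "snd (0, \<sigma>2 q) regC = 0 \<or> snd (0, \<sigma>2 q) regC = 1 \<and> snd (0, \<sigma>2 q) (regC + 1) < n \<and>
          snd (0, \<sigma>2 q) (regC + 2) < n \<and> snd (0, \<sigma>2 q) (regC + 3) =
          gen_matrix_prod f g n A B (snd (0, \<sigma>2 q) (regC + 1)) (snd (0, \<sigma>2 q) (regC + 2))"
        using r n1 by (simp add: gen_matrix_prod_def)
    next
      fix i j assume "i < n" "j < n"
      then have ij: "i = 0" "j = 0" using n1 by auto
      show "\<exists>!q. q \<in> mesh s \<and> snd (0, \<sigma>2 q) regC = 1 \<and> snd (0, \<sigma>2 q) (regC + 1) = i \<and> snd (0, \<sigma>2 q) (regC + 2) = j"
      proof (rule ex1I[of _ "(0, 0, 0)"])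
        show "(0, 0, 0) \<in> mesh s \<and> snd (0, \<sigma>2 (0, 0, 0)) regC = 1 \<and>
            snd (0, \<sigma>2 (0, 0, 0)) (regC + 1) = i \<and> snd (0, \<sigma>2 (0, 0, 0)) (regC + 2) = j"
          using r o ij by simp
      qed (use q0 in blast)
    qed
    moreover have "time product_cmd ?\<sigma> \<le> total_cost s n"
      using z v1(1)[OF o] n1 unfolding time by (simp add: total_cost_def)
    ultimately show ?thesis using well_formed_product by (simp add: fin)
  next
    case False
    then have n2: "2 \<le> n" using n by simp
    have s2: "2 \<le> s"
    proof (rule ccontr)
      assume "\<not> 2 \<le> s"
      then have "s = 1" using s0 by simp
      moreover have "2 ^ 2 \<le> n ^ 2" using n2 by (intro power_mono) auto
      ultimately show False using n(2) by simp
    qed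
    interpret word_machine w s f g by unfold_locales (fact s(1) s2)+
    have \<sigma>2: "\<sigma>2 = \<sigma>1" unfolding \<sigma>2_def using v1(1)[OF origin_mesh] False by (intro dec_none) simp
    have fin: "den product_cmd ?\<sigma> = dec 142 (den main \<sigma>1)"
      unfolding den \<sigma>2 using v1(2)[OF origin_mesh] False by (intro dec_once) simp_all
    have loc: "located \<sigma>1" unfolding located_def using init by (simp add: fr1)
    have P: "\<sigma>1 q 3 = s \<and> \<sigma>1 q 4 = n" if "q \<in> mesh s" for q using init'[OF that] by (simp add: fr1)
    have st': "stored s n 5 A (\<lambda>q. (0, \<sigma>1 q))" "stored s n 9 B (\<lambda>q. (0, \<sigma>1 q))"
      using st by (simp_all add: stored_def fr1)
    have co': "q \<in> mesh (corner_side n)" if "q \<in> mesh s" "\<sigma>1 q 5 = 1 \<or> \<sigma>1 q 9 = 1" for q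
      using co[OF that(1)] that(2) by (auto simp: fr1)
    have ops: "word_ops w f g" "word_matrix w n A" "word_matrix w n B"
      using inst by (simp_all add: gmm_instance_def)
    note main = den_main[OF n2 n(2) ops loc P st' co']
    have "stored s n regC (gen_matrix_prod f g n A B) (\<lambda>q. (0, den product_cmd ?\<sigma> q))"
      using main(1)[where pc = 0] unfolding fin by (simp add: stored_def dec_frame)
    moreover obtain L where L: "2 ^ (L - 1) \<le> s * s * s" "time main \<sigma>1 \<le> 4 * tile_cost s n L + 45 * s + 25"
      using main(2) by blast
    have "time product_cmd ?\<sigma> \<le> total_cost s n"
    proof -
      have "time product_cmd ?\<sigma> = 3 + (1 + (time main \<sigma>1 + 5 + 1))"
        using v1[OF origin_mesh] False unfolding time \<sigma>2 by simp
      then show ?thesis using L(2) tile_cost_mono[OF log_cost[OF L(1)], of s n] by (simp add: total_cost_def)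
    qed
    ultimately show ?thesis using well_formed_product by blast
  qed
  then show "halted s product_program (run w s f g product_program (total_cost s n) c)"
    "stored s n regC (gen_matrix_prod f g n A B) (run w s f g product_program (total_cost s n) c)"
    using run_product[OF inst nw sw] by blast+
qed

section \<open>Asymptotics\<close>

lemma powr_cube: "0 < x \<Longrightarrow> ((x::real) powr a) ^ 3 = x powr (3 * a)"
  by (simp add: power3_eq_cube powr_add[symmetric])

text \<open>The factor 2 absorbs the rounding, as
  \<open>real n powr \<beta> \<ge> 1\<close>.\<close>

lemma ceiling_powr_bounds:
  fixes n :: nat and \<beta> :: real
  assumes "1 \<le> n" and "0 \<le> \<beta>"
  defines "k \<equiv> nat \<lceil>real n powr \<beta>\<rceil>"
  shows "real n powr \<beta> \<le> real k" and "real k \<le> 2 * real n powr \<beta>"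
proof -
  have ge: "1 \<le> real n powr \<beta>" using assms by (simp add: ge_one_powr_ge_zero)
  then have k: "real k = of_int \<lceil>real n powr \<beta>\<rceil>" unfolding k_def by simp
  show "real n powr \<beta> \<le> real k" unfolding k by simp
  show "real k \<le> 2 * real n powr \<beta>"
    unfolding k using ge of_int_ceiling_le_add_one[of "real n powr \<beta>"] by linarith
qed

lemma corner_side_powr:
  assumes "1 \<le> n"
  shows "real (corner_side n) \<le> 2 * real n powr (2 / 3)"
proof -
  define k where "k = nat \<lceil>real n powr (2 / 3)\<rceil>"
  note k = ceiling_powr_bounds[OF assms, of "2 / 3", folded k_def]
  have "real (n ^ 2) = (real n powr (2 / 3)) ^ 3" using assms by (simp add: powr_cube powr_numeral)
  also have "\<dots> \<le> real k ^ 3" using k(1) by (intro power_mono) auto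
  finally have "n ^ 2 \<le> k ^ 3" by (simp only: of_nat_power[symmetric] of_nat_le_iff)
  then have "corner_side n \<le> k" unfolding corner_side_def by (rule Least_le)
  then show ?thesis using k(2) by simp
qed

context
  fixes \<alpha> :: real and n :: nat
  assumes \<alpha>: "2 \<le> \<alpha>" "\<alpha> \<le> 9 / 4" and n: "1 \<le> n"
begin

private abbreviation (input) "s \<equiv> mesh_side \<alpha> n"
private abbreviation (input) "x \<equiv> real n"

lemma mesh_side_bounds: "x powr (\<alpha> / 3) \<le> real s" "real s \<le> 2 * x powr (\<alpha> / 3)"
  using ceiling_powr_bounds[OF n, of "\<alpha> / 3"] \<alpha> by (simp_all add: mesh_side_def)

lemma mesh_side_large: "n ^ 2 \<le> s ^ 3"
proof -
  have "real (n ^ 2) = x powr 2" using n by (simp add: powr_numeral)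
  also have "\<dots> \<le> x powr \<alpha>" using n \<alpha> by (intro powr_mono) auto
  also have "\<dots> = (x powr (\<alpha> / 3)) ^ 3" using n by (simp add: powr_cube)
  also have "\<dots> \<le> real s ^ 3" using mesh_side_bounds(1) by (intro power_mono) auto
  finally show ?thesis by (simp only: of_nat_power[symmetric] of_nat_le_iff)
qed

lemma mesh_side_le: "s \<le> n"
proof -
  have "x powr (\<alpha> / 3) \<le> x powr 1" using n \<alpha> by (intro powr_mono) auto
  then have "x powr (\<alpha> / 3) \<le> x" by simp
  then show ?thesis by (simp add: mesh_side_def)
qed

text \<open>\<open>\<alpha> \<le> 9 / 4\<close> means \<open>3 / 4 \<le> 3 - \<alpha>\<close>; this
  absorbs the costs of transport and of sorting.\<close>

lemma powr_le_time:
  assumes "\<beta> \<le> 3 / 4"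
  shows "x powr \<beta> \<le> x powr (3 - \<alpha>)"
  using n \<alpha> assms by (intro powr_mono) auto

text \<open>The exponent \<open>1 / 12\<close> is what remains between the \<open>2 / 3\<close> of
  the corner side and the available \<open>3 / 4\<close>. The 36 is \<open>3 * 12\<close>, from the
  logarithm of \<open>n ^ 3\<close> and from \<open>ln x \<le> 12 * x powr (1 / 12)\<close>.\<close>

lemma log_cost_powr: "real (log_cost s) \<le> (36 / ln 2 + 1) * x powr (1 / 12)"
proof -
  have s0: "0 < s" using mesh_side_large n by (cases s) auto
  have "log 2 (real (s * s * s)) \<le> log 2 (x ^ 3)"
  proof -
    have "s * s * s \<le> n ^ 3" using mesh_side_le by (simp add: power3_eq_cube mult_le_mono)
    then have "real (s * s * s) \<le> x ^ 3" by (simp only: of_nat_power[symmetric] of_nat_le_iff)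
    then show ?thesis using s0 by (intro log_mono) auto
  qed
  also have "log 2 (x ^ 3) = 3 * ln x / ln 2" using n by (simp add: log_def ln_realpow)
  also have "\<dots> \<le> 3 * (x powr (1 / 12) / (1 / 12)) / ln 2"
    using n ln_powr_bound[of x "1 / 12"] by (intro divide_right_mono mult_left_mono) auto
  finally have "log 2 (real (s * s * s)) \<le> 36 / ln 2 * x powr (1 / 12)" by simp
  moreover have "real (log_cost s) \<le> log 2 (real (s * s * s)) + 1"
  proof -
    have "0 \<le> log 2 (real (s * s * s))" using s0 by (simp add: zero_le_log_cancel_iff Suc_leI flip: of_nat_mult)
    then show ?thesis by (simp add: log_cost_def)
  qed
  moreover have "1 \<le> x powr (1 / 12)" using n by (simp add: ge_one_powr_ge_zero)
  ultimately show ?thesis by (simp add: algebra_simps)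
qed

text \<open>The tile side is at most the rounded up \<open>n / s\<close>, hence at most
  \<open>2 * n powr (1 - \<alpha> / 3)\<close>. Its cube is the number of operand indices in one run
  of the pipeline.\<close>

lemma tile_side_powr: "real (tile_side n s) ^ 3 \<le> 8 * x powr (3 - \<alpha>)"
proof -
  have s0: "0 < s" using mesh_side_large n by (cases s) auto
  define c where "c = (n + s - 1) div s"
  have "c * s \<le> n + s - 1" unfolding c_def by (metis div_times_less_eq_dividend)
  then have "c * s \<le> 2 * n" using mesh_side_le by linarith
  then have "real (c * s) \<le> real (2 * n)" by (rule of_nat_mono)
  then have "real c * real s \<le> 2 * x" by simp
  moreover have "real c * x powr (\<alpha> / 3) \<le> real c * real s"
    using mesh_side_bounds(1) by (intro mult_left_mono) auto
  ultimately have "real c * x powr (\<alpha> / 3) \<le> 2 * x" by linarith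
  moreover have "0 < x powr (\<alpha> / 3)" using n by simp
  ultimately have "real c \<le> 2 * x / x powr (\<alpha> / 3)" by (simp add: field_simps)
  also have "\<dots> = 2 * x powr (1 - \<alpha> / 3)" using n by (simp add: powr_diff)
  finally have c: "real c \<le> 2 * x powr (1 - \<alpha> / 3)" .
  have "1 \<le> c" using n s0 by (simp add: c_def div_greater_zero_iff Suc_le_eq)
  then have "tile_side n s \<le> c" unfolding tile_side_def c_def[symmetric] by linarith
  then have "real (tile_side n s) \<le> 2 * x powr (1 - \<alpha> / 3)" using c by linarith
  then have "real (tile_side n s) ^ 3 \<le> (2 * x powr (1 - \<alpha> / 3)) ^ 3" by (intro power_mono) auto
  also have "\<dots> = 8 * x powr (3 - \<alpha>)" using n by (simp add: power_mult_distrib powr_cube algebra_simps)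
  finally show ?thesis .
qed

lemma total_cost_powr:
  "real (total_cost s n) \<le> (16 * (1214 * (36 / ln 2 + 1) + 699) + 16446) * x powr (3 - \<alpha>)"
proof -
  define X where "X = x powr (3 - \<alpha>)"
  define k where "k = 36 / ln 2 + (1::real)"
  define Lm where "Lm = real (log_cost s) * real (corner_side n)"
  have X1: "1 \<le> X" unfolding X_def using n \<alpha> by (simp add: ge_one_powr_ge_zero)
  have sX: "real s \<le> 2 * X"
    unfolding X_def using mesh_side_bounds(2) powr_le_time[of "\<alpha> / 3"] \<alpha> by simp
  have bX: "real (tile_side n s) * real (tile_side n s) * real (tile_side n s) \<le> 8 * X"
    unfolding X_def using tile_side_powr by (simp add: power3_eq_cube)
  have LmX: "Lm \<le> 2 * k * X"
  proof -
    have "Lm \<le> (k * x powr (1 / 12)) * (2 * x powr (2 / 3))"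
      unfolding Lm_def k_def using log_cost_powr corner_side_powr[OF n] by (intro mult_mono) auto
    also have "\<dots> = 2 * k * x powr (3 / 4)" using n by (simp add: powr_add[symmetric])
    also have "\<dots> \<le> 2 * k * X"
      unfolding X_def using powr_le_time[of "3 / 4"] by (intro mult_left_mono) (auto simp: k_def)
    finally show ?thesis .
  qed
  \<comment> \<open>Positivity of the corner side lets the bound on \<open>Lm\<close> cover the bare
    logarithm as well.\<close>
  have "1 \<le> corner_side n"
  proof (rule ccontr)
    assume "\<not> 1 \<le> corner_side n"
    then have "corner_side n = 0" by simp
    then show False using corner_side_bound[of n] n by simp
  qed
  then have LX: "real (log_cost s) \<le> 2 * k * X"
    using LmX mult_left_mono[of 1 "real (corner_side n)" "real (log_cost s)"] by (simp add: Lm_def)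
  have "real (total_cost s n) = 16 * (372 * Lm + 235 * real (log_cost s) + 264 * real s + 171) +
      8 * ((real (tile_side n s) * real (tile_side n s) * real (tile_side n s) + 5 * real s) * 98 + 23) +
      744 * real s + 532 + 45 * real s + 40"
    by (simp add: total_cost_def tile_cost_def Lm_def algebra_simps)
  also have "\<dots> \<le> 16 * (372 * (2 * k * X) + 235 * (2 * k * X) + 264 * (2 * X) + 171 * X) +
      8 * ((8 * X + 5 * (2 * X)) * 98 + 23 * X) + 744 * (2 * X) + 532 * X + 45 * (2 * X) + 40 * X"
    using LmX LX sX bX X1 by (intro add_mono mult_left_mono mult_right_mono) auto
  also have "\<dots> = (16 * (1214 * k + 699) + 16446) * X" by (simp add: algebra_simps)
  finally show ?thesis unfolding k_def X_def .
qed

end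

lemma computes_product_program:
  assumes "2 \<le> \<alpha>" "\<alpha> \<le> 9 / 4" "word_length W"
  shows "computes_gmm W (mesh_side \<alpha>) product_program"
    and "1 \<le> n \<Longrightarrow> run_time W (mesh_side \<alpha>) product_program n \<le> total_cost (mesh_side \<alpha> n) n"
proof -
  have *: "halted (mesh_side \<alpha> n) product_program
      (run (W (mesh_side \<alpha> n ^ 3)) (mesh_side \<alpha> n) f g product_program (total_cost (mesh_side \<alpha> n) n) c) \<and>
    stored (mesh_side \<alpha> n) n regC (gen_matrix_prod f g n A B)
      (run (W (mesh_side \<alpha> n ^ 3)) (mesh_side \<alpha> n) f g product_program (total_cost (mesh_side \<alpha> n) n) c)"
    if n: "1 \<le> n" and i: "gmm_instance (W (mesh_side \<alpha> n ^ 3)) (mesh_side \<alpha> n) n f g A B c" for n f g A B c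
  proof -
    have "mesh_side \<alpha> n ^ 3 < 2 ^ W (mesh_side \<alpha> n ^ 3)" using assms(3) by (simp add: word_length_def)
    then have s: "mesh_side \<alpha> n * mesh_side \<alpha> n * mesh_side \<alpha> n < 2 ^ W (mesh_side \<alpha> n ^ 3)"
      by (simp add: power3_eq_cube)
    have "n = 1 \<Longrightarrow> mesh_side \<alpha> n = 1" by (simp add: mesh_side_def)
    then show ?thesis
      using run_product_program[OF i n mesh_side_large[OF assms(1,2) n] s] by blast
  qed
  show "computes_gmm W (mesh_side \<alpha>) product_program"
    unfolding computes_gmm_def using * by blast
  show "run_time W (mesh_side \<alpha>) product_program n \<le> total_cost (mesh_side \<alpha> n) n" if "1 \<le> n"
    unfolding run_time_def by (rule Least_le) (use * that in blast)
qed

lemma product_program_theta: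
  assumes "2 \<le> \<alpha>" "\<alpha> \<le> 9 / 4" "word_length W"
  shows "(\<lambda>n. real (run_time W (mesh_side \<alpha>) product_program n)) \<in> \<Theta>(\<lambda>n. real n powr (3 - \<alpha>))"
proof (rule bigthetaI)
  let ?T = "\<lambda>n. run_time W (mesh_side \<alpha>) product_program n"
  define C where "C = 16 * (1214 * (36 / ln 2 + 1) + 699) + (16446 :: real)"
  show "(\<lambda>n. real (?T n)) \<in> O(\<lambda>n. real n powr (3 - \<alpha>))"
  proof (rule bigoI[of _ C], rule eventually_at_top_linorderI[of 1])
    fix n :: nat assume n: "1 \<le> n"
    have "real (?T n) \<le> real (total_cost (mesh_side \<alpha> n) n)"
      using computes_product_program(2)[OF assms n] by simp
    also have "\<dots> \<le> C * real n powr (3 - \<alpha>)"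
      unfolding C_def by (rule total_cost_powr[OF assms(1,2) n])
    finally show "norm (real (?T n)) \<le> C * norm (real n powr (3 - \<alpha>))" by simp
  qed
  \<comment> \<open>The queries fill \<open>T * s ^ 3\<close> slots at most. The constant
    \<open>1 / 8\<close> is the cube of the rounding factor in
    \<open>s \<le> 2 * n powr (\<alpha> / 3)\<close>.\<close>
  show "(\<lambda>n. real (?T n)) \<in> \<Omega>(\<lambda>n. real n powr (3 - \<alpha>))"
  proof (rule landau_omega.bigI[of "1 / 8"], simp, rule eventually_at_top_linorderI[of 1])
    fix n :: nat assume n: "1 \<le> n"
    let ?x = "real n"
    have "n ^ 3 \<le> ?T n * mesh_side \<alpha> n ^ 3"
      by (rule run_time_ge(1)[OF computes_product_program(1)[OF assms] n
            mesh_side_large[OF assms(1,2) n] assms(3)])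
    then have "?x ^ 3 \<le> real (?T n) * real (mesh_side \<alpha> n) ^ 3"
      by (simp only: of_nat_power[symmetric] of_nat_mult[symmetric] of_nat_le_iff)
    also have "\<dots> \<le> real (?T n) * (2 * ?x powr (\<alpha> / 3)) ^ 3"
      using mesh_side_bounds(2)[OF assms(1,2) n] by (intro mult_left_mono power_mono) auto
    also have "\<dots> = real (?T n) * 8 * ?x powr \<alpha>" using n by (simp add: power_mult_distrib powr_cube)
    finally have "?x ^ 3 \<le> real (?T n) * 8 * ?x powr \<alpha>" .
    moreover have "?x ^ 3 = ?x powr (3 - \<alpha>) * ?x powr \<alpha>"
      using n by (simp add: powr_add[symmetric] powr_numeral)
    moreover have "0 < ?x powr \<alpha>" using n by simp
    ultimately have "?x powr (3 - \<alpha>) \<le> real (?T n) * 8" by (simp only: mult_le_cancel_right_pos)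
    then show "1 / 8 * norm (?x powr (3 - \<alpha>)) \<le> norm (real (?T n))" by simp
  qed
qed

text \<open>If \<open>T\<close> were much smaller than \<open>n powr (3 / 4)\<close>, all queries
  would fall into a cube of side \<open>O(n powr (3 / 4))\<close>, because
  \<open>corner_side n\<close> is only \<open>O(n powr (2 / 3))\<close>. Within \<open>T\<close>
  steps that cube cannot make \<open>n ^ 3\<close> queries.\<close>

lemma run_time_omega:
  assumes S: "\<forall>n\<ge>1. n ^ 2 \<le> S n ^ 3" and P: "computes_gmm W S P" and W: "word_length W"
  shows "(\<lambda>n. real (run_time W S P n)) \<in> \<Omega>(\<lambda>n. real n powr (3 / 4))"
proof (rule landau_omega.bigI[of "1 / 64"], simp, rule eventually_at_top_linorderI[of 1])
  fix n :: nat assume n: "1 \<le> n"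
  define y where "y = real n powr (3 / 4)"
  define T where "T = real (run_time W S P n)"
  define m where "m = real (corner_side n)"
  have y0: "0 < y" using n by (simp add: y_def)
  have "1 / 64 * y \<le> T"
  proof (rule ccontr)
    assume "\<not> 1 / 64 * y \<le> T"
    then have T: "T < y / 64" by simp
    have "n ^ 3 \<le> run_time W S P n * (corner_side n + 2 * run_time W S P n) ^ 3"
      using run_time_ge(2)[OF P n _ W] S n by blast
    then have "real (n ^ 3) \<le> real (run_time W S P n * (corner_side n + 2 * run_time W S P n) ^ 3)"
      by (simp only: of_nat_le_iff)
    then have "real n ^ 3 \<le> T * (m + 2 * T) ^ 3" by (simp add: T_def m_def)
    \<comment> \<open>\<open>65 / 32\<close> is \<open>2 + 2 / 64\<close>, from
      \<open>m \<le> 2 * y\<close> and \<open>T < y / 64\<close>. The constant 64 is large enough,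
      since \<open>(65 / 32) ^ 3 / 64 < 1\<close>.\<close>
    also have "\<dots> \<le> y / 64 * (65 / 32 * y) ^ 3"
    proof (rule mult_mono)
      have "m \<le> 2 * real n powr (2 / 3)" unfolding m_def by (rule corner_side_powr[OF n])
      also have "\<dots> \<le> 2 * y" unfolding y_def using n by (intro mult_left_mono powr_mono) auto
      finally show "(m + 2 * T) ^ 3 \<le> (65 / 32 * y) ^ 3"
        using T by (intro power_mono) (auto simp: m_def T_def)
    qed (use T y0 in \<open>auto simp: m_def T_def\<close>)
    also have "\<dots> = 274625 / 2097152 * y ^ 4" by (simp add: power_numeral_reduce field_simps)
    also have "\<dots> < y ^ 4" using y0 by simp
    also have "y ^ 4 = real n ^ 3"
      using n by (simp add: y_def powr_power powr_numeral)
    finally show False by simp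
  qed
  then show "1 / 64 * norm (real n powr (3 / 4)) \<le> norm (real (run_time W S P n))"
    by (simp add: y_def T_def)
qed

theorem theorem1:
  fixes \<alpha> :: real and W :: "nat \<Rightarrow> nat"
  assumes "2 \<le> \<alpha>" and "\<alpha> \<le> 9 / 4"
    and "word_length W"
  shows
    "(\<exists>P. computes_gmm W (mesh_side \<alpha>) P \<and>
          (\<lambda>n. real (run_time W (mesh_side \<alpha>) P n)) \<in> \<Theta>(\<lambda>n. real n powr (3 - \<alpha>))) \<and>
     (\<alpha> = 9 / 4 \<longrightarrow>
        (\<exists>P. computes_gmm W (mesh_side \<alpha>) P \<and>
          (\<lambda>n. real (run_time W (mesh_side \<alpha>) P n)) \<in> \<Theta>(\<lambda>n. real n powr (3 / 4)))) \<and>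
     (\<forall>S P. (\<forall>n\<ge>1. n ^ 2 \<le> S n ^ 3) \<longrightarrow> computes_gmm W S P \<longrightarrow>
          (\<lambda>n. real (run_time W S P n)) \<in> \<Omega>(\<lambda>n. real n powr (3 / 4)))"
proof (intro conjI impI allI)
  show *: "\<exists>P. computes_gmm W (mesh_side \<alpha>) P \<and>
      (\<lambda>n. real (run_time W (mesh_side \<alpha>) P n)) \<in> \<Theta>(\<lambda>n. real n powr (3 - \<alpha>))"
    using computes_product_program(1)[OF assms] product_program_theta[OF assms] by blast
  show "\<exists>P. computes_gmm W (mesh_side \<alpha>) P \<and>
      (\<lambda>n. real (run_time W (mesh_side \<alpha>) P n)) \<in> \<Theta>(\<lambda>n. real n powr (3 / 4))" if \<alpha>: "\<alpha> = 9 / 4"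
    using * unfolding \<alpha> by simp
qed (use run_time_omega assms(3) in blast)

end
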